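(* Let $\Sigma_0\subset\mathbb R^3$ be a smoothly bounded domain. Let $\Phi\in\mathcal K(\Sigma_0)$ satisfy $\partial_y\Phi(x,0)=0$ for every $x\in\mathbb R^3$, assume further that $\Phi$ is representable, and set $S_\Phi:=\{x\in\Sigma_0:\Phi(x)=0\}$. Then, given a sequence $(Q_k)\subset L^\infty(\Sigma_0)$ with $\|Q_k\|_{L^\infty(\Sigma_0)}\le C$ for a constant $C$ independent of $k$, there exists a sequence $(U_k)\subset C^0(\overline{\mathbb R^4_+})$ of solutions to $$\Delta^2U_k=0\ \text{ in }\mathbb R^4_+,\qquad \partial_yU_k=0\ \text{ on }\mathbb R^3,\qquad \mathcal L_{\frac32}U_k=Q_ke^{3u_k}\ \text{ on }\Sigma_0,\qquad u_k:=U_k|_{y=0},$$ such that $U_k\to\infty$ on $S_\Phi$, $S_1=\emptyset$, and there are numbers $\beta_k\to\infty$ with $$\frac{U_k}{\beta_k}\to\Phi\quad\text{in }C^{2,\alpha}_{\mathrm{loc}}\big((\mathbb R^4_+\cup\Sigma_0)\setminus S_\Phi\big).$$ Here $\alpha\in[0,1)$ and $$S_1:=\Big\{\bar x\in\Sigma_0:\ \lim_{\varepsilon\to0^+}\liminf_{k\to\infty}\int_{B_\varepsilon(\bar x)}|Q_k|e^{3u_k}\,dx\ge2\pi^2\Big\}.$$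
   Context: Points of $\mathbb R^4$ are written $X=(x,y)$ with $x\in\mathbb R^3$, $y\in\mathbb R$; $\mathbb R^4_+=\{(x,y):y>0\}$, and $\mathbb R^3$ is identified with $\partial\mathbb R^4_+=\{y=0\}$. $\Delta$ is the Laplacian in the four variables $(x,y)$. $B_\varepsilon(\bar x)$ is the ball in $\mathbb R^3$. The boundary operator $\mathcal L_{\frac32}$ is $\mathcal L_{\frac32}U:=\frac12\lim_{y\to0^+}\partial_y\Delta U(\cdot,y)$; it can also be understood in the distributional sense: for $U$ with $\Delta^2U=0$ in $\mathbb R^4_+$ and $\partial_yU=0$ on $\mathbb R^3$, $\mathcal L_{\frac32}U=w$ means $0=\int_{\mathbb R^4_+}\Delta U\,\Delta\psi\,dxdy-2\int_{\mathbb R^3}w\psi\,dx$ for every smooth test function $\psi$ with compact support in $\overline{\mathbb R^4_+}$ and $\partial_y\psi=0$ on $y=0$ (for the equation on $\Sigma_0$ only, with the support of $\psi$ meeting $\{y=0\}$ inside $\Sigma_0$). $L_6(\mathbb R^3):=\{u\in L^1_{\mathrm{loc}}(\mathbb R^3):\int_{\mathbb R^3}\frac{|u(x)|}{1+|x|^6}dx<\infty\}$. A solution $U$ of $\Delta^2U=0$ in $\mathbb R^4_+$, $\partial_yU=0$ on $\mathbb R^3$, continuous on $\overline{\mathbb R^4_+}$, is called representable if its boundary value $u=U|_{y=0}$ belongs to $L_6(\mathbb R^3)$, $U$ coincides with its Poisson representation $$U(x,y)=\frac4{\pi^2}\int_{\mathbb R^3}\frac{y^3}{(y^2+|x-\tilde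 x|^2)^3}\,u(\tilde x)\,d\tilde x,$$ and $\mathcal L_{\frac32}U$ is well defined. $\mathcal K(\Sigma_0)$ is the set of all $H\in C^\infty(\mathbb R^4_+\cup\Sigma_0)$ with $\Delta^2H=0$ and $H\le0$ in $\mathbb R^4_+$, $H\not\equiv0$, and $\partial_yH=\mathcal L_{\frac32}H=0$ on $\Sigma_0$. *)

theory Defs
  imports "HOL-Analysis.Analysis" "HOL-Probability.Essential_Supremum"
begin

type_synonym R3 = "real ^ 3"
type_synonym R4 = "R3 \<times> real"

definition upper :: "R4 set" where
  "upper = {(x, y). 0 < y}"

definition upper_closed :: "R4 set" where
  "upper_closed = {(x, y). 0 \<le> y}"

abbreviation bdry :: "(R4 \<Rightarrow> real) \<Rightarrow> R3 \<Rightarrow> real" where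
  "bdry U \<equiv> (\<lambda>x. U (x, 0))"

text \<open>Iterated directional derivatives, taken within the set \<open>S\<close>. All sets \<open>S\<close> used below are
  relatively open in the whole space or in the closed half-space, so that derivatives within \<open>S\<close>
  are unique; at boundary points lying in \<open>S\<close> they are the one-sided ones. Thus
  \<open>Ck_on k S\<close> is the space of functions that are \<open>k\<close> times continuously differentiable up to the
  part of the boundary which belongs to \<open>S\<close>.\<close>

fun partial :: "'a::euclidean_space set \<Rightarrow> 'a list \<Rightarrow> ('a \<Rightarrow> real) \<Rightarrow> 'a \<Rightarrow> real" where
  "partial S [] f = f"
| "partial S (v # vs) f = (\<lambda>X. frechet_derivative (partial S vs f) (at X within S) v)"

definition dirs :: "nat \<Rightarrow> 'a::euclidean_space list set" where
  "dirs m = {vs. set vs \<subseteq> Basis \<and> length vs = m}"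

definition Ck_on :: "nat \<Rightarrow> 'a::euclidean_space set \<Rightarrow> ('a \<Rightarrow> real) set" where
  "Ck_on k S = {f. (\<forall>m\<le>k. \<forall>vs\<in>dirs m. continuous_on S (partial S vs f)) \<and>
                   (\<forall>m<k. \<forall>vs\<in>dirs m. partial S vs f differentiable_on S)}"

definition Cinf_on :: "'a::euclidean_space set \<Rightarrow> ('a \<Rightarrow> real) set" where
  "Cinf_on S = (\<Inter>k. Ck_on k S)"

definition Cinf_compact :: "(R3 \<Rightarrow> real) set" where
  "Cinf_compact = {\<phi> \<in> Cinf_on UNIV. compact (closure {x. \<phi> x \<noteq> 0})}"

text \<open>The norm of \<open>C\<^sup>m\<^sup>,\<^sup>\<alpha>(K)\<close>, possibly infinite, for functions on \<open>S \<supseteq> K\<close>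
  (derivatives are taken within \<open>S\<close>, as \<open>K\<close> is an arbitrary compact subset of it).\<close>

definition holder_norm ::
    "nat \<Rightarrow> real \<Rightarrow> 'a::euclidean_space set \<Rightarrow> 'a set \<Rightarrow> ('a \<Rightarrow> real) \<Rightarrow> ennreal" where
  "holder_norm m \<alpha> S K f =
     (\<Sum>j\<le>m. \<Sum>vs\<in>dirs j. SUP X\<in>K. ennreal \<bar>partial S vs f X\<bar>) +
     (\<Sum>vs\<in>dirs m. SUP (X, Y)\<in>{(X, Y). X \<in> K \<and> Y \<in> K \<and> X \<noteq> Y}.
        ennreal (\<bar>partial S vs f X - partial S vs f Y\<bar> / dist X Y powr \<alpha>))"

definition holder_loc :: "nat \<Rightarrow> real \<Rightarrow> 'a::euclidean_space set \<Rightarrow> ('a \<Rightarrow> real) set" where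
  "holder_loc m \<alpha> S =
     {f \<in> Ck_on m S. \<forall>K. compact K \<and> K \<subseteq> S \<longrightarrow> holder_norm m \<alpha> S K f < \<infinity>}"

definition tendsto_holder_loc ::
    "nat \<Rightarrow> real \<Rightarrow> 'a::euclidean_space set \<Rightarrow> (nat \<Rightarrow> 'a \<Rightarrow> real) \<Rightarrow> ('a \<Rightarrow> real) \<Rightarrow> bool" where
  "tendsto_holder_loc m \<alpha> S F f \<longleftrightarrow>
     (\<forall>k. F k \<in> holder_loc m \<alpha> S) \<and> f \<in> holder_loc m \<alpha> S \<and>
     (\<forall>K. compact K \<and> K \<subseteq> S \<longrightarrow>
        (\<lambda>k. holder_norm m \<alpha> S K (\<lambda>X. F k X - f X)) \<longlonglongrightarrow> 0)"

text \<open>A smoothly bounded domain: nonempty, open, connected, bounded, and near each boundary point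
  the sublevel set of a smooth function with nonvanishing gradient.\<close>

definition smooth_bounded_domain :: "R3 set \<Rightarrow> bool" where
  "smooth_bounded_domain S \<longleftrightarrow>
     S \<noteq> {} \<and> open S \<and> connected S \<and> bounded S \<and>
     (\<forall>p\<in>frontier S. \<exists>N \<rho>. open N \<and> p \<in> N \<and> \<rho> \<in> Cinf_on N \<and>
        (\<forall>x\<in>N. \<exists>i\<in>Basis. partial N [i] \<rho> x \<noteq> 0) \<and>
        S \<inter> N = {x\<in>N. \<rho> x < 0})"

definition Linf_norm :: "R3 set \<Rightarrow> (R3 \<Rightarrow> real) \<Rightarrow> ereal" where
  "Linf_norm S q = esssup (lebesgue_on S) (\<lambda>x. ereal \<bar>q x\<bar>)"

definition Linf :: "R3 set \<Rightarrow> (R3 \<Rightarrow> real) set" where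
  "Linf S = {q \<in> borel_measurable (lebesgue_on S). Linf_norm S q < \<infinity>}"

definition L1_loc :: "(R3 \<Rightarrow> real) set" where
  "L1_loc = {u. \<forall>K. compact K \<longrightarrow> set_integrable lebesgue K u}"

definition L6 :: "(R3 \<Rightarrow> real) set" where
  "L6 = {u \<in> L1_loc. integrable lebesgue (\<lambda>x. \<bar>u x\<bar> / (1 + norm x ^ 6))}"

text \<open>The Laplacian is only ever evaluated at interior points of the half-space.\<close>

definition laplacian :: "(R4 \<Rightarrow> real) \<Rightarrow> R4 \<Rightarrow> real" where
  "laplacian U X = (\<Sum>i\<in>Basis. partial UNIV [i, i] U X)"

definition biharmonic :: "(R4 \<Rightarrow> real) \<Rightarrow> bool" where
  "biharmonic U \<longleftrightarrow> U \<in> Ck_on 4 upper \<and> (\<forall>X\<in>upper. laplacian (laplacian U) X = 0)"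

definition dy_zero_on :: "R3 set \<Rightarrow> (R4 \<Rightarrow> real) \<Rightarrow> bool" where
  "dy_zero_on S U \<longleftrightarrow> (\<forall>x\<in>S. ((\<lambda>y. U (x, y)) has_real_derivative 0) (at 0 within {0..}))"

definition L32_at :: "(R4 \<Rightarrow> real) \<Rightarrow> R3 \<Rightarrow> real \<Rightarrow> bool" where
  "L32_at U x w \<longleftrightarrow>
     ((\<lambda>y. 1 / 2 * partial UNIV [(0, 1)] (laplacian U) (x, y)) \<longlongrightarrow> w) (at_right 0)"

definition test_functions :: "R3 set \<Rightarrow> (R4 \<Rightarrow> real) set" where
  "test_functions S =
     {\<psi> \<in> Cinf_on upper_closed.
        compact (closure {X\<in>upper_closed. \<psi> X \<noteq> 0}) \<and>
        (\<forall>x. (x, 0) \<in> closure {X\<in>upper_closed. \<psi> X \<noteq> 0} \<longrightarrow> x \<in> S) \<and>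
        dy_zero_on UNIV \<psi>}"

definition L32_weak_on :: "R3 set \<Rightarrow> (R4 \<Rightarrow> real) \<Rightarrow> (R3 \<Rightarrow> real) \<Rightarrow> bool" where
  "L32_weak_on S U w \<longleftrightarrow>
     (\<forall>\<psi>\<in>test_functions S.
        set_integrable lebesgue upper (\<lambda>X. laplacian U X * laplacian \<psi> X) \<and>
        set_integrable lebesgue S (\<lambda>x. w x * \<psi> (x, 0)) \<and>
        (LINT X:upper|lebesgue. laplacian U X * laplacian \<psi> X)
          - 2 * (LINT x:S|lebesgue. w x * \<psi> (x, 0)) = 0)"

definition is_distribution :: "((R3 \<Rightarrow> real) \<Rightarrow> real) \<Rightarrow> bool" where
  "is_distribution T \<longleftrightarrow>
     (\<forall>\<phi>\<in>Cinf_compact. \<forall>\<eta>\<in>Cinf_compact. \<forall>a b.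
        T (\<lambda>x. a * \<phi> x + b * \<eta> x) = a * T \<phi> + b * T \<eta>) \<and>
     (\<forall>K. compact K \<longrightarrow> (\<exists>C N. \<forall>\<phi>\<in>Cinf_compact. closure {x. \<phi> x \<noteq> 0} \<subseteq> K \<longrightarrow>
        (\<forall>M. (\<forall>m\<le>N. \<forall>vs\<in>dirs m. \<forall>x. \<bar>partial UNIV vs \<phi> x\<bar> \<le> M) \<longrightarrow> \<bar>T \<phi>\<bar> \<le> C * M)))"

text \<open>The boundary operator is well defined on \<open>\<real>\<^sup>3\<close> if it exists in one of its two senses: as a
  pointwise limit, or as a distribution on \<open>\<real>\<^sup>3\<close> (not necessarily a function).\<close>

definition L32_well_defined :: "(R4 \<Rightarrow> real) \<Rightarrow> bool" where
  "L32_well_defined U \<longleftrightarrow>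
     (\<forall>x. \<exists>w. L32_at U x w) \<or>
     (\<exists>T. is_distribution T \<and>
        (\<forall>\<psi>\<in>test_functions UNIV.
           set_integrable lebesgue upper (\<lambda>X. laplacian U X * laplacian \<psi> X) \<and>
           (LINT X:upper|lebesgue. laplacian U X * laplacian \<psi> X) - 2 * T (bdry \<psi>) = 0))"

definition representable :: "(R4 \<Rightarrow> real) \<Rightarrow> bool" where
  "representable U \<longleftrightarrow>
     continuous_on upper_closed U \<and> biharmonic U \<and> dy_zero_on UNIV U \<and>
     bdry U \<in> L6 \<and>
     (\<forall>x y. 0 < y \<longrightarrow>
        U (x, y) = 4 / pi\<^sup>2 *
          (LINT x'|lebesgue. y ^ 3 / (y\<^sup>2 + (norm (x - x'))\<^sup>2) ^ 3 * bdry U x')) \<and>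
     L32_well_defined U"

definition K_class :: "R3 set \<Rightarrow> (R4 \<Rightarrow> real) set" where
  "K_class S =
     {H \<in> Cinf_on (upper \<union> S \<times> {0}).
        biharmonic H \<and> (\<forall>X\<in>upper. H X \<le> 0) \<and>
        (\<exists>X\<in>upper \<union> S \<times> {0}. H X \<noteq> 0) \<and>
        dy_zero_on S H \<and> (\<forall>x\<in>S. L32_at H x 0)}"

definition zero_set :: "R3 set \<Rightarrow> (R4 \<Rightarrow> real) \<Rightarrow> R3 set" where
  "zero_set S H = {x\<in>S. H (x, 0) = 0}"

text \<open>As \<open>Q\<close> is merely bounded, the boundary equation is understood in the distributional sense.\<close>

definition is_solution :: "R3 set \<Rightarrow> (R3 \<Rightarrow> real) \<Rightarrow> (R4 \<Rightarrow> real) \<Rightarrow> bool" where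
  "is_solution S Q U \<longleftrightarrow>
     continuous_on upper_closed U \<and> biharmonic U \<and> dy_zero_on UNIV U \<and>
     L32_weak_on S U (\<lambda>x. Q x * exp (3 * bdry U x))"

text \<open>The limit in \<open>\<epsilon>\<close> exists by monotonicity. The functions \<open>Q k\<close> live on \<open>S\<close> only; for small
  \<open>\<epsilon>\<close> the ball is contained in the open set \<open>S\<close>.\<close>

definition concentration_set :: "R3 set \<Rightarrow> (nat \<Rightarrow> R3 \<Rightarrow> real) \<Rightarrow> (nat \<Rightarrow> R3 \<Rightarrow> real) \<Rightarrow> R3 set" where
  "concentration_set S Q u =
     {p\<in>S. Lim (at_right 0) (\<lambda>\<epsilon>. liminf (\<lambda>k.
              \<integral>\<^sup>+x\<in>ball p \<epsilon> \<inter> S. ennreal (\<bar>Q k x\<bar> * exp (3 * u k x)) \<partial>lebesgue))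
            \<ge> ennreal (2 * pi\<^sup>2)}"

end

theory Submission
  imports Defs
begin

text \<open>
  The solutions are sought as \<open>U k = \<beta> k * \<Phi> + k + W k\<close>, where \<open>W k\<close> is a multiple of the logarithmic potential of
  the density \<open>Q k * exp (3 * U k)\<close>. The kernel \<open>ln \<bar>X - z\<bar>\<close> is a multiple of the fundamental solution of the
  boundary problem (its Laplacian is \<open>2 / \<bar>X - z\<bar>\<^sup>2\<close>), so the boundary equation becomes a fixed point
  equation for \<open>W k\<close>. Its right-hand side carries the weight \<open>exp (3 * \<beta> k * \<Phi>)\<close>, which tends to zero
  almost everywhere as \<open>\<beta> k\<close> grows, because \<open>\<Phi> \<le> 0\<close> and the zero set of \<open>\<Phi>\<close> on \<open>\<Sigma>\<^sub>0\<close> is a null set. Hence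
  for \<open>\<beta> k\<close> large the map is a contraction of the unit ball of bounded continuous functions, \<open>W k\<close> is
  bounded by 1 there, and the total mass of the density is small, which excludes concentration.

  The zero set is null for the following reason. At a zero \<open>p\<close> the tangential gradient vanishes since \<open>\<Phi> \<le> 0\<close>.
  If the tangential Hessian vanished too, then \<open>\<Phi>\<close> would be \<open>O(\<bar>x - p\<bar>\<^sup>3)\<close> on the boundary, and the Poisson
  formula would give \<open>\<Phi>(p, y) = O(y powr (5/2))\<close> together with \<open>\<Phi>(p, y) \<le> - a * y ^ 3\<close> for some \<open>a > 0\<close>. But the
  odd \<open>y\<close>-derivatives of order 1 and 3 vanish, so \<open>\<Phi>(p, y) = \<alpha> * y\<^sup>2 + O(y ^ 4)\<close>, a contradiction. So near \<open>p\<close>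
  the zero set lies in a level set of a \<open>C\<^sup>1\<close> function with nonvanishing derivative.
\<close>

text \<open>The order of choices drives the construction. The summand \<open>k\<close> forces
  divergence at the zeros of \<Phi>, where \<open>\<beta> k * \<Phi>\<close> contributes nothing,
  but it may multiply the density by \<open>exp (3 * k + 3)\<close>. As \<open>\<beta> k\<close> is
  chosen after \<open>k\<close>, it can be so large that the weight beats this factor and that both
  \<open>k\<close> and the potential disappear after division by \<open>\<beta> k\<close>.
  \<open>Q k\<close> has no sign and no regularity, so the densities are merely bounded. Second
  derivatives of the logarithm have degree -2 and are integrable over the three-dimensional
  boundary, third ones are not; a Hoelder increment of order \<alpha> costs degree -(2 + \<alpha>),
  hence \<alpha> < 1 and the stop at two derivatives. The weight becomes small only in the mean, so
  uniform smallness of the logarithmic potential needs in addition a bound on the integral of the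
  squared logarithm. In the zero set argument the exponent 5/2 stands for any number strictly
  between 2 and 3: above 2 to kill the quadratic term, below 3 to keep an integral over the boundary
  finite.\<close>

section \<open>Iterated partial derivatives within a set\<close>

text \<open>Accumulation along every coordinate direction, which is what makes derivatives within the set unique.\<close>

definition thick :: "'a::euclidean_space set \<Rightarrow> bool" where
  "thick S \<longleftrightarrow> (\<forall>X\<in>S. \<forall>i\<in>Basis. \<forall>e>0. \<exists>d. 0 < \<bar>d\<bar> \<and> \<bar>d\<bar> < e \<and> X + d *\<^sub>R i \<in> S)"

lemma thick_frechet_derivative:
  assumes "thick S" "X \<in> S" "(f has_derivative f') (at X within S)"
  shows "frechet_derivative f (at X within S) = f'"
proof -
  have "(f has_derivative frechet_derivative f (at X within S)) (at X within S)"
    using assms(3) differentiable_def frechet_derivative_works by blast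
  then show ?thesis
    using frechet_derivative_unique_within[OF _ assms(3)] assms(1,2) unfolding thick_def by blast
qed

lemma thick_open:
  assumes "open (S::'a::euclidean_space set)"
  shows "thick S"
  unfolding thick_def
proof (intro ballI allI impI)
  fix X i :: 'a and e :: real
  assume X: "X \<in> S" and i: "i \<in> Basis" and e: "0 < e"
  then obtain r where r: "r > 0" "ball X r \<subseteq> S"
    using assms open_contains_ball by blast
  have "X + (min e r / 2) *\<^sub>R i \<in> S"
    using r e i by (intro subsetD[OF r(2)]) (simp add: dist_norm)
  then show "\<exists>d. 0 < \<bar>d\<bar> \<and> \<bar>d\<bar> < e \<and> X + d *\<^sub>R i \<in> S"
    using r e by (intro exI[of _ "min e r / 2"]) auto
qed

lemma Basis_R4_cases:
  assumes "i \<in> (Basis :: R4 set)"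
  obtains j where "j \<in> Basis" "i = (j, 0)" | "i = (0, 1)"
  using assms by (auto simp: Basis_prod_def)

text \<open>The increment chosen is positive in every coordinate direction, so a vertical step from
  a boundary point moves up into the half-space.\<close>

lemma thick_halfspace:
  assumes "open N"
  shows "thick (N \<inter> upper_closed)"
  unfolding thick_def
proof (intro ballI allI impI)
  fix X i :: R4 and e :: real
  assume X: "X \<in> N \<inter> upper_closed" and i: "i \<in> Basis" and e: "0 < e"
  then obtain r where r: "r > 0" "ball X r \<subseteq> N"
    using assms open_contains_ball by blast
  have "X + (min e r / 2) *\<^sub>R i \<in> N"
    using r e i by (intro subsetD[OF r(2)]) (simp add: dist_norm)
  moreover have "X + (min e r / 2) *\<^sub>R i \<in> upper_closed"
    using i X e r by (cases rule: Basis_R4_cases) (auto simp: upper_closed_def)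
  ultimately show "\<exists>d. 0 < \<bar>d\<bar> \<and> \<bar>d\<bar> < e \<and> X + d *\<^sub>R i \<in> N \<inter> upper_closed"
    using r e by (intro exI[of _ "min e r / 2"]) auto
qed

lemma has_derivative_local_cong:
  assumes "open N" "S \<inter> N = T \<inter> N" "X \<in> S \<inter> N" "\<And>Y. Y \<in> S \<inter> N \<Longrightarrow> f Y = g Y"
    and "(f has_derivative f') (at X within S)"
  shows "(g has_derivative f') (at X within T)"
proof -
  have "at X within S = at X within (S \<inter> N)" "at X within T = at X within (S \<inter> N)"
    using assms(1-3) by (auto intro!: at_within_nhd[of X N])
  then show ?thesis
    using has_derivative_transform[OF assms(3), of g f] assms(4,5) by metis
qed

text \<open>Derivatives within a set depend only on the germs of the set and of the function. This
  is the bridge between derivatives within \<open>UNIV\<close> (used by \<open>laplacian\<close>),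
  \<open>upper\<close>, \<open>upper_closed\<close> and sets with part of the boundary attached,
  which agree at interior points.\<close>

lemma partial_cong:
  assumes "open N" "S \<inter> N = T \<inter> N" "\<And>X. X \<in> S \<inter> N \<Longrightarrow> f X = g X" "X \<in> S \<inter> N"
  shows "partial S vs f X = partial T vs g X"
  using assms(4)
proof (induction vs arbitrary: X)
  case Nil
  then show ?case using assms by simp
next
  case (Cons v vs)
  have "(partial S vs f has_derivative f') (at X within S) \<longleftrightarrow>
        (partial T vs g has_derivative f') (at X within T)" for f'
    using has_derivative_local_cong[OF assms(1,2) Cons.prems, of "partial S vs f" "partial T vs g"]
      has_derivative_local_cong[OF assms(1) assms(2)[symmetric], of X "partial T vs g" "partial S vs f"]
      Cons.IH Cons.prems assms(2) by auto
  then have "frechet_derivative (partial S vs f) (at X within S) =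
      frechet_derivative (partial T vs g) (at X within T)"
    unfolding frechet_derivative_def by simp
  then show ?case by simp
qed

lemma partial_append: "partial S (us @ vs) f = partial S us (partial S vs f)"
  by (induction us) auto

lemma dirs_Nil [simp]: "[] \<in> dirs 0" and dirs_0: "dirs 0 = {[]}"
  by (auto simp: dirs_def)

lemma dirs_Cons: "i # vs \<in> dirs m \<longleftrightarrow> i \<in> Basis \<and> (\<exists>n. m = Suc n \<and> vs \<in> dirs n)"
  by (auto simp: dirs_def)

lemma finite_dirs [simp]: "finite (dirs m)"
  unfolding dirs_def by (rule finite_lists_length_eq) simp

lemma sum_Basis_pick:
  assumes "i \<in> (Basis :: 'a::euclidean_space set)"
  shows "(\<Sum>k\<in>Basis. (i \<bullet> k) * c k) = (c i :: real)"
proof -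
  have "(\<Sum>k\<in>Basis. (i \<bullet> k) * c k) = (\<Sum>k\<in>Basis. if k = i then c k else 0)"
    using assms by (intro sum.cong) (auto simp: inner_Basis)
  also have "\<dots> = c i" using assms by simp
  finally show ?thesis .
qed

text \<open>A family \<open>D\<close> indexed by words which obeys the differentiation rule letter
  by letter has to be the family of iterated partials, because derivatives within a thick set are
  unique. Later regularity proofs exhibit such a \<open>D\<close> instead of computing with
  \<open>frechet_derivative\<close>. For words of top length only continuity is asked.\<close>

lemma Ck_onI:
  fixes D :: "'a::euclidean_space list \<Rightarrow> 'a \<Rightarrow> real"
  assumes S: "thick S" and D0: "\<And>X. X \<in> S \<Longrightarrow> D [] X = f X"
    and DD: "\<And>vs X m. m < k \<Longrightarrow> vs \<in> dirs m \<Longrightarrow> X \<in> S \<Longrightarrow>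
      (D vs has_derivative (\<lambda>h. \<Sum>i\<in>Basis. (h \<bullet> i) * D (i # vs) X)) (at X within S)"
    and DC: "\<And>vs. vs \<in> dirs k \<Longrightarrow> continuous_on S (D vs)"
  shows "f \<in> Ck_on k S" "\<And>m vs X. m \<le> k \<Longrightarrow> vs \<in> dirs m \<Longrightarrow> X \<in> S \<Longrightarrow> partial S vs f X = D vs X"
proof -
  show P: "partial S vs f X = D vs X" if "m \<le> k" "vs \<in> dirs m" "X \<in> S" for m vs X
    using that
  proof (induction vs arbitrary: X m)
    case Nil
    then show ?case using D0 by simp
  next
    case (Cons v vs)
    then obtain n where n: "m = Suc n" "vs \<in> dirs n" "v \<in> Basis" by (auto simp: dirs_Cons)
    have "(partial S vs f has_derivative (\<lambda>h. \<Sum>i\<in>Basis. (h \<bullet> i) * D (i # vs) X)) (at X within S)"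
    proof -
      have "partial S vs f Y = D vs Y" if "Y \<in> S" for Y
        using Cons.IH[of n Y] Cons.prems(1) n that by auto
      moreover have "n < k" using Cons.prems n by auto
      ultimately show ?thesis
        by (intro has_derivative_transform[OF Cons.prems(3) _ DD[OF _ n(2) Cons.prems(3)]])
    qed
    then have "frechet_derivative (partial S vs f) (at X within S) = (\<lambda>h. \<Sum>i\<in>Basis. (h \<bullet> i) * D (i # vs) X)"
      by (rule thick_frechet_derivative[OF S Cons.prems(3)])
    then have "partial S (v # vs) f X = (\<Sum>i\<in>Basis. (v \<bullet> i) * D (i # vs) X)" by simp
    also have "\<dots> = D (v # vs) X" by (rule sum_Basis_pick[OF n(3)])
    finally show ?case .
  qed
  have der: "(partial S vs f has_derivative (\<lambda>h. \<Sum>i\<in>Basis. (h \<bullet> i) * D (i # vs) X)) (at X within S)"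
    if "m < k" "vs \<in> dirs m" "X \<in> S" for m vs X
  proof (rule has_derivative_transform[OF that(3) _ DD[OF that]])
    show "partial S vs f Y = D vs Y" if "Y \<in> S" for Y
      by (rule P[OF less_imp_le[OF \<open>m < k\<close>] \<open>vs \<in> dirs m\<close> that])
  qed
  show "f \<in> Ck_on k S"
    unfolding Ck_on_def
  proof (intro CollectI conjI allI impI ballI)
    fix m and vs :: "'a list" assume m: "m < k" and vs: "vs \<in> dirs m"
    show "partial S vs f differentiable_on S"
      unfolding differentiable_on_def by (intro ballI differentiableI[OF der[OF m vs]])
  next
    fix m and vs :: "'a list" assume m: "m \<le> k" and vs: "vs \<in> dirs m"
    show "continuous_on S (partial S vs f)"
    proof (cases "m = k")
      case True
      with vs have "continuous_on S (D vs)" using DC by blast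
      then show ?thesis by (rule continuous_on_eq) (simp only: P[OF m vs])
    next
      case False
      then have "partial S vs f differentiable_on S"
        unfolding differentiable_on_def
        by (intro ballI differentiableI[OF der[OF le_neq_implies_less[OF m] vs]])
      then show ?thesis by (rule differentiable_imp_continuous_on)
    qed
  qed
qed

lemma linear_sum_Basis:
  fixes f' :: "'a::euclidean_space \<Rightarrow> real"
  assumes "linear f'"
  shows "f' h = (\<Sum>i\<in>Basis. (h \<bullet> i) * f' i)"
proof -
  have "f' h = f' (\<Sum>i\<in>Basis. (h \<bullet> i) *\<^sub>R i)" by (simp add: euclidean_representation)
  also have "\<dots> = (\<Sum>i\<in>Basis. (h \<bullet> i) * f' i)"
    using assms by (simp add: linear_sum linear_scale)
  finally show ?thesis .
qed

lemma Ck_onD: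
  assumes "f \<in> Ck_on k S" "m < k" "vs \<in> dirs m" "X \<in> S"
  shows "(partial S vs f has_derivative (\<lambda>h. \<Sum>i\<in>Basis. (h \<bullet> i) * partial S (i # vs) f X)) (at X within S)"
proof -
  have "partial S vs f differentiable (at X within S)"
    using assms unfolding Ck_on_def differentiable_on_def by blast
  then have d: "(partial S vs f has_derivative frechet_derivative (partial S vs f) (at X within S)) (at X within S)"
    by (simp add: frechet_derivative_works)
  have "frechet_derivative (partial S vs f) (at X within S) = (\<lambda>h. \<Sum>i\<in>Basis. (h \<bullet> i) * partial S (i # vs) f X)"
  proof
    fix h
    show "frechet_derivative (partial S vs f) (at X within S) h = (\<Sum>i\<in>Basis. (h \<bullet> i) * partial S (i # vs) f X)"
      unfolding partial.simps by (rule linear_sum_Basis[OF has_derivative_linear[OF d]])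
  qed
  with d show ?thesis by (simp only:)
qed

lemma Ck_on_continuous: "f \<in> Ck_on k S \<Longrightarrow> m \<le> k \<Longrightarrow> vs \<in> dirs m \<Longrightarrow> continuous_on S (partial S vs f)"
  by (auto simp: Ck_on_def)

lemma Ck_on_mono: "f \<in> Ck_on k S \<Longrightarrow> m \<le> k \<Longrightarrow> f \<in> Ck_on m S"
  unfolding Ck_on_def mem_Collect_eq by (meson le_trans less_le_trans)

lemma Cinf_onD: "f \<in> Cinf_on S \<Longrightarrow> f \<in> Ck_on k S"
  by (auto simp: Cinf_on_def)

lemma Ck_on_lincomb:
  assumes S: "thick S" and f: "f \<in> Ck_on k S" and g: "g \<in> Ck_on k S"
  shows "(\<lambda>X. a * f X + b * g X) \<in> Ck_on k S"
    and "\<And>m vs X. m \<le> k \<Longrightarrow> vs \<in> dirs m \<Longrightarrow> X \<in> S \<Longrightarrow>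
      partial S vs (\<lambda>X. a * f X + b * g X) X = a * partial S vs f X + b * partial S vs g X"
proof -
  note * = Ck_onI[OF S, of "\<lambda>vs X. a * partial S vs f X + b * partial S vs g X" "\<lambda>X. a * f X + b * g X" k]
  have 1: "((\<lambda>X. a * partial S vs f X + b * partial S vs g X) has_derivative
      (\<lambda>h. \<Sum>i\<in>Basis. (h \<bullet> i) * (a * partial S (i # vs) f X + b * partial S (i # vs) g X))) (at X within S)"
    if "m < k" "vs \<in> dirs m" "X \<in> S" for m vs X
  proof -
    have "((\<lambda>X. a * partial S vs f X + b * partial S vs g X) has_derivative
      (\<lambda>h. a * (\<Sum>i\<in>Basis. (h \<bullet> i) * partial S (i # vs) f X) + b * (\<Sum>i\<in>Basis. (h \<bullet> i) * partial S (i # vs) g X))) (at X within S)"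
      by (intro derivative_intros Ck_onD[OF f that] Ck_onD[OF g that])
    moreover have "a * (\<Sum>i\<in>Basis. (h \<bullet> i) * partial S (i # vs) f X) + b * (\<Sum>i\<in>Basis. (h \<bullet> i) * partial S (i # vs) g X)
      = (\<Sum>i\<in>Basis. (h \<bullet> i) * (a * partial S (i # vs) f X + b * partial S (i # vs) g X))" for h
      by (simp add: sum_distrib_left sum.distrib algebra_simps del: partial.simps)
    ultimately show ?thesis by simp
  qed
  have 2: "continuous_on S (\<lambda>X. a * partial S vs f X + b * partial S vs g X)" if "vs \<in> dirs k" for vs
    by (intro continuous_intros Ck_on_continuous[OF f _ that] Ck_on_continuous[OF g _ that]) auto
  have 0: "a * partial S [] f X + b * partial S [] g X = a * f X + b * g X" if "X \<in> S" for X by simp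
  show "(\<lambda>X. a * f X + b * g X) \<in> Ck_on k S" by (rule *(1)[OF 0 1 2])
  show "partial S vs (\<lambda>X. a * f X + b * g X) X = a * partial S vs f X + b * partial S vs g X"
    if "m \<le> k" "vs \<in> dirs m" "X \<in> S" for m vs X
    by (rule *(2)[OF 0 1 2 that])
qed

text \<open>Thickness of the smaller set keeps its derivatives unique, and hence equal to those
  within the larger set.\<close>

lemma Ck_on_subset:
  assumes S: "thick S" "S \<subseteq> T" and f: "f \<in> Ck_on k T"
  shows "f \<in> Ck_on k S"
    and "\<And>m vs X. m \<le> k \<Longrightarrow> vs \<in> dirs m \<Longrightarrow> X \<in> S \<Longrightarrow> partial S vs f X = partial T vs f X"
proof -
  note * = Ck_onI[OF S(1), of "\<lambda>vs. partial T vs f" f k]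
  have 1: "(partial T vs f has_derivative (\<lambda>h. \<Sum>i\<in>Basis. (h \<bullet> i) * partial T (i # vs) f X)) (at X within S)"
    if "m < k" "vs \<in> dirs m" "X \<in> S" for m vs X
    using Ck_onD[OF f that(1,2), of X] that(3) S(2) has_derivative_subset by blast
  have 2: "continuous_on S (partial T vs f)" if "vs \<in> dirs k" for vs
    using Ck_on_continuous[OF f _ that] S(2) continuous_on_subset by blast
  have 0: "partial T [] f X = f X" if "X \<in> S" for X by simp
  show "f \<in> Ck_on k S" by (rule *(1)[OF 0 1 2])
  show "partial S vs f X = partial T vs f X" if "m \<le> k" "vs \<in> dirs m" "X \<in> S" for m vs X
    by (rule *(2)[OF 0 1 2 that])
qed

lemma Ck_on_partial:
  assumes "f \<in> Ck_on (n + k) S" "vs \<in> dirs n"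
  shows "partial S vs f \<in> Ck_on k S"
proof -
  have *: "us @ vs \<in> dirs (n + m)" if "us \<in> dirs m" for us :: "'a list" and m
    using that assms(2) by (auto simp: dirs_def)
  have "continuous_on S (partial S us (partial S vs f))" if "m \<le> k" "us \<in> dirs m" for m us
    unfolding partial_append[symmetric] using that *[of us m]
    by (intro Ck_on_continuous[OF assms(1), of "n + m"]) auto
  moreover have "partial S us (partial S vs f) differentiable_on S" if "m < k" "us \<in> dirs m" for m us
    unfolding partial_append[symmetric] differentiable_on_def using that *[of us m]
    by (intro ballI differentiableI[OF Ck_onD[OF assms(1), of "n + m"]]) auto
  ultimately show ?thesis unfolding Ck_on_def by blast
qed

section \<open>Mean value estimates and symmetry of second derivatives\<close>

lemma has_derivative_line:
  assumes "(g has_derivative G) (at (X + t *\<^sub>R e) within S)"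
  shows "((\<lambda>s. g (X + s *\<^sub>R e)) has_real_derivative G e) (at t within {s. X + s *\<^sub>R e \<in> S})"
proof -
  interpret G: bounded_linear G using assms by (rule has_derivative_bounded_linear)
  have "((\<lambda>s. g (X + s *\<^sub>R e)) has_derivative (\<lambda>s. G (s *\<^sub>R e))) (at t within {s. X + s *\<^sub>R e \<in> S})"
    by (rule has_derivative_in_compose[of "\<lambda>s. X + s *\<^sub>R e" "\<lambda>s. s *\<^sub>R e"])
      (auto intro!: derivative_eq_intros intro: has_derivative_subset[OF assms])
  moreover have "(\<lambda>s. G (s *\<^sub>R e)) = (*) (G e)" by (auto simp: G.scaleR mult.commute)
  ultimately show ?thesis by (simp add: has_field_derivative_def)
qed

lemma sum_Basis_bound:
  fixes h :: "'a::euclidean_space"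
  assumes "\<And>i. i \<in> Basis \<Longrightarrow> \<bar>c i\<bar> \<le> B"
  shows "\<bar>\<Sum>i\<in>Basis. (h \<bullet> i) * c i\<bar> \<le> (B * DIM('a)) * norm h"
proof -
  have "\<bar>\<Sum>i\<in>Basis. (h \<bullet> i) * c i\<bar> \<le> (\<Sum>i\<in>(Basis::'a set). norm h * B)"
    using assms Basis_le_norm by (intro sum_abs[THEN order_trans] sum_mono) (auto simp: abs_mult intro!: mult_mono)
  then show ?thesis by (simp add: mult_ac)
qed

lemma gradient_bound:
  fixes g :: "'a::euclidean_space \<Rightarrow> real"
  assumes S: "convex S" and g: "\<And>X. X \<in> S \<Longrightarrow> (g has_derivative (\<lambda>h. \<Sum>i\<in>Basis. (h \<bullet> i) * G i X)) (at X within S)"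
    and B: "\<And>X i. X \<in> S \<Longrightarrow> i \<in> Basis \<Longrightarrow> \<bar>G i X\<bar> \<le> B" and XY: "X \<in> S" "Y \<in> S"
  shows "\<bar>g X - g Y\<bar> \<le> (B * DIM('a)) * norm (X - Y)"
proof -
  have "onorm (\<lambda>h::'a. \<Sum>i\<in>Basis. (h \<bullet> i) * G i Z) \<le> B * DIM('a)" if "Z \<in> S" for Z
    using sum_Basis_bound[of "\<lambda>i. G i Z" B] B[OF that] by (intro onorm_le) auto
  from differentiable_bound[OF S g this XY] show ?thesis by simp
qed

text \<open>Passes an order of vanishing from the gradient to the function. The mean value estimate
  is applied on the part of \<open>S\<close> within distance \<open>norm (X - P)\<close> of
  \<open>P\<close>, where the gradient bound at \<open>X\<close> serves as a uniform bound.\<close>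

lemma growth_bound:
  fixes g :: "'a::euclidean_space \<Rightarrow> real"
  assumes S: "convex S" and g: "\<And>X. X \<in> S \<Longrightarrow> (g has_derivative (\<lambda>h. \<Sum>i\<in>Basis. (h \<bullet> i) * G i X)) (at X within S)"
    and B: "\<And>X i. X \<in> S \<Longrightarrow> i \<in> Basis \<Longrightarrow> \<bar>G i X\<bar> \<le> B * norm (X - P) ^ m" and X: "X \<in> S"
    and P: "P \<in> S" "g P = 0" and "0 \<le> B"
  shows "\<bar>g X\<bar> \<le> (B * DIM('a)) * norm (X - P) ^ Suc m"
proof -
  define T where "T = S \<inter> cball P (norm (X - P))"
  have "\<bar>g X - g P\<bar> \<le> (B * norm (X - P) ^ m * DIM('a)) * norm (X - P)"
  proof (rule gradient_bound[where S=T])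
    show "convex T" unfolding T_def by (intro convex_Int S convex_cball)
    show "(g has_derivative (\<lambda>h. \<Sum>i\<in>Basis. (h \<bullet> i) * G i Z)) (at Z within T)" if "Z \<in> T" for Z
      using g[of Z] that has_derivative_subset unfolding T_def by blast
    show "\<bar>G i Z\<bar> \<le> B * norm (X - P) ^ m" if "Z \<in> T" "i \<in> Basis" for Z i
    proof -
      have "norm (Z - P) \<le> norm (X - P)" using that by (simp add: T_def dist_norm norm_minus_commute)
      then have "B * norm (Z - P) ^ m \<le> B * norm (X - P) ^ m"
        using \<open>0 \<le> B\<close> by (intro mult_left_mono power_mono) auto
      then show ?thesis using B[of Z i] that by (auto simp: T_def)
    qed
  qed (use X P in \<open>auto simp: T_def dist_norm norm_minus_commute\<close>)
  then show ?thesis using P by (simp add: mult_ac)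
qed

lemma continuous_on_open_near:
  fixes g :: "'a::metric_space \<Rightarrow> real"
  assumes "open S" "continuous_on S g" "X \<in> S" "e > 0"
  shows "\<exists>r>0. ball X r \<subseteq> S \<and> (\<forall>Y\<in>ball X r. \<bar>g Y - g X\<bar> < e)"
proof -
  obtain r where r: "r > 0" "\<And>Y. Y \<in> S \<Longrightarrow> dist Y X < r \<Longrightarrow> dist (g Y) (g X) < e"
    using assms(2)[unfolded continuous_on_iff, rule_format, OF assms(3,4)] by blast
  obtain s where s: "s > 0" "ball X s \<subseteq> S" using assms(1,3) open_contains_ball by blast
  show ?thesis
  proof (intro exI[of _ "min r s"] conjI ballI)
    fix Y assume Y: "Y \<in> ball X (min r s)"
    then have "Y \<in> ball X s" by simp
    with s(2) have "Y \<in> S" by blast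
    with r(2)[of Y] Y show "\<bar>g Y - g X\<bar> < e" by (simp add: dist_commute dist_real_def)
  next
    show "ball X (min r s) \<subseteq> S" using s(2) by (auto simp: subset_iff)
  qed (use r(1) s(1) in simp)
qed

text \<open>The second difference over a small square is symmetric in the two directions, and two
  mean value steps express it by \<open>partial S [j, i] f\<close> as well as by
  \<open>partial S [i, j] f\<close> at nearby points. Continuity of both then excludes a
  gap.\<close>

lemma mixed_partials_commute:
  fixes f :: "'a::euclidean_space \<Rightarrow> real"
  assumes S: "open S" and f: "f \<in> Ck_on 2 S" and X: "X \<in> S" and ij: "i \<in> Basis" "j \<in> Basis"
  shows "partial S [i, j] f X = partial S [j, i] f X"
proof (rule ccontr)
  define A B where "A = partial S [i, j] f X" and "B = partial S [j, i] f X"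
  define e where "e = \<bar>A - B\<bar> / 2"
  assume "partial S [i, j] f X \<noteq> partial S [j, i] f X"
  then have "A \<noteq> B" unfolding A_def B_def .
  then have e: "e > 0" by (simp add: e_def)
  have near: "\<exists>r>0. ball X r \<subseteq> S \<and> (\<forall>Y\<in>ball X r. \<bar>partial S [a, b] f Y - partial S [a, b] f X\<bar> < e)"
    if "a \<in> Basis" "b \<in> Basis" for a b
  proof -
    have "[a, b] \<in> dirs 2" using that by (simp add: dirs_def)
    then show ?thesis
      by (rule continuous_on_open_near[OF S Ck_on_continuous[OF f order_refl] X e])
  qed
  obtain r1 where r1: "r1 > 0" "ball X r1 \<subseteq> S"
      "\<And>Y. Y \<in> ball X r1 \<Longrightarrow> \<bar>partial S [i, j] f Y - partial S [i, j] f X\<bar> < e"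
    using near[OF ij] by meson
  obtain r2 where r2: "r2 > 0"
      "\<And>Y. Y \<in> ball X r2 \<Longrightarrow> \<bar>partial S [j, i] f Y - partial S [j, i] f X\<bar> < e"
    using near[OF ij(2,1)] by meson
  define r where "r = min r1 r2"
  have sub: "ball X r \<subseteq> ball X r1" "ball X r \<subseteq> ball X r2" by (auto simp: r_def)
  have r: "r > 0" "ball X r \<subseteq> S" using r1(1,2) r2(1) sub(1) by (simp_all add: r_def subset_trans)
  note r3 = r1(3)[OF subsetD[OF sub(1)]]
  note r4 = r2(2)[OF subsetD[OF sub(2)]]
  \<comment> \<open>Two increments of length at most \<open>h\<close> add up to at most
    \<open>2 * r / 3\<close>, so all points used stay in the ball.\<close>
  define h where "h = r / 3"
  have h: "h > 0" using r(1) by (simp add: h_def)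
  have inball: "X + s *\<^sub>R a + t *\<^sub>R b \<in> ball X r" if "a \<in> Basis" "b \<in> Basis" "0 \<le> s" "s \<le> h" "0 \<le> t" "t \<le> h" for a b :: 'a and s t
  proof -
    have "norm (s *\<^sub>R a + t *\<^sub>R b) \<le> s + t"
      using norm_triangle_ineq[of "s *\<^sub>R a" "t *\<^sub>R b"] that by simp
    also have "\<dots> < r" using that r(1) by (simp add: h_def)
    finally have "norm (s *\<^sub>R a + t *\<^sub>R b) < r" .
    moreover have "X - (X + s *\<^sub>R a + t *\<^sub>R b) = - (s *\<^sub>R a + t *\<^sub>R b)" by simp
    ultimately show ?thesis by (simp only: mem_ball dist_norm norm_minus_cancel)
  qed
  have line: "((\<lambda>s. partial S vs f (Z + s *\<^sub>R a)) has_real_derivative partial S (a # vs) f (Z + t *\<^sub>R a)) (at t)"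
    if vs: "vs \<in> dirs m" "m < 2" and a: "a \<in> Basis" and Z: "Z + t *\<^sub>R a \<in> S" for vs m a Z t
  proof -
    have op: "open {s. Z + s *\<^sub>R a \<in> S}"
    proof -
      have "continuous_on UNIV (\<lambda>s. Z + s *\<^sub>R a)" by (intro continuous_intros)
      from open_vimage[OF S this] show ?thesis by (simp add: vimage_def)
    qed
    have "((\<lambda>s. partial S vs f (Z + s *\<^sub>R a)) has_real_derivative (\<Sum>k\<in>Basis. (a \<bullet> k) * partial S (k # vs) f (Z + t *\<^sub>R a)))
       (at t within {s. Z + s *\<^sub>R a \<in> S})"
      by (rule has_derivative_line[OF Ck_onD[OF f vs(2,1) Z]])
    moreover have "(\<Sum>k\<in>Basis. (a \<bullet> k) * partial S (k # vs) f (Z + t *\<^sub>R a)) = partial S (a # vs) f (Z + t *\<^sub>R a)"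
      using sum_Basis_pick[OF a, of "\<lambda>k. partial S (k # vs) f (Z + t *\<^sub>R a)"] .
    ultimately show ?thesis
      using at_within_open[OF _ op, of t] Z by simp
  qed
  have key: "\<exists>Y\<in>ball X r. f (X + h *\<^sub>R a + h *\<^sub>R b) - f (X + h *\<^sub>R a) - f (X + h *\<^sub>R b) + f X = h * h * partial S [b, a] f Y"
    if ab: "a \<in> Basis" "b \<in> Basis" for a b
  proof -
    have d1: "((\<lambda>s. f (X + h *\<^sub>R b + s *\<^sub>R a) - f (X + s *\<^sub>R a)) has_real_derivative
       partial S [a] f (X + h *\<^sub>R b + s *\<^sub>R a) - partial S [a] f (X + s *\<^sub>R a)) (at s)" if "0 \<le> s" "s \<le> h" for s
      using line[of "[]" 0 a "X + h *\<^sub>R b" s] line[of "[]" 0 a "X" s] inball[OF ab(2,1), of h s] inball[OF ab(1,1), of s 0] ab that h r(2)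
      by (intro DERIV_diff) auto
    obtain s where s: "0 < s" "s < h" "(f (X + h *\<^sub>R b + h *\<^sub>R a) - f (X + h *\<^sub>R a)) - (f (X + h *\<^sub>R b + 0 *\<^sub>R a) - f (X + 0 *\<^sub>R a))
      = (h - 0) * (partial S [a] f (X + h *\<^sub>R b + s *\<^sub>R a) - partial S [a] f (X + s *\<^sub>R a))"
      using MVT2[OF h, of "\<lambda>s. f (X + h *\<^sub>R b + s *\<^sub>R a) - f (X + s *\<^sub>R a)" 
          "\<lambda>s. partial S [a] f (X + h *\<^sub>R b + s *\<^sub>R a) - partial S [a] f (X + s *\<^sub>R a)"] d1 by blast
    have d2: "((\<lambda>t. partial S [a] f (X + s *\<^sub>R a + t *\<^sub>R b)) has_real_derivative
       partial S [b, a] f (X + s *\<^sub>R a + t *\<^sub>R b)) (at t)" if "0 \<le> t" "t \<le> h" for t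
      using line[of "[a]" 1 b "X + s *\<^sub>R a" t] inball[OF ab, of s t] ab that s r(2)
      by (auto simp: dirs_def simp del: partial.simps)
    obtain t where t: "0 < t" "t < h" "partial S [a] f (X + s *\<^sub>R a + h *\<^sub>R b) - partial S [a] f (X + s *\<^sub>R a + 0 *\<^sub>R b)
        = (h - 0) * partial S [b, a] f (X + s *\<^sub>R a + t *\<^sub>R b)"
      using MVT2[OF h, of "\<lambda>t. partial S [a] f (X + s *\<^sub>R a + t *\<^sub>R b)" "\<lambda>t. partial S [b,a] f (X + s *\<^sub>R a + t *\<^sub>R b)"] d2 by blast
    have "X + s *\<^sub>R a + t *\<^sub>R b \<in> ball X r" using inball[OF ab, of s t] s t by auto
    moreover have "f (X + h *\<^sub>R a + h *\<^sub>R b) - f (X + h *\<^sub>R a) - f (X + h *\<^sub>R b) + f X = h * h * partial S [b, a] f (X + s *\<^sub>R a + t *\<^sub>R b)"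
      using s(3) t(3) by (simp add: algebra_simps del: partial.simps)
    ultimately show ?thesis by blast
  qed
  obtain Y1 Y2 where Y: "Y1 \<in> ball X r" "Y2 \<in> ball X r"
    "h * h * partial S [i, j] f Y1 = h * h * partial S [j, i] f Y2"
    using key[OF ij] key[OF ij(2,1)] by (auto simp: algebra_simps simp del: partial.simps)
  then have "partial S [i, j] f Y1 = partial S [j, i] f Y2" using h by simp
  moreover define p where "p = partial S [j, i] f Y2"
  ultimately have "\<bar>p - A\<bar> < e" "\<bar>p - B\<bar> < e"
    using r3[OF Y(1)] r4[OF Y(2)] unfolding A_def B_def by (simp_all only:)
  then show False using abs_triangle_ineq4[of "p - B" "p - A"] unfolding e_def by simp
qed

section \<open>Riesz-type integrals over the boundary\<close>

lemma ex_dyadic_shell: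
  assumes "0 < r" "r \<le> (1::real)"
  shows "\<exists>k. (1/2) ^ Suc k < r \<and> r \<le> (1/2) ^ k"
proof -
  obtain n where "(1/2) ^ n < r" using real_arch_pow_inv[of r "1/2"] assms by auto
  then have "\<exists>k<n. (\<forall>i\<le>k. \<not> (1/2) ^ i < r) \<and> (1/2) ^ Suc k < r"
    by (rule ex_least_nat_less) (use assms in simp)
  then show ?thesis by (meson le_refl not_less)
qed

lemma term_le_suminf: "f k \<le> suminf (f :: nat \<Rightarrow> ennreal)"
  using sum_le_suminf[of f "{k}"] by simp

text \<open>Dyadic shells: between the radii \<open>(1/2) ^ Suc k\<close> and
  \<open>(1/2) ^ k\<close> the integrand is at most \<open>2 powr (s * Suc k)\<close>, while the
  volume of the enclosing ball is a multiple of \<open>((1/2) ^ k) ^ DIM('a)\<close>. The ratio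
  \<open>q\<close> of the resulting geometric series is below 1 exactly because
  \<open>s < DIM('a)\<close>.\<close>

lemma nn_integral_powr_unit_ball:
  fixes s :: real
  assumes "0 \<le> s" "s < DIM('a::euclidean_space)"
  shows "(\<integral>\<^sup>+(x::'a). indicator (cball 0 1) x * ennreal (norm x powr - s) \<partial>lborel) < \<infinity>"
proof -
  define q where "q = (2::real) powr (s - DIM('a))"
  have q: "0 < q" "q < 1" using assms by (auto simp: q_def powr_less_one)
  define c where "c = 2 powr s * unit_ball_vol (real DIM('a))"
  have "(\<integral>\<^sup>+(x::'a). indicator (cball 0 1) x * ennreal (norm x powr - s) \<partial>lborel)
      \<le> (\<integral>\<^sup>+(x::'a). (\<Sum>k. ennreal (2 powr (s * Suc k)) * indicator (cball 0 ((1/2)^k)) x) \<partial>lborel)"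
  proof (rule nn_integral_mono)
    fix x :: 'a
    show "indicator (cball 0 1) x * ennreal (norm x powr - s)
        \<le> (\<Sum>k. ennreal (2 powr (s * Suc k)) * indicator (cball 0 ((1/2)^k)) x)"
    \<comment> \<open>At the origin \<open>0 powr - s\<close> is 0, so the singular point itself
      lies in no shell and causes no trouble.\<close>
    proof (cases "x = 0 \<or> norm x > 1")
      case False
      then obtain k where k: "(1/2) ^ Suc k < norm x" "norm x \<le> (1/2) ^ k"
        using ex_dyadic_shell[of "norm x"] by auto
      have "norm x powr - s \<le> ((1/2) ^ Suc k) powr - s"
        using k assms by (intro powr_mono2') auto
      also have "((1/2::real) ^ Suc k) = 2 powr (- real (Suc k))"
        by (simp add: powr_minus powr_realpow power_one_over divide_simps del: power_Suc of_nat_Suc)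
      also have "(2 powr (- real (Suc k))) powr - s = 2 powr (s * Suc k)"
        by (simp only: powr_powr minus_mult_minus mult.commute)
      finally have "indicator (cball 0 1) x * ennreal (norm x powr - s)
          \<le> ennreal (2 powr (s * Suc k)) * indicator (cball 0 ((1/2)^k)) x"
        using k(2) False by (auto simp: indicator_def intro: ennreal_leI)
      also have "\<dots> \<le> (\<Sum>k. ennreal (2 powr (s * Suc k)) * indicator (cball 0 ((1/2)^k)) x)"
        by (rule term_le_suminf)
      finally show ?thesis .
    qed auto
  qed
  also have "\<dots> = (\<Sum>k. \<integral>\<^sup>+(x::'a). ennreal (2 powr (s * Suc k)) * indicator (cball 0 ((1/2)^k)) x \<partial>lborel)"
    by (intro nn_integral_suminf borel_measurable_times_ennreal borel_measurable_indicator borel_measurable_const) simp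
  also have "\<dots> = (\<Sum>k. ennreal (c * q ^ k))"
  proof (rule suminf_cong)
    fix k
    have "(\<integral>\<^sup>+(x::'a). ennreal (2 powr (s * Suc k)) * indicator (cball 0 ((1/2)^k)) x \<partial>lborel)
      = ennreal (2 powr (s * Suc k)) * ennreal (unit_ball_vol (real DIM('a)) * ((1/2)^k) ^ DIM('a))"
      by (simp add: nn_integral_cmult_indicator emeasure_cball)
    also have "\<dots> = ennreal (2 powr (s * Suc k) * (unit_ball_vol (real DIM('a)) * ((1/2)^k) ^ DIM('a)))"
      by (simp add: ennreal_mult')
    also have "2 powr (s * Suc k) * (unit_ball_vol (real DIM('a)) * ((1/2)^k) ^ DIM('a)) = c * q ^ k"
    proof -
      have "q ^ k = 2 powr (s * k) * 2 powr (- (real DIM('a) * k))"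
        by (simp add: q_def powr_realpow[symmetric] powr_powr powr_add[symmetric] algebra_simps)
      moreover have "2 powr (- (real DIM('a) * k)) = ((1/2)^k) ^ DIM('a)"
        by (simp add: powr_minus powr_powr[symmetric] powr_realpow power_one_over
            divide_simps power_mult[symmetric] mult.commute flip: of_nat_mult)
      moreover have "2 powr (s * Suc k) = 2 powr s * 2 powr (s * k)"
        by (simp add: powr_add[symmetric] algebra_simps)
      ultimately show ?thesis by (simp add: c_def)
    qed
    finally show "(\<integral>\<^sup>+(x::'a). ennreal (2 powr (s * Suc k)) * indicator (cball 0 ((1/2)^k)) x \<partial>lborel) = ennreal (c * q ^ k)" .
  qed
  also have "\<dots> = ennreal (\<Sum>k. c * q ^ k)"
    using q by (intro suminf_ennreal2) (auto simp: c_def intro!: summable_mult summable_geometric)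
  also have "\<dots> < \<infinity>" by simp
  finally show ?thesis .
qed

lemma nn_integral_lborel_translate:
  fixes f :: "'a::euclidean_space \<Rightarrow> ennreal"
  assumes [measurable]: "f \<in> borel_measurable borel"
  shows "(\<integral>\<^sup>+x. f (x - a) \<partial>lborel) = (\<integral>\<^sup>+x. f x \<partial>lborel)"
proof -
  have "(\<integral>\<^sup>+x. f x \<partial>lborel) = (\<integral>\<^sup>+x. f x \<partial>distr lborel borel ((+) (-a)))"
    by (simp add: lborel_distr_plus)
  also have "\<dots> = (\<integral>\<^sup>+x. f (x - a) \<partial>lborel)"
    by (subst nn_integral_distr) auto
  finally show ?thesis ..
qed

text \<open>At distance more than 1 from \<open>a\<close> the kernel is at most 1 and contributes no
  more than the measure of \<open>A\<close>; at smaller distance the integral is a translate of the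
  one over the unit ball. Neither part depends on \<open>a\<close>, so \<open>J\<close> does
  not.\<close>

lemma nn_integral_riesz_bounded:
  fixes s :: real and A :: "'a::euclidean_space set"
  assumes "0 \<le> s" "s < DIM('a)" and A: "A \<in> sets borel" "bounded A"
  obtains J :: real where "0 \<le> J" "\<And>a. (\<integral>\<^sup>+x. indicator A x * ennreal (norm (x - a) powr - s) \<partial>lborel) \<le> ennreal J"
proof -
  define I where "I = (\<integral>\<^sup>+(x::'a). indicator (cball 0 1) x * ennreal (norm x powr - s) \<partial>lborel)"
  have "I < \<infinity>" unfolding I_def by (rule nn_integral_powr_unit_ball[OF assms(1,2)])
  moreover have "emeasure lborel A < \<infinity>" using emeasure_bounded_finite[OF A(2)] by simp
  ultimately have fin: "emeasure lborel A + I < \<infinity>" by simp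
  have [measurable]: "A \<in> sets borel" by fact
  have "(\<integral>\<^sup>+x. indicator A x * ennreal (norm (x - a) powr - s) \<partial>lborel) \<le> emeasure lborel A + I" for a
  proof -
    have [measurable]: "(\<lambda>x. indicator (cball 0 1) (x - a) :: ennreal) \<in> borel_measurable borel"
      by (rule measurable_compose[of "\<lambda>x. x - a" _ borel]) (auto intro!: borel_measurable_indicator)
    have "(\<integral>\<^sup>+x. indicator A x * ennreal (norm (x - a) powr - s) \<partial>lborel)
       \<le> (\<integral>\<^sup>+x. indicator A x + indicator (cball 0 1) (x - a) * ennreal (norm (x - a) powr - s) \<partial>lborel)"
    proof (rule nn_integral_mono)
      fix x
      have "norm (x - a) powr - s \<le> 1" if "norm (x - a) > 1"
        using powr_mono2'[of "- s" 1 "norm (x - a)"] assms(1) that by simp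
      then show "indicator A x * ennreal (norm (x - a) powr - s)
        \<le> indicator A x + indicator (cball 0 1) (x - a) * ennreal (norm (x - a) powr - s)"
        by (cases "norm (x - a) > 1")
          (auto simp: indicator_def dist_norm norm_minus_commute intro: ennreal_leI[of _ 1, simplified])
    qed
    also have "\<dots> = emeasure lborel A + (\<integral>\<^sup>+x. indicator (cball 0 1) (x - a) * ennreal (norm (x - a) powr - s) \<partial>lborel)"
      by (subst nn_integral_add) auto
    also have "(\<integral>\<^sup>+x. indicator (cball 0 1) (x - a) * ennreal (norm (x - a) powr - s) \<partial>lborel) = I"
      unfolding I_def by (rule nn_integral_lborel_translate[of "\<lambda>x. indicator (cball 0 1) x * ennreal (norm x powr - s)"])
        (intro borel_measurable_times_ennreal borel_measurable_indicator, simp_all)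
    finally show ?thesis .
  qed
  moreover have "emeasure lborel A + I = ennreal (enn2real (emeasure lborel A + I))" using fin by simp
  ultimately show ?thesis using that[of "enn2real (emeasure lborel A + I)"] by simp
qed

lemma integrable_riesz_bounded:
  fixes s :: real and A :: "'a::euclidean_space set"
  assumes s: "0 \<le> s" "s < DIM('a)" and A: "A \<in> sets borel" "bounded A"
  obtains J :: real where "0 \<le> J"
    "\<And>a. integrable lborel (\<lambda>x. indicator A x * norm (x - a) powr - s)"
    "\<And>a. (LINT x|lborel. indicator A x * norm (x - a) powr - s) \<le> J"
proof -
  obtain J :: real where J: "0 \<le> J" "\<And>a. (\<integral>\<^sup>+x. indicator A x * ennreal (norm (x - a) powr - s) \<partial>lborel) \<le> ennreal J"
    using nn_integral_riesz_bounded[OF assms] by blast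
  have [measurable]: "A \<in> sets borel" by fact
  have eq: "(\<integral>\<^sup>+x. ennreal (indicator A x * norm (x - a) powr - s) \<partial>lborel)
     = (\<integral>\<^sup>+x. indicator A x * ennreal (norm (x - a) powr - s) \<partial>lborel)" for a
    by (intro nn_integral_cong) (auto simp: indicator_def)
  have int: "integrable lborel (\<lambda>x. indicator A x * norm (x - a) powr - s)" for a
  proof (rule integrableI_nonneg)
    show "(\<integral>\<^sup>+x. ennreal (indicator A x * norm (x - a) powr - s) \<partial>lborel) < \<infinity>"
      unfolding eq using J(2)[of a] by (auto intro: le_less_trans)
  qed (simp_all)
  have "(LINT x|lborel. indicator A x * norm (x - a) powr - s) \<le> J" for a
  proof -
    have "ennreal (LINT x|lborel. indicator A x * norm (x - a) powr - s) \<le> ennreal J"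
      using J(2)[of a] nn_integral_eq_integral[OF int[of a]] unfolding eq by simp
    then show ?thesis using J(1) by simp
  qed
  with J(1) int show ?thesis using that by blast
qed

lemma norm_diff_boundary_ge: "norm (fst X - z) \<le> norm (X - (z, 0::real))"
  by (metis fst_conv fst_diff norm_fst_le prod.collapse)

text \<open>Moving \<open>X\<close> vertically onto the boundary only shortens its distance to
  boundary points, so the three-dimensional bound applies, uniformly up to the boundary and with
  critical exponent 3.\<close>

lemma integrable_riesz_R4:
  fixes s :: real and A :: "R3 set"
  assumes s: "0 \<le> s" "s < 3" and A: "A \<in> sets borel" "bounded A"
  obtains J :: real where "0 \<le> J"
    "\<And>X :: R4. integrable lborel (\<lambda>z. indicator A z * norm (X - (z, 0)) powr - s)"
    "\<And>X :: R4. (LINT z|lborel. indicator A z * norm (X - (z, 0)) powr - s) \<le> J"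
proof -
  have s': "s < DIM(R3)" using s by simp
  obtain J where J: "0 \<le> J" "\<And>a. integrable lborel (\<lambda>x. indicator A x * norm (x - a) powr - s)"
    "\<And>a. (LINT x|lborel. indicator A x * norm (x - a) powr - s) \<le> J"
    using integrable_riesz_bounded[OF s(1) s' A] by blast
  have [measurable]: "A \<in> sets borel" by fact
  have bd: "AE z in lborel. indicator A z * norm (X - (z, 0)) powr - s \<le> indicator A z * norm (z - fst X) powr - s" for X :: R4
    using AE_lborel_singleton[of "fst X"]
  proof eventually_elim
    case (elim z)
    then have "norm (X - (z, 0)) powr - s \<le> norm (z - fst X) powr - s"
      using norm_diff_boundary_ge[of X z] s by (intro powr_mono2') (auto simp: norm_minus_commute)
    then show ?case by (auto simp: indicator_def)
  qed
  have int: "integrable lborel (\<lambda>z. indicator A z * norm (X - (z, 0)) powr - s)" for X :: R4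
    by (rule Bochner_Integration.integrable_bound[OF J(2)[of "fst X"]]) (use bd[of X] in auto)
  moreover have "(LINT z|lborel. indicator A z * norm (X - (z, 0)) powr - s) \<le> J" for X :: R4
    using integral_mono_AE[OF int J(2)[of "fst X"] bd[of X]] J(3)[of "fst X"] by linarith
  ultimately show ?thesis using that J(1) by blast
qed

text \<open>Up to the factor -8 the integrand is the Laplacian of
  \<open>1 / (1 + (norm X)\<^sup>2)\<close>, the profile of the regularised kernel used further
  below. Growing dyadic balls give convergence: decay \<open>64 ^ k\<close> against volume
  \<open>16 ^ k\<close>.\<close>

lemma integrable_bubble:
  "integrable lborel (\<lambda>X::R4. 1 / (1 + (norm X)\<^sup>2) ^ 3)"
proof (rule integrableI_nonneg)
  have "(\<integral>\<^sup>+(X::R4). ennreal (1 / (1 + (norm X)\<^sup>2) ^ 3) \<partial>lborel)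
      \<le> (\<integral>\<^sup>+(X::R4). (\<Sum>k. ennreal (64 * (1/64) ^ k) * indicator (cball 0 (2^k)) X) \<partial>lborel)"
  proof (rule nn_integral_mono)
    fix X :: R4
    show "ennreal (1 / (1 + (norm X)\<^sup>2) ^ 3) \<le> (\<Sum>k. ennreal (64 * (1/64) ^ k) * indicator (cball 0 (2^k)) X)"
    proof -
      obtain n where n: "norm X < 2 ^ n" using real_arch_pow[of 2 "norm X"] by auto
      \<comment> \<open>By minimality \<open>norm X\<close> exceeds \<open>2 ^ (k - 1)\<close>
        unless \<open>k = 0\<close>; this lag by one dyadic step is the factor 64 in the
        bound.\<close>
      define k where "k = (LEAST k. norm X \<le> 2 ^ k)"
      have k: "norm X \<le> 2 ^ k" unfolding k_def by (rule LeastI[of _ n]) (use n in simp)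
      have "1 / (1 + (norm X)\<^sup>2) ^ 3 \<le> 64 * (1/64) ^ k"
      proof (cases k)
        case 0
        have "1 \<le> (1 + (norm X)\<^sup>2) ^ 3" by (rule one_le_power) simp
        then have "1 / (1 + (norm X)\<^sup>2) ^ 3 \<le> 1" by (subst divide_le_eq_1) linarith
        then show ?thesis using 0 by simp
      next
        case (Suc m)
        then have "\<not> norm X \<le> 2 ^ m" unfolding k_def using not_less_Least[of m "\<lambda>k. norm X \<le> 2 ^ k"] by auto
        then have "(2 ^ m)\<^sup>2 \<le> (norm X)\<^sup>2" by (intro power_mono) auto
        then have "(2 ^ m)\<^sup>2 \<le> 1 + (norm X)\<^sup>2" by linarith
        then have "((2 ^ m)\<^sup>2) ^ 3 \<le> (1 + (norm X)\<^sup>2) ^ 3" by (intro power_mono) simp_all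
        also have "((2 ^ m)\<^sup>2) ^ 3 = (64::real) ^ m"
          by (simp add: power2_eq_square power3_eq_cube flip: power_mult_distrib)
        finally have "1 / (1 + (norm X)\<^sup>2) ^ 3 \<le> 1 / 64 ^ m" by (intro divide_left_mono) (auto simp: add_pos_nonneg)
        then show ?thesis using Suc by (simp add: power_one_over)
      qed
      then have "ennreal (1 / (1 + (norm X)\<^sup>2) ^ 3) \<le> ennreal (64 * (1/64) ^ k) * indicator (cball 0 (2^k)) X"
        using k by (auto simp: indicator_def intro: ennreal_leI)
      also have "\<dots> \<le> (\<Sum>i. ennreal (64 * (1/64) ^ i) * indicator (cball 0 (2^i)) X)"
        by (rule term_le_suminf)
      finally show ?thesis .
    qed
  qed
  also have "\<dots> = (\<Sum>k. \<integral>\<^sup>+(X::R4). ennreal (64 * (1/64) ^ k) * indicator (cball 0 (2^k)) X \<partial>lborel)"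
    by (intro nn_integral_suminf borel_measurable_times_ennreal borel_measurable_indicator borel_measurable_const) simp
  also have "\<dots> = (\<Sum>k. ennreal (64 * unit_ball_vol 4 * (1/4) ^ k))"
  proof (rule suminf_cong)
    fix k
    have "(\<integral>\<^sup>+(X::R4). ennreal (64 * (1/64) ^ k) * indicator (cball 0 (2^k)) X \<partial>lborel)
      = ennreal (64 * (1/64) ^ k) * ennreal (unit_ball_vol 4 * (2^k) ^ 4)"
      by (simp add: nn_integral_cmult_indicator emeasure_cball)
    also have "\<dots> = ennreal (64 * (1/64) ^ k * (unit_ball_vol 4 * (2^k) ^ 4))"
      by (simp add: ennreal_mult')
    also have "64 * (1/64) ^ k * (unit_ball_vol 4 * (2^k) ^ 4) = 64 * unit_ball_vol 4 * (1/4::real) ^ k"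
    proof -
      have "((2::real)^k) ^ 4 = 16 ^ k" by (simp add: power4_eq_xxxx flip: power_mult_distrib)
      moreover have "(1/64::real) ^ k * 16 ^ k = (1/4) ^ k" by (simp flip: power_mult_distrib)
      ultimately show ?thesis by (simp add: mult_ac)
    qed
    finally show "(\<integral>\<^sup>+(X::R4). ennreal (64 * (1/64) ^ k) * indicator (cball 0 (2^k)) X \<partial>lborel)
       = ennreal (64 * unit_ball_vol 4 * (1/4) ^ k)" .
  qed
  also have "\<dots> = ennreal (\<Sum>k. 64 * unit_ball_vol 4 * (1/4) ^ k)"
    by (intro suminf_ennreal2) (auto intro!: summable_mult summable_geometric)
  also have "\<dots> < \<infinity>" by simp
  finally show "(\<integral>\<^sup>+(X::R4). ennreal (1 / (1 + (norm X)\<^sup>2) ^ 3) \<partial>lborel) < \<infinity>" .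
qed (auto intro!: borel_measurable_continuous_onI continuous_intros simp: add_pos_nonneg)

section \<open>Kernels obtained by differentiating the logarithm\<close>

text \<open>The \<open>i\<close>-th partial derivative of \<open>ln (norm X)\<close> for
  \<open>X \<noteq> 0\<close>; division by zero gives it the value 0 at the origin.\<close>

definition log_grad :: "'a::euclidean_space \<Rightarrow> 'a \<Rightarrow> real" where
  "log_grad i X = (X \<bullet> i) / (norm X)\<^sup>2"

text \<open>In dimension four this is half the Laplacian of \<open>ln (norm X)\<close>, and it is
  harmonic off the origin.\<close>

definition inv_square :: "'a::euclidean_space \<Rightarrow> real" where
  "inv_square X = 1 / (norm X)\<^sup>2"

text \<open>\<open>log_kernel d q q'\<close>: \<open>q\<close> belongs to the algebra generated by the first derivatives of \<open>ln \<bar>X\<bar>\<close> and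
  \<open>1 / \<bar>X\<bar>\<^sup>2\<close>, is homogeneous of degree \<open>- d\<close>, and \<open>q'\<close> is its formal gradient.\<close>

inductive log_kernel :: "nat \<Rightarrow> ('a::euclidean_space \<Rightarrow> real) \<Rightarrow> ('a \<Rightarrow> 'a \<Rightarrow> real) \<Rightarrow> bool" where
  log_kernel_p: "j \<in> Basis \<Longrightarrow> log_kernel 1 (log_grad j) (\<lambda>i X. (if i = j then 1 else 0) * inv_square X + (-2) * (log_grad i X * log_grad j X))"
| log_kernel_s: "log_kernel 2 inv_square (\<lambda>i X. (-2) * (log_grad i X * inv_square X))"
| log_kernel_add: "log_kernel d q q' \<Longrightarrow> log_kernel d r r' \<Longrightarrow> log_kernel d (\<lambda>X. q X + r X) (\<lambda>i X. q' i X + r' i X)"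
| log_kernel_scale: "log_kernel d q q' \<Longrightarrow> log_kernel d (\<lambda>X. c * q X) (\<lambda>i X. c * q' i X)"
| log_kernel_mult: "log_kernel d q q' \<Longrightarrow> log_kernel e r r' \<Longrightarrow> log_kernel (d + e) (\<lambda>X. q X * r X) (\<lambda>i X. q X * r' i X + q' i X * r X)"

text \<open>Differentiation stays inside the algebra and raises the degree by one, so estimates
  proved for all kernels automatically cover all derivatives of the logarithm.\<close>

lemma log_kernel_derivative:
  assumes "log_kernel d q q'" "i \<in> Basis"
  shows "\<exists>q''. log_kernel (Suc d) (q' i) q''"
  using assms
proof (induction rule: log_kernel.induct)
  case (log_kernel_p j)
  have "log_kernel (1 + 1) (\<lambda>X. log_grad i X * log_grad j X) (\<lambda>k X. log_grad i X * ((if k = j then 1 else 0) * inv_square X + (-2) * (log_grad k X * log_grad j X))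
       + ((if k = i then 1 else 0) * inv_square X + (-2) * (log_grad k X * log_grad i X)) * log_grad j X)"
    by (rule log_kernel.log_kernel_mult[OF log_kernel.log_kernel_p[OF log_kernel_p(2)] log_kernel.log_kernel_p[OF log_kernel_p(1)]])
  then have "log_kernel 2 (\<lambda>X. log_grad i X * log_grad j X) (\<lambda>k X. log_grad i X * ((if k = j then 1 else 0) * inv_square X + (-2) * (log_grad k X * log_grad j X))
       + ((if k = i then 1 else 0) * inv_square X + (-2) * (log_grad k X * log_grad i X)) * log_grad j X)" by (simp only: one_add_one)
  note * = log_kernel.log_kernel_add[OF log_kernel.log_kernel_scale[OF log_kernel.log_kernel_s, of "if i = j then 1 else 0"] log_kernel.log_kernel_scale[OF this, of "-2"]]
  show ?case unfolding Suc_1 by (rule exI, rule *)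
next
  case log_kernel_s
  have "log_kernel (1 + 2) (\<lambda>X. log_grad i X * inv_square X) (\<lambda>k X. log_grad i X * ((-2) * (log_grad k X * inv_square X))
       + ((if k = i then 1 else 0) * inv_square X + (-2) * (log_grad k X * log_grad i X)) * inv_square X)"
    by (rule log_kernel.log_kernel_mult[OF log_kernel.log_kernel_p[OF log_kernel_s] log_kernel.log_kernel_s])
  note * = log_kernel.log_kernel_scale[OF this, of "-2", unfolded plus_1_eq_Suc]
  show ?case by (rule exI, rule *)
next
  case (log_kernel_add d q q' r r')
  obtain q'' where q: "log_kernel (Suc d) (q' i) q''" using log_kernel_add.IH(1)[OF log_kernel_add.prems] ..
  obtain r'' where r: "log_kernel (Suc d) (r' i) r''" using log_kernel_add.IH(2)[OF log_kernel_add.prems] ..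
  show ?case by (rule exI, rule log_kernel.log_kernel_add[OF q r])
next
  case (log_kernel_scale d q q' c)
  obtain q'' where q: "log_kernel (Suc d) (q' i) q''" using log_kernel_scale.IH[OF log_kernel_scale.prems] ..
  show ?case by (rule exI, rule log_kernel.log_kernel_scale[OF q])
next
  case (log_kernel_mult d q q' e r r')
  obtain q'' where q: "log_kernel (Suc d) (q' i) q''" using log_kernel_mult.IH(1)[OF log_kernel_mult.prems] ..
  obtain r'' where r: "log_kernel (Suc e) (r' i) r''" using log_kernel_mult.IH(2)[OF log_kernel_mult.prems] ..
  note * = log_kernel.log_kernel_add[OF log_kernel.log_kernel_mult[OF log_kernel_mult.hyps(1) r, unfolded add_Suc_right] log_kernel.log_kernel_mult[OF q log_kernel_mult.hyps(2), unfolded add_Suc]]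
  show ?case by (rule exI, rule *)
qed

section \<open>Taylor estimates for the kernels, valid across the singularity\<close>

definition inv_norm :: "'a::real_normed_vector \<Rightarrow> real" where "inv_norm X = inverse (norm X)"

abbreviation inv_norm2 :: "'a::real_normed_vector \<Rightarrow> 'a \<Rightarrow> real" where "inv_norm2 X Y \<equiv> inv_norm X + inv_norm Y"

lemma inv_norm_nonneg [simp]: "0 \<le> inv_norm X" by (simp add: inv_norm_def)

text \<open>Bounds on the value, the increment and the first order Taylor remainder, with no condition on the
  segment from \<open>X\<close> to \<open>Y\<close>, which may pass near the singularity.\<close>

definition taylor_kernel :: "nat \<Rightarrow> ('a::euclidean_space \<Rightarrow> real) \<Rightarrow> ('a \<Rightarrow> 'a \<Rightarrow> real) \<Rightarrow> real \<Rightarrow> bool" where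
  "taylor_kernel d q q' C \<longleftrightarrow> 0 \<le> C \<and> (\<forall>X Y. X \<noteq> 0 \<longrightarrow> Y \<noteq> 0 \<longrightarrow>
     \<bar>q X\<bar> \<le> C * inv_norm X ^ d \<and>
     \<bar>q Y - q X\<bar> \<le> C * (norm (Y - X) * inv_norm2 X Y) * inv_norm2 X Y ^ d \<and>
     \<bar>q Y - q X - (\<Sum>i\<in>Basis. ((Y - X) \<bullet> i) * q' i X)\<bar> \<le> C * (norm (Y - X) * inv_norm2 X Y)\<^sup>2 * inv_norm2 X Y ^ d)"

text \<open>With \<open>a = 1 / norm X\<close> and \<open>b = 1 / norm Y\<close> as variables,
  increments are controlled by polynomials in \<open>a\<close>, \<open>b\<close> and
  \<open>norm h\<close>. The identity for \<open>b\<^sup>2 - a\<^sup>2\<close> is exact, so the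
  segment between the points never has to be followed.\<close>

lemma inv_norm_expansion:
  fixes X Y :: "'a::euclidean_space"
  assumes "X \<noteq> 0" "Y \<noteq> 0"
  defines "a \<equiv> inv_norm X" and "b \<equiv> inv_norm Y" and "h \<equiv> Y - X"
  shows "0 < a" "0 < b" "norm X = 1 / a" "inv_square X = a\<^sup>2" "inv_square Y = b\<^sup>2" "\<bar>b - a\<bar> \<le> norm h * (a * b)"
    and "\<bar>X \<bullet> h\<bar> \<le> norm h / a"
    and "b\<^sup>2 - a\<^sup>2 = - (2 * (X \<bullet> h) + (norm h)\<^sup>2) * (a\<^sup>2 * b\<^sup>2)"
    and "\<bar>b\<^sup>2 - a\<^sup>2\<bar> \<le> norm h * (a * b\<^sup>2 + a\<^sup>2 * b)"
proof -
  have nz: "norm X > 0" "norm Y > 0" using assms by auto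
  show ab: "0 < a" "0 < b" using assms by (auto simp: inv_norm_def)
  show nX: "norm X = 1 / a" "inv_square X = a\<^sup>2" "inv_square Y = b\<^sup>2"
    by (auto simp: a_def b_def inv_norm_def inv_square_def power_inverse divide_inverse)
  have nY: "norm Y = 1 / b" by (simp add: b_def inv_norm_def divide_inverse)
  have "b - a = (norm X - norm Y) * (a * b)"
    unfolding nX nY using ab by (simp add: field_simps)
  moreover have "\<bar>norm X - norm Y\<bar> \<le> norm h"
    using norm_triangle_ineq3[of X Y] by (simp add: h_def norm_minus_commute)
  ultimately show ba: "\<bar>b - a\<bar> \<le> norm h * (a * b)"
    using ab by (simp add: abs_mult mult_right_mono)
  show "\<bar>X \<bullet> h\<bar> \<le> norm h / a"
    using Cauchy_Schwarz_ineq2[of X h] nX by (simp add: mult.commute divide_inverse)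
  have "(norm Y)\<^sup>2 = (norm X)\<^sup>2 + 2 * (X \<bullet> h) + (norm h)\<^sup>2"
    by (simp add: h_def power2_norm_eq_inner inner_diff_left inner_diff_right inner_commute)
  then have "1 / b\<^sup>2 - 1 / a\<^sup>2 = 2 * (X \<bullet> h) + (norm h)\<^sup>2"
    unfolding nX nY by (simp add: power_divide)
  then have "(1 / b\<^sup>2 - 1 / a\<^sup>2) * (a\<^sup>2 * b\<^sup>2) = (2 * (X \<bullet> h) + (norm h)\<^sup>2) * (a\<^sup>2 * b\<^sup>2)" by simp
  moreover have "(1 / b\<^sup>2 - 1 / a\<^sup>2) * (a\<^sup>2 * b\<^sup>2) = a\<^sup>2 - b\<^sup>2"
    using ab by (simp add: field_simps)
  ultimately show "b\<^sup>2 - a\<^sup>2 = - (2 * (X \<bullet> h) + (norm h)\<^sup>2) * (a\<^sup>2 * b\<^sup>2)" by linarith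
  have "b\<^sup>2 - a\<^sup>2 = (b - a) * (a + b)" by (simp add: power2_eq_square algebra_simps)
  then have "\<bar>b\<^sup>2 - a\<^sup>2\<bar> \<le> norm h * (a * b) * (a + b)"
    using ba ab by (simp add: abs_mult mult_right_mono)
  then show "\<bar>b\<^sup>2 - a\<^sup>2\<bar> \<le> norm h * (a * b\<^sup>2 + a\<^sup>2 * b)"
    by (simp add: power2_eq_square algebra_simps)
qed

lemma taylor_kernel_s: "taylor_kernel 2 (inv_square :: 'a::euclidean_space \<Rightarrow> real) (\<lambda>i X. (-2) * (log_grad i X * inv_square X)) 3"
  unfolding taylor_kernel_def
proof (intro conjI allI impI)
  fix X Y :: 'a assume XY: "X \<noteq> 0" "Y \<noteq> 0"
  define a b h x where "a = inv_norm X" and "b = inv_norm Y" and "h = Y - X" and "x = X \<bullet> h"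
  note E = inv_norm_expansion[OF XY, folded a_def b_def h_def, folded x_def]
  have ab: "0 \<le> a" "0 \<le> b" using E by auto
  show "\<bar>inv_square X\<bar> \<le> 3 * inv_norm X ^ 2" using E(4) by (simp add: a_def)
  have "a * b\<^sup>2 + a\<^sup>2 * b \<le> (a + b) ^ 3"
    using ab by (simp add: power2_eq_square power3_eq_cube algebra_simps)
  then have D: "\<bar>b\<^sup>2 - a\<^sup>2\<bar> \<le> norm h * (a + b) ^ 3"
    using E(9) by (meson mult_left_mono norm_ge_zero order_trans)
  then have "\<bar>b\<^sup>2 - a\<^sup>2\<bar> \<le> 3 * (norm h * (a + b) ^ 3)" using ab by (smt (verit) norm_ge_zero mult_nonneg_nonneg zero_le_power)
  then show "\<bar>inv_square Y - inv_square X\<bar> \<le> 3 * (norm (Y - X) * inv_norm2 X Y) * inv_norm2 X Y ^ 2"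
    unfolding E(4,5) a_def[symmetric] b_def[symmetric] h_def[symmetric]
    by (simp add: power2_eq_square power3_eq_cube mult_ac)
  have sum: "(\<Sum>i\<in>Basis. (h \<bullet> i) * ((-2) * (log_grad i X * inv_square X))) = - 2 * x * (a\<^sup>2)\<^sup>2"
  proof -
    have "(\<Sum>i\<in>Basis. (h \<bullet> i) * ((-2) * (log_grad i X * inv_square X))) = (\<Sum>i\<in>Basis. (X \<bullet> i) * (h \<bullet> i)) * ((-2) * (inv_square X * inv_square X))"
      unfolding sum_distrib_right by (rule sum.cong) (simp_all add: log_grad_def inv_square_def)
    also have "(\<Sum>i\<in>Basis. (X \<bullet> i) * (h \<bullet> i)) = x" unfolding x_def by (rule euclidean_inner[symmetric])
    finally show ?thesis unfolding E(4) by (simp add: power2_eq_square)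
  qed
  \<comment> \<open>The linear part of the exact formula differs from the derivative only by having
    \<open>b\<^sup>2\<close> in place of one factor \<open>a\<^sup>2\<close>; what remains are two
    terms of second order in \<open>norm h\<close>.\<close>
  have eq: "b\<^sup>2 - a\<^sup>2 + 2 * x * (a\<^sup>2)\<^sup>2 = - (2 * x * a\<^sup>2 * (b\<^sup>2 - a\<^sup>2)) - (norm h)\<^sup>2 * (a\<^sup>2 * b\<^sup>2)"
    using E(8) by (simp add: algebra_simps power2_eq_square)
  have "\<bar>2 * x * a\<^sup>2 * (b\<^sup>2 - a\<^sup>2)\<bar> = 2 * (\<bar>x\<bar> * a\<^sup>2) * \<bar>b\<^sup>2 - a\<^sup>2\<bar>" by (simp add: abs_mult)
  also have "\<dots> \<le> 2 * (norm h * a) * (norm h * (a + b) ^ 3)"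
  proof (rule mult_mono[OF _ D])
    have "\<bar>x\<bar> * a\<^sup>2 \<le> norm h / a * a\<^sup>2" using E(7) by (intro mult_right_mono) auto
    then show "2 * (\<bar>x\<bar> * a\<^sup>2) \<le> 2 * (norm h * a)" using E(1) by (simp add: power2_eq_square)
  qed (use ab in auto)
  also have "\<dots> \<le> 2 * (norm h * (a + b)) * (norm h * (a + b) ^ 3)"
    using ab by (intro mult_right_mono mult_left_mono) auto
  finally have 1: "\<bar>2 * x * a\<^sup>2 * (b\<^sup>2 - a\<^sup>2)\<bar> \<le> 2 * ((norm h * (a + b))\<^sup>2 * (a + b)\<^sup>2)"
    by (simp add: power2_eq_square power3_eq_cube mult_ac)
  have "a\<^sup>2 * b\<^sup>2 \<le> (a + b)\<^sup>2 * (a + b)\<^sup>2" using ab by (intro mult_mono power_mono) auto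
  then have 2: "(norm h)\<^sup>2 * (a\<^sup>2 * b\<^sup>2) \<le> (norm h * (a + b))\<^sup>2 * (a + b)\<^sup>2"
    by (simp add: power_mult_distrib mult_left_mono mult.assoc)
  have 3: "0 \<le> (norm h)\<^sup>2 * (a\<^sup>2 * b\<^sup>2)" by simp
  have "\<bar>b\<^sup>2 - a\<^sup>2 + 2 * x * (a\<^sup>2)\<^sup>2\<bar> \<le> 3 * ((norm h * (a + b))\<^sup>2 * (a + b)\<^sup>2)"
    unfolding eq using 1 2 3 by linarith
  then show "\<bar>inv_square Y - inv_square X - (\<Sum>i\<in>Basis. ((Y - X) \<bullet> i) * ((-2) * (log_grad i X * inv_square X)))\<bar>
      \<le> 3 * (norm (Y - X) * inv_norm2 X Y)\<^sup>2 * inv_norm2 X Y ^ 2"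
    unfolding a_def[symmetric] b_def[symmetric] h_def[symmetric] sum unfolding E(4,5) by (simp add: mult.assoc)
qed simp

lemma taylor_kernel_p:
  assumes j: "j \<in> Basis"
  shows "taylor_kernel 1 (log_grad j) (\<lambda>i X. (if i = j then 1 else 0) * inv_square X + (-2) * (log_grad i X * log_grad j X)) 4"
  unfolding taylor_kernel_def
proof (intro conjI allI impI)
  fix X Y :: 'a assume XY: "X \<noteq> 0" "Y \<noteq> 0"
  define a b h x where "a = inv_norm X" and "b = inv_norm Y" and "h = Y - X" and "x = X \<bullet> h"
  note E = inv_norm_expansion[OF XY, folded a_def b_def h_def, folded x_def]
  define xj hj where "xj = X \<bullet> j" and "hj = h \<bullet> j"
  have xj: "\<bar>xj\<bar> \<le> 1 / a" "\<bar>hj\<bar> \<le> norm h"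
    using Basis_le_norm[OF j, of X] Basis_le_norm[OF j, of h] E(3) by (simp_all add: xj_def hj_def)
  have ab: "0 \<le> a" "0 \<le> b" using E by auto
  have pX: "log_grad j X = xj * a\<^sup>2" "log_grad j Y = (xj + hj) * b\<^sup>2"
    unfolding E(4)[symmetric] E(5)[symmetric] by (simp_all add: log_grad_def inv_square_def xj_def hj_def h_def inner_diff_left)
  have "\<bar>log_grad j X\<bar> \<le> 1 / a * a\<^sup>2"
    unfolding pX using mult_right_mono[OF xj(1), of "a\<^sup>2"] by (simp add: abs_mult)
  then have "\<bar>log_grad j X\<bar> \<le> a" using E(1) by (simp add: power2_eq_square)
  then show "\<bar>log_grad j X\<bar> \<le> 4 * inv_norm X ^ 1" using ab by (simp add: a_def)
  define D where "D = b\<^sup>2 - a\<^sup>2"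
  have D: "\<bar>D\<bar> \<le> norm h * (a * b\<^sup>2 + a\<^sup>2 * b)" using E(9) by (simp add: D_def)
  have xD: "\<bar>xj * D\<bar> \<le> norm h * (b\<^sup>2 + a * b)"
  proof -
    have "\<bar>xj * D\<bar> \<le> 1 / a * (norm h * (a * b\<^sup>2 + a\<^sup>2 * b))"
      unfolding abs_mult using xj D ab by (intro mult_mono) auto
    also have "\<dots> = norm h * (b\<^sup>2 + a * b)" using E(1) by (simp add: field_simps power2_eq_square)
    finally show ?thesis .
  qed
  have "log_grad j Y - log_grad j X = hj * b\<^sup>2 + xj * D" unfolding pX D_def by (simp add: algebra_simps)
  moreover have "\<bar>hj * b\<^sup>2\<bar> \<le> norm h * b\<^sup>2" using xj by (simp add: abs_mult mult_right_mono)
  ultimately have "\<bar>log_grad j Y - log_grad j X\<bar> \<le> norm h * b\<^sup>2 + norm h * (b\<^sup>2 + a * b)" using xD by linarith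
  also have "\<dots> = norm h * (2 * b\<^sup>2 + a * b)" by (simp add: algebra_simps)
  also have "\<dots> \<le> norm h * (4 * (a + b)\<^sup>2)"
    using ab by (intro mult_left_mono) (auto simp: power2_eq_square algebra_simps)
  finally show "\<bar>log_grad j Y - log_grad j X\<bar> \<le> 4 * (norm (Y - X) * inv_norm2 X Y) * inv_norm2 X Y ^ 1"
    by (simp add: a_def b_def h_def power2_eq_square mult_ac)
  have sum: "(\<Sum>i\<in>Basis. (h \<bullet> i) * ((if i = j then 1 else 0) * inv_square X + (-2) * (log_grad i X * log_grad j X))) = hj * a\<^sup>2 - 2 * x * a\<^sup>2 * (xj * a\<^sup>2)"
  proof -
    have "(\<Sum>i\<in>Basis. (h \<bullet> i) * ((if i = j then 1 else 0) * inv_square X + (-2) * (log_grad i X * log_grad j X)))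
       = (\<Sum>i\<in>Basis. if i = j then (h \<bullet> i) * inv_square X else 0) + (\<Sum>i\<in>Basis. (X \<bullet> i) * (h \<bullet> i)) * ((-2) * (inv_square X * log_grad j X))"
      unfolding sum_distrib_right sum.distrib[symmetric]
      by (rule sum.cong) (simp_all add: log_grad_def inv_square_def algebra_simps)
    also have "(\<Sum>i\<in>Basis. (X \<bullet> i) * (h \<bullet> i)) = x" unfolding x_def by (rule euclidean_inner[symmetric])
    also have "(\<Sum>i\<in>Basis. if i = j then (h \<bullet> i) * inv_square X else 0) = hj * inv_square X" using j by (simp add: hj_def)
    finally show ?thesis unfolding E(4) pX by simp
  qed
  \<comment> \<open>\<open>R\<close> is the first-order remainder of \<open>inv_square\<close> and
    \<open>D\<close> its increment. The remainder of the product
    \<open>(X \<bullet> j) * inv_square X\<close> becomes \<open>hj * D + xj * R\<close>, where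
    \<open>\<bar>xj\<bar> \<le> 1 / a\<close> cancels one factor \<open>a\<close> in the bound for
    \<open>R\<close>.\<close>
  define R where "R = D + 2 * x * (a\<^sup>2)\<^sup>2"
  have R: "R = - (2 * x * a\<^sup>2 * D) - (norm h)\<^sup>2 * (a\<^sup>2 * b\<^sup>2)"
    using E(8) unfolding R_def D_def by (simp add: algebra_simps power2_eq_square)
  have "\<bar>2 * x * a\<^sup>2 * D\<bar> = 2 * (\<bar>x\<bar> * a\<^sup>2) * \<bar>D\<bar>" by (simp add: abs_mult)
  also have "\<dots> \<le> 2 * (norm h * a) * (norm h * (a * b\<^sup>2 + a\<^sup>2 * b))"
  proof (rule mult_mono[OF _ D])
    have "\<bar>x\<bar> * a\<^sup>2 \<le> norm h / a * a\<^sup>2" using E(7) by (intro mult_right_mono) auto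
    then show "2 * (\<bar>x\<bar> * a\<^sup>2) \<le> 2 * (norm h * a)" using E(1) by (simp add: power2_eq_square)
  qed (use ab in auto)
  finally have "\<bar>R\<bar> \<le> 2 * (norm h * a) * (norm h * (a * b\<^sup>2 + a\<^sup>2 * b)) + (norm h)\<^sup>2 * (a\<^sup>2 * b\<^sup>2)"
    unfolding R using ab by (smt (verit) mult_nonneg_nonneg zero_le_power2)
  then have "\<bar>xj * R\<bar> \<le> 1 / a * (2 * (norm h * a) * (norm h * (a * b\<^sup>2 + a\<^sup>2 * b)) + (norm h)\<^sup>2 * (a\<^sup>2 * b\<^sup>2))"
    unfolding abs_mult using xj ab by (intro mult_mono) auto
  also have "\<dots> = (norm h)\<^sup>2 * (2 * (a * b\<^sup>2 + a\<^sup>2 * b) + a * b\<^sup>2)"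
    using E(1) by (simp add: field_simps power2_eq_square)
  finally have xR: "\<bar>xj * R\<bar> \<le> (norm h)\<^sup>2 * (2 * (a * b\<^sup>2 + a\<^sup>2 * b) + a * b\<^sup>2)" .
  have "\<bar>hj * D\<bar> \<le> norm h * (norm h * (a * b\<^sup>2 + a\<^sup>2 * b))"
    unfolding abs_mult using xj D by (intro mult_mono) auto
  then have hD: "\<bar>hj * D\<bar> \<le> (norm h)\<^sup>2 * (a * b\<^sup>2 + a\<^sup>2 * b)" by (simp add: power2_eq_square mult.assoc)
  have "log_grad j Y - log_grad j X - (hj * a\<^sup>2 - 2 * x * a\<^sup>2 * (xj * a\<^sup>2)) = hj * D + xj * R"
    unfolding pX D_def R_def by (simp add: algebra_simps power2_eq_square)
  then have "\<bar>log_grad j Y - log_grad j X - (hj * a\<^sup>2 - 2 * x * a\<^sup>2 * (xj * a\<^sup>2))\<bar>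
      \<le> (norm h)\<^sup>2 * (a * b\<^sup>2 + a\<^sup>2 * b) + (norm h)\<^sup>2 * (2 * (a * b\<^sup>2 + a\<^sup>2 * b) + a * b\<^sup>2)"
    using hD xR by linarith
  also have "\<dots> = (norm h)\<^sup>2 * (4 * a * b\<^sup>2 + 3 * a\<^sup>2 * b)" by (simp add: algebra_simps)
  also have "\<dots> \<le> (norm h)\<^sup>2 * (4 * (a + b) ^ 3)"
    using ab by (intro mult_left_mono) (auto simp: power2_eq_square power3_eq_cube algebra_simps)
  finally show "\<bar>log_grad j Y - log_grad j X - (\<Sum>i\<in>Basis. ((Y - X) \<bullet> i) * ((if i = j then 1 else 0) * inv_square X + (-2) * (log_grad i X * log_grad j X)))\<bar>
      \<le> 4 * (norm (Y - X) * inv_norm2 X Y)\<^sup>2 * inv_norm2 X Y ^ 1"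
    unfolding a_def[symmetric] b_def[symmetric] h_def[symmetric] sum
    by (simp add: power2_eq_square power3_eq_cube mult_ac)
qed simp

lemma taylor_kernel_add:
  assumes "taylor_kernel d q q' C" "taylor_kernel d r r' D"
  shows "taylor_kernel d (\<lambda>X. q X + r X) (\<lambda>i X. q' i X + r' i X) (C + D)"
  unfolding taylor_kernel_def
proof (intro conjI allI impI)
  show "0 \<le> C + D" using assms unfolding taylor_kernel_def by simp
  fix X Y :: 'a assume XY: "X \<noteq> 0" "Y \<noteq> 0"
  define u t where "u = inv_norm2 X Y" and "t = norm (Y - X) * u"
  note q = assms(1)[unfolded taylor_kernel_def, THEN conjunct2, rule_format, OF XY, folded u_def, folded t_def]
  note r = assms(2)[unfolded taylor_kernel_def, THEN conjunct2, rule_format, OF XY, folded u_def, folded t_def]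
  show "\<bar>q X + r X\<bar> \<le> (C + D) * inv_norm X ^ d" using q r unfolding distrib_right by linarith
  show "\<bar>q Y + r Y - (q X + r X)\<bar> \<le> (C + D) * (norm (Y - X) * inv_norm2 X Y) * inv_norm2 X Y ^ d"
    unfolding u_def[symmetric] unfolding t_def[symmetric] using q r unfolding distrib_right by linarith
  have "(\<Sum>i\<in>Basis. ((Y - X) \<bullet> i) * (q' i X + r' i X)) = (\<Sum>i\<in>Basis. ((Y - X) \<bullet> i) * q' i X) + (\<Sum>i\<in>Basis. ((Y - X) \<bullet> i) * r' i X)"
    by (simp add: distrib_left sum.distrib)
  then show "\<bar>q Y + r Y - (q X + r X) - (\<Sum>i\<in>Basis. ((Y - X) \<bullet> i) * (q' i X + r' i X))\<bar>
      \<le> (C + D) * (norm (Y - X) * inv_norm2 X Y)\<^sup>2 * inv_norm2 X Y ^ d"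
    unfolding u_def[symmetric] unfolding t_def[symmetric] using q r unfolding distrib_right by linarith
qed

lemma taylor_kernel_scale:
  assumes "taylor_kernel d q q' C"
  shows "taylor_kernel d (\<lambda>X. c * q X) (\<lambda>i X. c * q' i X) (\<bar>c\<bar> * C)"
  unfolding taylor_kernel_def
proof (intro conjI allI impI)
  show "0 \<le> \<bar>c\<bar> * C" using assms unfolding taylor_kernel_def by simp
  fix X Y :: 'a assume XY: "X \<noteq> 0" "Y \<noteq> 0"
  define u t where "u = inv_norm2 X Y" and "t = norm (Y - X) * u"
  note q = assms(1)[unfolded taylor_kernel_def, THEN conjunct2, rule_format, OF XY, folded u_def, folded t_def]
  show "\<bar>c * q X\<bar> \<le> \<bar>c\<bar> * C * inv_norm X ^ d" using q by (simp add: abs_mult mult.assoc mult_left_mono)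
  have "c * q Y - c * q X = c * (q Y - q X)" by (simp add: algebra_simps)
  then show "\<bar>c * q Y - c * q X\<bar> \<le> \<bar>c\<bar> * C * (norm (Y - X) * inv_norm2 X Y) * inv_norm2 X Y ^ d"
    unfolding u_def[symmetric] unfolding t_def[symmetric] using q by (simp add: abs_mult mult.assoc mult_left_mono)
  have "c * q Y - c * q X - (\<Sum>i\<in>Basis. ((Y - X) \<bullet> i) * (c * q' i X)) = c * (q Y - q X - (\<Sum>i\<in>Basis. ((Y - X) \<bullet> i) * q' i X))"
    by (simp add: sum_distrib_left right_diff_distrib mult_ac)
  then show "\<bar>c * q Y - c * q X - (\<Sum>i\<in>Basis. ((Y - X) \<bullet> i) * (c * q' i X))\<bar>
      \<le> \<bar>c\<bar> * C * (norm (Y - X) * inv_norm2 X Y)\<^sup>2 * inv_norm2 X Y ^ d"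
    unfolding u_def[symmetric] unfolding t_def[symmetric] using q by (simp add: abs_mult mult.assoc mult_left_mono)
qed

text \<open>Leibniz rule with remainder: the error splits exactly into the product of the two
  increments and, for each factor, its remainder times the value of the other at \<open>X\<close>.
  The three terms account for the factor 3.\<close>

lemma taylor_kernel_mult:
  assumes "taylor_kernel d q q' C" "taylor_kernel e r r' D"
  shows "taylor_kernel (d + e) (\<lambda>X. q X * r X) (\<lambda>i X. q X * r' i X + q' i X * r X) (3 * C * D)"
  unfolding taylor_kernel_def
proof (intro conjI allI impI)
  have CD: "0 \<le> C" "0 \<le> D" using assms unfolding taylor_kernel_def by auto
  then show "0 \<le> 3 * C * D" by simp
  fix X Y :: 'a assume XY: "X \<noteq> 0" "Y \<noteq> 0"
  define u t where "u = inv_norm2 X Y" and "t = norm (Y - X) * u"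
  note q = assms(1)[unfolded taylor_kernel_def, THEN conjunct2, rule_format, OF XY, folded u_def, folded t_def]
  note r = assms(2)[unfolded taylor_kernel_def, THEN conjunct2, rule_format, OF XY, folded u_def, folded t_def]
  note qY = assms(1)[unfolded taylor_kernel_def, THEN conjunct2, rule_format, OF XY(2,2), THEN conjunct1]
  have u: "0 \<le> t" "0 \<le> u" "inv_norm X \<le> u" "inv_norm Y \<le> u" by (simp_all add: u_def t_def)
  have "inv_norm X ^ d \<le> u ^ d" "inv_norm Y ^ d \<le> u ^ d" "inv_norm X ^ e \<le> u ^ e" using u by (auto intro!: power_mono)
  then have qX: "\<bar>q X\<bar> \<le> C * u ^ d" "\<bar>q Y\<bar> \<le> C * u ^ d" "\<bar>r X\<bar> \<le> D * u ^ e"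
    using q qY r CD by (meson mult_left_mono order_trans)+
  have "\<bar>q X * r X\<bar> \<le> (C * inv_norm X ^ d) * (D * inv_norm X ^ e)"
    unfolding abs_mult using q r CD by (intro mult_mono) auto
  also have "\<dots> \<le> 3 * ((C * inv_norm X ^ d) * (D * inv_norm X ^ e))" using CD by simp
  finally show "\<bar>q X * r X\<bar> \<le> 3 * C * D * inv_norm X ^ (d + e)" by (simp add: power_add mult_ac)
  have m: "\<bar>A * B\<bar> \<le> (C * T * u ^ d) * (D * S * u ^ e)" if "\<bar>A\<bar> \<le> C * T * u ^ d" "\<bar>B\<bar> \<le> D * S * u ^ e" "0 \<le> T" for A B T S
    unfolding abs_mult using that CD u by (intro mult_mono) auto
  have 1: "\<bar>q Y * (r Y - r X)\<bar> \<le> (C * 1 * u ^ d) * (D * t * u ^ e)" by (rule m) (use qX r in auto)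
  have 2: "\<bar>(q Y - q X) * r X\<bar> \<le> (C * t * u ^ d) * (D * 1 * u ^ e)" by (rule m) (use qX q u in auto)
  have nn: "0 \<le> C * D * u ^ (d + e)" using CD u by simp
  have "q Y * r Y - q X * r X = q Y * (r Y - r X) + (q Y - q X) * r X" by (simp add: algebra_simps)
  then have "\<bar>q Y * r Y - q X * r X\<bar> \<le> 2 * (C * D * u ^ (d + e) * t)" using 1 2 by (simp add: power_add mult_ac)
  also have "\<dots> \<le> 3 * (C * D * u ^ (d + e) * t)" using mult_nonneg_nonneg[OF nn u(1)] by linarith
  finally show "\<bar>q Y * r Y - q X * r X\<bar> \<le> 3 * C * D * (norm (Y - X) * inv_norm2 X Y) * inv_norm2 X Y ^ (d + e)"
    unfolding u_def[symmetric] unfolding t_def[symmetric] by (simp add: mult_ac)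
  define Sq Sr where "Sq = (\<Sum>i\<in>Basis. ((Y - X) \<bullet> i) * q' i X)" and "Sr = (\<Sum>i\<in>Basis. ((Y - X) \<bullet> i) * r' i X)"
  have S: "(\<Sum>i\<in>Basis. ((Y - X) \<bullet> i) * (q X * r' i X + q' i X * r X)) = q X * Sr + Sq * r X"
    unfolding Sq_def Sr_def sum_distrib_left sum_distrib_right sum.distrib[symmetric]
    by (rule sum.cong) (simp_all add: algebra_simps)
  have 3: "\<bar>(q Y - q X) * (r Y - r X)\<bar> \<le> (C * t * u ^ d) * (D * t * u ^ e)" by (rule m) (use q r u in auto)
  have 4: "\<bar>q X * (r Y - r X - Sr)\<bar> \<le> (C * 1 * u ^ d) * (D * t\<^sup>2 * u ^ e)" by (rule m) (use qX r in \<open>auto simp: Sr_def\<close>)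
  have 5: "\<bar>(q Y - q X - Sq) * r X\<bar> \<le> (C * t\<^sup>2 * u ^ d) * (D * 1 * u ^ e)" by (rule m) (use qX q in \<open>auto simp: Sq_def\<close>)
  have "q Y * r Y - q X * r X - (q X * Sr + Sq * r X) = (q Y - q X) * (r Y - r X) + q X * (r Y - r X - Sr) + (q Y - q X - Sq) * r X"
    by (simp add: algebra_simps)
  then have "\<bar>q Y * r Y - q X * r X - (q X * Sr + Sq * r X)\<bar> \<le> 3 * (C * D * u ^ (d + e) * t\<^sup>2)"
    using 3 4 5 by (simp add: power_add power2_eq_square mult_ac)
  then show "\<bar>q Y * r Y - q X * r X - (\<Sum>i\<in>Basis. ((Y - X) \<bullet> i) * (q X * r' i X + q' i X * r X))\<bar>
      \<le> 3 * C * D * (norm (Y - X) * inv_norm2 X Y)\<^sup>2 * inv_norm2 X Y ^ (d + e)"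
    unfolding u_def[symmetric] unfolding t_def[symmetric] S by (simp add: mult_ac)
qed

lemma log_kernel_imp_taylor_kernel: "log_kernel d q q' \<Longrightarrow> \<exists>C. taylor_kernel d q q' C"
  by (induction rule: log_kernel.induct) (blast intro: taylor_kernel_p taylor_kernel_s taylor_kernel_add taylor_kernel_scale taylor_kernel_mult)+

lemma log_kernel_measurable: "log_kernel d q q' \<Longrightarrow> q \<in> borel_measurable borel"
proof (induction rule: log_kernel.induct)
  case (log_kernel_p j)
  then show ?case unfolding log_grad_def[abs_def] by measurable
next
  case log_kernel_s
  then show ?case unfolding inv_square_def[abs_def] by measurable
qed auto

text \<open>The logarithm is not homogeneous and lies outside the kernel algebra, so it is treated
  by hand: \<open>ln t \<le> t - 1\<close>, applied to \<open>a\<^sup>2 / b\<^sup>2\<close> and to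
  its inverse, bounds the increment from both sides without a path between the points.\<close>

lemma ln_norm_expansion:
  fixes X Y :: "'a::euclidean_space"
  assumes XY: "X \<noteq> 0" "Y \<noteq> 0"
  shows "\<bar>ln (norm Y) - ln (norm X) - (\<Sum>i\<in>Basis. ((Y - X) \<bullet> i) * log_grad i X)\<bar> \<le> 2 * (norm (Y - X) * inv_norm2 X Y)\<^sup>2"
proof -
  define a b h x where "a = inv_norm X" and "b = inv_norm Y" and "h = Y - X" and "x = X \<bullet> h"
  note E = inv_norm_expansion[OF XY, folded a_def b_def h_def, folded x_def]
  have ab: "0 \<le> a" "0 \<le> b" using E by auto
  define D where "D = b\<^sup>2 - a\<^sup>2"
  define H where "H = (norm h)\<^sup>2"
  have DE: "D = - (2 * x + H) * (a\<^sup>2 * b\<^sup>2)" using E(8) by (simp add: D_def H_def)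
  have sum: "(\<Sum>i\<in>Basis. (h \<bullet> i) * log_grad i X) = x * a\<^sup>2"
  proof -
    have "(\<Sum>i\<in>Basis. (h \<bullet> i) * log_grad i X) = (\<Sum>i\<in>Basis. (X \<bullet> i) * (h \<bullet> i)) * inv_square X"
      unfolding sum_distrib_right by (rule sum.cong) (simp_all add: log_grad_def inv_square_def)
    also have "(\<Sum>i\<in>Basis. (X \<bullet> i) * (h \<bullet> i)) = x" unfolding x_def by (rule euclidean_inner[symmetric])
    finally show ?thesis unfolding E(4) .
  qed
  have nY: "norm Y = 1 / b" by (simp add: b_def inv_norm_def divide_inverse)
  have lnX: "ln (norm X) = - (ln (a\<^sup>2) / 2)" "ln (norm Y) = - (ln (b\<^sup>2) / 2)"
    unfolding E(3) nY using E(1,2) by (simp_all add: ln_div ln_realpow)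
  have up: "ln (a\<^sup>2) - ln (b\<^sup>2) \<le> (2 * x + H) * a\<^sup>2"
  proof -
    have "ln (a\<^sup>2 / b\<^sup>2) \<le> a\<^sup>2 / b\<^sup>2 - 1" using E(1,2) by (intro ln_le_minus_one) simp
    also have "a\<^sup>2 / b\<^sup>2 - 1 = - D / b\<^sup>2" using E(1,2) by (simp add: D_def field_simps)
    also have "\<dots> = (2 * x + H) * a\<^sup>2" unfolding DE using E(1,2) by (simp add: field_simps)
    finally show ?thesis using E(1,2) by (simp add: ln_div)
  qed
  have lo: "ln (b\<^sup>2) - ln (a\<^sup>2) \<le> - ((2 * x + H) * b\<^sup>2)"
  proof -
    have "ln (b\<^sup>2 / a\<^sup>2) \<le> b\<^sup>2 / a\<^sup>2 - 1" using E(1,2) by (intro ln_le_minus_one) simp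
    also have "b\<^sup>2 / a\<^sup>2 - 1 = D / a\<^sup>2" using E(1,2) by (simp add: D_def field_simps)
    also have "\<dots> = - ((2 * x + H) * b\<^sup>2)" unfolding DE using E(1,2) by (simp add: field_simps)
    finally show ?thesis using E(1,2) by (simp add: ln_div)
  qed
  have "\<bar>x * D\<bar> \<le> norm h / a * (norm h * (a * b\<^sup>2 + a\<^sup>2 * b))"
    unfolding abs_mult D_def using E(7,9) ab by (intro mult_mono) auto
  also have "\<dots> = H * (b\<^sup>2 + a * b)" using E(1) by (simp add: field_simps power2_eq_square H_def)
  finally have xD: "\<bar>x * D\<bar> \<le> H * (b\<^sup>2 + a * b)" .
  have "x * b\<^sup>2 - x * a\<^sup>2 = x * D" by (simp add: D_def algebra_simps)
  moreover have "ln (a\<^sup>2) - ln (b\<^sup>2) \<le> 2 * (x * a\<^sup>2) + H * a\<^sup>2" using up by (simp add: algebra_simps)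
  moreover have "ln (b\<^sup>2) - ln (a\<^sup>2) \<le> - (2 * (x * b\<^sup>2)) - H * b\<^sup>2" using lo by (simp add: algebra_simps)
  moreover have "0 \<le> H * a\<^sup>2" "0 \<le> H * b\<^sup>2" by (simp_all add: H_def)
  ultimately have "\<bar>ln (norm Y) - ln (norm X) - x * a\<^sup>2\<bar> \<le> H * a\<^sup>2 + H * b\<^sup>2 + H * (b\<^sup>2 + a * b)"
    using xD unfolding lnX abs_le_iff by linarith
  also have "\<dots> = H * (a\<^sup>2 + 2 * b\<^sup>2 + a * b)" by (simp add: algebra_simps)
  also have "\<dots> \<le> H * (2 * (a + b)\<^sup>2)"
    using ab by (intro mult_left_mono) (auto simp: H_def power2_eq_square algebra_simps)
  finally show ?thesis
    unfolding a_def[symmetric] b_def[symmetric] h_def[symmetric] sum H_def by (simp add: power_mult_distrib mult_ac)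
qed

section \<open>Logarithmic potentials of bounded boundary densities\<close>

text \<open>Raises regularity by one order. Since \<open>partial\<close> applies the last letter of
  a word first, the prescribed gradient sits at the end of the word, as in
  \<open>vs @ [i]\<close>.\<close>

lemma Ck_on_SucI:
  assumes S: "thick S" and f: "\<And>X. X \<in> S \<Longrightarrow> (f has_derivative (\<lambda>h. \<Sum>i\<in>Basis. (h \<bullet> i) * g i X)) (at X within S)"
    and g: "\<And>i. i \<in> Basis \<Longrightarrow> g i \<in> Ck_on k S"
  shows "f \<in> Ck_on (Suc k) S"
    and "\<And>i X. i \<in> Basis \<Longrightarrow> X \<in> S \<Longrightarrow> partial S [i] f X = g i X"
    and "\<And>m vs i X. m \<le> k \<Longrightarrow> vs \<in> dirs m \<Longrightarrow> i \<in> Basis \<Longrightarrow> X \<in> S \<Longrightarrow> partial S (vs @ [i]) f X = partial S vs (g i) X"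
proof -
  define D where "D = (\<lambda>vs. if vs = [] then f else partial S (butlast vs) (g (last vs)))"
  note * = Ck_onI[OF S, of D f "Suc k"]
  have 0: "D [] X = f X" if "X \<in> S" for X by (simp add: D_def)
  have D1: "D [i] = g i" for i by (simp add: D_def)
  have snoc: "\<exists>us i. vs = us @ [i] \<and> us \<in> dirs n \<and> i \<in> Basis" if "vs \<in> dirs (Suc n)" for vs :: "'a list" and n
    using that by (cases vs rule: rev_cases) (auto simp: dirs_def)
  have Ds: "D (us @ [i]) = partial S us (g i)" for us i by (simp add: D_def)
  have 1: "(D vs has_derivative (\<lambda>h. \<Sum>i\<in>Basis. (h \<bullet> i) * D (i # vs) X)) (at X within S)"
    if m: "m < Suc k" and vs: "vs \<in> dirs m" and X: "X \<in> S" for m vs X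
  proof (cases m)
    case 0
    then have "vs = []" using vs by (simp add: dirs_0)
    moreover have "D [] = f" by (simp add: D_def)
    ultimately show ?thesis using f[OF X] by (simp only: D1)
  next
    case (Suc n)
    then obtain us i where us: "vs = us @ [i]" "us \<in> dirs n" "i \<in> Basis" using snoc vs by blast
    have "n < k" using Suc m by simp
    from Ck_onD[OF g[OF us(3)] this us(2) X]
    have "(D (us @ [i]) has_derivative (\<lambda>h. \<Sum>j\<in>Basis. (h \<bullet> j) * D ((j # us) @ [i]) X)) (at X within S)"
      unfolding Ds .
    then show ?thesis unfolding us(1) by (simp only: append_Cons)
  qed
  have 2: "continuous_on S (D vs)" if vs: "vs \<in> dirs (Suc k)" for vs
  proof -
    obtain us i where us: "vs = us @ [i]" "us \<in> dirs k" "i \<in> Basis" using snoc vs by blast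
    show ?thesis unfolding us(1) Ds by (rule Ck_on_continuous[OF g[OF us(3)] order_refl us(2)])
  qed
  show "f \<in> Ck_on (Suc k) S" by (rule *(1)[OF 0 1 2])
  have P: "partial S vs f X = D vs X" if "m \<le> Suc k" "vs \<in> dirs m" "X \<in> S" for m vs X
    by (rule *(2)[OF 0 1 2 that])
  show "partial S [i] f X = g i X" if "i \<in> Basis" "X \<in> S" for i X
    unfolding D1[symmetric] by (rule P[of 1]) (use that in \<open>auto simp: dirs_def\<close>)
  show "partial S (vs @ [i]) f X = partial S vs (g i) X"
    if "m \<le> k" "vs \<in> dirs m" "i \<in> Basis" "X \<in> S" for m vs i X
    unfolding Ds[symmetric] by (rule P[of "Suc m"]) (use that in \<open>auto simp: dirs_def\<close>)
qed

lemma Ck_on_0I: "continuous_on S f \<Longrightarrow> f \<in> Ck_on 0 S"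
  by (simp add: Ck_on_def dirs_0)

text \<open>A supremum in the reals, hence meaningful only where the family is bounded;
  \<open>riesz_sup_bounds\<close> gives this for bounded Borel \<open>\<Omega>\<close> and
  \<open>0 \<le> s\<close>, \<open>s < 3\<close>. It is the constant behind all estimates of
  potentials.\<close>

definition riesz_sup :: "R3 set \<Rightarrow> real \<Rightarrow> real" where
  "riesz_sup \<Omega> s = (SUP X::R4. LINT z|lborel. indicator \<Omega> z * norm (X - (z, 0)) powr - s)"

lemma riesz_sup_bounds:
  assumes "\<Omega> \<in> sets borel" "bounded \<Omega>" "0 \<le> s" "s < 3"
  shows "integrable lborel (\<lambda>z. indicator \<Omega> z * norm (X - (z, 0 :: real)) powr - s)"
    and "(LINT z|lborel. indicator \<Omega> z * norm (X - (z, 0)) powr - s) \<le> riesz_sup \<Omega> s"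
    and "0 \<le> riesz_sup \<Omega> s"
proof -
  obtain J where J: "0 \<le> J"
    "\<And>X :: R4. integrable lborel (\<lambda>z. indicator \<Omega> z * norm (X - (z, 0)) powr - s)"
    "\<And>X :: R4. (LINT z|lborel. indicator \<Omega> z * norm (X - (z, 0)) powr - s) \<le> J"
    using integrable_riesz_R4[OF assms(3,4,1,2)] by blast
  show "integrable lborel (\<lambda>z. indicator \<Omega> z * norm (X - (z, 0 :: real)) powr - s)" by (rule J)
  have "bdd_above (range (\<lambda>X::R4. LINT z|lborel. indicator \<Omega> z * norm (X - (z, 0)) powr - s))"
    using J(3) by (intro bdd_aboveI2)
  then show *: "(LINT z|lborel. indicator \<Omega> z * norm (X - (z, 0)) powr - s) \<le> riesz_sup \<Omega> s" for X :: R4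
    unfolding riesz_sup_def by (rule cSUP_upper[OF UNIV_I])
  have "0 \<le> (LINT z|lborel. indicator \<Omega> z * norm (0 - (z, 0::real)) powr - s)"
    by (intro integral_nonneg_AE) auto
  with *[of 0] show "0 \<le> riesz_sup \<Omega> s" by linarith
qed

text \<open>The bound holds at every point and not just almost everywhere, and the indicator in it
  also encodes that \<open>f\<close> vanishes off \<open>\<Omega>\<close>.\<close>

definition bounded_density :: "R3 set \<Rightarrow> real \<Rightarrow> (R3 \<Rightarrow> real) \<Rightarrow> bool" where
  "bounded_density \<Omega> M f \<longleftrightarrow> \<Omega> \<in> sets borel \<and> bounded \<Omega> \<and> f \<in> borel_measurable borel \<and> 0 \<le> M \<and>
     (\<forall>z. \<bar>f z\<bar> \<le> M * indicator \<Omega> z)"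

definition potential :: "(R4 \<Rightarrow> real) \<Rightarrow> (R3 \<Rightarrow> real) \<Rightarrow> R4 \<Rightarrow> real" where
  "potential g f X = (LINT z|lborel. g (X - (z, 0)) * f z)"

lemma measurable_shift [measurable]: "(\<lambda>z::R3. X - (z, 0::real)) \<in> borel_measurable borel"
  by (intro borel_measurable_continuous_onI continuous_intros)

lemma AE_off_boundary_point: "AE z in lborel. (X::R4) - (z, 0) \<noteq> 0"
  using AE_lborel_singleton[of "fst X"] by eventually_elim (auto simp: prod_eq_iff)

text \<open>Values, increments and Taylor remainders of kernels are all dominated by two Riesz
  kernels centred at \<open>X\<close> and \<open>Y\<close>, and the estimate is required only off
  these centres, which meet the boundary in a null set. The two centres give the factor 2.\<close>

lemma density_integral_bound:
  assumes f: "bounded_density \<Omega> M f" and s: "0 \<le> s" "s < 3" and G: "G \<in> borel_measurable borel" and C: "0 \<le> C"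
    and b: "\<And>z. z \<in> \<Omega> \<Longrightarrow> X - (z, 0) \<noteq> 0 \<Longrightarrow> Y - (z, 0) \<noteq> 0 \<Longrightarrow>
       \<bar>G z\<bar> \<le> C * (norm (X - (z, 0 :: real)) powr - s + norm (Y - (z, 0 :: real)) powr - s)"
  shows "integrable lborel (\<lambda>z. G z * f z)" and "\<bar>(LINT z|lborel. G z * f z)\<bar> \<le> 2 * C * M * riesz_sup \<Omega> s"
proof -
  have O: "\<Omega> \<in> sets borel" "bounded \<Omega>" and [measurable]: "f \<in> borel_measurable borel" and M: "0 \<le> M"
    and fM: "\<And>z. \<bar>f z\<bar> \<le> M * indicator \<Omega> z" using f by (auto simp: bounded_density_def)
  note [measurable] = G
  define H where "H = (\<lambda>z. (C * M) * (indicator \<Omega> z * norm (X - (z, 0)) powr - s) + (C * M) * (indicator \<Omega> z * norm (Y - (z, 0)) powr - s))"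
  have H: "integrable lborel H" unfolding H_def
    by (intro Bochner_Integration.integrable_add integrable_mult_right riesz_sup_bounds O s)
  have ae: "AE z in lborel. norm (G z * f z) \<le> H z"
    using AE_off_boundary_point[of X] AE_off_boundary_point[of Y]
  proof eventually_elim
    case (elim z)
    show ?case
    proof (cases "z \<in> \<Omega>")
      case True
      have "norm (G z * f z) \<le> (C * (norm (X - (z, 0)) powr - s + norm (Y - (z, 0)) powr - s)) * (M * indicator \<Omega> z)"
        unfolding real_norm_def abs_mult using b[OF True elim] fM[of z] C by (intro mult_mono) auto
      then show ?thesis by (simp add: H_def algebra_simps)
    next
      case False
      then have "f z = 0" using fM[of z] by simp
      then show ?thesis using False by (simp add: H_def)
    qed
  qed
  show int: "integrable lborel (\<lambda>z. G z * f z)"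
    by (rule Bochner_Integration.integrable_bound[OF H]) (use ae in \<open>auto elim!: eventually_mono\<close>)
  have "\<bar>(LINT z|lborel. G z * f z)\<bar> \<le> (LINT z|lborel. H z)"
    using order_trans[OF integral_norm_bound[of lborel "\<lambda>z. G z * f z"] integral_mono_AE[OF integrable_norm[OF int] H ae]]
    by (simp only: real_norm_def)
  also have "\<dots> = (C * M) * (LINT z|lborel. indicator \<Omega> z * norm (X - (z, 0)) powr - s)
      + (C * M) * (LINT z|lborel. indicator \<Omega> z * norm (Y - (z, 0)) powr - s)"
    unfolding H_def by (subst Bochner_Integration.integral_add) (auto intro!: integrable_mult_right riesz_sup_bounds O s)
  also have "\<dots> \<le> (C * M) * riesz_sup \<Omega> s + (C * M) * riesz_sup \<Omega> s"
    using C M by (intro add_mono mult_left_mono riesz_sup_bounds O s) auto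
  finally show "\<bar>(LINT z|lborel. G z * f z)\<bar> \<le> 2 * C * M * riesz_sup \<Omega> s" by (simp add: mult_ac)
qed

text \<open>Differentiation under the integral without dominated convergence: it is enough that the
  integrated Taylor remainder is of order \<open>1 + \<beta>\<close>. As this concerns the integral
  only, the pointwise remainder may be singular in \<open>z\<close>.\<close>

lemma potential_has_derivative:
  assumes "0 < r" "0 < \<beta>" and g: "\<And>Y. Y \<in> ball X r \<Longrightarrow> integrable lborel (\<lambda>z. g (Y - (z, 0)) * f z)"
    and g': "\<And>i. i \<in> Basis \<Longrightarrow> integrable lborel (\<lambda>z. g' i (X - (z, 0)) * f z)"
    and K: "\<And>Y. Y \<in> ball X r \<Longrightarrow> Y \<noteq> X \<Longrightarrow>
      \<bar>(LINT z|lborel. (g (Y - (z, 0)) - g (X - (z, 0)) - (\<Sum>i\<in>Basis. ((Y - X) \<bullet> i) * g' i (X - (z, 0)))) * f z)\<bar>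
        \<le> K * norm (Y - X) powr (1 + \<beta>)"
  shows "(potential g f has_derivative (\<lambda>h. \<Sum>i\<in>Basis. (h \<bullet> i) * potential (g' i) f X)) (at X)"
proof (rule has_derivativeI_sandwich[where e=r and H="\<lambda>Y. K * norm (Y - X) powr \<beta>"])
  show "bounded_linear (\<lambda>h. \<Sum>i\<in>Basis. (h \<bullet> i) * potential (g' i) f X)"
    by (intro bounded_linear_sum bounded_linear_mult_left bounded_linear_compose[OF bounded_linear_mult_left] bounded_linear_inner_left)
  show "((\<lambda>Y. K * norm (Y - X) powr \<beta>) \<longlongrightarrow> 0) (at X)"
  proof -
    have "((\<lambda>Y. norm (Y - X)) \<longlongrightarrow> 0) (at X)" by (rule tendsto_norm_zero, rule LIM_zero, rule tendsto_ident_at)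
    then have "((\<lambda>Y. norm (Y - X) powr \<beta>) \<longlongrightarrow> 0) (at X)"
      by (rule tendsto_zero_powrI[where b=\<beta>]) (use assms(2) in auto)
    then show ?thesis by (rule tendsto_mult_right_zero)
  qed
  fix Y assume Y: "Y \<noteq> X" "dist Y X < r"
  then have Yb: "Y \<in> ball X r" by (simp add: dist_commute)
  have gX: "integrable lborel (\<lambda>z. g (X - (z, 0)) * f z)" using g[of X] assms(1) by simp
  have iS: "integrable lborel (\<lambda>z. \<Sum>i\<in>Basis. ((Y - X) \<bullet> i) * (g' i (X - (z, 0)) * f z))"
    by (intro Bochner_Integration.integrable_sum integrable_mult_right g')
  have "(LINT z|lborel. (g (Y - (z, 0)) - g (X - (z, 0)) - (\<Sum>i\<in>Basis. ((Y - X) \<bullet> i) * g' i (X - (z, 0)))) * f z)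
     = (LINT z|lborel. g (Y - (z, 0)) * f z - g (X - (z, 0)) * f z - (\<Sum>i\<in>Basis. ((Y - X) \<bullet> i) * (g' i (X - (z, 0)) * f z)))"
    by (rule Bochner_Integration.integral_cong) (simp_all add: left_diff_distrib sum_distrib_right mult.assoc)
  also have "\<dots> = potential g f Y - potential g f X - (LINT z|lborel. (\<Sum>i\<in>Basis. ((Y - X) \<bullet> i) * (g' i (X - (z, 0)) * f z)))"
    unfolding potential_def
    by (subst Bochner_Integration.integral_diff, intro Bochner_Integration.integrable_diff g Yb gX, rule iS,
        subst Bochner_Integration.integral_diff, intro g Yb, rule gX, rule refl)
  also have "(LINT z|lborel. (\<Sum>i\<in>Basis. ((Y - X) \<bullet> i) * (g' i (X - (z, 0)) * f z))) = (\<Sum>i\<in>Basis. ((Y - X) \<bullet> i) * potential (g' i) f X)"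
    unfolding potential_def
    by (subst Bochner_Integration.integral_sum, intro integrable_mult_right g', assumption)
      (intro sum.cong refl Bochner_Integration.integral_mult_right_zero)
  finally have "\<bar>potential g f Y - potential g f X - (\<Sum>i\<in>Basis. ((Y - X) \<bullet> i) * potential (g' i) f X)\<bar> \<le> K * norm (Y - X) powr (1 + \<beta>)"
    using K[OF Yb Y(1)] by simp
  also have "\<dots> = (K * norm (Y - X) powr \<beta>) * norm (Y - X)" using Y by (simp add: powr_add)
  finally show "norm (potential g f Y - potential g f X - (\<Sum>i\<in>Basis. ((Y - X) \<bullet> i) * potential (g' i) f X)) / norm (Y - X) \<le> K * norm (Y - X) powr \<beta>"
    using Y by (subst pos_divide_le_eq) auto
qed (use assms in auto)

section \<open>Fractional kernel estimates and regularity of potentials up to the boundary\<close>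

lemma powr_add_le:
  assumes "0 \<le> (a::real)" "0 \<le> b" "0 \<le> s"
  shows "(a + b) powr s \<le> 2 powr s * (a powr s + b powr s)"
proof -
  have "(a + b) powr s \<le> (2 * max a b) powr s" using assms by (intro powr_mono2) auto
  also have "\<dots> = 2 powr s * max a b powr s" using assms by (simp add: powr_mult)
  also have "\<dots> \<le> 2 powr s * (a powr s + b powr s)" by (intro mult_left_mono) (auto simp: max_def)
  finally show ?thesis .
qed

lemma inv_norm_powr: "inv_norm X powr s = norm X powr - s"
  by (simp add: inv_norm_def powr_minus inverse_powr)

lemma inv_norm2_powr_le:
  assumes "0 \<le> s"
  shows "inv_norm2 X Y powr s \<le> 2 powr s * (norm X powr - s + norm Y powr - s)"
  using powr_add_le[OF inv_norm_nonneg inv_norm_nonneg assms, of X Y] by (simp add: inv_norm_powr)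

text \<open>Interpolation with \<open>t = norm (Y - X) * inv_norm2 X Y\<close>: for
  \<open>t \<le> 1\<close> the increment bound applies and \<open>t \<le> t powr \<alpha>\<close>,
  for \<open>t > 1\<close> the size of the two values suffices since
  \<open>1 \<le> t powr \<alpha>\<close>. Gaining \<alpha> orders of distance costs \<alpha> degrees
  of singularity.\<close>

lemma taylor_kernel_increment_powr:
  assumes q: "taylor_kernel d q q' C" and XY: "X \<noteq> 0" "Y \<noteq> 0" "X \<noteq> Y" and \<alpha>: "0 \<le> \<alpha>" "\<alpha> \<le> 1"
  shows "\<bar>q Y - q X\<bar> \<le> (2 * C * 2 powr (d + \<alpha>)) * norm (Y - X) powr \<alpha> * (norm X powr - (d + \<alpha>) + norm Y powr - (d + \<alpha>))"
proof -
  define u t where "u = inv_norm2 X Y" and "t = norm (Y - X) * u"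
  note E = q[unfolded taylor_kernel_def, THEN conjunct2, rule_format, OF XY(1,2), folded u_def, folded t_def]
  note EY = q[unfolded taylor_kernel_def, THEN conjunct2, rule_format, OF XY(2,2), THEN conjunct1]
  have C: "0 \<le> C" using q by (simp add: taylor_kernel_def)
  have ab: "0 < inv_norm X" "0 < inv_norm Y" using XY by (auto simp: inv_norm_def)
  then have u: "0 < u" "0 < t" using XY by (auto simp: u_def t_def)
  have "\<bar>q Y - q X\<bar> \<le> 2 * C * (t powr \<alpha> * u ^ d)"
  proof (cases "t \<le> 1")
    case True
    have "t \<le> t powr \<alpha>" using powr_mono'[of \<alpha> 1 t] True u \<alpha> by simp
    then have "C * t * u ^ d \<le> C * t powr \<alpha> * u ^ d" using C u by (intro mult_right_mono mult_left_mono) auto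
    moreover have "0 \<le> C * t powr \<alpha> * u ^ d" using C u by auto
    ultimately show ?thesis using E by (simp add: mult.assoc)
  next
    case False
    have "C * inv_norm X ^ d \<le> C * u ^ d" "C * inv_norm Y ^ d \<le> C * u ^ d"
      using C ab by (auto simp: u_def intro!: mult_left_mono power_mono)
    with E EY have "\<bar>q Y - q X\<bar> \<le> 2 * C * (1 * u ^ d)" by (simp add: abs_le_iff)
    also have "\<dots> \<le> 2 * C * (t powr \<alpha> * u ^ d)"
      using False \<alpha> C u by (intro mult_left_mono mult_right_mono) (auto simp: ge_one_powr_ge_zero)
    finally show ?thesis .
  qed
  also have "t powr \<alpha> * u ^ d = norm (Y - X) powr \<alpha> * u powr (d + \<alpha>)"
    using u by (simp add: t_def powr_mult powr_add powr_realpow)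
  also have "2 * C * (norm (Y - X) powr \<alpha> * u powr (d + \<alpha>))
     \<le> 2 * C * (norm (Y - X) powr \<alpha> * (2 powr (d + \<alpha>) * (norm X powr - (d + \<alpha>) + norm Y powr - (d + \<alpha>))))"
    unfolding u_def using C \<alpha> by (intro mult_left_mono inv_norm2_powr_le) auto
  finally show ?thesis by (simp add: mult_ac)
qed

lemma log_kernel_gradient_bound:
  assumes "log_kernel d q q'"
  obtains B where "0 \<le> B" "\<And>i X. i \<in> Basis \<Longrightarrow> X \<noteq> 0 \<Longrightarrow> \<bar>q' i X\<bar> \<le> B * inv_norm X ^ Suc d"
proof -
  have "\<forall>i\<in>Basis. \<exists>C. 0 \<le> C \<and> (\<forall>X. X \<noteq> 0 \<longrightarrow> \<bar>q' i X\<bar> \<le> C * inv_norm X ^ Suc d)"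
  proof
    fix i :: 'a assume "i \<in> Basis"
    then obtain q'' where "log_kernel (Suc d) (q' i) q''" using log_kernel_derivative[OF assms] by meson
    then obtain C where C: "taylor_kernel (Suc d) (q' i) q'' C" using log_kernel_imp_taylor_kernel by meson
    then show "\<exists>C. 0 \<le> C \<and> (\<forall>X. X \<noteq> 0 \<longrightarrow> \<bar>q' i X\<bar> \<le> C * inv_norm X ^ Suc d)"
      unfolding taylor_kernel_def by (intro exI[of _ C]) auto
  qed
  then obtain C where C: "\<And>i. i \<in> Basis \<Longrightarrow> 0 \<le> C i" "\<And>i X. i \<in> Basis \<Longrightarrow> X \<noteq> 0 \<Longrightarrow> \<bar>q' i X\<bar> \<le> C i * inv_norm X ^ Suc d"
    by (metis (no_types, lifting) bchoice)
  show ?thesis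
  proof (rule that[of "\<Sum>i\<in>Basis. C i"])
    show "0 \<le> (\<Sum>i\<in>Basis. C i)" using C(1) by (rule sum_nonneg)
    fix i X :: 'a assume i: "i \<in> Basis" and X: "X \<noteq> 0"
    have "C i \<le> (\<Sum>i\<in>Basis. C i)" using C(1) i by (intro member_le_sum) auto
    then have "C i * inv_norm X ^ Suc d \<le> (\<Sum>i\<in>Basis. C i) * inv_norm X ^ Suc d" by (intro mult_right_mono) auto
    with C(2)[OF i X] show "\<bar>q' i X\<bar> \<le> (\<Sum>i\<in>Basis. C i) * inv_norm X ^ Suc d" by linarith
  qed
qed

text \<open>The full remainder of order 2 would raise the degree by 2, which for a kernel of degree
  1 already reaches the critical exponent 3. Comparing \<open>t\<^sup>2\<close> or \<open>t\<close>
  with \<open>t powr (1 + \<alpha>)\<close> trades order for integrability; the case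
  \<open>t > 1\<close> uses the gradient bound.\<close>

lemma taylor_kernel_remainder_powr:
  fixes X Y :: "'a::euclidean_space" and B C :: real
  assumes q: "taylor_kernel d q q' C" and B: "0 \<le> B" "\<And>i X. i \<in> Basis \<Longrightarrow> X \<noteq> 0 \<Longrightarrow> \<bar>q' i X\<bar> \<le> B * inv_norm X ^ Suc d"
    and XY: "X \<noteq> 0" "Y \<noteq> 0" "X \<noteq> Y" and \<alpha>: "0 \<le> \<alpha>" "\<alpha> \<le> 1"
  shows "\<bar>q Y - q X - (\<Sum>i\<in>Basis. ((Y - X) \<bullet> i) * q' i X)\<bar> \<le> ((C + B * DIM('a)) * 2 powr (d + (1 + \<alpha>))) *
     norm (Y - X) powr (1 + \<alpha>) * (norm X powr - (d + (1 + \<alpha>)) + norm Y powr - (d + (1 + \<alpha>)))"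
proof -
  define u t where "u = inv_norm2 X Y" and "t = norm (Y - X) * u"
  note E = q[unfolded taylor_kernel_def, THEN conjunct2, rule_format, OF XY(1,2), folded u_def, folded t_def]
  have C: "0 \<le> C" using q by (simp add: taylor_kernel_def)
  have ab: "0 < inv_norm X" "0 < inv_norm Y" using XY by (auto simp: inv_norm_def)
  then have u: "0 < u" "0 < t" using XY by (auto simp: u_def t_def)
  define A where "A = C + B * DIM('a)"
  have A: "0 \<le> A" "C \<le> A" using C B by (auto simp: A_def)
  have "\<bar>q Y - q X - (\<Sum>i\<in>Basis. ((Y - X) \<bullet> i) * q' i X)\<bar> \<le> A * (t powr (1 + \<alpha>) * u ^ d)"
  proof (cases "t \<le> 1")
    case True
    have "t\<^sup>2 \<le> t powr (1 + \<alpha>)" using powr_mono'[of "1 + \<alpha>" 2 t] True u \<alpha> by (simp add: powr_numeral)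
    then have "C * t\<^sup>2 * u ^ d \<le> A * t powr (1 + \<alpha>) * u ^ d" using A C u by (intro mult_right_mono mult_mono) auto
    then show ?thesis using E by (simp add: mult.assoc)
  next
    case False
    have "\<bar>\<Sum>i\<in>Basis. ((Y - X) \<bullet> i) * q' i X\<bar> \<le> ((B * inv_norm X ^ Suc d) * DIM('a)) * norm (Y - X)"
      by (rule sum_Basis_bound) (use B XY in auto)
    also have "\<dots> = (B * DIM('a)) * ((norm (Y - X) * inv_norm X) * inv_norm X ^ d)" by (simp add: mult_ac)
    also have "\<dots> \<le> (B * DIM('a)) * (t * u ^ d)"
      unfolding t_def u_def using ab B by (intro mult_left_mono mult_mono power_mono) auto
    finally have "\<bar>q Y - q X - (\<Sum>i\<in>Basis. ((Y - X) \<bullet> i) * q' i X)\<bar> \<le> A * (t * u ^ d)"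
      using E unfolding A_def by (simp add: algebra_simps abs_le_iff)
    also have "\<dots> \<le> A * (t powr (1 + \<alpha>) * u ^ d)"
      using False \<alpha> A u powr_mono[of 1 "1 + \<alpha>" t] by (intro mult_left_mono mult_right_mono) auto
    finally show ?thesis .
  qed
  also have "t powr (1 + \<alpha>) * u ^ d = norm (Y - X) powr (1 + \<alpha>) * u powr (d + (1 + \<alpha>))"
    using u by (simp add: t_def powr_mult powr_add powr_realpow)
  also have "A * (norm (Y - X) powr (1 + \<alpha>) * u powr (d + (1 + \<alpha>)))
     \<le> A * (norm (Y - X) powr (1 + \<alpha>) * (2 powr (d + (1 + \<alpha>)) * (norm X powr - (d + (1 + \<alpha>)) + norm Y powr - (d + (1 + \<alpha>)))))"
    unfolding u_def using A \<alpha> by (intro mult_left_mono inv_norm2_powr_le) auto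
  finally show ?thesis by (simp add: A_def mult_ac)
qed

lemma potential_kernel_bound:
  assumes f: "bounded_density \<Omega> M f" and q: "taylor_kernel d q q' C" "q \<in> borel_measurable borel" and d: "d < 3"
  shows "integrable lborel (\<lambda>z. q (X - (z, 0)) * f z)" and "\<bar>potential q f X\<bar> \<le> 2 * C * M * riesz_sup \<Omega> d"
proof -
  have C: "0 \<le> C" using q by (simp add: taylor_kernel_def)
  have [measurable]: "q \<in> borel_measurable borel" by fact
  have G: "(\<lambda>z. q (X - (z, 0))) \<in> borel_measurable borel" by measurable
  have b: "\<bar>q (X - (z, 0))\<bar> \<le> C * (norm (X - (z, 0)) powr - real d + norm (X - (z, 0)) powr - real d)"
    if z: "X - (z, 0) \<noteq> 0" for z
  proof -
    have "\<bar>q (X - (z, 0))\<bar> \<le> C * inv_norm (X - (z, 0)) ^ d"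
      using q(1) z unfolding taylor_kernel_def by blast
    also have "inv_norm (X - (z, 0)) ^ d = norm (X - (z, 0)) powr - real d"
      using z by (subst inv_norm_powr[symmetric], subst powr_realpow) (auto simp: inv_norm_def)
    also have "C * \<dots> \<le> C * (norm (X - (z, 0)) powr - real d + norm (X - (z, 0)) powr - real d)"
      using C by (intro mult_left_mono) auto
    finally show ?thesis .
  qed
  have d': "0 \<le> real d" "real d < 3" using d by auto
  note * = density_integral_bound[OF f d' G C, of X X]
  show "integrable lborel (\<lambda>z. q (X - (z, 0)) * f z)" by (rule *(1)) (rule b)
  show "\<bar>potential q f X\<bar> \<le> 2 * C * M * riesz_sup \<Omega> d" unfolding potential_def by (rule *(2)) (rule b)
qed

text \<open>For second derivatives of the logarithm, \<open>d = 2\<close>, the condition on the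
  degree reads \<alpha> < 1.\<close>

lemma potential_kernel_holder:
  assumes f: "bounded_density \<Omega> M f" and q: "taylor_kernel d q q' C" "q \<in> borel_measurable borel"
    and \<alpha>: "0 \<le> \<alpha>" "\<alpha> \<le> 1" "d + \<alpha> < 3" and XY: "X \<noteq> Y"
  shows "\<bar>potential q f Y - potential q f X\<bar> \<le> (4 * C * 2 powr (d + \<alpha>) * M * riesz_sup \<Omega> (d + \<alpha>)) * norm (Y - X) powr \<alpha>"
proof -
  have C: "0 \<le> C" using q by (simp add: taylor_kernel_def)
  have [measurable]: "q \<in> borel_measurable borel" by fact
  have G: "(\<lambda>z. q (Y - (z, 0)) - q (X - (z, 0))) \<in> borel_measurable borel" by measurable
  have d': "0 \<le> real d + \<alpha>" using \<alpha> by simp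
  have d: "d < 3" using \<alpha> by linarith
  define K where "K = 2 * C * 2 powr (d + \<alpha>) * norm (Y - X) powr \<alpha>"
  have K: "0 \<le> K" using C by (simp add: K_def)
  have b: "\<bar>q (Y - (z, 0)) - q (X - (z, 0))\<bar> \<le> K * (norm (X - (z, 0)) powr - (d + \<alpha>) + norm (Y - (z, 0)) powr - (d + \<alpha>))"
    if z: "X - (z, 0) \<noteq> 0" "Y - (z, 0) \<noteq> 0" for z
    using taylor_kernel_increment_powr[OF q(1) z _ \<alpha>(1,2)] XY by (simp add: K_def)
  have "potential q f Y - potential q f X = (LINT z|lborel. (q (Y - (z, 0)) - q (X - (z, 0))) * f z)"
    unfolding potential_def left_diff_distrib
    by (rule Bochner_Integration.integral_diff[symmetric]) (rule potential_kernel_bound[OF f q d])+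
  also have "\<bar>\<dots>\<bar> \<le> 2 * K * M * riesz_sup \<Omega> (d + \<alpha>)"
    by (rule density_integral_bound(2)[OF f d' \<alpha>(3) G K]) (rule b)
  finally show ?thesis by (simp add: K_def mult_ac)
qed

lemma log_kernel_gradient_measurable: "log_kernel d q q' \<Longrightarrow> i \<in> Basis \<Longrightarrow> q' i \<in> borel_measurable borel"
  using log_kernel_derivative log_kernel_measurable by meson

text \<open>Valid at every \<open>X\<close>, boundary points included; this is what makes the
  logarithmic potential twice differentiable there although its density is only bounded.\<close>

lemma potential_kernel1_has_derivative:
  fixes q :: "R4 \<Rightarrow> real"
  assumes f: "bounded_density \<Omega> M f" and q: "log_kernel 1 q q'"
  shows "(potential q f has_derivative (\<lambda>h. \<Sum>i\<in>Basis. (h \<bullet> i) * potential (q' i) f X)) (at X)"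
proof -
  obtain C where C: "taylor_kernel 1 q q' C" using log_kernel_imp_taylor_kernel[OF q] by blast
  obtain B where B: "0 \<le> B" "\<And>i X. i \<in> Basis \<Longrightarrow> X \<noteq> 0 \<Longrightarrow> \<bar>q' i X\<bar> \<le> B * inv_norm X ^ Suc 1"
    using log_kernel_gradient_bound[OF q] by blast
  have [measurable]: "q \<in> borel_measurable borel" using q by (rule log_kernel_measurable)
  have qm: "q' i \<in> borel_measurable borel" if "i \<in> Basis" for i using log_kernel_gradient_measurable[OF q that] .
  \<comment> \<open>A remainder of order 3/2 for a kernel of degree 1 has degree 5/2, still below
    3.\<close>
  define A where "A = (C + B * DIM(R4)) * 2 powr (5/2)"
  have A: "0 \<le> A" using B C by (simp add: A_def taylor_kernel_def)
  show ?thesis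
  proof (rule potential_has_derivative[where r=1 and \<beta>="1/2" and K="2 * A * M * riesz_sup \<Omega> (5/2)"])
    show "integrable lborel (\<lambda>z. q (Y - (z, 0)) * f z)" for Y
      by (rule potential_kernel_bound(1)[OF f C]) auto
    show "integrable lborel (\<lambda>z. q' i (X - (z, 0)) * f z)" if i: "i \<in> Basis" for i
    proof -
      obtain q'' where k: "log_kernel (Suc 1) (q' i) q''" using log_kernel_derivative[OF q i] by blast
      then obtain C' where "taylor_kernel (Suc 1) (q' i) q'' C'" using log_kernel_imp_taylor_kernel by blast
      then show ?thesis by (rule potential_kernel_bound(1)[OF f]) (use qm i in auto)
    qed
    fix Y assume Y: "Y \<noteq> X"
    define G where "G = (\<lambda>z. q (Y - (z, 0)) - q (X - (z, 0)) - (\<Sum>i\<in>Basis. ((Y - X) \<bullet> i) * q' i (X - (z, 0))))"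
    have [measurable]: "(\<lambda>z. q' i (X - (z, 0))) \<in> borel_measurable borel" if "i \<in> Basis" for i
      by (rule measurable_compose[OF measurable_shift qm[OF that]])
    have G: "G \<in> borel_measurable borel" unfolding G_def by measurable
    have K: "0 \<le> A * norm (Y - X) powr (3/2)" using A by simp
    have b: "\<bar>G z\<bar> \<le> (A * norm (Y - X) powr (3/2)) * (norm (X - (z, 0)) powr - (5/2) + norm (Y - (z, 0)) powr - (5/2))"
      if z: "X - (z, 0) \<noteq> 0" "Y - (z, 0) \<noteq> 0" for z
      using taylor_kernel_remainder_powr[OF C B z, of "1/2"] Y by (simp add: G_def A_def)
    have "\<bar>(LINT z|lborel. G z * f z)\<bar> \<le> 2 * (A * norm (Y - X) powr (3/2)) * M * riesz_sup \<Omega> (5/2)"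
      by (rule density_integral_bound(2)[OF f _ _ G K]) (use b in auto)
    then show "\<bar>(LINT z|lborel. (q (Y - (z, 0)) - q (X - (z, 0)) - (\<Sum>i\<in>Basis. ((Y - X) \<bullet> i) * q' i (X - (z, 0)))) * f z)\<bar>
        \<le> 2 * A * M * riesz_sup \<Omega> (5/2) * norm (Y - X) powr (1 + 1/2)"
      unfolding G_def by (simp add: mult_ac)
  qed auto
qed

lemma abs_ln_le: "0 < r \<Longrightarrow> \<bar>ln r\<bar> \<le> r + 1 / (r::real)"
proof -
  assume r: "0 < r"
  have "ln r \<le> r" "ln (1 / r) \<le> 1 / r" using r by (auto intro: ln_bound)
  then show ?thesis using r by (simp add: ln_div abs_le_iff) (smt (verit) divide_pos_pos)
qed

text \<open>The logarithm is unbounded in both directions, so \<open>X\<close> is kept in a ball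
  that also contains \<open>\<Omega>\<close>: then \<open>r = norm (X - (z, 0))\<close> is at most
  \<open>2 * R\<close>, and \<open>r + 1 / r \<le> (4 * R\<^sup>2 + 1) / r\<close>.\<close>

lemma potential_ln_bound:
  fixes X :: R4
  assumes f: "bounded_density \<Omega> M f" and R: "\<Omega> \<subseteq> cball 0 R" "X \<in> cball 0 R"
  shows "integrable lborel (\<lambda>z. ln (norm (X - (z, 0))) * f z)"
    and "\<bar>potential (\<lambda>Z. ln (norm Z)) f X\<bar> \<le> 2 * (4 * R\<^sup>2 + 1) * M * riesz_sup \<Omega> 1"
proof -
  have G: "(\<lambda>z. ln (norm (X - (z, 0 :: real)))) \<in> borel_measurable borel" by measurable
  have C: "0 \<le> 4 * R\<^sup>2 + 1" by simp
  have b: "\<bar>ln (norm (X - (z, 0)))\<bar> \<le> (4 * R\<^sup>2 + 1) * (norm (X - (z, 0)) powr - 1 + norm (X - (z, 0)) powr - 1)"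
    if z: "z \<in> \<Omega>" "X - (z, 0) \<noteq> 0" for z
  proof -
    define r where "r = norm (X - (z, 0))"
    have r: "0 < r" using z by (simp add: r_def)
    have "norm (z, 0::real) \<le> R" using R z by (auto simp: norm_Pair)
    then have "r \<le> 2 * R" using norm_triangle_ineq4[of X "(z, 0)"] R(2) by (simp add: r_def)
    then have "r * r \<le> (2 * R) * (2 * R)" using r by (intro mult_mono) auto
    then have "r * r + 1 \<le> 4 * R\<^sup>2 + 1" by (simp add: power2_eq_square)
    then have "(r * r + 1) * (1 / r) \<le> (4 * R\<^sup>2 + 1) * (1 / r)" using r by (intro mult_right_mono) auto
    then have "r + 1 / r \<le> (4 * R\<^sup>2 + 1) * (1 / r)" using r by (simp add: field_simps)
    also have "\<dots> \<le> (4 * R\<^sup>2 + 1) * (1 / r + 1 / r)"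
      using r by (intro mult_left_mono) (auto simp: divide_right_mono)
    finally have "\<bar>ln r\<bar> \<le> (4 * R\<^sup>2 + 1) * (1 / r + 1 / r)" using abs_ln_le[OF r] by linarith
    moreover have "1 / r = r powr - 1" using r by (simp add: powr_minus divide_inverse)
    ultimately show ?thesis unfolding r_def by metis
  qed
  note * = density_integral_bound[OF f _ _ G C, where s=1 and X=X and Y=X]
  show "integrable lborel (\<lambda>z. ln (norm (X - (z, 0))) * f z)" by (rule *(1)) (use b in auto)
  show "\<bar>potential (\<lambda>Z. ln (norm Z)) f X\<bar> \<le> 2 * (4 * R\<^sup>2 + 1) * M * riesz_sup \<Omega> 1"
    unfolding potential_def by (rule *(2)) (use b in auto)
qed

lemma potential_ln_has_derivative:
  assumes f: "bounded_density \<Omega> M f"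
  shows "(potential (\<lambda>Z. ln (norm Z)) f has_derivative (\<lambda>h. \<Sum>i\<in>Basis. (h \<bullet> i) * potential (log_grad i) f X)) (at X)"
proof (rule potential_has_derivative[where r=1 and \<beta>=1 and K="2 * 8 * M * riesz_sup \<Omega> 2"])
  obtain R0 where "\<forall>z\<in>\<Omega>. norm z \<le> R0" using f by (auto simp: bounded_density_def bounded_iff)
  \<comment> \<open>The radius is large enough to cover the unit ball around \<open>X\<close>, in
    which the derivative is tested.\<close>
  then have R: "\<Omega> \<subseteq> cball 0 (max R0 (norm X + 1))" by (auto simp: le_max_iff_disj)
  have pm: "log_grad i \<in> borel_measurable borel" if "i \<in> Basis" for i :: R4
    using log_kernel_p[OF that] by (rule log_kernel_measurable)
  show "integrable lborel (\<lambda>z. ln (norm (Y - (z, 0))) * f z)" if Y: "Y \<in> ball X 1" for Y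
  proof (rule potential_ln_bound(1)[OF f R])
    have "norm Y \<le> norm X + norm (Y - X)" using norm_triangle_ineq[of X "Y - X"] by simp
    then show "Y \<in> cball 0 (max R0 (norm X + 1))" using Y by (simp add: dist_norm norm_minus_commute)
  qed
  show "integrable lborel (\<lambda>z. log_grad i (X - (z, 0)) * f z)" if i: "i \<in> Basis" for i
    using potential_kernel_bound(1)[OF f taylor_kernel_p[OF i] pm[OF i]] by simp
  fix Y assume Y: "Y \<noteq> X"
  define G where "G = (\<lambda>z. ln (norm (Y - (z, 0))) - ln (norm (X - (z, 0))) - (\<Sum>i\<in>Basis. ((Y - X) \<bullet> i) * log_grad i (X - (z, 0))))"
  have [measurable]: "(\<lambda>z. log_grad i (X - (z, 0))) \<in> borel_measurable borel" if "i \<in> Basis" for i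
    by (rule measurable_compose[OF measurable_shift pm[OF that]])
  have G: "G \<in> borel_measurable borel" unfolding G_def by measurable
  have b: "\<bar>G z\<bar> \<le> (8 * (norm (Y - X))\<^sup>2) * (norm (X - (z, 0)) powr - 2 + norm (Y - (z, 0)) powr - 2)"
    if z: "X - (z, 0) \<noteq> 0" "Y - (z, 0) \<noteq> 0" for z
  proof -
    define u where "u = inv_norm2 (X - (z, 0)) (Y - (z, 0))"
    have u: "0 < u" using z by (auto simp: u_def inv_norm_def intro!: add_pos_pos)
    have "\<bar>G z\<bar> \<le> 2 * (norm (Y - X) * u)\<^sup>2"
      using ln_norm_expansion[OF z] by (simp add: G_def u_def)
    also have "\<dots> = 2 * (norm (Y - X))\<^sup>2 * u powr 2" using u by (simp add: power_mult_distrib powr_numeral)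
    also have "\<dots> \<le> 2 * (norm (Y - X))\<^sup>2 * (2 powr 2 * (norm (X - (z, 0)) powr - 2 + norm (Y - (z, 0)) powr - 2))"
      unfolding u_def by (intro mult_left_mono inv_norm2_powr_le) auto
    finally show ?thesis by (simp add: algebra_simps)
  qed
  have "\<bar>(LINT z|lborel. G z * f z)\<bar> \<le> 2 * (8 * (norm (Y - X))\<^sup>2) * M * riesz_sup \<Omega> 2"
    by (rule density_integral_bound(2)[OF f _ _ G]) (use b in auto)
  also have "(norm (Y - X))\<^sup>2 = norm (Y - X) powr (1 + 1)" using Y by (simp add: powr_numeral)
  finally show "\<bar>(LINT z|lborel. (ln (norm (Y - (z, 0))) - ln (norm (X - (z, 0))) - (\<Sum>i\<in>Basis. ((Y - X) \<bullet> i) * log_grad i (X - (z, 0)))) * f z)\<bar>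
        \<le> 2 * 8 * M * riesz_sup \<Omega> 2 * norm (Y - X) powr (1 + 1)"
    unfolding G_def by (simp add: mult_ac)
qed auto

definition log_hess :: "R4 \<Rightarrow> R4 \<Rightarrow> R4 \<Rightarrow> real" where
  "log_hess i j X = (if i = j then 1 else 0) * inv_square X + (-2) * (log_grad i X * log_grad j X)"

lemma log_kernel_log_grad_log_hess: "j \<in> Basis \<Longrightarrow> log_kernel 1 (log_grad j) (\<lambda>i. log_hess i j)"
  using log_kernel_p unfolding log_hess_def by blast

lemma log_hess_taylor_kernel:
  assumes "i \<in> Basis" "j \<in> Basis"
  obtains C q'' where "taylor_kernel 2 (log_hess i j) q'' C" "log_hess i j \<in> borel_measurable borel"
proof -
  obtain q'' where k: "log_kernel (Suc 1) (log_hess i j) q''" using log_kernel_derivative[OF log_kernel_log_grad_log_hess[OF assms(2)] assms(1)] by blast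
  then obtain C where "taylor_kernel (Suc 1) (log_hess i j) q'' C" using log_kernel_imp_taylor_kernel by blast
  then show ?thesis using that log_kernel_measurable[OF k] by (metis Suc_1)
qed

lemma continuous_on_powr_holder:
  fixes g :: "'a::real_normed_vector \<Rightarrow> real"
  assumes "0 < \<alpha>" and K: "\<And>X Y. X \<noteq> Y \<Longrightarrow> \<bar>g Y - g X\<bar> \<le> K * norm (Y - X) powr \<alpha>"
  shows "continuous_on S g"
proof -
  have "isCont g X" for X
    unfolding isCont_def
  proof (rule Lim_null[THEN iffD2], rule Lim_null_comparison)
    show "\<forall>\<^sub>F Y in at X. norm (g Y - g X) \<le> K * norm (Y - X) powr \<alpha>"
      unfolding eventually_at_filter by (intro always_eventually) (use K in auto)
    have "((\<lambda>Y. norm (Y - X)) \<longlongrightarrow> 0) (at X)" by (rule tendsto_norm_zero, rule LIM_zero, rule tendsto_ident_at)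
    then have "((\<lambda>Y. norm (Y - X) powr \<alpha>) \<longlongrightarrow> 0) (at X)"
      by (rule tendsto_zero_powrI[where b=\<alpha>]) (use assms(1) in auto)
    then show "((\<lambda>Y. K * norm (Y - X) powr \<alpha>) \<longlongrightarrow> 0) (at X)" by (rule tendsto_mult_right_zero)
  qed
  then show ?thesis by (simp add: continuous_at_imp_continuous_on)
qed

text \<open>Two derivatives fall on the kernel and leave degree 2, integrable over the boundary;
  continuity of the second derivatives is their Hoelder bound with exponent 1/2. Any thick
  \<open>S\<close> is allowed, so the formulas hold within half-spaces as well as in the whole
  space.\<close>

lemma potential_ln_Ck2:
  assumes f: "bounded_density \<Omega> M f" and S: "thick S"
  shows "potential (\<lambda>Z. ln (norm Z)) f \<in> Ck_on 2 S"
    and "\<And>i X. i \<in> Basis \<Longrightarrow> X \<in> S \<Longrightarrow> partial S [i] (potential (\<lambda>Z. ln (norm Z)) f) X = potential (log_grad i) f X"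
    and "\<And>i j X. i \<in> Basis \<Longrightarrow> j \<in> Basis \<Longrightarrow> X \<in> S \<Longrightarrow> partial S [i, j] (potential (\<lambda>Z. ln (norm Z)) f) X = potential (log_hess i j) f X"
proof -
  have d1: "(potential (\<lambda>Z. ln (norm Z)) f has_derivative (\<lambda>h. \<Sum>i\<in>Basis. (h \<bullet> i) * potential (log_grad i) f X)) (at X within S)" for X
    using potential_ln_has_derivative[OF f] has_derivative_at_withinI by blast
  have d2: "(potential (log_grad j) f has_derivative (\<lambda>h. \<Sum>i\<in>Basis. (h \<bullet> i) * potential (log_hess i j) f X)) (at X within S)" if "j \<in> Basis" for X j
    using potential_kernel1_has_derivative[OF f log_kernel_log_grad_log_hess[OF that]] has_derivative_at_withinI by blast
  have c2: "potential (log_hess i j) f \<in> Ck_on 0 S" if ij: "i \<in> Basis" "j \<in> Basis" for i j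
  proof -
    obtain C q'' where q: "taylor_kernel 2 (log_hess i j) q'' C" "log_hess i j \<in> borel_measurable borel" using log_hess_taylor_kernel[OF ij] .
    show ?thesis
      using potential_kernel_holder[OF f q, of "1/2"] by (intro Ck_on_0I continuous_on_powr_holder[of "1/2"]) auto
  qed
  have p1: "potential (log_grad j) f \<in> Ck_on (Suc 0) S" if "j \<in> Basis" for j
    by (rule Ck_on_SucI(1)[OF S d2[OF that] c2[OF _ that]])
  have "potential (\<lambda>Z. ln (norm Z)) f \<in> Ck_on (Suc (Suc 0)) S" by (rule Ck_on_SucI(1)[OF S d1 p1])
  then show "potential (\<lambda>Z. ln (norm Z)) f \<in> Ck_on 2 S" by (simp only: Suc_1 One_nat_def[symmetric])
  show "partial S [i] (potential (\<lambda>Z. ln (norm Z)) f) X = potential (log_grad i) f X" if "i \<in> Basis" "X \<in> S" for i X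
    by (rule Ck_on_SucI(2)[OF S d1 p1 that])
  show "partial S [i, j] (potential (\<lambda>Z. ln (norm Z)) f) X = potential (log_hess i j) f X" if "i \<in> Basis" "j \<in> Basis" "X \<in> S" for i j X
  proof -
    have "[i] \<in> dirs 1" using that by (simp add: dirs_def)
    have "partial S ([i] @ [j]) (potential (\<lambda>Z. ln (norm Z)) f) X = partial S [i] (potential (log_grad j) f) X"
      by (rule Ck_on_SucI(3)[OF S d1 p1 _ \<open>[i] \<in> dirs 1\<close> that(2,3)]) simp_all
    also have "\<dots> = potential (log_hess i j) f X" by (rule Ck_on_SucI(2)[OF S d2[OF that(2)] c2[OF _ that(2)] that(1,3)])
    finally show ?thesis by simp
  qed
qed

section \<open>Smoothness and biharmonicity of the potential in the open half-space\<close>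

lemma open_upper: "open upper"
proof -
  have *: "upper = UNIV \<times> {0<..}" by (auto simp: upper_def)
  show ?thesis unfolding * by (intro open_Times open_UNIV open_greaterThan)
qed

lemma abs_snd_le: "\<bar>snd Z\<bar> \<le> norm (Z :: 'a::real_normed_vector \<times> real)"
  using norm_snd_le[of "snd Z" "fst Z"] by simp

text \<open>Every point within distance \<open>y / 2\<close> of \<open>X\<close> is at least
  \<open>y / 2\<close> away from the boundary. The kernel and its remainder have no singularity
  there, so any degree is admissible and the Riesz exponent is taken to be 0.\<close>

lemma potential_upper_has_derivative:
  assumes f: "bounded_density \<Omega> M f" and q: "log_kernel d q q'" and X: "X \<in> upper"
  shows "(potential q f has_derivative (\<lambda>h. \<Sum>i\<in>Basis. (h \<bullet> i) * potential (q' i) f X)) (at X)"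
proof -
  define y where "y = snd X"
  have y: "0 < y" using X by (auto simp: y_def upper_def)
  obtain C where C: "taylor_kernel d q q' C" using log_kernel_imp_taylor_kernel[OF q] by blast
  then have C0: "0 \<le> C" by (simp add: taylor_kernel_def)
  have [measurable]: "q \<in> borel_measurable borel" using q by (rule log_kernel_measurable)
  have qm: "q' i \<in> borel_measurable borel" if "i \<in> Basis" for i using log_kernel_gradient_measurable[OF q that] .
  have dist: "y / 2 \<le> norm (Y - (z, 0))" if "Y \<in> ball X (y/2)" for Y z
  proof -
    have "\<bar>snd (X - Y)\<bar> \<le> norm (X - Y)" by (rule abs_snd_le)
    then have "y / 2 \<le> snd Y" using that by (simp add: dist_norm y_def)
    moreover have "\<bar>snd (Y - (z, 0))\<bar> \<le> norm (Y - (z, 0))" by (rule abs_snd_le)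
    ultimately show ?thesis by simp
  qed
  have inv: "inv_norm (Y - (z, 0)) \<le> 2 / y" if "Y \<in> ball X (y/2)" for Y z
    using dist[OF that, of z] y unfolding inv_norm_def by (simp add: divide_simps)
  have XB: "X \<in> ball X (y/2)" using y by simp
  have int: "integrable lborel (\<lambda>z. g (Y - (z, 0)) * f z)"
    if g: "taylor_kernel e g g' D" "g \<in> borel_measurable borel" and Y: "Y \<in> ball X (y/2)" for g g' D Y e
  proof (rule density_integral_bound(1)[OF f, of 0 _ "D * (2 / y) ^ e" Y Y])
    have D: "0 \<le> D" using g by (simp add: taylor_kernel_def)
    show "(\<lambda>z. g (Y - (z, 0))) \<in> borel_measurable borel" by (rule measurable_compose[OF measurable_shift g(2)])
    show "0 \<le> D * (2 / y) ^ e" using D y by simp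
    fix z assume z: "Y - (z, 0) \<noteq> 0"
    have "\<bar>g (Y - (z, 0))\<bar> \<le> D * inv_norm (Y - (z, 0)) ^ e" using g(1) z unfolding taylor_kernel_def by blast
    also have "\<dots> \<le> D * (2 / y) ^ e" using D inv[OF Y] by (intro mult_left_mono power_mono) auto
    also have "\<dots> \<le> D * (2 / y) ^ e * (1 + 1)" using D y by simp
    finally show "\<bar>g (Y - (z, 0))\<bar> \<le> D * (2 / y) ^ e * (norm (Y - (z, 0)) powr - 0 + norm (Y - (z, 0)) powr - 0)"
      using z by simp
  qed auto
  show ?thesis
  proof (rule potential_has_derivative[where r="y/2" and \<beta>=1 and K="2 * (C * (4 / y) ^ (d + 2)) * M * riesz_sup \<Omega> 0"])
    show "integrable lborel (\<lambda>z. q (Y - (z, 0)) * f z)" if "Y \<in> ball X (y/2)" for Y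
      by (rule int[OF C _ that]) auto
    show "integrable lborel (\<lambda>z. q' i (X - (z, 0)) * f z)" if i: "i \<in> Basis" for i
    proof -
      obtain q'' where k: "log_kernel (Suc d) (q' i) q''" using log_kernel_derivative[OF q i] by blast
      then obtain C' where "taylor_kernel (Suc d) (q' i) q'' C'" using log_kernel_imp_taylor_kernel by blast
      then show ?thesis by (rule int[OF _ qm[OF i] XB])
    qed
    fix Y assume Y: "Y \<in> ball X (y/2)" "Y \<noteq> X"
    define G where "G = (\<lambda>z. q (Y - (z, 0)) - q (X - (z, 0)) - (\<Sum>i\<in>Basis. ((Y - X) \<bullet> i) * q' i (X - (z, 0))))"
    have [measurable]: "(\<lambda>z. q' i (X - (z, 0))) \<in> borel_measurable borel" if "i \<in> Basis" for i
      by (rule measurable_compose[OF measurable_shift qm[OF that]])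
    have G: "G \<in> borel_measurable borel" unfolding G_def by measurable
    have K: "0 \<le> C * (4 / y) ^ (d + 2) * (norm (Y - X))\<^sup>2" using C0 y by simp
    have dbl: "p \<le> p * (1 + 1)" if "0 \<le> p" for p :: real using that by simp
    have b: "\<bar>G z\<bar> \<le> (C * (4 / y) ^ (d + 2) * (norm (Y - X))\<^sup>2) * (norm (X - (z, 0)) powr - 0 + norm (Y - (z, 0)) powr - 0)"
      if z: "X - (z, 0) \<noteq> 0" "Y - (z, 0) \<noteq> 0" for z
    proof -
      define u where "u = inv_norm2 (X - (z, 0)) (Y - (z, 0))"
      have u: "0 \<le> u" "u \<le> 4 / y" using inv[OF XB, of z] inv[OF Y(1), of z] by (auto simp: u_def)
      have "\<bar>G z\<bar> \<le> C * (norm (Y - X) * u)\<^sup>2 * u ^ d"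
        using C[unfolded taylor_kernel_def, THEN conjunct2, rule_format, OF z] unfolding G_def u_def by simp
      also have "\<dots> = (C * (norm (Y - X))\<^sup>2) * u ^ (d + 2)" by (simp add: power_mult_distrib power_add power2_eq_square mult_ac)
      also have "\<dots> \<le> (C * (norm (Y - X))\<^sup>2) * (4 / y) ^ (d + 2)" using u C0 by (intro mult_left_mono power_mono) auto
      also have "(C * (norm (Y - X))\<^sup>2) * (4 / y) ^ (d + 2) = C * (4 / y) ^ (d + 2) * (norm (Y - X))\<^sup>2"
        by (simp only: mult_ac)
      also have "\<dots> \<le> (C * (4 / y) ^ (d + 2) * (norm (Y - X))\<^sup>2) * (1 + 1)"
        by (rule dbl[OF K])
      finally show ?thesis using z by simp
    qed
    have "\<bar>(LINT z|lborel. G z * f z)\<bar> \<le> 2 * (C * (4 / y) ^ (d + 2) * (norm (Y - X))\<^sup>2) * M * riesz_sup \<Omega> 0"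
      by (rule density_integral_bound(2)[OF f _ _ G K]) (use b in auto)
    also have "(norm (Y - X))\<^sup>2 = norm (Y - X) powr (1 + 1)" using Y by (simp add: powr_numeral)
    finally show "\<bar>(LINT z|lborel. (q (Y - (z, 0)) - q (X - (z, 0)) - (\<Sum>i\<in>Basis. ((Y - X) \<bullet> i) * q' i (X - (z, 0)))) * f z)\<bar>
        \<le> 2 * (C * (4 / y) ^ (d + 2)) * M * riesz_sup \<Omega> 0 * norm (Y - X) powr (1 + 1)"
      unfolding G_def by (simp add: mult_ac)
  qed (use y in auto)
qed

lemma potential_kernel_Ck_upper:
  assumes f: "bounded_density \<Omega> M f"
  shows "log_kernel d q q' \<Longrightarrow> potential q f \<in> Ck_on k upper"
proof (induction k arbitrary: d q q')
  case 0
  have "continuous_on upper (potential q f)"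
    using potential_upper_has_derivative[OF f 0] has_derivative_continuous
    by (meson continuous_at_imp_continuous_on)
  then show ?case by (rule Ck_on_0I)
next
  case (Suc k)
  show ?case
  proof (rule Ck_on_SucI(1)[OF thick_open[OF open_upper]])
    show "(potential q f has_derivative (\<lambda>h. \<Sum>i\<in>Basis. (h \<bullet> i) * potential (q' i) f X)) (at X within upper)" if "X \<in> upper" for X
      using potential_upper_has_derivative[OF f Suc.prems that] has_derivative_at_withinI by blast
    show "potential (q' i) f \<in> Ck_on k upper" if "i \<in> Basis" for i
    proof -
      obtain q'' where "log_kernel (Suc d) (q' i) q''" using log_kernel_derivative[OF Suc.prems \<open>i \<in> Basis\<close>] by blast
      then show ?thesis by (rule Suc.IH)
    qed
  qed
qed

lemma potential_ln_Ck_upper: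
  assumes f: "bounded_density \<Omega> M f"
  shows "potential (\<lambda>Z. ln (norm Z)) f \<in> Ck_on k upper"
proof -
  have "potential (\<lambda>Z. ln (norm Z)) f \<in> Ck_on (Suc k) upper"
  proof (rule Ck_on_SucI(1)[OF thick_open[OF open_upper]])
    show "(potential (\<lambda>Z. ln (norm Z)) f has_derivative (\<lambda>h. \<Sum>i\<in>Basis. (h \<bullet> i) * potential (log_grad i) f X)) (at X within upper)" for X
      using potential_ln_has_derivative[OF f] has_derivative_at_withinI by blast
    show "potential (log_grad i) f \<in> Ck_on k upper" if "i \<in> Basis" for i
      by (rule potential_kernel_Ck_upper[OF f log_kernel_p[OF that]])
  qed
  then show ?thesis by (rule Ck_on_mono) simp
qed

lemma sum_log_grad_squares: "(\<Sum>i\<in>Basis. log_grad i X * log_grad i X) = inv_square (X :: 'a::euclidean_space)"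
proof -
  have "(\<Sum>i\<in>Basis. log_grad i X * log_grad i X) = (\<Sum>i\<in>Basis. (X \<bullet> i) * (X \<bullet> i)) * (inv_square X * inv_square X)"
    unfolding sum_distrib_right by (rule sum.cong) (simp_all add: log_grad_def inv_square_def)
  also have "(\<Sum>i\<in>Basis. (X \<bullet> i) * (X \<bullet> i)) = (norm X)\<^sup>2"
    unfolding power2_norm_eq_inner by (rule euclidean_inner[symmetric])
  finally have fin: "(\<Sum>i\<in>Basis. log_grad i X * log_grad i X) = (norm X)\<^sup>2 * (inv_square X * inv_square X)" .
  show ?thesis
  proof (cases "X = 0")
    case False
    then have "(norm X)\<^sup>2 * inv_square X = 1" by (simp add: inv_square_def)
    then have "(norm X)\<^sup>2 * (inv_square X * inv_square X) = inv_square X" by (simp only: mult.assoc[symmetric] mult_1)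
    with fin show ?thesis by simp
  qed (use fin in \<open>simp add: inv_square_def\<close>)
qed

text \<open>The dimension enters here: four diagonal terms minus twice the squared gradient,
  \<open>4 - 2 = 2\<close>.\<close>

lemma sum_log_hess: "(\<Sum>i\<in>Basis. log_hess i i X) = 2 * inv_square X"
proof -
  have "(\<Sum>i\<in>Basis. log_hess i i X) = (\<Sum>i\<in>(Basis::R4 set). inv_square X) - 2 * (\<Sum>i\<in>Basis. log_grad i X * log_grad i X)"
    unfolding sum_distrib_left sum_subtractf[symmetric] by (rule sum.cong) (simp_all add: log_hess_def)
  then show ?thesis by (simp add: sum_log_grad_squares)
qed

lemma laplacian_potential_ln:
  assumes f: "bounded_density \<Omega> M f"
  shows "laplacian (potential (\<lambda>Z. ln (norm Z)) f) X = 2 * potential inv_square f X"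
proof -
  have "laplacian (potential (\<lambda>Z. ln (norm Z)) f) X = (\<Sum>i\<in>Basis. potential (log_hess i i) f X)"
    unfolding laplacian_def
    by (rule sum.cong[OF refl], rule potential_ln_Ck2(3)[OF f thick_open[OF open_UNIV]]) auto
  also have "\<dots> = (LINT z|lborel. (\<Sum>i\<in>Basis. log_hess i i (X - (z, 0)) * f z))"
    unfolding potential_def
  proof (rule Bochner_Integration.integral_sum[symmetric])
    fix i :: R4 assume i: "i \<in> Basis"
    obtain C q'' where q: "taylor_kernel 2 (log_hess i i) q'' C" "log_hess i i \<in> borel_measurable borel" using log_hess_taylor_kernel[OF i i] .
    show "integrable lborel (\<lambda>z. log_hess i i (X - (z, 0)) * f z)" by (rule potential_kernel_bound(1)[OF f q]) simp
  qed
  also have "\<dots> = (LINT z|lborel. 2 * (inv_square (X - (z, 0)) * f z))"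
    by (simp add: sum_distrib_right[symmetric] sum_log_hess mult.assoc)
  finally show ?thesis unfolding potential_def by simp
qed

lemma partial_UNIV_open:
  assumes "open S" "X \<in> S"
  shows "partial UNIV vs f X = partial S vs f X"
  using partial_cong[of S UNIV S f f X vs] assms by auto

lemma biharmonic_potential_ln:
  assumes f: "bounded_density \<Omega> M f"
  shows "biharmonic (potential (\<lambda>Z. ln (norm Z)) f)"
  unfolding biharmonic_def
proof (intro conjI ballI)
  show "potential (\<lambda>Z. ln (norm Z)) f \<in> Ck_on 4 upper" by (rule potential_ln_Ck_upper[OF f])
  fix X assume X: "X \<in> upper"
  let ?U = "upper"
  note S = thick_open[OF open_upper]
  define ds where "ds = (\<lambda>i X::R4. (-2) * (log_grad i X * inv_square X))"
  define dds where "dds = (\<lambda>i k X. (-2) * (log_grad i X * ((-2) * (log_grad k X * inv_square X)) + log_hess k i X * inv_square X))"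
  have ks: "log_kernel 2 inv_square ds" unfolding ds_def by (rule log_kernel_s)
  have kds: "log_kernel 3 (ds i) (dds i)" if "i \<in> Basis" for i
  proof -
    have "log_kernel (1 + 2) (\<lambda>X. log_grad i X * inv_square X) (\<lambda>k X. log_grad i X * ((-2) * (log_grad k X * inv_square X)) + log_hess k i X * inv_square X)"
      by (rule log_kernel_mult[OF log_kernel_log_grad_log_hess[OF that] log_kernel_s])
    have 3: "(3::nat) = 1 + 2" by simp
    show ?thesis unfolding ds_def dds_def 3 by (rule log_kernel_scale[OF \<open>log_kernel (1 + 2) _ _\<close>])
  qed
  \<comment> \<open>The summand with coefficient 0 brings the expression into the shape of a linear
    combination, as \<open>Ck_on_lincomb\<close> expects.\<close>
  have eq: "laplacian (potential (\<lambda>Z. ln (norm Z)) f) = (\<lambda>X. 2 * potential inv_square f X + 0 * potential inv_square f X)"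
    using laplacian_potential_ln[OF f] by auto
  have d1: "(potential inv_square f has_derivative (\<lambda>h. \<Sum>i\<in>Basis. (h \<bullet> i) * potential (ds i) f X)) (at X within ?U)" if "X \<in> ?U" for X
    using potential_upper_has_derivative[OF f ks that] has_derivative_at_withinI by blast
  have d2: "(potential (ds i) f has_derivative (\<lambda>h. \<Sum>k\<in>Basis. (h \<bullet> k) * potential (dds i k) f X)) (at X within ?U)"
    if "X \<in> ?U" "i \<in> Basis" for X i
    using potential_upper_has_derivative[OF f kds[OF that(2)] that(1)] has_derivative_at_withinI by blast
  have kdds: "\<exists>q'. log_kernel 4 (dds i k) q'" if "i \<in> Basis" "k \<in> Basis" for i k
    using log_kernel_derivative[OF kds[OF that(1)] that(2)] by simp
  have Cdds: "potential (dds i k) f \<in> Ck_on 0 ?U" if ik: "i \<in> Basis" "k \<in> Basis" for i k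
    using kdds[OF ik] potential_kernel_Ck_upper[OF f] by blast
  have Cds: "potential (ds i) f \<in> Ck_on 1 ?U" if "i \<in> Basis" for i by (rule potential_kernel_Ck_upper[OF f kds[OF that]])
  have p: "partial ?U [i, i] (potential inv_square f) X = potential (dds i i) f X" if i: "i \<in> Basis" for i
  proof -
    have "[i] \<in> dirs 1" using i by (simp add: dirs_def)
    from Ck_on_SucI(3)[OF S d1 Cds order_refl this i X]
    have "partial ?U ([i] @ [i]) (potential inv_square f) X = partial ?U [i] (potential (ds i) f) X" by blast
    also have "\<dots> = potential (dds i i) f X" by (rule Ck_on_SucI(2)[OF S d2[OF _ i] Cdds[OF i] i X])
    finally show ?thesis by simp
  qed
  have "laplacian (laplacian (potential (\<lambda>Z. ln (norm Z)) f)) X = (\<Sum>i\<in>Basis. partial ?U [i, i] (\<lambda>X. 2 * potential inv_square f X + 0 * potential inv_square f X) X)"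
    unfolding eq unfolding laplacian_def
    by (intro sum.cong refl partial_UNIV_open open_upper X)
  also have "\<dots> = (\<Sum>i\<in>Basis. 2 * potential (dds i i) f X)"
  proof (rule sum.cong[OF refl])
    fix i :: R4 assume i: "i \<in> Basis"
    then have ii: "[i, i] \<in> dirs 2" by (simp add: dirs_def)
    have sC: "potential inv_square f \<in> Ck_on 2 ?U" by (rule potential_kernel_Ck_upper[OF f ks])
    from Ck_on_lincomb(2)[OF S sC sC order_refl ii X, of 2 0] p[OF i]
    show "partial ?U [i, i] (\<lambda>X. 2 * potential inv_square f X + 0 * potential inv_square f X) X = 2 * potential (dds i i) f X"
      by (simp only: mult_zero_left add_0_right)
  qed
  also have "\<dots> = 2 * (\<Sum>i\<in>Basis. potential (dds i i) f X)" by (simp add: sum_distrib_left)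
  also have "(\<Sum>i\<in>Basis. potential (dds i i) f X) = (LINT z|lborel. (\<Sum>i\<in>Basis. dds i i (X - (z, 0)) * f z))"
    unfolding potential_def
  proof (rule Bochner_Integration.integral_sum[symmetric])
    fix i :: R4 assume i: "i \<in> Basis"
    have y: "0 < snd X" using X by (auto simp: upper_def)
    obtain q' where k: "log_kernel 4 (dds i i) q'" using kdds[OF i i] by blast
    obtain D where D: "taylor_kernel 4 (dds i i) q' D" using log_kernel_imp_taylor_kernel[OF k] by blast
    have D0: "0 \<le> D" using D by (simp add: taylor_kernel_def)
    show "integrable lborel (\<lambda>z. dds i i (X - (z, 0)) * f z)"
    proof (rule density_integral_bound(1)[OF f, of 0 _ "D * (1 / snd X) ^ 4" X X])
      show "(\<lambda>z. dds i i (X - (z, 0))) \<in> borel_measurable borel"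
        by (rule measurable_compose[OF measurable_shift log_kernel_measurable[OF k]])
      show "0 \<le> D * (1 / snd X) ^ 4" using D0 y by simp
      fix z assume z: "X - (z, 0) \<noteq> 0"
      have "snd X \<le> norm (X - (z, 0))" using abs_snd_le[of "X - (z, 0)"] y by simp
      then have "inv_norm (X - (z, 0)) \<le> 1 / snd X" unfolding inv_norm_def inverse_eq_divide using y
        by (intro divide_left_mono mult_pos_pos) (auto intro: less_le_trans)
      then have "D * inv_norm (X - (z, 0)) ^ 4 \<le> D * (1 / snd X) ^ 4" using D0 by (intro mult_left_mono power_mono) auto
      moreover have "\<bar>dds i i (X - (z, 0))\<bar> \<le> D * inv_norm (X - (z, 0)) ^ 4" using D z unfolding taylor_kernel_def by blast
      moreover have "0 \<le> D * (1 / snd X) ^ 4" using D0 y by simp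
      ultimately show "\<bar>dds i i (X - (z, 0))\<bar> \<le> D * (1 / snd X) ^ 4 * (norm (X - (z, 0)) powr - 0 + norm (X - (z, 0)) powr - 0)"
        using z by simp
    qed auto
  qed
  also have "\<dots> = 0"
  proof -
    \<comment> \<open>Harmonicity of \<open>inv_square\<close> in dimension four: 8 from the squared
      gradient against \<open>4 * 2\<close> from the four diagonal terms.\<close>
    have "(\<Sum>i\<in>Basis. dds i i Z) = 0" for Z
    proof -
      have "(\<Sum>i\<in>Basis. dds i i Z) = 8 * inv_square Z * (\<Sum>i\<in>Basis. log_grad i Z * log_grad i Z) - (\<Sum>i\<in>(Basis::R4 set). 2 * inv_square Z * inv_square Z)"
        unfolding sum_distrib_left sum_subtractf[symmetric]
        by (rule sum.cong) (simp_all add: dds_def log_hess_def algebra_simps)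
      then show ?thesis by (simp add: sum_log_grad_squares)
    qed
    then show ?thesis by (simp add: sum_distrib_right[symmetric])
  qed
  finally show "laplacian (laplacian (potential (\<lambda>Z. ln (norm Z)) f)) X = 0" by simp
qed

section \<open>Green's identity in the half-space\<close>

lemma integral_lborel_translate:
  fixes f :: "'a::euclidean_space \<Rightarrow> real"
  assumes [measurable]: "f \<in> borel_measurable borel"
  shows "(LINT x|lborel. f (x + a)) = (LINT x|lborel. f x)"
    and "integrable lborel f \<Longrightarrow> integrable lborel (\<lambda>x. f (x + a))"
proof -
  have "(LINT x|lborel. f x) = (LINT x|distr lborel borel ((+) a). f x)" by (simp add: lborel_distr_plus)
  also have "\<dots> = (LINT x|lborel. f (a + x))" by (rule integral_distr) auto
  finally show "(LINT x|lborel. f (x + a)) = (LINT x|lborel. f x)" by (simp add: add.commute)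
  assume "integrable lborel f"
  then have "integrable (distr lborel borel ((+) a)) f" by (simp add: lborel_distr_plus)
  then have "integrable lborel (\<lambda>x. f (a + x))" by (subst (asm) integrable_distr_eq) auto
  then show "integrable lborel (\<lambda>x. f (x + a))" by (simp add: add.commute)
qed

lemma integrable_bounded_support:
  fixes f :: "'a::euclidean_space \<Rightarrow> real"
  assumes f: "f \<in> borel_measurable borel" and B: "\<And>x. \<bar>f x\<bar> \<le> B" and R: "\<And>x. R < norm x \<Longrightarrow> f x = 0"
  shows "integrable lborel f"
proof (rule Bochner_Integration.integrable_bound)
  show "integrable lborel (\<lambda>x. B * indicator (cball (0::'a) R) x)"
    by (intro integrable_mult_right integrable_real_indicator) (simp_all add: emeasure_bounded_finite[OF bounded_cball, unfolded infinity_ennreal_def])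
  show "AE x in lborel. norm (f x) \<le> norm (B * indicator (cball (0::'a) R) x)"
  proof (rule AE_I2)
    fix x show "norm (f x) \<le> norm (B * indicator (cball (0::'a) R) x)"
      using B[of x] R[of x] by (cases "R < norm x") (auto simp: indicator_def)
  qed
qed (use f in simp)

text \<open>Translation invariance makes every difference quotient of \<open>F\<close> integrate to zero.\<close>

lemma integral_directional_derivative_zero:
  fixes F D :: "'a::euclidean_space \<Rightarrow> real"
  assumes F: "F \<in> borel_measurable borel" and D: "D \<in> borel_measurable borel" and e: "norm e \<le> 1"
    and B: "\<And>X. \<bar>F X\<bar> \<le> B" and R: "\<And>X. R < norm X \<Longrightarrow> F X = 0"
    and inc: "AE X in lborel. \<forall>h. 0 < h \<longrightarrow> h \<le> 1 \<longrightarrow> \<bar>F (X + h *\<^sub>R e) - F X\<bar> \<le> M * h"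
    and lim: "AE X in lborel. (\<lambda>n. (F (X + (1 / Suc n) *\<^sub>R e) - F X) * Suc n) \<longlonglongrightarrow> D X"
  shows "integrable lborel D" "(LINT X|lborel. D X) = 0"
proof -
  define s where "s = (\<lambda>n X. (F (X + (1 / Suc n) *\<^sub>R e) - F X) * Suc n)"
  have iF: "integrable lborel F" by (rule integrable_bounded_support[OF F B R])
  have sm: "s n \<in> borel_measurable lborel" for n
    unfolding s_def using F by measurable
  have s0: "(LINT X|lborel. s n X) = 0" for n
    unfolding s_def using integral_lborel_translate[OF F, of "(1 / Suc n) *\<^sub>R e"] iF by simp
  have wi: "integrable lborel (\<lambda>X. M * indicator (cball (0::'a) (R + 1)) X)"
    by (intro integrable_mult_right integrable_real_indicator) (simp_all add: emeasure_bounded_finite[OF bounded_cball, unfolded infinity_ennreal_def])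
  have bd: "AE X in lborel. norm (s n X) \<le> M * indicator (cball (0::'a) (R + 1)) X" for n
    using inc
  proof eventually_elim
    case (elim X)
    have h: "0 < 1 / real (Suc n)" "1 / real (Suc n) \<le> 1" by auto
    show ?case
    proof (cases "norm X \<le> R + 1")
      case True
      have "\<bar>F (X + (1 / Suc n) *\<^sub>R e) - F X\<bar> \<le> M * (1 / Suc n)" using elim h by blast
      then have "\<bar>F (X + (1 / Suc n) *\<^sub>R e) - F X\<bar> * Suc n \<le> (M * (1 / Suc n)) * Suc n"
        by (intro mult_right_mono) auto
      then show ?thesis using True by (simp add: s_def abs_mult del: of_nat_Suc)
    next
      case False
      have "norm ((1 / real (Suc n)) *\<^sub>R e) \<le> 1 * 1" unfolding norm_scaleR using e by (intro mult_mono) auto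
      then have "R < norm (X + (1 / Suc n) *\<^sub>R e)"
        using False norm_diff_ineq[of X "(1 / Suc n) *\<^sub>R e"] by linarith
      moreover have "R < norm X" using False by simp
      ultimately show ?thesis using False by (simp add: s_def R del: of_nat_Suc)
    qed
  qed
  have l: "AE X in lborel. (\<lambda>n. s n X) \<longlonglongrightarrow> D X" using lim by (simp add: s_def)
  show "integrable lborel D" by (rule integrable_dominated_convergence[OF _ sm wi l bd]) (use D in simp)
  have "(\<lambda>n. LINT X|lborel. s n X) \<longlonglongrightarrow> (LINT X|lborel. D X)"
    by (rule integral_dominated_convergence[OF _ sm wi l bd]) (use D in simp)
  then show "(LINT X|lborel. D X) = 0" unfolding s0 by (simp add: LIMSEQ_const_iff)
qed

lemma closed_upper_closed: "closed upper_closed"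
proof -
  have *: "upper_closed = UNIV \<times> {0..}" by (auto simp: upper_closed_def)
  show ?thesis unfolding * by (intro closed_Times closed_UNIV closed_atLeast)
qed

lemma upper_subset_closed: "upper \<subseteq> upper_closed"
  by (auto simp: upper_def upper_closed_def)

lemma mem_upper: "X \<in> upper \<longleftrightarrow> 0 < snd X" and mem_upper_closed: "X \<in> upper_closed \<longleftrightarrow> 0 \<le> snd X"
  by (auto simp: upper_def upper_closed_def)

text \<open>In each direction \<open>i\<close> the function \<open>w * p1 i - \<psi> * w1 i\<close>
  is extended by zero below the boundary, and its derivative \<open>w * p2 i - \<psi> * w2 i\<close>
  integrates to zero by translation invariance. In the vertical direction the extension is Lipschitz
  across the boundary because both normal derivatives vanish there, so no boundary term arises. The
  set \<open>T\<close> allows \<open>w\<close> to be regular only near those boundary points that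
  the support \<open>K\<close> can reach.\<close>

lemma Green_half_space:
  fixes w \<psi> :: "R4 \<Rightarrow> real" and w1 w2 p1 p2 :: "R4 \<Rightarrow> R4 \<Rightarrow> real"
  assumes T: "upper \<subseteq> T" "T \<subseteq> upper_closed" and K: "compact K" "K \<subseteq> T"
    and cw: "continuous_on T w" "\<And>i. i \<in> Basis \<Longrightarrow> continuous_on T (w1 i)" "\<And>i. i \<in> Basis \<Longrightarrow> continuous_on T (w2 i)"
    and cp: "continuous_on upper_closed \<psi>" "\<And>i. i \<in> Basis \<Longrightarrow> continuous_on upper_closed (p1 i)"
      "\<And>i. i \<in> Basis \<Longrightarrow> continuous_on upper_closed (p2 i)"
    and dw: "\<And>X i. X \<in> upper \<Longrightarrow> i \<in> Basis \<Longrightarrow> ((\<lambda>t. w (X + t *\<^sub>R i)) has_real_derivative w1 i X) (at 0)"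
      "\<And>X i. X \<in> upper \<Longrightarrow> i \<in> Basis \<Longrightarrow> ((\<lambda>t. w1 i (X + t *\<^sub>R i)) has_real_derivative w2 i X) (at 0)"
    and dp: "\<And>X i. X \<in> upper \<Longrightarrow> i \<in> Basis \<Longrightarrow> ((\<lambda>t. \<psi> (X + t *\<^sub>R i)) has_real_derivative p1 i X) (at 0)"
      "\<And>X i. X \<in> upper \<Longrightarrow> i \<in> Basis \<Longrightarrow> ((\<lambda>t. p1 i (X + t *\<^sub>R i)) has_real_derivative p2 i X) (at 0)"
    and supp: "\<And>X. X \<in> upper_closed - K \<Longrightarrow> \<psi> X = 0" "\<And>X i. X \<in> upper_closed - K \<Longrightarrow> i \<in> Basis \<Longrightarrow> p1 i X = 0"
      "\<And>X i. X \<in> upper_closed - K \<Longrightarrow> i \<in> Basis \<Longrightarrow> p2 i X = 0"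
    and bw: "\<And>x. (x, 0) \<in> T \<Longrightarrow> w1 (0, 1) (x, 0) = 0" and bp: "\<And>x. p1 (0, 1) (x, 0) = 0"
  shows "integrable lborel (\<lambda>X. indicator upper X * (w X * (\<Sum>i\<in>Basis. p2 i X))) \<and>
         (LINT X|lborel. indicator upper X * (w X * (\<Sum>i\<in>Basis. p2 i X))) =
         (LINT X|lborel. indicator upper X * (\<psi> X * (\<Sum>i\<in>Basis. w2 i X)))"
proof -
  have KU: "K \<subseteq> upper_closed" using K T by blast
  have Kc: "closed K" using K compact_imp_closed by blast
  have [measurable]: "upper \<in> sets borel" "K \<in> sets borel" using open_upper Kc by auto
  obtain R where R: "\<And>X. X \<in> K \<Longrightarrow> norm X \<le> R" using K(1) compact_imp_bounded bounded_iff by metis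
  define U where "U = upper \<inter> K"
  have Um: "U \<in> sets borel" by (simp add: U_def)
  have UT: "U \<subseteq> T" "U \<subseteq> upper_closed" using K KU by (auto simp: U_def)
  have bdd: "\<exists>B. \<forall>X\<in>K. \<bar>g X\<bar> \<le> B" if "continuous_on K g" for g :: "R4 \<Rightarrow> real"
    using compact_imp_bounded[OF compact_continuous_image[OF that K(1)]] by (auto simp: bounded_iff)
  have cK: "continuous_on K g" if "continuous_on T g \<or> continuous_on upper_closed g" for g :: "R4 \<Rightarrow> real"
    using that K(2) KU continuous_on_subset by blast
  have meas: "(\<lambda>X. indicator A X * g X) \<in> borel_measurable borel"
    if "continuous_on A g" "A \<in> sets borel" for g :: "R4 \<Rightarrow> real" and A
    using borel_measurable_continuous_on_indicator[OF that(2,1)] by simp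
  have int: "integrable lborel (\<lambda>X. indicator U X * g X)" if g: "continuous_on K g" for g :: "R4 \<Rightarrow> real"
  proof -
    obtain B where B: "\<forall>X\<in>K. \<bar>g X\<bar> \<le> B" using bdd[OF g] by blast
    show ?thesis
    proof (rule integrable_bounded_support[where B="\<bar>B\<bar>" and R=R])
      show "(\<lambda>X. indicator U X * g X) \<in> borel_measurable borel"
        by (rule meas[OF continuous_on_subset[OF g] Um]) (auto simp: U_def)
      show "\<bar>indicator U X * g X\<bar> \<le> \<bar>B\<bar>" for X using B by (auto simp: indicator_def U_def)
      show "indicator U X * g X = 0" if "R < norm X" for X using R[of X] that by (auto simp: indicator_def U_def)
    qed
  qed
  have eq1: "indicator upper X * (w X * p2 i X) = indicator U X * (w X * p2 i X)" if "i \<in> Basis" for X i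
    using supp(3)[of X i] that upper_subset_closed by (auto simp: indicator_def U_def)
  have eq2: "indicator upper X * (\<psi> X * w2 i X) = indicator U X * (\<psi> X * w2 i X)" for X i
    using supp(1)[of X] upper_subset_closed by (auto simp: indicator_def U_def)
  have i1: "integrable lborel (\<lambda>X. indicator upper X * (w X * p2 i X))" if "i \<in> Basis" for i
    unfolding eq1[OF that] by (intro int continuous_on_mult cK) (use cw cp that in auto)
  have i2: "integrable lborel (\<lambda>X. indicator upper X * (\<psi> X * w2 i X))" if "i \<in> Basis" for i
    unfolding eq2 by (intro int continuous_on_mult cK) (use cw cp that in auto)
  have s1: "indicator upper X * (w X * (\<Sum>i\<in>Basis. p2 i X)) = (\<Sum>i\<in>Basis. indicator upper X * (w X * p2 i X))" for X
    by (simp add: sum_distrib_left)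
  have s2: "indicator upper X * (\<psi> X * (\<Sum>i\<in>Basis. w2 i X)) = (\<Sum>i\<in>Basis. indicator upper X * (\<psi> X * w2 i X))" for X
    by (simp add: sum_distrib_left)
  have I: "integrable lborel (\<lambda>X. indicator upper X * (w X * (\<Sum>i\<in>Basis. p2 i X)))"
    unfolding s1 by (intro Bochner_Integration.integrable_sum i1)
  have main: "(LINT X|lborel. indicator upper X * (w X * p2 i X)) = (LINT X|lborel. indicator upper X * (\<psi> X * w2 i X))"
    if i: "i \<in> Basis" for i
  proof -
    define f where "f = (\<lambda>X. w X * p1 i X - \<psi> X * w1 i X)"
    define F where "F = (\<lambda>X. indicator K X * f X)"
    define d where "d = (\<lambda>X. w X * p2 i X - \<psi> X * w2 i X)"
    define D where "D = (\<lambda>X. indicator U X * d X)"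
    have cf: "continuous_on T f" unfolding f_def
      using cw(1) cw(2)[OF i] continuous_on_subset[OF cp(1) T(2)] continuous_on_subset[OF cp(2)[OF i] T(2)]
      by (intro continuous_intros)
    have cd: "continuous_on K d" unfolding d_def
      by (intro continuous_on_diff continuous_on_mult cK) (use cw cp i in auto)
    have Ff: "F X = f X" if "X \<in> upper_closed" for X
      using supp(1)[of X] supp(2)[of X i] i that by (auto simp: F_def f_def indicator_def)
    have F0: "F X = 0" if "snd X < 0" for X
      using that KU by (auto simp: F_def indicator_def mem_upper_closed)
    have Dd: "D X = d X" if "X \<in> upper" for X
      using supp(1)[of X] supp(3)[of X i] i that upper_subset_closed by (auto simp: D_def d_def indicator_def U_def)
    have Fm: "F \<in> borel_measurable borel"
      unfolding F_def by (rule meas[OF continuous_on_subset[OF cf K(2)]]) simp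
    have Dm: "D \<in> borel_measurable borel"
      unfolding D_def by (rule meas[OF continuous_on_subset[OF cd] Um]) (auto simp: U_def)
    obtain B where B: "\<forall>X\<in>K. \<bar>f X\<bar> \<le> B" using bdd[OF continuous_on_subset[OF cf K(2)]] by blast
    obtain M0 where "\<forall>X\<in>K. \<bar>d X\<bar> \<le> M0" using bdd[OF cd] by blast
    then have M: "\<bar>D X\<bar> \<le> \<bar>M0\<bar>" for X by (auto simp: D_def U_def indicator_def)
    have der: "((\<lambda>t. F (X + t *\<^sub>R i)) has_real_derivative D (X + t *\<^sub>R i)) (at t)" if X: "X + t *\<^sub>R i \<in> upper" for X t
    proof -
      have *: "((\<lambda>s. f (Y + s *\<^sub>R i)) has_real_derivative d Y) (at 0)" if "Y \<in> upper" for Y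
        unfolding f_def d_def
        by (rule derivative_eq_intros dw[OF that i] dp[OF that i] refl)+ simp
      have op: "open {s. Y + s *\<^sub>R i \<in> upper}" for Y
      proof -
        have "continuous_on UNIV (\<lambda>s. Y + s *\<^sub>R i)" by (intro continuous_intros)
        from open_vimage[OF open_upper this] show ?thesis by (simp add: vimage_def)
      qed
      have "((\<lambda>s. F (Y + s *\<^sub>R i)) has_real_derivative D Y) (at 0)" if Y: "Y \<in> upper" for Y
        unfolding Dd[OF Y]
      proof (rule has_field_derivative_transform_within_open[OF *[OF Y] op[of Y]])
        show "0 \<in> {s. Y + s *\<^sub>R i \<in> upper}" using Y by simp
        fix s assume "s \<in> {s. Y + s *\<^sub>R i \<in> upper}"
        then have "Y + s *\<^sub>R i \<in> upper_closed" using upper_subset_closed by blast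
        then show "f (Y + s *\<^sub>R i) = F (Y + s *\<^sub>R i)" using Ff by simp
      qed
      from this[OF X] have "((\<lambda>s. F (X + t *\<^sub>R i + s *\<^sub>R i)) has_real_derivative D (X + t *\<^sub>R i)) (at (t + - t))" by simp
      then have "((\<lambda>s. F (X + t *\<^sub>R i + (s + - t) *\<^sub>R i)) has_real_derivative D (X + t *\<^sub>R i)) (at t)"
        by (simp only: DERIV_shift[of "\<lambda>s. F (X + t *\<^sub>R i + s *\<^sub>R i)"])
      moreover have "X + t *\<^sub>R i + (s + - t) *\<^sub>R i = X + s *\<^sub>R i" for s by (simp add: algebra_simps)
      ultimately show ?thesis by (simp only:)
    qed
    have mv: "\<bar>F (X + b *\<^sub>R i) - F (X + a *\<^sub>R i)\<bar> \<le> \<bar>M0\<bar> * (b - a)"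
      if ab: "a < b" and up: "\<And>t. a \<le> t \<Longrightarrow> t \<le> b \<Longrightarrow> X + t *\<^sub>R i \<in> upper" for X a b
    proof -
      obtain t where t: "F (X + b *\<^sub>R i) - F (X + a *\<^sub>R i) = (b - a) * D (X + t *\<^sub>R i)"
        using MVT2[OF ab, of "\<lambda>t. F (X + t *\<^sub>R i)" "\<lambda>t. D (X + t *\<^sub>R i)"] der up by blast
      have "\<bar>F (X + b *\<^sub>R i) - F (X + a *\<^sub>R i)\<bar> = (b - a) * \<bar>D (X + t *\<^sub>R i)\<bar>" unfolding t using ab by (simp add: abs_mult)
      also have "\<dots> \<le> (b - a) * \<bar>M0\<bar>" using M ab by (intro mult_left_mono) auto
      finally show ?thesis by (simp add: mult.commute)
    qed
    \<comment> \<open>Linear decay towards the boundary in the vertical direction; it makes up for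
      the zero extension not being differentiable at height 0.\<close>
    have near: "\<bar>F (x, s)\<bar> \<le> \<bar>M0\<bar> * s" if iy: "i = (0, 1)" and s: "0 \<le> s" for x s
    proof (cases "s = 0")
      case True
      have "F (x, 0) = 0"
      proof (cases "(x, 0) \<in> K")
        case True
        then show ?thesis using bw[of x] bp[of x] K(2) iy by (auto simp: F_def f_def)
      qed (simp add: F_def)
      then show ?thesis using True by simp
    next
      case False
      then have s: "0 < s" using s by simp
      have line: "(x, t) = (x, 0) + t *\<^sub>R i" for t unfolding iy by simp
      show ?thesis
      proof (cases "(x, 0) \<in> T")
        case False
        \<comment> \<open>Here \<open>w\<close> is not controlled at the boundary point, but
          \<open>K\<close> is closed and misses it, so \<open>F\<close> vanishes just above it and
          the mean value estimate can start at height \<open>\<delta>\<close>.\<close>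
        then have "(x, 0) \<in> - K" using K(2) by auto
        then obtain e where e: "e > 0" "ball (x, 0) e \<subseteq> - K" using Kc open_contains_ball by (metis open_Compl)
        define \<delta> where "\<delta> = min s e / 2"
        have \<delta>: "0 < \<delta>" "\<delta> < s" using s e by (auto simp: \<delta>_def)
        have "(x, \<delta>) \<in> ball (x, 0) e" using s e by (auto simp: \<delta>_def dist_Pair_Pair dist_real_def)
        then have "F (x, \<delta>) = 0" using e by (auto simp: F_def indicator_def)
        moreover have "\<bar>F ((x, 0) + s *\<^sub>R i) - F ((x, 0) + \<delta> *\<^sub>R i)\<bar> \<le> \<bar>M0\<bar> * (s - \<delta>)"
          by (rule mv[OF \<delta>(2)]) (use \<delta> in \<open>auto simp: iy mem_upper\<close>)
        moreover have "\<bar>M0\<bar> * (s - \<delta>) \<le> \<bar>M0\<bar> * s" using \<delta> by (intro mult_left_mono) auto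
        ultimately show ?thesis unfolding line[symmetric] by linarith
      next
        case True
        have inT: "(x, t) \<in> T" if "0 \<le> t" for t
          using that True T(1) by (cases "t = 0") (auto simp: upper_def)
        have "continuous_on {0..s} (\<lambda>t. f (x, t))"
          by (rule continuous_on_compose2[OF cf]) (use inT in \<open>auto intro!: continuous_intros\<close>)
        then have cont: "continuous_on {0..s} (\<lambda>t. F (x, t))"
          by (rule continuous_on_eq) (use Ff in \<open>auto simp: mem_upper_closed\<close>)
        have dF: "((\<lambda>t. F (x, t)) has_real_derivative D (x, t)) (at t)" if "0 < t" for t
          using der[of "(x, 0)" t] that unfolding line[symmetric] by (simp add: mem_upper)
        obtain t where t: "0 < t" "t < s" "F (x, s) - F (x, 0) = D (x, t) * (s - 0)"
          using mvt[OF s cont, of "\<lambda>t h. D (x, t) * h"] dF by (auto simp: has_field_derivative_def)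
        have "F (x, 0) = 0" using Ff[of "(x, 0)"] bw[of x] bp[of x] True iy by (auto simp: f_def mem_upper_closed)
        then have "\<bar>F (x, s)\<bar> = \<bar>D (x, t)\<bar> * s" using t s by (simp add: abs_mult)
        also have "\<dots> \<le> \<bar>M0\<bar> * s" using M s by (intro mult_right_mono) auto
        finally show ?thesis .
      qed
    qed
    have inc: "\<bar>F (X + h *\<^sub>R i) - F X\<bar> \<le> \<bar>M0\<bar> * h" if X: "snd X \<noteq> 0" and h: "0 < h" for X h
    proof (cases "0 < snd X")
      case True
      have "\<bar>F (X + h *\<^sub>R i) - F (X + 0 *\<^sub>R i)\<bar> \<le> \<bar>M0\<bar> * (h - 0)"
      proof (rule mv[OF h])
        fix t :: real assume "0 \<le> t" "t \<le> h"
        with i show "X + t *\<^sub>R i \<in> upper"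
          by (cases rule: Basis_R4_cases) (use True in \<open>auto simp: mem_upper\<close>)
      qed
      then show ?thesis by simp
    next
      case False
      then have X0: "snd X < 0" using X by simp
      show ?thesis using i
      proof (cases rule: Basis_R4_cases)
        case (1 j)
        then have "snd (X + h *\<^sub>R i) < 0" using X0 by simp
        then show ?thesis using F0 X0 h by simp
      next
        case 2
        show ?thesis
        proof (cases "snd X + h < 0")
          case True
          then have "snd (X + h *\<^sub>R i) < 0" using 2 by simp
          then show ?thesis using F0 X0 h by simp
        next
          case False
          have "X + h *\<^sub>R i = (fst X, snd X + h)" unfolding 2 by (simp add: prod_eq_iff)
          then have "\<bar>F (X + h *\<^sub>R i)\<bar> \<le> \<bar>M0\<bar> * (snd X + h)" using near[OF 2, of "snd X + h" "fst X"] False by simp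
          also have "\<dots> \<le> \<bar>M0\<bar> * h" using X0 by (intro mult_left_mono) auto
          finally show ?thesis using F0[OF X0] by simp
        qed
      qed
    qed
    have lim: "(\<lambda>n. (F (X + (1 / Suc n) *\<^sub>R i) - F X) * Suc n) \<longlonglongrightarrow> D X" if X: "snd X \<noteq> 0" for X
    proof (cases "0 < snd X")
      case True
      then have "X + 0 *\<^sub>R i \<in> upper" by (simp add: mem_upper)
      from der[OF this] have "((\<lambda>h. (F (X + h *\<^sub>R i) - F X) / h) \<longlongrightarrow> D X) (at 0)"
        by (simp add: DERIV_def)
      moreover have "filterlim (\<lambda>n. 1 / real (Suc n)) (at 0) sequentially"
        unfolding filterlim_at using LIMSEQ_inverse_real_of_nat by (auto simp: divide_inverse)
      ultimately have "(\<lambda>n. (F (X + (1 / Suc n) *\<^sub>R i) - F X) / (1 / Suc n)) \<longlonglongrightarrow> D X"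
        by (rule filterlim_compose)
      then show ?thesis by simp
    next
      case False
      then have X0: "snd X < 0" using X by simp
      have D0: "D X = 0" using X0 by (simp add: D_def U_def mem_upper)
      have "(\<lambda>n. 1 / real (Suc n)) \<longlonglongrightarrow> 0" using LIMSEQ_inverse_real_of_nat by (simp add: divide_inverse)
      then have "\<forall>\<^sub>F n in sequentially. 1 / real (Suc n) < - snd X" using X0 by (intro order_tendstoD) auto
      then have "\<forall>\<^sub>F n in sequentially. (F (X + (1 / Suc n) *\<^sub>R i) - F X) * Suc n = 0"
      proof eventually_elim
        case (elim n)
        have "snd (X + (1 / Suc n) *\<^sub>R i) < 0"
          using i by (cases rule: Basis_R4_cases) (use elim X0 in auto)
        then show ?case using F0 X0 by simp
      qed
      then show ?thesis unfolding D0 by (rule tendsto_eventually)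
    qed
    \<comment> \<open>The bounds above hold off the hyperplane of height 0, which is a null
      set.\<close>
    have "(0::R3, 1::real) \<in> Basis" by (simp add: Basis_prod_def)
    from AE_lborel_inner_neq[OF this, of 0] have AE: "AE X in lborel. snd (X::R4) \<noteq> 0" by (simp add: inner_prod_def)
    have "(LINT X|lborel. D X) = 0"
    proof (rule integral_directional_derivative_zero(2)[OF Fm Dm, of i "\<bar>B\<bar>" R "\<bar>M0\<bar>"])
      show "norm i \<le> 1" using i by simp
      show "\<bar>F X\<bar> \<le> \<bar>B\<bar>" for X using B by (auto simp: F_def indicator_def)
      show "F X = 0" if "R < norm X" for X using R[of X] that by (auto simp: F_def indicator_def)
      show "AE X in lborel. \<forall>h. 0 < h \<longrightarrow> h \<le> 1 \<longrightarrow> \<bar>F (X + h *\<^sub>R i) - F X\<bar> \<le> \<bar>M0\<bar> * h"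
        using AE by eventually_elim (use inc in auto)
      show "AE X in lborel. (\<lambda>n. (F (X + (1 / Suc n) *\<^sub>R i) - F X) * Suc n) \<longlonglongrightarrow> D X"
        using AE by eventually_elim (rule lim)
    qed
    moreover have "D = (\<lambda>X. indicator upper X * (w X * p2 i X) - indicator upper X * (\<psi> X * w2 i X))"
      unfolding eq1[OF i] eq2 D_def d_def by (auto simp: algebra_simps)
    ultimately show ?thesis using Bochner_Integration.integral_diff[OF i1[OF i] i2[OF i]] by simp
  qed
  have "(LINT X|lborel. indicator upper X * (w X * (\<Sum>i\<in>Basis. p2 i X))) =
         (LINT X|lborel. indicator upper X * (\<psi> X * (\<Sum>i\<in>Basis. w2 i X)))"
  proof -
    have "(LINT X|lborel. (\<Sum>i\<in>Basis. indicator upper X * (w X * p2 i X))) = (\<Sum>i\<in>Basis. LINT X|lborel. indicator upper X * (w X * p2 i X))"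
      by (rule Bochner_Integration.integral_sum[OF i1])
    also have "\<dots> = (\<Sum>i\<in>Basis. LINT X|lborel. indicator upper X * (\<psi> X * w2 i X))"
      by (rule sum.cong[OF refl main])
    also have "\<dots> = (LINT X|lborel. (\<Sum>i\<in>Basis. indicator upper X * (\<psi> X * w2 i X)))"
      by (rule Bochner_Integration.integral_sum[OF i2, symmetric])
    finally show ?thesis unfolding s1 s2 .
  qed
  with I show ?thesis by (rule conjI)
qed

section \<open>The weak boundary equation for smooth functions\<close>

lemma partial_zero:
  assumes "thick S" "X \<in> S" "vs \<in> dirs m"
  shows "partial S vs (\<lambda>_. 0) X = 0"
  by (rule Ck_onI(2)[OF assms(1), of "\<lambda>_ _. 0" "\<lambda>_. 0" m m, OF _ _ _ order_refl assms(3,2)]) auto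

lemma Ck_on_line_derivative:
  assumes f: "f \<in> Ck_on k S" "m < k" "vs \<in> dirs m" and X: "X \<in> upper" "upper \<subseteq> S" and i: "i \<in> Basis"
  shows "((\<lambda>t. partial S vs f (X + t *\<^sub>R i)) has_real_derivative partial S (i # vs) f X) (at 0)"
proof -
  have XS: "X + 0 *\<^sub>R i \<in> S" using X by auto
  have "((\<lambda>t. partial S vs f (X + t *\<^sub>R i)) has_real_derivative (\<Sum>k\<in>Basis. (i \<bullet> k) * partial S (k # vs) f (X + 0 *\<^sub>R i)))
      (at 0 within {s. X + s *\<^sub>R i \<in> S})"
    by (rule has_derivative_line[OF Ck_onD[OF f XS]])
  then have *: "((\<lambda>t. partial S vs f (X + t *\<^sub>R i)) has_real_derivative partial S (i # vs) f X)
      (at 0 within {s. X + s *\<^sub>R i \<in> S})"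
    unfolding sum_Basis_pick[OF i, of "\<lambda>k. partial S (k # vs) f (X + 0 *\<^sub>R i)"] by (simp only: scaleR_zero_left add_0_right)
  have "continuous_on UNIV (\<lambda>s. X + s *\<^sub>R i)" by (intro continuous_intros)
  from open_vimage[OF open_upper this] have op: "open {s. X + s *\<^sub>R i \<in> upper}" by (simp add: vimage_def)
  have "((\<lambda>t. partial S vs f (X + t *\<^sub>R i)) has_real_derivative partial S (i # vs) f X)
      (at 0 within {s. X + s *\<^sub>R i \<in> upper})"
    by (rule DERIV_subset[OF *]) (use X in auto)
  moreover have "at 0 within {s. X + s *\<^sub>R i \<in> upper} = at 0"
    by (rule at_within_open[OF _ op]) (use X in simp)
  ultimately show ?thesis by (simp only:)
qed

lemma thick_upper_closed: "thick upper_closed"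
  using thick_halfspace[OF open_UNIV] by simp

text \<open>Off the closed support the derivatives vanish by locality. The normal derivative in the
  sense of \<open>partial\<close> agrees with the one in \<open>dy_zero_on\<close> by uniqueness of
  one-sided limits.\<close>

lemma test_function_facts:
  assumes \<psi>: "\<psi> \<in> test_functions S"
  defines "K \<equiv> closure {X \<in> upper_closed. \<psi> X \<noteq> 0}"
  shows "compact K" "K \<subseteq> upper_closed" "\<And>x. (x, 0) \<in> K \<Longrightarrow> x \<in> S" "\<And>k. \<psi> \<in> Ck_on k upper_closed"
    and "\<And>m vs X. vs \<in> dirs m \<Longrightarrow> X \<in> upper_closed - K \<Longrightarrow> partial upper_closed vs \<psi> X = 0"
    and "\<And>x. partial upper_closed [(0, 1)] \<psi> (x, 0) = 0"
    and "\<And>X. X \<in> upper \<Longrightarrow> laplacian \<psi> X = (\<Sum>i\<in>Basis. partial upper_closed [i, i] \<psi> X)"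
proof -
  show "compact K" using \<psi> by (simp add: test_functions_def K_def)
  show "K \<subseteq> upper_closed" unfolding K_def by (rule closure_minimal[OF _ closed_upper_closed]) auto
  show "(x, 0) \<in> K \<Longrightarrow> x \<in> S" for x using \<psi> by (auto simp: test_functions_def K_def)
  show C: "\<psi> \<in> Ck_on k upper_closed" for k using \<psi> by (simp add: test_functions_def Cinf_onD)
  show "partial upper_closed vs \<psi> X = 0" if vs: "vs \<in> dirs m" and X: "X \<in> upper_closed - K" for vs m X
  proof -
    have op: "open (- K)" unfolding K_def by (simp add: open_Compl)
    have "partial upper_closed vs \<psi> X = partial upper_closed vs (\<lambda>_. 0) X"
    proof (rule partial_cong[OF op refl])
      fix Y assume "Y \<in> upper_closed \<inter> - K"
      then show "\<psi> Y = 0" unfolding K_def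
        using closure_subset[of "{X \<in> upper_closed. \<psi> X \<noteq> 0}"] by blast
    qed (use X in auto)
    also have "\<dots> = 0" by (rule partial_zero[OF thick_upper_closed _ vs]) (use X in simp)
    finally show ?thesis .
  qed
  show "laplacian \<psi> X = (\<Sum>i\<in>Basis. partial upper_closed [i, i] \<psi> X)" if X: "X \<in> upper" for X
    unfolding laplacian_def
    by (rule sum.cong[OF refl], rule partial_cong[OF open_upper]) (use X upper_subset_closed in auto)
  fix x
  have e: "(0::R3, 1::real) \<in> Basis" by (simp add: Basis_prod_def)
  have X: "(x, 0) + 0 *\<^sub>R (0, 1) \<in> upper_closed" by (simp add: upper_closed_def)
  have "((\<lambda>t. partial upper_closed [] \<psi> ((x, 0) + t *\<^sub>R (0, 1))) has_real_derivative
      (\<Sum>k\<in>Basis. ((0, 1) \<bullet> k) * partial upper_closed [k] \<psi> ((x, 0) + 0 *\<^sub>R (0, 1))))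
      (at 0 within {s. (x, 0) + s *\<^sub>R (0, 1) \<in> upper_closed})"
    by (rule has_derivative_line[OF Ck_onD[OF C[of 1] _ _ X, of 0]]) auto
  also have "{s. (x, 0::real) + s *\<^sub>R (0, 1) \<in> upper_closed} = {0..}" by (auto simp: upper_closed_def)
  finally have 1: "((\<lambda>t. \<psi> (x, t)) has_real_derivative partial upper_closed [(0, 1)] \<psi> (x, 0)) (at 0 within {0..})"
    unfolding sum_Basis_pick[OF e, of "\<lambda>k. partial upper_closed [k] \<psi> ((x, 0) + 0 *\<^sub>R (0, 1))"]
    by (simp del: partial.simps(2))
  have 2: "((\<lambda>t. \<psi> (x, t)) has_real_derivative 0) (at 0 within {0..})"
    using \<psi> by (simp add: test_functions_def dy_zero_on_def)
  have "at (0::real) within {0..} \<noteq> bot"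
    by (metis at_within_Ici_at_right trivial_limit_at_right_real trivial_limit_def)
  then show "partial upper_closed [(0, 1)] \<psi> (x, 0) = 0"
    using tendsto_unique[OF _ 1[unfolded has_field_derivative_iff] 2[unfolded has_field_derivative_iff]] by blast
qed

text \<open>The weak formulation integrates with respect to \<open>lebesgue\<close>, the estimates
  with respect to \<open>lborel\<close>; for Borel integrands the two agree. Only the values of
  \<open>g\<close> on \<open>A\<close> enter, which matters because \<open>laplacian\<close> is
  uncontrolled outside \<open>upper\<close>.\<close>

lemma set_lebesgue_of_lborel:
  fixes g h :: "R4 \<Rightarrow> real"
  assumes h: "integrable lborel (\<lambda>X. indicator A X * h X)" and eq: "\<And>X. X \<in> A \<Longrightarrow> g X = h X"
  shows "set_integrable lebesgue A g" "(LINT X:A|lebesgue. g X) = (LINT X|lborel. indicator A X * h X)"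
proof -
  have e: "(\<lambda>X. indicator A X *\<^sub>R g X) = (\<lambda>X. indicator A X * h X)" using eq by (auto simp: indicator_def)
  have m: "(\<lambda>X. indicator A X * h X) \<in> borel_measurable lborel" using h by (rule borel_measurable_integrable)
  show "set_integrable lebesgue A g"
    unfolding set_integrable_def e using integrable_completion[OF m] h by simp
  show "(LINT X:A|lebesgue. g X) = (LINT X|lborel. indicator A X * h X)"
    unfolding set_lebesgue_integral_def e by (rule integral_completion[OF m])
qed

lemma upper_Un_boundary: "upper \<union> S \<times> {0} = (S \<times> UNIV \<union> upper) \<inter> upper_closed"
  by (auto simp: upper_def upper_closed_def)

text \<open>\<open>laplacian\<close> differentiates within \<open>UNIV\<close>, while regularity up
  to the boundary is known within \<open>T\<close>; in the open half-space both agree. The letters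
  \<open>j, j\<close> come last in the word because the Laplacian is applied first.\<close>

lemma partial_laplacian:
  assumes C: "\<Phi> \<in> Ck_on (k + 2) T" and T: "thick T" "upper \<subseteq> T"
  shows "m \<le> k \<Longrightarrow> vs \<in> dirs m \<Longrightarrow> X \<in> upper \<Longrightarrow> partial UNIV vs (laplacian \<Phi>) X = (\<Sum>j\<in>Basis. partial T (vs @ [j, j]) \<Phi> X)"
proof -
  assume m: "m \<le> k" and vs: "vs \<in> dirs m" and X: "X \<in> upper"
  have jj: "us @ [j, j] \<in> dirs (n + 2)" if "us \<in> dirs n" "j \<in> Basis" for us n and j :: R4
    using that by (auto simp: dirs_def)
  have eq: "laplacian \<Phi> Y = (\<Sum>j\<in>Basis. partial T [j, j] \<Phi> Y)" if "Y \<in> upper" for Y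
    unfolding laplacian_def
    by (rule sum.cong[OF refl], rule partial_cong[OF open_upper]) (use that T in auto)
  have "partial UNIV vs (laplacian \<Phi>) X = partial upper vs (laplacian \<Phi>) X"
    by (rule partial_UNIV_open[OF open_upper X])
  also have "\<dots> = (\<Sum>j\<in>Basis. partial T (vs @ [j, j]) \<Phi> X)"
  proof (rule Ck_onI(2)[OF thick_open[OF open_upper], of "\<lambda>vs X. \<Sum>j\<in>Basis. partial T (vs @ [j, j]) \<Phi> X" "laplacian \<Phi>" k m vs X, OF _ _ _ m vs X])
    show "(\<Sum>j\<in>Basis. partial T ([] @ [j, j]) \<Phi> Y) = laplacian \<Phi> Y" if "Y \<in> upper" for Y
      using eq[OF that] by simp
    fix us :: "R4 list" and n Y assume n: "n < k" and us: "us \<in> dirs n" and Y: "Y \<in> upper"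
    have "((\<lambda>X. \<Sum>j\<in>Basis. partial T (us @ [j, j]) \<Phi> X) has_derivative
        (\<lambda>h. \<Sum>j\<in>Basis. \<Sum>i\<in>Basis. (h \<bullet> i) * partial T (i # (us @ [j, j])) \<Phi> Y)) (at Y within upper)"
    proof (rule has_derivative_sum)
      fix j :: R4 assume j: "j \<in> Basis"
      have "Y \<in> T" using Y T by auto
      moreover have "n + 2 < k + 2" using n by simp
      ultimately show "(partial T (us @ [j, j]) \<Phi> has_derivative (\<lambda>h. \<Sum>i\<in>Basis. (h \<bullet> i) * partial T (i # (us @ [j, j])) \<Phi> Y)) (at Y within upper)"
        by (intro has_derivative_subset[OF Ck_onD[OF C _ jj[OF us j]] T(2)])
    qed
    moreover have "(\<lambda>h. \<Sum>j\<in>Basis. \<Sum>i\<in>Basis. (h \<bullet> i) * partial T (i # (us @ [j, j])) \<Phi> Y)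
       = (\<lambda>h. \<Sum>i\<in>Basis. (h \<bullet> i) * (\<Sum>j\<in>Basis. partial T ((i # us) @ [j, j]) \<Phi> Y))"
      unfolding sum_distrib_left append_Cons by (rule ext, rule sum.swap)
    ultimately show "((\<lambda>X. \<Sum>j\<in>Basis. partial T (us @ [j, j]) \<Phi> X) has_derivative
        (\<lambda>h. \<Sum>i\<in>Basis. (h \<bullet> i) * (\<Sum>j\<in>Basis. partial T ((i # us) @ [j, j]) \<Phi> Y))) (at Y within upper)"
      by (simp only:)
  next
    fix us :: "R4 list" assume us: "us \<in> dirs k"
    show "continuous_on upper (\<lambda>X. \<Sum>j\<in>Basis. partial T (us @ [j, j]) \<Phi> X)"
      by (intro continuous_on_sum continuous_on_subset[OF Ck_on_continuous[OF C order_refl jj[OF us]] T(2)])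
  qed
  finally show ?thesis .
qed

lemma continuous_on_vertical_line:
  assumes c: "continuous_on (upper \<union> S \<times> {0}) g" and x: "x \<in> S"
  shows "continuous_on {0..} (\<lambda>y. g (x, y))"
proof (rule continuous_on_compose2[OF c])
  show "(\<lambda>y. (x, y)) ` {0..} \<subseteq> upper \<union> S \<times> {0}"
  proof
    fix Y :: R4 assume "Y \<in> (\<lambda>y. (x, y)) ` {0..}"
    then obtain y where "Y = (x, y)" "0 \<le> y" by auto
    then show "Y \<in> upper \<union> S \<times> {0}" using x by (cases "y = 0") (auto simp: upper_def)
  qed
qed (auto intro!: continuous_intros)

lemma thick_upper_Un_boundary:
  assumes "open S"
  shows "thick (upper \<union> S \<times> {0})"
proof -
  have "open (S \<times> (UNIV::real set) \<union> upper)" by (intro open_Un open_Times assms open_UNIV open_upper)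
  then show ?thesis unfolding upper_Un_boundary by (rule thick_halfspace)
qed

text \<open>\<open>L32_at\<close> is a limit from inside. Since the third derivatives are continuous
  up to \<open>S\<close>, this limit is half the boundary value of the normal derivative of the
  Laplacian.\<close>

lemma normal_derivative_laplacian_zero:
  assumes S: "open S" and C: "\<Phi> \<in> Ck_on (2 + 2) (upper \<union> S \<times> {0})" and x: "x \<in> S" and L: "L32_at \<Phi> x 0"
  shows "(\<Sum>j\<in>Basis. partial (upper \<union> S \<times> {0}) ([(0, 1)] @ [j, j]) \<Phi> (x, 0)) = 0"
proof -
  define T where "T = upper \<union> S \<times> {0::real}"
  note C = C[folded T_def]
  have th: "thick T" unfolding T_def by (rule thick_upper_Un_boundary[OF S])
  have T: "upper \<subseteq> T" by (auto simp: T_def)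
  have e: "(0::R3, 1::real) \<in> Basis" by (simp add: Basis_prod_def)
  define w1 where "w1 = (\<lambda>X. \<Sum>j\<in>Basis. partial T ([(0, 1)] @ [j, j]) \<Phi> X)"
  have d3: "j \<in> Basis \<Longrightarrow> [(0, 1)] @ [j, j] \<in> dirs 3" for j :: R4 using e by (auto simp: dirs_def)
  have cw1: "continuous_on T w1"
    unfolding w1_def by (intro continuous_on_sum Ck_on_continuous[OF C _ d3]) auto
  have "((\<lambda>y. 1 / 2 * partial UNIV [(0, 1)] (laplacian \<Phi>) (x, y)) \<longlongrightarrow> 0) (at_right 0)"
    using L by (simp add: L32_at_def)
  moreover have "\<forall>\<^sub>F y in at_right 0. 1 / 2 * partial UNIV [(0, 1)] (laplacian \<Phi>) (x, y) = 1 / 2 * w1 (x, y)"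
    unfolding eventually_at_right_field w1_def
    by (intro exI[of _ 1] conjI allI impI arg_cong[of _ _ "\<lambda>s. 1 / 2 * s"] partial_laplacian[OF C th T(1), of 1])
      (use e in \<open>auto simp: dirs_def upper_def\<close>)
  ultimately have 1: "((\<lambda>y. 1 / 2 * w1 (x, y)) \<longlongrightarrow> 0) (at_right 0)"
    by (rule Lim_transform_eventually)
  have "continuous_on {0..} (\<lambda>y. w1 (x, y))"
    by (rule continuous_on_vertical_line[OF cw1[unfolded T_def] x])
  then have "((\<lambda>y. w1 (x, y)) \<longlongrightarrow> w1 (x, 0)) (at 0 within {0..})"
    by (auto simp: continuous_on_def)
  then have "((\<lambda>y. 1 / 2 * w1 (x, y)) \<longlongrightarrow> 1 / 2 * w1 (x, 0)) (at_right 0)"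
    by (intro tendsto_mult tendsto_const) (simp add: at_within_Ici_at_right)
  from tendsto_unique[OF _ this 1] have "w1 (x, 0) = 0" by simp
  then show ?thesis unfolding w1_def T_def .
qed

text \<open>Green's identity with \<open>w\<close> the Laplacian of \<Phi>: its normal derivative
  vanishes on \<open>S\<close> and its Laplacian vanishes inside, so the right-hand side is zero.
  The support of \<open>\<psi>\<close> meets the boundary only within \<open>S\<close>, where \<Phi>
  is regular.\<close>

lemma weak_equation_smooth:
  assumes S: "open S" and C: "\<Phi> \<in> Ck_on 4 (upper \<union> S \<times> {0})" and bi: "biharmonic \<Phi>"
    and L: "\<And>x. x \<in> S \<Longrightarrow> L32_at \<Phi> x 0" and \<psi>: "\<psi> \<in> test_functions S"
  shows "set_integrable lebesgue upper (\<lambda>X. laplacian \<Phi> X * laplacian \<psi> X)"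
    and "(LINT X:upper|lebesgue. laplacian \<Phi> X * laplacian \<psi> X) = 0"
proof -
  define T where "T = upper \<union> S \<times> {0::real}"
  have C: "\<Phi> \<in> Ck_on (2 + 2) T" using C by (simp add: T_def)
  have th: "thick T" unfolding T_def by (rule thick_upper_Un_boundary[OF S])
  have T: "upper \<subseteq> T" "T \<subseteq> upper_closed" using upper_subset_closed by (auto simp: T_def upper_closed_def)
  define K where "K = closure {X \<in> upper_closed. \<psi> X \<noteq> 0}"
  note tf = test_function_facts[OF \<psi>, folded K_def]
  have KT: "K \<subseteq> T"
  proof
    fix X assume X: "X \<in> K"
    then have "0 \<le> snd X" using tf(2) by (auto simp: mem_upper_closed)
    then consider "0 < snd X" | "snd X = 0" by linarith
    then show "X \<in> T"
    proof cases
      case 2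
      then have "X = (fst X, 0)" by (simp add: prod_eq_iff)
      then have "fst X \<in> S" using tf(3) X by metis
      then show ?thesis using \<open>X = (fst X, 0)\<close> unfolding T_def by (metis SigmaI UnI2 singletonI)
    qed (simp add: T_def mem_upper)
  qed
  have d3: "vs \<in> dirs m \<Longrightarrow> j \<in> Basis \<Longrightarrow> vs @ [j, j] \<in> dirs (m + 2)" for vs m and j :: R4 by (auto simp: dirs_def)
  define w where "w = (\<lambda>X. \<Sum>j\<in>Basis. partial T ([] @ [j, j]) \<Phi> X)"
  define w1 where "w1 = (\<lambda>i X. \<Sum>j\<in>Basis. partial T ([i] @ [j, j]) \<Phi> X)"
  define w2 where "w2 = (\<lambda>i X. \<Sum>j\<in>Basis. partial T ([i, i] @ [j, j]) \<Phi> X)"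
  have dir: "[] \<in> dirs 0" "i \<in> Basis \<Longrightarrow> [i] \<in> dirs 1" "i \<in> Basis \<Longrightarrow> [i, i] \<in> dirs 2" for i :: R4 by (auto simp: dirs_def)
  have cont: "continuous_on T (\<lambda>X. \<Sum>j\<in>Basis. partial T (vs @ [j, j]) \<Phi> X)" if "vs \<in> dirs m" "m \<le> 2" for vs m
    by (intro continuous_on_sum Ck_on_continuous[OF C _ d3[OF that(1)]]) (use that in auto)
  have der: "((\<lambda>t. \<Sum>j\<in>Basis. partial T (vs @ [j, j]) \<Phi> (X + t *\<^sub>R i)) has_real_derivative
      (\<Sum>j\<in>Basis. partial T ((i # vs) @ [j, j]) \<Phi> X)) (at 0)"
    if "vs \<in> dirs m" "m < 2" "X \<in> upper" "i \<in> Basis" for vs m X i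
    unfolding append_Cons
    by (intro DERIV_sum Ck_on_line_derivative[OF C _ d3[OF that(1)] that(3) T(1) that(4)]) (use that in auto)
  have lapPhi: "laplacian \<Phi> X = w X" if "X \<in> upper" for X
    using partial_laplacian[OF C th T(1), of 0 "[]"] that by (simp add: w_def)
  have lap2: "(\<Sum>i\<in>Basis. w2 i X) = 0" if X: "X \<in> upper" for X
  proof -
    have "laplacian (laplacian \<Phi>) X = (\<Sum>i\<in>Basis. w2 i X)"
      unfolding laplacian_def[of "laplacian \<Phi>"] w2_def
      by (rule sum.cong[OF refl], rule partial_laplacian[OF C th T(1), of 2]) (use X in \<open>auto simp: dirs_def\<close>)
    then show ?thesis using bi X by (simp add: biharmonic_def)
  qed
  have cw1: "continuous_on T (w1 i)" if "i \<in> Basis" for i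
    unfolding w1_def by (rule cont[OF dir(2)[OF that]]) simp
  have bw: "w1 (0, 1) (x, 0) = 0" if xT: "(x, 0) \<in> T" for x
  proof -
    have x: "x \<in> S" using xT by (auto simp: T_def upper_def)
    show ?thesis
      unfolding w1_def T_def by (rule normal_derivative_laplacian_zero[OF S C[unfolded T_def] x L[OF x]])
  qed
  note G = Green_half_space[OF T tf(1) KT, of w w1 w2 \<psi> "\<lambda>i. partial upper_closed [i] \<psi>" "\<lambda>i. partial upper_closed [i, i] \<psi>"]
  have g: "integrable lborel (\<lambda>X. indicator upper X * (w X * (\<Sum>i\<in>Basis. partial upper_closed [i, i] \<psi> X)))
    \<and> (LINT X|lborel. indicator upper X * (w X * (\<Sum>i\<in>Basis. partial upper_closed [i, i] \<psi> X)))
     = (LINT X|lborel. indicator upper X * (\<psi> X * (\<Sum>i\<in>Basis. w2 i X)))"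
  proof (rule G)
    show "continuous_on T w" unfolding w_def by (rule cont[OF dir(1)]) simp
    show "continuous_on T (w1 i)" if "i \<in> Basis" for i by (rule cw1[OF that])
    show "continuous_on T (w2 i)" if "i \<in> Basis" for i unfolding w2_def by (rule cont[OF dir(3)[OF that]]) simp
    show "continuous_on upper_closed \<psi>" using Ck_on_continuous[OF tf(4) order_refl dir(1)] by simp
    show "continuous_on upper_closed (partial upper_closed [i] \<psi>)" if "i \<in> Basis" for i
      by (rule Ck_on_continuous[OF tf(4) order_refl dir(2)[OF that]])
    show "continuous_on upper_closed (partial upper_closed [i, i] \<psi>)" if "i \<in> Basis" for i
      by (rule Ck_on_continuous[OF tf(4) order_refl dir(3)[OF that]])
    show "((\<lambda>t. w (X + t *\<^sub>R i)) has_real_derivative w1 i X) (at 0)" if "X \<in> upper" "i \<in> Basis" for X i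
      unfolding w_def w1_def by (rule der[OF dir(1) _ that]) simp
    show "((\<lambda>t. w1 i (X + t *\<^sub>R i)) has_real_derivative w2 i X) (at 0)" if "X \<in> upper" "i \<in> Basis" for X i
      unfolding w1_def w2_def by (rule der[OF dir(2)[OF that(2)] _ that]) simp
    show "((\<lambda>t. \<psi> (X + t *\<^sub>R i)) has_real_derivative partial upper_closed [i] \<psi> X) (at 0)" if "X \<in> upper" "i \<in> Basis" for X i
      using Ck_on_line_derivative[OF tf(4)[of 1] _ dir(1) that(1) upper_subset_closed that(2)] by (simp del: partial.simps(2))
    show "((\<lambda>t. partial upper_closed [i] \<psi> (X + t *\<^sub>R i)) has_real_derivative partial upper_closed [i, i] \<psi> X) (at 0)" if "X \<in> upper" "i \<in> Basis" for X i
      by (rule Ck_on_line_derivative[OF tf(4)[of 2] _ dir(2)[OF that(2)] that(1) upper_subset_closed that(2)]) simp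
    show "\<psi> X = 0" if "X \<in> upper_closed - K" for X using tf(5)[OF dir(1) that] by simp
    show "partial upper_closed [i] \<psi> X = 0" if "X \<in> upper_closed - K" "i \<in> Basis" for X i
      by (rule tf(5)[OF dir(2)[OF that(2)] that(1)])
    show "partial upper_closed [i, i] \<psi> X = 0" if "X \<in> upper_closed - K" "i \<in> Basis" for X i
      by (rule tf(5)[OF dir(3)[OF that(2)] that(1)])
    show "w1 (0, 1) (x, 0) = 0" if "(x, 0) \<in> T" for x by (rule bw[OF that])
    show "partial upper_closed [(0, 1)] \<psi> (x, 0) = 0" for x by (rule tf(6))
  qed
  have eq: "laplacian \<Phi> X * laplacian \<psi> X = w X * (\<Sum>i\<in>Basis. partial upper_closed [i, i] \<psi> X)" if "X \<in> upper" for X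
    using lapPhi[OF that] tf(7)[OF that] by (simp only:)
  have "indicator upper X * (\<psi> X * (\<Sum>i\<in>Basis. w2 i X)) = 0" for X
    using lap2[of X] by (cases "X \<in> upper") simp_all
  then have "(LINT X|lborel. indicator upper X * (\<psi> X * (\<Sum>i\<in>Basis. w2 i X))) = 0"
    by (simp only: Bochner_Integration.integral_zero)
  with g set_lebesgue_of_lborel[OF conjunct1[OF g] eq]
  show "set_integrable lebesgue upper (\<lambda>X. laplacian \<Phi> X * laplacian \<psi> X)"
    and "(LINT X:upper|lebesgue. laplacian \<Phi> X * laplacian \<psi> X) = 0" by (simp_all only:)
qed

section \<open>The weak boundary equation for logarithmic potentials\<close>

lemma integral_lborel_scale:
  fixes g :: "'a::euclidean_space \<Rightarrow> real"
  assumes [measurable]: "g \<in> borel_measurable borel" and c: "0 < c"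
  shows "(LINT X|lborel. g X) = c ^ DIM('a) * (LINT Y|lborel. g (P + c *\<^sub>R Y))"
proof -
  have "(LINT X|lborel. g X) = (LINT X|density (distr lborel borel (\<lambda>x. P + c *\<^sub>R x)) (\<lambda>_. \<bar>c\<bar> ^ DIM('a)). g X)"
    using lborel_affine[of c P] c by simp
  also have "\<dots> = (LINT X|distr lborel borel (\<lambda>x. P + c *\<^sub>R x). \<bar>c\<bar> ^ DIM('a) *\<^sub>R g X)"
    by (rule integral_density) auto
  also have "\<dots> = (LINT Y|lborel. \<bar>c\<bar> ^ DIM('a) *\<^sub>R g (P + c *\<^sub>R Y))"
    by (rule integral_distr) auto
  finally show ?thesis using c by simp
qed

lemma integrable_riesz_local:
  fixes s :: real and A :: "'a::euclidean_space set"
  assumes "0 \<le> s" "s < DIM('a)" "A \<in> sets borel" "bounded A"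
  shows "integrable lborel (\<lambda>x. indicator A x * norm (x - a) powr - s)"
proof -
  obtain J :: real where "\<And>a. integrable lborel (\<lambda>x. indicator A x * norm (x - a) powr - s)"
    using integrable_riesz_bounded[OF assms] by blast
  then show ?thesis .
qed

text \<open>The integral can be evaluated and gives \<open>2 * pi\<^sup>2\<close>; only its sign matters below.\<close>

definition flux_const :: real where
  "flux_const = 8 * (LINT X|lborel. indicator upper X * (1 / (1 + (norm (X::R4))\<^sup>2) ^ 3))"

lemma upper_borel [measurable]: "upper \<in> sets borel"
  using open_upper by simp

lemma integrable_half_bubble: "integrable lborel (\<lambda>X. indicator upper X * (1 / (1 + (norm (X::R4))\<^sup>2) ^ 3))"
  using integrable_real_mult_indicator[OF _ integrable_bubble, of upper] upper_borel by (simp add: mult.commute)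

lemma one_plus_norm_pos: "0 < 1 + (norm (X::'a::real_normed_vector))\<^sup>2"
  by (simp add: add_pos_nonneg)

text \<open>A nonnegative integrable function with zero integral vanishes almost everywhere, but
  this one is positive on the nonempty open set \<open>upper\<close>.\<close>

lemma flux_const_pos: "0 < flux_const"
proof -
  let ?g = "\<lambda>X::R4. indicator upper X * (1 / (1 + (norm X)\<^sup>2) ^ 3)"
  have nn: "AE X in lborel. 0 \<le> ?g X" using one_plus_norm_pos by (auto intro!: AE_I2 simp: less_imp_le)
  have "(LINT X|lborel. ?g X) \<noteq> 0"
  proof
    assume "(LINT X|lborel. ?g X) = 0"
    then have "AE X in lborel. ?g X = 0" using integral_nonneg_eq_0_iff_AE[OF integrable_half_bubble nn] by simp
    then have "AE X in lborel. X \<notin> upper"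
    proof eventually_elim
      case (elim X)
      then show ?case using one_plus_norm_pos[of X] by (auto simp: indicator_def)
    qed
    then have "upper \<in> null_sets lborel" using AE_iff_null_sets[of upper lborel] by simp
    then have "negligible upper" by (simp add: negligible_iff_null_sets null_sets_completionI)
    moreover have "upper \<noteq> {}" by (auto simp: upper_def intro!: exI[of _ 1])
    ultimately show False using open_not_negligible[OF open_upper] by blast
  qed
  moreover have "0 \<le> (LINT X|lborel. ?g X)" by (rule integral_nonneg_AE[OF nn])
  ultimately have "0 < (LINT X|lborel. ?g X)" by linarith
  then show ?thesis unfolding flux_const_def by linarith
qed

text \<open>The kernel \<open>1 / \<bar>X - P\<bar>\<^sup>2\<close> is regularised to \<open>1 / (\<bar>X - P\<bar>\<^sup>2 + \<epsilon>\<^sup>2)\<close>, whose Laplacian is an approximate identity.\<close>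

lemma regularised_kernel_derivatives:
  fixes X P i :: R4 and \<epsilon> :: real
  assumes i: "i \<in> Basis" and \<epsilon>: "0 < \<epsilon>"
  defines "s \<equiv> \<lambda>X. (norm (X - P))\<^sup>2 + \<epsilon>\<^sup>2"
  shows "((\<lambda>t. 1 / s (X + t *\<^sub>R i)) has_real_derivative - 2 * ((X - P) \<bullet> i) / (s X)\<^sup>2) (at 0)"
    and "((\<lambda>t. - 2 * ((X + t *\<^sub>R i - P) \<bullet> i) / (s (X + t *\<^sub>R i))\<^sup>2) has_real_derivative
        - 2 / (s X)\<^sup>2 + 8 * ((X - P) \<bullet> i)\<^sup>2 / (s X) ^ 3) (at 0)"
proof -
  define c where "c = (X - P) \<bullet> i"
  define n where "n = s X"
  have n: "0 < n" using \<epsilon> by (simp add: n_def s_def add_nonneg_pos)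
  have ii: "i \<bullet> i = 1" using i by (simp add: inner_same_Basis)
  have s: "s (X + t *\<^sub>R i) = n + 2 * t * c + t\<^sup>2" for t
    unfolding s_def n_def c_def power2_norm_eq_inner
    by (simp add: inner_diff_left inner_diff_right inner_add_left inner_add_right inner_commute ii algebra_simps power2_eq_square)
  have c: "(X + t *\<^sub>R i - P) \<bullet> i = c + t" for t
    by (simp add: c_def inner_diff_left inner_add_left ii)
  show "((\<lambda>t. 1 / s (X + t *\<^sub>R i)) has_real_derivative - 2 * ((X - P) \<bullet> i) / (s X)\<^sup>2) (at 0)"
    unfolding s c_def[symmetric] n_def[symmetric] using n
    by (auto intro!: derivative_eq_intros simp: power2_eq_square)
  show "((\<lambda>t. - 2 * ((X + t *\<^sub>R i - P) \<bullet> i) / (s (X + t *\<^sub>R i))\<^sup>2) has_real_derivative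
        - 2 / (s X)\<^sup>2 + 8 * ((X - P) \<bullet> i)\<^sup>2 / (s X) ^ 3) (at 0)"
    unfolding s c c_def[symmetric] n_def[symmetric] using n
    by (auto intro!: derivative_eq_intros simp: power2_eq_square power3_eq_cube field_simps)
qed

lemma regularised_kernel_laplacian:
  fixes X P :: R4 and s :: real
  assumes "s = (norm (X - P))\<^sup>2 + \<epsilon>\<^sup>2" "0 < s"
  shows "(\<Sum>i\<in>Basis. - 2 / s\<^sup>2 + 8 * ((X - P) \<bullet> i)\<^sup>2 / s ^ 3) = - 8 * \<epsilon>\<^sup>2 / s ^ 3"
proof -
  have a: "(\<Sum>i\<in>Basis. ((X - P) \<bullet> i)\<^sup>2) = (norm (X - P))\<^sup>2"
    unfolding power2_norm_eq_inner unfolding power2_eq_square by (rule euclidean_inner[symmetric])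
  have "(\<Sum>i\<in>Basis. - 2 / s\<^sup>2 + 8 * ((X - P) \<bullet> i)\<^sup>2 / s ^ 3) = 4 * (- 2 / s\<^sup>2) + 8 * (s - \<epsilon>\<^sup>2) / s ^ 3"
  proof -
    have "(\<Sum>i\<in>Basis. - 2 / s\<^sup>2 + 8 * ((X - P) \<bullet> i)\<^sup>2 / s ^ 3)
       = (\<Sum>i\<in>(Basis::R4 set). - 2 / s\<^sup>2) + (8 / s ^ 3) * (\<Sum>i\<in>Basis. ((X - P) \<bullet> i)\<^sup>2)"
      unfolding sum_distrib_left sum.distrib[symmetric] by (rule sum.cong) simp_all
    also have "(\<Sum>i\<in>(Basis::R4 set). - 2 / s\<^sup>2) = 4 * (- 2 / s\<^sup>2)" by simp
    also have "(\<Sum>i\<in>Basis. ((X - P) \<bullet> i)\<^sup>2) = s - \<epsilon>\<^sup>2" unfolding a using assms(1) by simp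
    finally show ?thesis by simp
  qed
  also have "\<dots> = - 8 * \<epsilon>\<^sup>2 / s ^ 3" using assms(2) by (simp add: power2_eq_square power3_eq_cube field_simps)
  finally show ?thesis .
qed

text \<open>Derivatives are taken within \<open>upper_closed\<close> and cut off outside
  \<open>upper\<close>, which gives a bounded Borel function with bounded support on the whole
  space. Test functions are prescribed on the closed half-space only, so
  \<open>laplacian \<psi>\<close> carries no information elsewhere.\<close>

definition test_laplacian :: "(R4 \<Rightarrow> real) \<Rightarrow> R4 \<Rightarrow> real" where
  "test_laplacian \<psi> X = indicator upper X * (\<Sum>i\<in>Basis. partial upper_closed [i, i] \<psi> X)"

lemma test_laplacian_bounded:
  assumes \<psi>: "\<psi> \<in> test_functions S"
  shows "test_laplacian \<psi> \<in> borel_measurable borel"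
    and "\<And>X. X \<in> upper \<Longrightarrow> test_laplacian \<psi> X = laplacian \<psi> X" and "\<And>X. X \<notin> upper \<Longrightarrow> test_laplacian \<psi> X = 0"
    and "\<exists>B R. 0 \<le> B \<and> (\<forall>X. \<bar>test_laplacian \<psi> X\<bar> \<le> B * indicator (cball 0 R) X)"
proof -
  define K where "K = closure {X \<in> upper_closed. \<psi> X \<noteq> 0}"
  note tf = test_function_facts[OF \<psi>, folded K_def]
  define l where "l = (\<lambda>X. \<Sum>i\<in>Basis. partial upper_closed [i, i] \<psi> X)"
  have h_def: "test_laplacian \<psi> = (\<lambda>X. indicator upper X * l X)" by (rule ext) (simp only: test_laplacian_def l_def)
  have dir: "i \<in> Basis \<Longrightarrow> [i, i] \<in> dirs 2" for i :: R4 by (auto simp: dirs_def)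
  have cl: "continuous_on upper_closed l"
    unfolding l_def by (intro continuous_on_sum Ck_on_continuous[OF tf(4) order_refl dir])
  obtain B where B: "\<And>X. X \<in> K \<Longrightarrow> \<bar>l X\<bar> \<le> B"
    using compact_imp_bounded[OF compact_continuous_image[OF continuous_on_subset[OF cl tf(2)] tf(1)]]
    by (auto simp: bounded_iff)
  obtain R where R: "\<And>X. X \<in> K \<Longrightarrow> norm X \<le> R" using tf(1) compact_imp_bounded bounded_iff by metis
  have l0: "l X = 0" if "X \<in> upper_closed - K" for X
    unfolding l_def by (rule sum.neutral, intro ballI, rule tf(5)[OF dir that])
  have "(\<lambda>X. indicator upper X *\<^sub>R l X) \<in> borel_measurable borel"
    by (rule borel_measurable_continuous_on_indicator[OF upper_borel continuous_on_subset[OF cl upper_subset_closed]])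
  then show "test_laplacian \<psi> \<in> borel_measurable borel" by (simp add: h_def)
  show "test_laplacian \<psi> X = laplacian \<psi> X" if "X \<in> upper" for X
    using tf(7)[OF that] that by (simp only: h_def l_def indicator_simps mult_1)
  show "test_laplacian \<psi> X = 0" if "X \<notin> upper" for X using that by (simp add: h_def)
  show "\<exists>B R. 0 \<le> B \<and> (\<forall>X. \<bar>test_laplacian \<psi> X\<bar> \<le> B * indicator (cball 0 R) X)"
  proof (rule exI[of _ "\<bar>B\<bar>"], rule exI[of _ "\<bar>R\<bar>"], intro conjI allI)
    show "\<bar>test_laplacian \<psi> X\<bar> \<le> \<bar>B\<bar> * indicator (cball 0 \<bar>R\<bar>) X" for X
    proof (cases "X \<in> K")
      case True
      then show ?thesis using B[OF True] R[OF True] by (auto simp: h_def indicator_def)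
    next
      case False
      then have "test_laplacian \<psi> X = 0" using l0[of X] upper_subset_closed by (auto simp: h_def indicator_def)
      then show ?thesis by simp
    qed
  qed simp
qed

text \<open>\<open>inv_square\<close> centred at a boundary point is a multiple of the fundamental
  solution for zero normal derivative. Green's identity holds for the regularised kernel, whose
  vertical derivative vanishes at height 0; the substitution
  \<open>X = P + \<epsilon> n *\<^sub>R Y\<close> turns its Laplacian into a fixed integrable
  profile, and letting \<epsilon> tend to 0 leaves the value of \<open>\<psi>\<close> at
  \<open>P\<close>.\<close>

lemma half_space_fundamental_solution:
  fixes z :: R3
  assumes \<psi>: "\<psi> \<in> test_functions S"
  shows "(LINT X|lborel. indicator upper X * (inv_square (X - (z, 0)) * (\<Sum>i\<in>Basis. partial upper_closed [i, i] \<psi> X))) = - flux_const * \<psi> (z, 0)"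
proof -
  define P where "P = (z, 0::real)"
  define K where "K = closure {X \<in> upper_closed. \<psi> X \<noteq> 0}"
  note tf = test_function_facts[OF \<psi>, folded K_def]
  define h where "h = test_laplacian \<psi>"
  note tl = test_laplacian_bounded[OF \<psi>, folded h_def]
  obtain B R where BR: "0 \<le> B" "\<And>X. \<bar>h X\<bar> \<le> B * indicator (cball 0 R) X" using tl(4) by auto
  have h4: "h X = indicator upper X * (\<Sum>i\<in>Basis. partial upper_closed [i, i] \<psi> X)" for X
    unfolding h_def test_laplacian_def ..
  note h = tl(1) BR h4
  note [measurable] = h(1)
  define \<epsilon> where "\<epsilon> = (\<lambda>n. 1 / real (Suc n))"
  have \<epsilon>: "0 < \<epsilon> n" for n by (simp add: \<epsilon>_def)
  have \<epsilon>0: "\<epsilon> \<longlonglongrightarrow> 0" unfolding \<epsilon>_def using LIMSEQ_inverse_real_of_nat by (simp add: divide_inverse)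
  define s where "s = (\<lambda>n X. (norm (X - P))\<^sup>2 + (\<epsilon> n)\<^sup>2)"
  have sp: "0 < s n X" for n X using \<epsilon>[of n] by (simp add: s_def add_nonneg_pos)
  have cs: "continuous_on A (s n)" for A n unfolding s_def by (intro continuous_intros)
  have dir: "[] \<in> dirs 0" "i \<in> Basis \<Longrightarrow> [i] \<in> dirs 1" "i \<in> Basis \<Longrightarrow> [i, i] \<in> dirs 2" for i :: R4 by (auto simp: dirs_def)
  have green: "(LINT X|lborel. indicator upper X * (1 / s n X * (\<Sum>i\<in>Basis. partial upper_closed [i, i] \<psi> X))) =
     (LINT X|lborel. indicator upper X * (\<psi> X * (\<Sum>i\<in>Basis. - 2 / (s n X)\<^sup>2 + 8 * ((X - P) \<bullet> i)\<^sup>2 / (s n X) ^ 3)))" for n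
  proof (rule Green_half_space[OF upper_subset_closed order_refl tf(1,2), of "\<lambda>X. 1 / s n X" "\<lambda>i X. - 2 * ((X - P) \<bullet> i) / (s n X)\<^sup>2" "\<lambda>i X. - 2 / (s n X)\<^sup>2 + 8 * ((X - P) \<bullet> i)\<^sup>2 / (s n X) ^ 3" \<psi> "\<lambda>i. partial upper_closed [i] \<psi>" "\<lambda>i. partial upper_closed [i, i] \<psi>", THEN conjunct2])
    have nz: "s n X \<noteq> 0" for X using sp[of n X] by simp
    show "continuous_on upper_closed (\<lambda>X. 1 / s n X)" using nz by (intro continuous_intros cs) auto
    show "continuous_on upper_closed (\<lambda>X. - 2 * ((X - P) \<bullet> i) / (s n X)\<^sup>2)" for i using nz by (intro continuous_intros cs) auto
    show "continuous_on upper_closed (\<lambda>X. - 2 / (s n X)\<^sup>2 + 8 * ((X - P) \<bullet> i)\<^sup>2 / (s n X) ^ 3)" for i using nz by (intro continuous_intros cs) auto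
    show "continuous_on upper_closed \<psi>" using Ck_on_continuous[OF tf(4) order_refl dir(1)] by simp
    show "continuous_on upper_closed (partial upper_closed [i] \<psi>)" if "i \<in> Basis" for i
      by (rule Ck_on_continuous[OF tf(4) order_refl dir(2)[OF that]])
    show "continuous_on upper_closed (partial upper_closed [i, i] \<psi>)" if "i \<in> Basis" for i
      by (rule Ck_on_continuous[OF tf(4) order_refl dir(3)[OF that]])
    show "((\<lambda>t. 1 / s n (X + t *\<^sub>R i)) has_real_derivative - 2 * ((X - P) \<bullet> i) / (s n X)\<^sup>2) (at 0)" if "i \<in> Basis" for X i
      unfolding s_def by (rule regularised_kernel_derivatives(1)[OF that \<epsilon>])
    show "((\<lambda>t. - 2 * ((X + t *\<^sub>R i - P) \<bullet> i) / (s n (X + t *\<^sub>R i))\<^sup>2) has_real_derivative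
        - 2 / (s n X)\<^sup>2 + 8 * ((X - P) \<bullet> i)\<^sup>2 / (s n X) ^ 3) (at 0)" if "i \<in> Basis" for X i
      unfolding s_def by (rule regularised_kernel_derivatives(2)[OF that \<epsilon>])
    show "((\<lambda>t. \<psi> (X + t *\<^sub>R i)) has_real_derivative partial upper_closed [i] \<psi> X) (at 0)" if "X \<in> upper" "i \<in> Basis" for X i
      using Ck_on_line_derivative[OF tf(4)[of 1] _ dir(1) that(1) upper_subset_closed that(2)] by (simp del: partial.simps(2))
    show "((\<lambda>t. partial upper_closed [i] \<psi> (X + t *\<^sub>R i)) has_real_derivative partial upper_closed [i, i] \<psi> X) (at 0)" if "X \<in> upper" "i \<in> Basis" for X i
      by (rule Ck_on_line_derivative[OF tf(4)[of 2] _ dir(2)[OF that(2)] that(1) upper_subset_closed that(2)]) simp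
    show "\<psi> X = 0" if "X \<in> upper_closed - K" for X using tf(5)[OF dir(1) that] by simp
    show "partial upper_closed [i] \<psi> X = 0" if "X \<in> upper_closed - K" "i \<in> Basis" for X i
      by (rule tf(5)[OF dir(2)[OF that(2)] that(1)])
    show "partial upper_closed [i, i] \<psi> X = 0" if "X \<in> upper_closed - K" "i \<in> Basis" for X i
      by (rule tf(5)[OF dir(3)[OF that(2)] that(1)])
    show "- 2 * (((x, 0) - P) \<bullet> (0, 1)) / (s n (x, 0))\<^sup>2 = 0" for x by (simp add: P_def)
    show "partial upper_closed [(0, 1)] \<psi> (x, 0) = 0" for x by (rule tf(6))
  qed
  have left: "(\<lambda>n. LINT X|lborel. 1 / s n X * h X) \<longlonglongrightarrow> (LINT X|lborel. inv_square (X - P) * h X)"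
  proof (rule integral_dominated_convergence)
    have d4: "(2::real) < DIM(R4)" by simp
    have "integrable lborel (\<lambda>x::R4. indicator (cball 0 R) x * norm (x - P) powr - 2)"
      by (rule integrable_riesz_local[OF _ d4 _ bounded_cball]) simp_all
    then show "integrable lborel (\<lambda>X. B * (indicator (cball 0 R) X * norm (X - P) powr - 2))" by (rule integrable_mult_right)
    show "(\<lambda>X. inv_square (X - P) * h X) \<in> borel_measurable lborel" unfolding inv_square_def by measurable
    show "(\<lambda>X. 1 / s n X * h X) \<in> borel_measurable lborel" for n unfolding s_def by measurable
    show "AE X in lborel. (\<lambda>n. 1 / s n X * h X) \<longlonglongrightarrow> inv_square (X - P) * h X"
      using AE_lborel_singleton[of P]
    proof eventually_elim
      case (elim X)
      have "(\<lambda>n. s n X) \<longlonglongrightarrow> (norm (X - P))\<^sup>2 + 0\<^sup>2" unfolding s_def by (intro tendsto_intros \<epsilon>0)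
      then have "(\<lambda>n. 1 / s n X * h X) \<longlonglongrightarrow> 1 / ((norm (X - P))\<^sup>2 + 0\<^sup>2) * h X" using elim by (intro tendsto_intros) auto
      then show ?case by (simp add: inv_square_def)
    qed
    show "AE X in lborel. norm (1 / s n X * h X) \<le> B * (indicator (cball 0 R) X * norm (X - P) powr - 2)" for n
      using AE_lborel_singleton[of P]
    proof eventually_elim
      case (elim X)
      then have p: "0 < (norm (X - P))\<^sup>2" by simp
      have "1 / s n X \<le> 1 / (norm (X - P))\<^sup>2" using p by (intro divide_left_mono mult_pos_pos sp) (auto simp: s_def)
      also have "\<dots> = norm (X - P) powr - 2" using elim by (simp add: powr_minus powr_numeral divide_inverse)
      finally have "(1 / s n X) * \<bar>h X\<bar> \<le> norm (X - P) powr - 2 * (B * indicator (cball 0 R) X)"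
        using h(3)[of X] by (intro mult_mono) auto
      then show ?case using sp[of n X] by (simp add: abs_mult mult_ac)
    qed
  qed
  have cont: "continuous_on upper_closed \<psi>" using Ck_on_continuous[OF tf(4) order_refl dir(1)] by simp
  obtain A where A: "\<And>X. X \<in> K \<Longrightarrow> \<bar>\<psi> X\<bar> \<le> A"
    using compact_imp_bounded[OF compact_continuous_image[OF continuous_on_subset[OF cont tf(2)] tf(1)]]
    by (auto simp: bounded_iff)
  have \<psi>A: "\<bar>\<psi> X\<bar> \<le> \<bar>A\<bar>" if "X \<in> upper" for X
    using A[of X] tf(5)[OF dir(1), of X] that upper_subset_closed by (cases "X \<in> K") auto
  have \<psi>m: "(\<lambda>X. indicator upper X * \<psi> X) \<in> borel_measurable borel"
    using borel_measurable_continuous_on_indicator[OF upper_borel continuous_on_subset[OF cont upper_subset_closed]] by simp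
  have up: "P + \<epsilon> n *\<^sub>R Y \<in> upper \<longleftrightarrow> Y \<in> upper" for n Y
    using \<epsilon>[of n] by (simp add: mem_upper P_def zero_less_mult_iff)
  have right: "(LINT X|lborel. 1 / s n X * h X) =
      - 8 * (LINT Y|lborel. (indicator upper Y * \<psi> (P + \<epsilon> n *\<^sub>R Y)) * (1 / (1 + (norm Y)\<^sup>2) ^ 3))" for n
  proof -
    define g where "g = (\<lambda>X. (indicator upper X * \<psi> X) * (- 8 * (\<epsilon> n)\<^sup>2 / (s n X) ^ 3))"
    have "(LINT X|lborel. 1 / s n X * h X) = (LINT X|lborel. g X)"
    proof -
      have "(LINT X|lborel. 1 / s n X * h X) = (LINT X|lborel. indicator upper X * (1 / s n X * (\<Sum>i\<in>Basis. partial upper_closed [i, i] \<psi> X)))"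
        unfolding h(4) by (simp only: mult_ac)
      also have "\<dots> = (LINT X|lborel. g X)"
        unfolding green g_def regularised_kernel_laplacian[OF s_def[THEN fun_cong, THEN fun_cong] sp] by (simp only: mult_ac)
      finally show ?thesis .
    qed
    also have "\<dots> = (\<epsilon> n) ^ DIM(R4) * (LINT Y|lborel. g (P + \<epsilon> n *\<^sub>R Y))"
    proof (rule integral_lborel_scale[OF _ \<epsilon>])
      show "g \<in> borel_measurable borel" unfolding g_def s_def by (rule borel_measurable_times[OF \<psi>m]) measurable
    qed
    also have "\<dots> = (LINT Y|lborel. (\<epsilon> n) ^ 4 * g (P + \<epsilon> n *\<^sub>R Y))" by simp
    also have "\<dots> = (LINT Y|lborel. - 8 * ((indicator upper Y * \<psi> (P + \<epsilon> n *\<^sub>R Y)) * (1 / (1 + (norm Y)\<^sup>2) ^ 3)))"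
    proof (rule Bochner_Integration.integral_cong[OF refl])
      fix Y
      have i: "indicator upper (P + \<epsilon> n *\<^sub>R Y) = (indicator upper Y :: real)" using up[of n Y] by (simp add: indicator_def)
      have e: "(\<epsilon> n) ^ 4 * (- 8 * (\<epsilon> n)\<^sup>2 / (s n (P + \<epsilon> n *\<^sub>R Y)) ^ 3) = - 8 * (1 / (1 + (norm Y)\<^sup>2) ^ 3)"
      proof -
        have "s n (P + \<epsilon> n *\<^sub>R Y) = (\<epsilon> n)\<^sup>2 * (1 + (norm Y)\<^sup>2)"
          using \<epsilon>[of n] by (simp add: s_def power_mult_distrib algebra_simps)
        \<comment> \<open>The powers of \<open>\<epsilon> n\<close> balance: 4 from the volume
          element and 2 from the numerator against 6 from the cubed denominator.\<close>
        then have "(s n (P + \<epsilon> n *\<^sub>R Y)) ^ 3 = ((\<epsilon> n) ^ 4 * (\<epsilon> n)\<^sup>2) * (1 + (norm Y)\<^sup>2) ^ 3"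
          by (simp only: power_mult_distrib power_mult[symmetric] power_add[symmetric]) simp
        moreover have "a * (- 8 * b / (a * b * q)) = - 8 * (1 / q)" if "0 < a" "0 < b" for a b q :: real
          using that by (cases "q = 0") (auto simp: field_simps)
        ultimately show ?thesis using \<epsilon>[of n] by (simp only: zero_less_power)
      qed
      have "(\<epsilon> n) ^ 4 * g (P + \<epsilon> n *\<^sub>R Y) = (indicator upper Y * \<psi> (P + \<epsilon> n *\<^sub>R Y)) * ((\<epsilon> n) ^ 4 * (- 8 * (\<epsilon> n)\<^sup>2 / (s n (P + \<epsilon> n *\<^sub>R Y)) ^ 3))"
        unfolding g_def i by (simp only: mult_ac)
      also have "\<dots> = - 8 * ((indicator upper Y * \<psi> (P + \<epsilon> n *\<^sub>R Y)) * (1 / (1 + (norm Y)\<^sup>2) ^ 3))"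
        unfolding e by (simp only: mult_ac)
      finally show "(\<epsilon> n) ^ 4 * g (P + \<epsilon> n *\<^sub>R Y) = - 8 * ((indicator upper Y * \<psi> (P + \<epsilon> n *\<^sub>R Y)) * (1 / (1 + (norm Y)\<^sup>2) ^ 3))" .
    qed
    finally show ?thesis by (simp only: Bochner_Integration.integral_mult_right_zero)
  qed
  have lim: "(\<lambda>n. LINT Y|lborel. (indicator upper Y * \<psi> (P + \<epsilon> n *\<^sub>R Y)) * (1 / (1 + (norm Y)\<^sup>2) ^ 3))
     \<longlonglongrightarrow> (LINT Y|lborel. (indicator upper Y * \<psi> P) * (1 / (1 + (norm Y)\<^sup>2) ^ 3))"
  proof (rule integral_dominated_convergence)
    have bm: "(\<lambda>Y::R4. 1 / (1 + (norm Y)\<^sup>2) ^ 3) \<in> borel_measurable borel" by measurable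
    show "(\<lambda>Y. (indicator upper Y * \<psi> P) * (1 / (1 + (norm Y)\<^sup>2) ^ 3)) \<in> borel_measurable lborel" using bm by measurable
    show "(\<lambda>Y. (indicator upper Y * \<psi> (P + \<epsilon> n *\<^sub>R Y)) * (1 / (1 + (norm Y)\<^sup>2) ^ 3)) \<in> borel_measurable lborel" for n
    proof -
      have "(\<lambda>Y. indicator upper (P + \<epsilon> n *\<^sub>R Y) * \<psi> (P + \<epsilon> n *\<^sub>R Y)) \<in> borel_measurable borel"
        by (rule measurable_compose[OF _ \<psi>m]) measurable
      moreover have "indicator upper (P + \<epsilon> n *\<^sub>R Y) = (indicator upper Y :: real)" for Y using up[of n Y] by (simp add: indicator_def)
      ultimately show ?thesis using bm by simp
    qed
    show "integrable lborel (\<lambda>Y::R4. \<bar>A\<bar> * (1 / (1 + (norm Y)\<^sup>2) ^ 3))" by (intro integrable_mult_right integrable_bubble)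
    show "AE Y in lborel. (\<lambda>n. (indicator upper Y * \<psi> (P + \<epsilon> n *\<^sub>R Y)) * (1 / (1 + (norm Y)\<^sup>2) ^ 3))
       \<longlonglongrightarrow> (indicator upper Y * \<psi> P) * (1 / (1 + (norm Y)\<^sup>2) ^ 3)"
    proof (rule AE_I2)
      fix Y :: R4
      show "(\<lambda>n. (indicator upper Y * \<psi> (P + \<epsilon> n *\<^sub>R Y)) * (1 / (1 + (norm Y)\<^sup>2) ^ 3))
       \<longlonglongrightarrow> (indicator upper Y * \<psi> P) * (1 / (1 + (norm Y)\<^sup>2) ^ 3)"
      proof (cases "Y \<in> upper")
        case True
        have "(\<lambda>n. P + \<epsilon> n *\<^sub>R Y) \<longlonglongrightarrow> P + 0 *\<^sub>R Y" by (intro tendsto_intros \<epsilon>0)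
        then have "(\<lambda>n. \<psi> (P + \<epsilon> n *\<^sub>R Y)) \<longlonglongrightarrow> \<psi> P"
        proof (intro continuous_on_tendsto_compose[OF cont])
          show "P \<in> upper_closed" by (simp add: P_def upper_closed_def)
          show "\<forall>\<^sub>F n in sequentially. P + \<epsilon> n *\<^sub>R Y \<in> upper_closed"
            using up True upper_subset_closed by (intro always_eventually) blast
        qed simp
        then show ?thesis by (intro tendsto_intros)
      qed simp
    qed
    show "AE Y in lborel. norm ((indicator upper Y * \<psi> (P + \<epsilon> n *\<^sub>R Y)) * (1 / (1 + (norm Y)\<^sup>2) ^ 3)) \<le> \<bar>A\<bar> * (1 / (1 + (norm Y)\<^sup>2) ^ 3)" for n
    proof (rule AE_I2)
      fix Y :: R4
      have "\<bar>indicator upper Y * \<psi> (P + \<epsilon> n *\<^sub>R Y)\<bar> \<le> \<bar>A\<bar>"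
        using \<psi>A[of "P + \<epsilon> n *\<^sub>R Y"] up[of n Y] by (auto simp: indicator_def)
      moreover have "0 \<le> 1 / (1 + (norm Y)\<^sup>2) ^ 3" using one_plus_norm_pos[of Y] by simp
      ultimately show "norm ((indicator upper Y * \<psi> (P + \<epsilon> n *\<^sub>R Y)) * (1 / (1 + (norm Y)\<^sup>2) ^ 3)) \<le> \<bar>A\<bar> * (1 / (1 + (norm Y)\<^sup>2) ^ 3)"
        unfolding real_norm_def abs_mult[of "indicator upper Y * \<psi> (P + \<epsilon> n *\<^sub>R Y)"]
        by (simp only: abs_of_nonneg) (rule mult_right_mono)
    qed
  qed
  have "(\<lambda>n. LINT X|lborel. 1 / s n X * h X) \<longlonglongrightarrow> - 8 * (LINT Y|lborel. (indicator upper Y * \<psi> P) * (1 / (1 + (norm Y)\<^sup>2) ^ 3))"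
    unfolding right by (intro tendsto_mult tendsto_const lim)
  from LIMSEQ_unique[OF left this]
  have "(LINT X|lborel. inv_square (X - P) * h X) = - 8 * (LINT Y|lborel. \<psi> P * (indicator upper Y * (1 / (1 + (norm Y)\<^sup>2) ^ 3)))"
    by (simp only: mult_ac)
  also have "\<dots> = - flux_const * \<psi> P" unfolding flux_const_def Bochner_Integration.integral_mult_right_zero by (simp only: mult_ac mult_minus_left)
  finally show ?thesis unfolding h(4) P_def by (simp only: mult_ac)
qed

text \<open>Fubini moves the integral over the half-space inside; for each \<open>z\<close> it is
  then the identity for the fundamental solution. Absolute integrability reduces to the potential of
  \<open>\<bar>f\<bar>\<close>, because \<open>inv_square\<close> is nonnegative.\<close>

lemma weak_equation_potential:
  assumes f: "bounded_density \<Omega> M f" and \<psi>: "\<psi> \<in> test_functions S"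
  shows "set_integrable lebesgue upper (\<lambda>X. potential inv_square f X * laplacian \<psi> X)"
    and "(LINT X:upper|lebesgue. potential inv_square f X * laplacian \<psi> X) = - flux_const * (LINT z|lborel. f z * \<psi> (z, 0))"
proof -
  define h where "h = test_laplacian \<psi>"
  note tl = test_laplacian_bounded[OF \<psi>, folded h_def]
  obtain B R where BR: "0 \<le> B" "\<And>X. \<bar>h X\<bar> \<le> B * indicator (cball 0 R) X" using tl(4) by auto
  have h7: "h X = indicator upper X * (\<Sum>i\<in>Basis. partial upper_closed [i, i] \<psi> X)" for X
    unfolding h_def test_laplacian_def ..
  note h = tl(1-3) BR(1) BR(1) BR(2) h7
  note [measurable] = h(1)
  have [measurable]: "f \<in> borel_measurable borel" using f by (simp add: bounded_density_def)
  have fa: "bounded_density \<Omega> M (\<lambda>z. \<bar>f z\<bar>)" using f by (auto simp: bounded_density_def)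
  define k where "k = (\<lambda>X z. h X * (inv_square (X - (z, 0)) * f z))"
  have skm: "inv_square \<in> borel_measurable borel" using log_kernel_measurable[OF log_kernel_s] .
  have km: "case_prod k \<in> borel_measurable (lborel \<Otimes>\<^sub>M lborel)"
  proof -
    have c: "continuous_on UNIV (\<lambda>p::R4 \<times> R3. fst p - (snd p, 0::real))" by (intro continuous_intros)
    have "(\<lambda>p::R4 \<times> R3. fst p - (snd p, 0::real)) \<in> borel_measurable borel" by (rule borel_measurable_continuous_onI[OF c])
    then have 1: "(\<lambda>p::R4 \<times> R3. inv_square (fst p - (snd p, 0::real))) \<in> borel_measurable (borel \<Otimes>\<^sub>M borel)"
      unfolding borel_prod by (rule measurable_compose[OF _ skm])
    have 2: "(\<lambda>p::R4 \<times> R3. h (fst p)) \<in> borel_measurable (borel \<Otimes>\<^sub>M borel)" "(\<lambda>p::R4 \<times> R3. f (snd p)) \<in> borel_measurable (borel \<Otimes>\<^sub>M borel)"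
      by measurable
    have "(\<lambda>p. h (fst p) * (inv_square (fst p - (snd p, 0)) * f (snd p))) \<in> borel_measurable (borel \<Otimes>\<^sub>M borel)"
      by (intro borel_measurable_times 1 2)
    then show ?thesis
      unfolding k_def case_prod_beta by (simp cong: measurable_cong_sets add: sets_pair_measure_cong[OF sets_lborel sets_lborel])
  qed
  have skb: "integrable lborel (\<lambda>z. inv_square (X - (z, 0)) * g z)" "\<bar>potential inv_square g X\<bar> \<le> 2 * 3 * M * riesz_sup \<Omega> 2" if "bounded_density \<Omega> M g" for g X
    using potential_kernel_bound[OF that taylor_kernel_s skm, of X] by auto
  have pm: "(\<lambda>X. potential inv_square g X) \<in> borel_measurable borel" if g: "bounded_density \<Omega> M g" for g
  proof -
    have "continuous_on UNIV (potential inv_square g)"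
      by (rule continuous_on_powr_holder[of "1/2"])
        (use potential_kernel_holder[OF g taylor_kernel_s skm, of "1/2"] in auto)
    then show ?thesis by (rule borel_measurable_continuous_onI)
  qed
  define c where "c = 2 * 3 * M * riesz_sup \<Omega> 2"
  have hp: "integrable lborel (\<lambda>X. h' X * potential inv_square g X)" if g: "bounded_density \<Omega> M g" and h': "h' = h \<or> h' = (\<lambda>X. \<bar>h X\<bar>)" for g h'
  proof (rule integrable_bounded_support[where B="B * \<bar>c\<bar>" and R=R])
    show "(\<lambda>X. h' X * potential inv_square g X) \<in> borel_measurable borel" using pm[OF g] h' by auto
    show "\<bar>h' X * potential inv_square g X\<bar> \<le> B * \<bar>c\<bar>" for X
    proof -
      have "\<bar>h' X\<bar> \<le> B" using h(6)[of X] h' h(4) by (cases "norm X \<le> R") auto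
      moreover have "\<bar>potential inv_square g X\<bar> \<le> \<bar>c\<bar>" using skb(2)[OF g, of X] by (simp add: c_def)
      ultimately show ?thesis unfolding abs_mult using h(4) by (intro mult_mono) auto
    qed
    show "h' X * potential inv_square g X = 0" if "R < norm X" for X using h(6)[of X] h' that by auto
  qed
  have inner: "(LINT z|lborel. norm (k X z)) = \<bar>h X\<bar> * potential inv_square (\<lambda>z. \<bar>f z\<bar>) X" for X
  proof -
    have "norm (k X z) = \<bar>h X\<bar> * (inv_square (X - (z, 0)) * \<bar>f z\<bar>)" for z by (simp add: k_def abs_mult inv_square_def)
    then show ?thesis by (simp add: potential_def)
  qed
  have int: "integrable (lborel \<Otimes>\<^sub>M lborel) (case_prod k)"
  proof (rule lborel_pair.Fubini_integrable[OF km])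
    show "integrable lborel (\<lambda>X. LINT z|lborel. norm (case_prod k (X, z)))"
      using hp[OF fa, of "\<lambda>X. \<bar>h X\<bar>"] unfolding prod.case inner by simp
    show "AE X in lborel. integrable lborel (\<lambda>z. case_prod k (X, z))"
      using skb(1)[OF f] by (auto simp: k_def)
  qed
  have L: "(LINT z|lborel. k X z) = h X * potential inv_square f X" for X by (simp add: k_def potential_def)
  have Rr: "(LINT X|lborel. k X z) = - flux_const * (f z * \<psi> (z, 0))" for z
  proof -
    have "(LINT X|lborel. k X z) = (LINT X|lborel. f z * (indicator upper X * (inv_square (X - (z, 0)) * (\<Sum>i\<in>Basis. partial upper_closed [i, i] \<psi> X))))"
      unfolding k_def h(7) by (simp only: mult_ac)
    also have "\<dots> = f z * (- flux_const * \<psi> (z, 0))"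
      unfolding Bochner_Integration.integral_mult_right_zero half_space_fundamental_solution[OF \<psi>] ..
    finally show ?thesis by (simp only: mult_ac)
  qed
  have "(LINT X|lborel. h X * potential inv_square f X) = - flux_const * (LINT z|lborel. f z * \<psi> (z, 0))"
    using lborel_pair.Fubini_integral[OF int] unfolding L Rr by simp
  moreover have e: "indicator upper X * (h X * potential inv_square f X) = h X * potential inv_square f X" for X
    using h(3)[of X] by (cases "X \<in> upper") auto
  ultimately have main: "(LINT X|lborel. indicator upper X * (h X * potential inv_square f X)) = - flux_const * (LINT z|lborel. f z * \<psi> (z, 0))"
    by (simp only:)
  have ii: "integrable lborel (\<lambda>X. indicator upper X * (h X * potential inv_square f X))" unfolding e using hp[OF f, of h] by simp
  have eq: "potential inv_square f X * laplacian \<psi> X = h X * potential inv_square f X" if "X \<in> upper" for X using h(2)[OF that] by simp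
  show "set_integrable lebesgue upper (\<lambda>X. potential inv_square f X * laplacian \<psi> X)"
    by (rule set_lebesgue_of_lborel(1)[OF ii eq])
  show "(LINT X:upper|lebesgue. potential inv_square f X * laplacian \<psi> X) = - flux_const * (LINT z|lborel. f z * \<psi> (z, 0))"
    using set_lebesgue_of_lborel(2)[OF ii eq] main by simp
qed

section \<open>The zero set of the limit profile is negligible\<close>

definition profile :: "R3 set \<Rightarrow> (R4 \<Rightarrow> real) \<Rightarrow> bool" where
  "profile S \<Phi> \<longleftrightarrow> open S \<and> bounded S \<and> \<Phi> \<in> K_class S \<and> representable \<Phi>"

abbreviation half_space_with :: "R3 set \<Rightarrow> R4 set" where "half_space_with S \<equiv> upper \<union> S \<times> {0}"

lemma emeasure_translate_vimage:
  fixes N :: "'a::euclidean_space set"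
  assumes [measurable]: "N \<in> sets borel"
  shows "emeasure lborel {x. x - a \<in> N} = emeasure lborel N" "{x. x - a \<in> N} \<in> sets borel"
proof -
  have "(\<lambda>x. x - a) -` N \<inter> space borel \<in> sets borel" by (rule measurable_sets) measurable
  then show m: "{x. x - a \<in> N} \<in> sets borel" by (simp add: vimage_def)
  have "emeasure lborel {x. x - a \<in> N} = (\<integral>\<^sup>+x. indicator {x. x - a \<in> N} x \<partial>lborel)"
    using m by (simp only: nn_integral_indicator sets_lborel)
  also have "\<dots> = (\<integral>\<^sup>+x. indicator N (x - a) \<partial>lborel)"
    by (rule nn_integral_cong) (simp add: indicator_def)
  also have "\<dots> = (\<integral>\<^sup>+x. indicator N x \<partial>lborel)" by (rule nn_integral_lborel_translate) measurable
  finally show "emeasure lborel {x. x - a \<in> N} = emeasure lborel N" using assms by simp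
qed

text \<open>Infinitely many disjoint translates of \<open>N\<close> fit into a bounded set.\<close>

lemma null_of_disjoint_translates:
  fixes N :: "'a::euclidean_space set"
  assumes N: "N \<in> sets borel" "bounded N"
    and d: "\<And>x t. x \<in> N \<Longrightarrow> 0 < t \<Longrightarrow> t < 1 \<Longrightarrow> x + t *\<^sub>R e \<notin> N"
  shows "emeasure lborel N = 0"
proof (rule ccontr)
  assume ne: "emeasure lborel N \<noteq> 0"
  obtain R where R: "\<And>x. x \<in> N \<Longrightarrow> norm x \<le> R" using N(2) bounded_iff by metis
  \<comment> \<open>Pairwise distinct shifts whose mutual distances lie strictly between 0 and 1, as
    the disjointness hypothesis requires.\<close>
  define t where "t = (\<lambda>k::nat. 1 / (real k + 2))"
  have t: "0 < t k" "t k \<le> 1" for k by (auto simp: t_def)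
  define F where "F = (\<lambda>k. {x. x - t k *\<^sub>R e \<in> N})"
  have Fm: "F k \<in> sets lborel" for k unfolding F_def using emeasure_translate_vimage(2)[OF N(1)] by simp
  have dj: "F k \<inter> F l = {}" if "k < l" for k l
  proof (rule ccontr)
    assume "F k \<inter> F l \<noteq> {}"
    then obtain x where x: "x - t k *\<^sub>R e \<in> N" "x - t l *\<^sub>R e \<in> N" by (auto simp: F_def)
    have lt: "t l < t k" using that by (simp add: t_def frac_less2)
    have eq: "(x - t k *\<^sub>R e) + (t k - t l) *\<^sub>R e = x - t l *\<^sub>R e" by (simp add: algebra_simps)
    have "t k - t l < 1" using t[of k] t[of l] by linarith
    then show False using d[OF x(1), of "t k - t l"] x(2) lt unfolding eq by simp
  qed
  have dis: "disjoint_family_on F {..<n}" for n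
    unfolding disjoint_family_on_def using dj by (metis Int_commute nat_neq_iff)
  define B where "B = cball (0::'a) (R + norm e)"
  have FB: "F k \<subseteq> B" for k
  proof
    fix x assume "x \<in> F k"
    then have "norm (x - t k *\<^sub>R e) \<le> R" using R by (simp add: F_def)
    moreover have "norm (t k *\<^sub>R e) \<le> norm e" using t[of k] by (simp add: mult_left_le_one_le)
    moreover have "norm x \<le> norm (x - t k *\<^sub>R e) + norm (t k *\<^sub>R e)"
      using norm_triangle_ineq[of "x - t k *\<^sub>R e" "t k *\<^sub>R e"] by simp
    ultimately show "x \<in> B" by (simp add: B_def)
  qed
  have fin: "emeasure lborel B < \<infinity>" unfolding B_def by (rule emeasure_bounded_finite) simp
  have le: "of_nat n * emeasure lborel N \<le> emeasure lborel B" for n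
  proof -
    have "of_nat n * emeasure lborel N = (\<Sum>k<n. emeasure lborel (F k))"
      unfolding F_def emeasure_translate_vimage(1)[OF N(1)] by simp
    also have "\<dots> = emeasure lborel (\<Union>k<n. F k)" by (rule sum_emeasure[OF _ dis]) (use Fm in auto)
    also have "\<dots> \<le> emeasure lborel B" by (rule emeasure_mono) (use FB in \<open>auto simp: B_def\<close>)
    finally show ?thesis .
  qed
  have fN: "emeasure lborel N < \<infinity>" using emeasure_bounded_finite[OF N(2)] .
  define a b where "a = enn2real (emeasure lborel N)" and "b = enn2real (emeasure lborel B)"
  have ab: "emeasure lborel N = ennreal a" "emeasure lborel B = ennreal b" "0 \<le> a" "0 \<le> b"
    using fN fin by (auto simp: a_def b_def less_top)
  have "0 < a" using ne ab by (cases "a = 0") auto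
  then obtain n where "b < real n * a" using reals_Archimedean3 by blast
  moreover have "real n * a \<le> b"
    using le[of n] ab by (simp add: ennreal_of_nat_eq_real_of_nat ennreal_mult[symmetric])
  ultimately show False by simp
qed

text \<open>A substitute for the implicit function theorem: two zeros on a line in direction
  \<open>e\<close> would produce, by the mean value theorem inside the convex ball, a point where
  \<open>D\<close> vanishes. So the zero set is disjoint from its proper translates along
  \<open>e\<close>.\<close>

lemma null_level_set:
  fixes h :: "'a::euclidean_space \<Rightarrow> real"
  assumes B: "0 < r" and h: "continuous_on (ball p r) h"
    and d: "\<And>x. x \<in> ball p r \<Longrightarrow> ((\<lambda>t. h (x + t *\<^sub>R e)) has_real_derivative D x) (at 0)"
    and nz: "\<And>x. x \<in> ball p r \<Longrightarrow> D x \<noteq> 0"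
  shows "negligible {x \<in> ball p r. h x = 0}"
proof -
  define N where "N = {x \<in> ball p r. h x = 0}"
  have "openin (top_of_set (ball p r)) (ball p r \<inter> h -` (- {0}))"
    by (rule continuous_openin_preimage_gen[OF h]) auto
  then have "open (ball p r \<inter> h -` (- {0}))" by (simp add: openin_open_eq)
  moreover have "N = ball p r - (ball p r \<inter> h -` (- {0}))" by (auto simp: N_def)
  ultimately have Nm: "N \<in> sets borel" by auto
  have Nb: "bounded N" by (rule bounded_subset[OF bounded_ball]) (auto simp: N_def)
  have "emeasure lborel N = 0"
  proof (rule null_of_disjoint_translates[OF Nm Nb])
    fix x t assume x: "x \<in> N" and t: "0 < t" "t < (1::real)"
    show "x + t *\<^sub>R e \<notin> N"
    proof
      assume xt: "x + t *\<^sub>R e \<in> N"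
      have inb: "x + s *\<^sub>R e \<in> ball p r" if "0 \<le> s" "s \<le> t" for s
      proof -
        have "x + s *\<^sub>R e = (1 - s / t) *\<^sub>R x + (s / t) *\<^sub>R (x + t *\<^sub>R e)"
          using t by (simp add: algebra_simps)
        moreover have "(1 - s / t) *\<^sub>R x + (s / t) *\<^sub>R (x + t *\<^sub>R e) \<in> ball p r"
          by (rule convexD_alt[OF convex_ball]) (use x xt that t in \<open>auto simp: N_def\<close>)
        ultimately show ?thesis by simp
      qed
      have der: "((\<lambda>s. h (x + s *\<^sub>R e)) has_real_derivative D (x + s *\<^sub>R e)) (at s)" if "0 \<le> s" "s \<le> t" for s
      proof -
        have "((\<lambda>u. h (x + s *\<^sub>R e + u *\<^sub>R e)) has_real_derivative D (x + s *\<^sub>R e)) (at (s + - s))"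
          using d[OF inb[OF that]] by simp
        then have "((\<lambda>u. h (x + s *\<^sub>R e + (u + - s) *\<^sub>R e)) has_real_derivative D (x + s *\<^sub>R e)) (at s)"
          by (simp only: DERIV_shift[of "\<lambda>u. h (x + s *\<^sub>R e + u *\<^sub>R e)"])
        moreover have "x + s *\<^sub>R e + (u + - s) *\<^sub>R e = x + u *\<^sub>R e" for u by (simp add: algebra_simps)
        ultimately show ?thesis by (simp only:)
      qed
      obtain s where s: "0 < s" "s < t" "h (x + t *\<^sub>R e) - h (x + 0 *\<^sub>R e) = (t - 0) * D (x + s *\<^sub>R e)"
        using MVT2[OF t(1), of "\<lambda>s. h (x + s *\<^sub>R e)" "\<lambda>s. D (x + s *\<^sub>R e)"] der by blast
      then have "D (x + s *\<^sub>R e) = 0" using x xt t by (simp add: N_def)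
      then show False using nz[OF inb[of s]] s by simp
    qed
  qed
  then have "N \<in> null_sets lborel" using Nm by (simp add: null_sets_def)
  then have "negligible N" by (simp add: negligible_iff_null_sets null_sets_completionI)
  then show ?thesis by (simp add: N_def)
qed

text \<open>The sign on the boundary comes from the interior by continuity. The last item rests on
  the Poisson formula: if \<Phi> vanished on the whole boundary, it would vanish everywhere.\<close>

lemma profile_facts:
  assumes "profile S \<Phi>"
  shows "open S" "bounded S" "\<And>k. \<Phi> \<in> Ck_on k (half_space_with S)" "thick (half_space_with S)" "\<And>x. \<Phi> (x, 0) \<le> 0"
    "continuous_on UNIV (bdry \<Phi>)" "\<And>x. x \<in> S \<Longrightarrow> L32_at \<Phi> x 0" "biharmonic \<Phi>" "dy_zero_on S \<Phi>"
    "\<exists>p c r. 0 < c \<and> 0 < r \<and> (\<forall>x\<in>ball p r. \<Phi> (x, 0) \<le> - c)"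
proof -
  show S: "open S" and "bounded S" using assms by (auto simp: profile_def)
  show "\<Phi> \<in> Ck_on k (half_space_with S)" for k using assms by (simp add: profile_def K_class_def Cinf_onD)
  show "thick (half_space_with S)" by (rule thick_upper_Un_boundary[OF S])
  show "L32_at \<Phi> x 0" if "x \<in> S" for x using assms that by (simp add: profile_def K_class_def)
  show "biharmonic \<Phi>" "dy_zero_on S \<Phi>" using assms by (simp_all add: profile_def K_class_def)
  have c: "continuous_on upper_closed \<Phi>" using assms by (simp add: profile_def representable_def)
  show cb: "continuous_on UNIV (bdry \<Phi>)"
    by (rule continuous_on_compose2[OF c]) (auto intro!: continuous_intros simp: upper_closed_def)
  show le: "\<Phi> (x, 0) \<le> 0" for x
  proof -
    have "continuous_on {0..} (\<lambda>y. \<Phi> (x, y))"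
      by (rule continuous_on_compose2[OF c]) (auto intro!: continuous_intros simp: upper_closed_def)
    then have "((\<lambda>y. \<Phi> (x, y)) \<longlongrightarrow> \<Phi> (x, 0)) (at_right 0)"
      by (auto simp: continuous_on_def at_within_Ici_at_right[symmetric])
    moreover have "\<forall>\<^sub>F y in at_right 0. \<Phi> (x, y) \<le> 0"
      unfolding eventually_at_right_field
      by (intro exI[of _ 1]) (use assms in \<open>auto simp: profile_def K_class_def upper_def\<close>)
    ultimately show ?thesis by (intro tendsto_upperbound) auto
  qed
  have "\<exists>p. \<Phi> (p, 0) \<noteq> 0"
  proof (rule ccontr)
    assume "\<nexists>p. \<Phi> (p, 0) \<noteq> 0"
    then have z: "\<Phi> (p, 0) = 0" for p by blast
    have "\<Phi> (x, y) = 4 / pi\<^sup>2 * (LINT x'|lebesgue. y ^ 3 / (y\<^sup>2 + (norm (x - x'))\<^sup>2) ^ 3 * bdry \<Phi> x')" if "0 < y" for x y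
      using assms that unfolding profile_def representable_def by blast
    then have "\<Phi> (x, y) = 0" if "0 < y" for x y using that by (simp add: z)
    then have "\<Phi> X = 0" if "X \<in> half_space_with S" for X using that z by (auto simp: upper_def)
    then show False using assms by (auto simp: profile_def K_class_def)
  qed
  then obtain p where "\<Phi> (p, 0) \<noteq> 0" ..
  then have p: "\<Phi> (p, 0) < 0" using le[of p] by simp
  obtain r where r: "r > 0" "\<And>x. dist x p < r \<Longrightarrow> dist (\<Phi> (x, 0)) (\<Phi> (p, 0)) < - \<Phi> (p, 0) / 2"
    using cb p unfolding continuous_on_iff by (metis UNIV_I half_gt_zero neg_0_less_iff_less)
  show "\<exists>p c r. 0 < c \<and> 0 < r \<and> (\<forall>x\<in>ball p r. \<Phi> (x, 0) \<le> - c)"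
  proof (rule exI[of _ p], rule exI[of _ "- \<Phi> (p, 0) / 2"], rule exI[of _ r], intro conjI ballI)
    fix x assume "x \<in> ball p r"
    then have "dist x p < r" by (simp add: dist_commute)
    from r(2)[OF this] have "dist (\<Phi> (x, 0)) (\<Phi> (p, 0)) < - \<Phi> (p, 0) / 2" .
    then show "\<Phi> (x, 0) \<le> - (- \<Phi> (p, 0) / 2)" by (simp add: dist_real_def abs_if split: if_splits)
  qed (use p r in auto)
qed

section \<open>Boundary derivatives of the profile at its zeros\<close>

lemma sum_Basis_R4: "(\<Sum>i\<in>(Basis::R4 set). f i) = (\<Sum>e\<in>Basis. f (e, 0)) + (f (0, 1) :: real)"
proof -
  have B: "(Basis::R4 set) = insert (0, 1) ((\<lambda>e. (e, 0)) ` Basis)" by (auto simp: Basis_prod_def)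
  have "(\<Sum>i\<in>(\<lambda>e::R3. (e, 0::real)) ` Basis. f i) = (\<Sum>e\<in>Basis. f (e, 0))"
    by (subst sum.reindex) (auto simp: inj_on_def)
  then show ?thesis unfolding B by (subst sum.insert) auto
qed

lemma tangential_derivative:
  assumes C: "\<Phi> \<in> Ck_on k (half_space_with S)" and S: "open S" and vs: "m < k" "vs \<in> dirs m" and x: "x \<in> S"
  shows "((\<lambda>x. partial (half_space_with S) vs \<Phi> (x, 0)) has_derivative
     (\<lambda>h. \<Sum>e\<in>Basis. (h \<bullet> e) * partial (half_space_with S) ((e, 0) # vs) \<Phi> (x, 0))) (at x)"
proof -
  have "((\<lambda>x. partial (half_space_with S) vs \<Phi> (x, 0)) has_derivative
     (\<lambda>h. \<Sum>i\<in>Basis. ((h, 0) \<bullet> i) * partial (half_space_with S) (i # vs) \<Phi> (x, 0))) (at x within S)"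
  proof (rule has_derivative_in_compose[of "\<lambda>x. (x, 0)" "\<lambda>h. (h, 0)"])
    show "((\<lambda>x. (x, 0::real)) has_derivative (\<lambda>h. (h, 0))) (at x within S)"
      by (intro has_derivative_Pair has_derivative_ident has_derivative_const)
    show "(partial (half_space_with S) vs \<Phi> has_derivative (\<lambda>h. \<Sum>i\<in>Basis. (h \<bullet> i) * partial (half_space_with S) (i # vs) \<Phi> (x, 0)))
       (at (x, 0) within (\<lambda>x. (x, 0)) ` S)"
      by (rule has_derivative_subset[OF Ck_onD[OF C vs]]) (use x in auto)
  qed
  moreover have "(\<Sum>i\<in>Basis. ((h, 0::real) \<bullet> i) * partial (half_space_with S) (i # vs) \<Phi> (x, 0))
     = (\<Sum>e\<in>Basis. (h \<bullet> e) * partial (half_space_with S) ((e, 0) # vs) \<Phi> (x, 0))" for h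
    unfolding sum_Basis_R4 by (simp del: partial.simps)
  ultimately show ?thesis using at_within_open[OF x S] by (simp only:)
qed

lemma tangential_line_derivative:
  assumes C: "\<Phi> \<in> Ck_on k (half_space_with S)" and S: "open S" and vs: "m < k" "vs \<in> dirs m" and x: "x \<in> S" and e: "e \<in> Basis"
  shows "((\<lambda>t. partial (half_space_with S) vs \<Phi> (x + t *\<^sub>R e, 0)) has_real_derivative partial (half_space_with S) ((e, 0) # vs) \<Phi> (x, 0)) (at 0)"
proof -
  have x0: "x + 0 *\<^sub>R e \<in> S" using x by simp
  have "((\<lambda>t. partial (half_space_with S) vs \<Phi> (x + t *\<^sub>R e, 0)) has_real_derivative
      (\<Sum>k\<in>Basis. (e \<bullet> k) * partial (half_space_with S) ((k, 0) # vs) \<Phi> (x + 0 *\<^sub>R e, 0))) (at 0 within {s. x + s *\<^sub>R e \<in> UNIV})"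
    by (rule has_derivative_line[of "\<lambda>x. partial (half_space_with S) vs \<Phi> (x, 0)" _ x 0 e UNIV, OF tangential_derivative[OF C S vs x0]])
  then show ?thesis
    unfolding sum_Basis_pick[OF e, of "\<lambda>k. partial (half_space_with S) ((k, 0) # vs) \<Phi> (x + 0 *\<^sub>R e, 0)"]
    by (simp del: partial.simps)
qed

lemma tangential_derivative_zero:
  assumes C: "\<Phi> \<in> Ck_on k (half_space_with S)" and S: "open S" and vs: "m < k" "vs \<in> dirs m" and x: "x \<in> S" and e: "e \<in> Basis"
    and z: "\<And>x. x \<in> S \<Longrightarrow> partial (half_space_with S) vs \<Phi> (x, 0) = 0"
  shows "partial (half_space_with S) ((e, 0) # vs) \<Phi> (x, 0) = 0"
proof -
  have "continuous_on UNIV (\<lambda>s. x + s *\<^sub>R e)" by (intro continuous_intros)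
  from open_vimage[OF S this] have op: "open {s. x + s *\<^sub>R e \<in> S}" by (simp add: vimage_def)
  have "((\<lambda>t. 0) has_real_derivative partial (half_space_with S) ((e, 0) # vs) \<Phi> (x, 0)) (at 0)"
    by (rule has_field_derivative_transform_within_open[OF tangential_line_derivative[OF C S vs x e] op])
      (use x z in \<open>auto simp del: partial.simps\<close>)
  then show ?thesis using DERIV_unique DERIV_const by blast
qed

lemma boundary_value_zero:
  assumes c: "continuous_on (half_space_with S) g" and x: "x \<in> S" and z: "\<And>X. X \<in> upper \<Longrightarrow> g X = 0"
  shows "g (x, 0) = (0::real)"
proof -
  have "continuous_on {0..} (\<lambda>y. g (x, y))" by (rule continuous_on_vertical_line[OF c x])
  then have "((\<lambda>y. g (x, y)) \<longlongrightarrow> g (x, 0)) (at_right 0)"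
    by (auto simp: continuous_on_def at_within_Ici_at_right[symmetric])
  moreover have "\<forall>\<^sub>F y in at_right 0. g (x, y) = 0"
    unfolding eventually_at_right_field by (intro exI[of _ 1]) (auto intro!: z simp: upper_def)
  then have "((\<lambda>y. g (x, y)) \<longlongrightarrow> 0) (at_right 0)" by (rule tendsto_eventually)
  ultimately show ?thesis by (rule tendsto_unique[rotated]) simp
qed

lemma upper_partial_eq:
  assumes "X \<in> upper"
  shows "partial (half_space_with S) vs \<Phi> X = partial upper vs \<Phi> X"
  by (rule partial_cong[OF open_upper]) (use assms in auto)

text \<open>Two swaps of adjacent letters: the first for the function
  \<open>partial upper [j] \<Phi>\<close>, the second for \<Phi> itself under an outer
  derivative.\<close>

lemma partial3_commute:
  assumes C: "\<Phi> \<in> Ck_on 3 upper" and X: "X \<in> upper" and ij: "i \<in> Basis" "j \<in> Basis"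
  shows "partial upper [i, j, j] \<Phi> X = partial upper [j, j, i] \<Phi> X"
proof -
  have dj: "[j] \<in> dirs 1" using ij by (simp add: dirs_def)
  have "\<Phi> \<in> Ck_on (1 + 2) upper" using C by (simp add: numeral_3_eq_3)
  from Ck_on_partial[OF this dj] have "partial upper [j] \<Phi> \<in> Ck_on 2 upper" .
  from mixed_partials_commute[OF open_upper this X ij]
  have "partial upper ([i, j] @ [j]) \<Phi> X = partial upper ([j, i] @ [j]) \<Phi> X" unfolding partial_append .
  also have "\<dots> = partial upper ([j] @ [i, j]) \<Phi> X" by simp
  also have "\<dots> = partial upper ([j] @ [j, i]) \<Phi> X"
    unfolding partial_append
    by (rule partial_cong[OF open_upper refl])
      (use X mixed_partials_commute[OF open_upper Ck_on_mono[OF C]] ij in \<open>auto simp del: partial.simps\<close>)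
  finally show ?thesis by simp
qed

text \<open>On \<open>S\<close> the normal derivative of the Laplacian vanishes. Its tangential part
  consists of second tangential derivatives of the normal derivative of \<Phi>, which is zero along
  \<open>S\<close>, so only the third vertical derivative is left.\<close>

lemma vertical_third_derivative_zero:
  assumes b: "profile S \<Phi>" and x: "x \<in> S"
  shows "partial (half_space_with S) [(0, 1)] \<Phi> (x, 0) = 0" "partial (half_space_with S) [(0, 1), (0, 1), (0, 1)] \<Phi> (x, 0) = 0"
proof -
  note bf = profile_facts[OF b]
  have ey: "(0::R3, 1::real) \<in> Basis" by (simp add: Basis_prod_def)
  have y0: "partial (half_space_with S) [(0, 1)] \<Phi> (x, 0) = 0" if x: "x \<in> S" for x
  proof -
    have X: "(x, 0) + 0 *\<^sub>R (0, 1) \<in> half_space_with S" using x by simp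
    have "((\<lambda>t. partial (half_space_with S) [] \<Phi> ((x, 0) + t *\<^sub>R (0, 1))) has_real_derivative
      (\<Sum>k\<in>Basis. ((0, 1) \<bullet> k) * partial (half_space_with S) [k] \<Phi> ((x, 0) + 0 *\<^sub>R (0, 1))))
      (at 0 within {s. (x, 0) + s *\<^sub>R (0, 1) \<in> half_space_with S})"
      by (rule has_derivative_line[OF Ck_onD[OF bf(3)[of 1] _ _ X, of 0]]) auto
    also have "{s. (x, 0::real) + s *\<^sub>R (0, 1) \<in> half_space_with S} = {0..}" using x by (auto simp: upper_def)
    finally have 1: "((\<lambda>t. \<Phi> (x, t)) has_real_derivative partial (half_space_with S) [(0, 1)] \<Phi> (x, 0)) (at 0 within {0..})"
      unfolding sum_Basis_pick[OF ey, of "\<lambda>k. partial (half_space_with S) [k] \<Phi> ((x, 0) + 0 *\<^sub>R (0, 1))"]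
      by (simp del: partial.simps(2))
    have 2: "((\<lambda>t. \<Phi> (x, t)) has_real_derivative 0) (at 0 within {0..})"
      using bf(9) x by (simp add: dy_zero_on_def)
    have "at (0::real) within {0..} \<noteq> bot"
      by (metis at_within_Ici_at_right trivial_limit_at_right_real trivial_limit_def)
    then show ?thesis
      using tendsto_unique[OF _ 1[unfolded has_field_derivative_iff] 2[unfolded has_field_derivative_iff]] by blast
  qed
  show "partial (half_space_with S) [(0, 1)] \<Phi> (x, 0) = 0" by (rule y0[OF x])
  have tan: "partial (half_space_with S) [(0, 1), (e, 0), (e, 0)] \<Phi> (x, 0) = 0" if e: "e \<in> Basis" for e :: R3
  proof -
    have e4: "(e, 0::real) \<in> Basis" using e by (simp add: Basis_prod_def)
    \<comment> \<open>Commuting derivatives is known only in the open half-space; the difference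
      \<open>g\<close> vanishes there and continuity carries this to the boundary.\<close>
    define g where "g = (\<lambda>X. partial (half_space_with S) [(0, 1), (e, 0), (e, 0)] \<Phi> X - partial (half_space_with S) [(e, 0), (e, 0), (0, 1)] \<Phi> X)"
    have "continuous_on (half_space_with S) g"
      unfolding g_def using ey e4
      by (intro continuous_on_diff Ck_on_continuous[OF bf(3) order_refl, of _ 3]) (auto simp: dirs_def)
    moreover have "g X = 0" if X: "X \<in> upper" for X
    proof -
      have "\<Phi> \<in> Ck_on 3 upper" by (rule Ck_on_subset(1)[OF thick_open[OF open_upper] _ bf(3)]) auto
      from partial3_commute[OF this X ey e4] show ?thesis
        unfolding g_def upper_partial_eq[OF X] by simp
    qed
    ultimately have "g (x, 0) = 0" by (rule boundary_value_zero[OF _ x])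
    moreover have "partial (half_space_with S) [(e, 0), (e, 0), (0, 1)] \<Phi> (x, 0) = 0"
    proof (rule tangential_derivative_zero[OF bf(3)[of 3] bf(1) _ _ x e, of 2])
      show "[(e, 0), (0, 1)] \<in> (dirs 2 :: R4 list set)" using ey e4 by (simp add: dirs_def)
      fix x assume x: "x \<in> S"
      show "partial (half_space_with S) [(e, 0), (0, 1)] \<Phi> (x, 0) = 0"
        by (rule tangential_derivative_zero[OF bf(3)[of 2] bf(1) _ _ x e, of 1]) (use y0 ey in \<open>auto simp: dirs_def simp del: partial.simps\<close>)
    qed simp
    ultimately show ?thesis unfolding g_def by simp
  qed
  have "(\<Sum>j\<in>Basis. partial (half_space_with S) ([(0, 1)] @ [j, j]) \<Phi> (x, 0)) = 0"
    by (rule normal_derivative_laplacian_zero[OF bf(1) _ x bf(7)[OF x]]) (rule bf(3))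
  also have "(\<Sum>j\<in>Basis. partial (half_space_with S) ([(0, 1)] @ [j, j]) \<Phi> (x, 0)) =
     (\<Sum>e\<in>Basis. partial (half_space_with S) [(0, 1), (e, 0), (e, 0)] \<Phi> (x, 0)) + partial (half_space_with S) [(0, 1), (0, 1), (0, 1)] \<Phi> (x, 0)"
    unfolding sum_Basis_R4 append_Cons append_Nil by (simp del: partial.simps)
  also have "(\<Sum>e\<in>Basis. partial (half_space_with S) [(0, 1), (e, 0), (e, 0)] \<Phi> (x, 0)) = 0"
    by (rule sum.neutral, intro ballI, rule tan)
  finally show "partial (half_space_with S) [(0, 1), (0, 1), (0, 1)] \<Phi> (x, 0) = 0" by (simp only: add_0_left)
qed

lemma compact_abs_bound:
  fixes g :: "'a::topological_space \<Rightarrow> real"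
  assumes "compact K" "continuous_on K g"
  shows "\<exists>B. \<forall>x\<in>K. \<bar>g x\<bar> \<le> B"
  using compact_imp_bounded[OF compact_continuous_image[OF assms(2,1)]] by (auto simp: bounded_iff)

lemma tangential_dirs: "ws \<in> dirs m \<Longrightarrow> map (\<lambda>e::R3. (e, 0::real)) ws \<in> dirs m"
  by (auto simp: dirs_def Basis_prod_def)

lemma continuous_on_tangential:
  assumes b: "profile S \<Phi>" and vs: "vs \<in> dirs m"
  shows "continuous_on S (\<lambda>x. partial (half_space_with S) vs \<Phi> (x, 0))"
  by (rule continuous_on_compose2[OF Ck_on_continuous[OF profile_facts(3)[OF b] order_refl vs]])
    (auto intro!: continuous_intros)

lemma gradient_zero_on_zero_set:
  assumes b: "profile S \<Phi>" and x: "x \<in> S" "\<Phi> (x, 0) = 0" and e: "e \<in> Basis"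
  shows "partial (half_space_with S) [(e, 0)] \<Phi> (x, 0) = 0"
proof -
  note bf = profile_facts[OF b]
  have "((\<lambda>t. partial (half_space_with S) [] \<Phi> (x + t *\<^sub>R e, 0)) has_real_derivative partial (half_space_with S) [(e, 0)] \<Phi> (x, 0)) (at 0)"
    by (rule tangential_line_derivative[OF bf(3)[of 1] bf(1) _ dirs_Nil x(1) e]) simp
  then have "((\<lambda>t. \<Phi> (x + t *\<^sub>R e, 0)) has_real_derivative partial (half_space_with S) [(e, 0)] \<Phi> (x, 0)) (at 0)"
    by (simp del: partial.simps(2))
  then show ?thesis by (rule DERIV_local_max[of _ _ _ 1]) (use bf(5) x in auto)
qed

text \<open>Value, gradient (by maximality) and Hessian vanish at \<open>p\<close>. Starting from a
  local bound on the third tangential derivatives, \<open>growth_bound\<close> is applied three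
  times, each time with a factor 3 for the dimension of the boundary.\<close>

lemma cubic_vanishing:
  assumes b: "profile S \<Phi>" and p: "p \<in> S" "\<Phi> (p, 0) = 0"
    and z2: "\<And>e e'. e \<in> Basis \<Longrightarrow> e' \<in> Basis \<Longrightarrow> partial (half_space_with S) [(e, 0), (e', 0)] \<Phi> (p, 0) = 0"
  shows "\<exists>C r. 0 \<le> C \<and> 0 < r \<and> (\<forall>x\<in>ball p r. \<bar>\<Phi> (x, 0)\<bar> \<le> C * norm (x - p) ^ 3)"
proof -
  note bf = profile_facts[OF b]
  obtain r where r: "0 < r" "cball p r \<subseteq> S" using bf(1) p(1) open_contains_cball by blast
  then have rS: "x \<in> ball p r \<Longrightarrow> x \<in> S" for x by auto
  \<comment> \<open>Summing the absolute values of all third tangential derivatives lets one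
    compactness argument bound them simultaneously.\<close>
  define G where "G = (\<lambda>x. \<Sum>ws\<in>dirs 3. \<bar>partial (half_space_with S) (map (\<lambda>e. (e, 0)) ws) \<Phi> (x, 0)\<bar>)"
  have "continuous_on S G"
    unfolding G_def by (intro continuous_on_sum continuous_on_rabs continuous_on_tangential[OF b tangential_dirs])
  then have "continuous_on (cball p r) G" using r(2) continuous_on_subset by blast
  from compact_abs_bound[OF compact_cball this]
  obtain B where B: "\<And>x. x \<in> cball p r \<Longrightarrow> \<bar>G x\<bar> \<le> B" by blast
  have B0: "0 \<le> B" using B[of p] r(1) by (meson abs_ge_zero centre_in_cball less_imp_le order_trans)
  have b3: "\<bar>partial (half_space_with S) [(e1, 0), (e2, 0), (e3, 0)] \<Phi> (x, 0)\<bar> \<le> B * norm (x - p) ^ 0"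
    if x: "x \<in> ball p r" and e: "e1 \<in> Basis" "e2 \<in> Basis" "e3 \<in> Basis" for x e1 e2 e3
  proof -
    have m: "[e1, e2, e3] \<in> dirs 3" using e by (simp add: dirs_def)
    have "\<bar>partial (half_space_with S) (map (\<lambda>e. (e, 0)) [e1, e2, e3]) \<Phi> (x, 0)\<bar> \<le> G x"
      unfolding G_def by (rule member_le_sum[OF m]) auto
    also have "\<dots> \<le> B" using B[of x] x by auto
    finally show ?thesis by (simp only: list.map power_0 mult_1_right)
  qed
  have der: "((\<lambda>x. partial (half_space_with S) vs \<Phi> (x, 0)) has_derivative
     (\<lambda>h. \<Sum>e\<in>Basis. (h \<bullet> e) * partial (half_space_with S) ((e, 0) # vs) \<Phi> (x, 0))) (at x within ball p r)"
    if "vs \<in> dirs m" "x \<in> ball p r" for vs m x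
    by (rule has_derivative_at_withinI[OF tangential_derivative[OF bf(3)[of "Suc m"] bf(1) _ that(1) rS[OF that(2)]]]) simp
  have pb: "p \<in> ball p r" using r by simp
  have d: "e \<in> Basis \<Longrightarrow> (e, 0::real) \<in> Basis" for e :: R3 by (simp add: Basis_prod_def)
  have b2: "\<bar>partial (half_space_with S) [(e2, 0), (e3, 0)] \<Phi> (x, 0)\<bar> \<le> (B * 3) * norm (x - p) ^ 1"
    if x: "x \<in> ball p r" and e: "e2 \<in> Basis" "e3 \<in> Basis" for x e2 e3
  proof -
    have "[(e2, 0), (e3, 0)] \<in> (dirs 2 :: R4 list set)" using d e by (simp add: dirs_def)
    from growth_bound[OF convex_ball der[OF this] b3[OF _ _ e] x pb z2[OF e] B0]
    show ?thesis by simp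
  qed
  have b1: "\<bar>partial (half_space_with S) [(e3, 0)] \<Phi> (x, 0)\<bar> \<le> (B * 3 * 3) * norm (x - p) ^ 2"
    if x: "x \<in> ball p r" and e: "e3 \<in> Basis" for x e3
  proof -
    have 1: "[(e3, 0)] \<in> (dirs 1 :: R4 list set)" using d e by (simp add: dirs_def)
    have 2: "0 \<le> B * 3" using B0 by simp
    from growth_bound[OF convex_ball der[OF 1] b2[OF _ _ e] x pb gradient_zero_on_zero_set[OF b p e] 2]
    show ?thesis by (simp add: numeral_2_eq_2 del: partial.simps)
  qed
  have b0: "\<bar>\<Phi> (x, 0)\<bar> \<le> (B * 3 * 3 * 3) * norm (x - p) ^ 3" if x: "x \<in> ball p r" for x
  proof -
    have 2: "0 \<le> B * 3 * 3" using B0 by simp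
    have 3: "partial (half_space_with S) [] \<Phi> (p, 0) = 0" using p by simp
    from growth_bound[OF convex_ball der[OF dirs_Nil] b1 x pb 3 2]
    show ?thesis by (simp add: numeral_3_eq_3)
  qed
  have "0 \<le> B * 3 * 3 * 3" using B0 by simp
  with b0 r(1) show ?thesis by blast
qed

text \<open>In dimension one \<open>growth_bound\<close> loses no factor, so a single constant
  \<open>B\<close> survives repeated integration.\<close>

lemma growth_real:
  fixes g g' :: "real \<Rightarrow> real"
  assumes g: "\<And>t. t \<in> {0..1} \<Longrightarrow> (g has_real_derivative g' t) (at t within {0..1})"
    and B: "\<And>t. t \<in> {0..1} \<Longrightarrow> \<bar>g' t\<bar> \<le> B * t ^ m" and g0: "g 0 = 0" and B0: "0 \<le> B" and t: "t \<in> {0..1}"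
  shows "\<bar>g t\<bar> \<le> B * t ^ Suc m"
proof -
  have "(g has_derivative (\<lambda>h. \<Sum>i\<in>Basis. (h \<bullet> i) * g' s)) (at s within {0..1})" if "s \<in> {0..1}" for s
    using g[OF that] by (simp add: has_field_derivative_def mult_commute_abs)
  moreover have "\<bar>g' s\<bar> \<le> B * norm (s - 0) ^ m" if "s \<in> {0..1}" for s using B[OF that] that by simp
  ultimately have "\<bar>g t\<bar> \<le> (B * DIM(real)) * norm (t - 0) ^ Suc m"
    by (intro growth_bound[of "{0..1}" g "\<lambda>_. g'"]) (use g0 B0 t in auto)
  then show ?thesis using t by simp
qed

text \<open>Taylor expansion upwards from the boundary point, integrated four times from a bound on
  the fourth derivative. The terms of order 0, 1 and 3 vanish, and \<open>\<alpha>\<close> is half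
  the second derivative.\<close>

lemma vertical_expansion:
  assumes b: "profile S \<Phi>" and x: "x \<in> S" "\<Phi> (x, 0) = 0"
  shows "\<exists>\<alpha> B. 0 \<le> B \<and> (\<forall>y\<in>{0..1}. \<bar>\<Phi> (x, y) - \<alpha> * y\<^sup>2\<bar> \<le> B * y ^ 4)"
proof -
  note bf = profile_facts[OF b]
  have ey: "(0::R3, 1::real) \<in> Basis" by (simp add: Basis_prod_def)
  define g where "g = (\<lambda>m y. partial (half_space_with S) (replicate m (0, 1)) \<Phi> (x, y))"
  have d: "replicate m (0, 1) \<in> (dirs m :: R4 list set)" for m using ey by (auto simp: dirs_def)
  have der: "(g m has_real_derivative g (Suc m) y) (at y within {0..1})" if y: "y \<in> {0..1}" for m y
  proof -
    have set: "{s. (x, 0::real) + s *\<^sub>R (0, 1) \<in> half_space_with S} = {0..}" using x by (auto simp: upper_def)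
    have "y \<in> {s. (x, 0::real) + s *\<^sub>R (0, 1) \<in> half_space_with S}" unfolding set using y by simp
    then have X: "(x, 0) + y *\<^sub>R (0, 1) \<in> half_space_with S" by blast
    have "((\<lambda>t. partial (half_space_with S) (replicate m (0, 1)) \<Phi> ((x, 0) + t *\<^sub>R (0, 1))) has_real_derivative
      (\<Sum>k\<in>Basis. ((0, 1) \<bullet> k) * partial (half_space_with S) (k # replicate m (0, 1)) \<Phi> ((x, 0) + y *\<^sub>R (0, 1))))
      (at y within {s. (x, 0) + s *\<^sub>R (0, 1) \<in> half_space_with S})"
      by (rule has_derivative_line[OF Ck_onD[OF bf(3)[of "Suc m"] _ d X]]) simp
    then have "(g m has_real_derivative g (Suc m) y) (at y within {0..})"
      unfolding set sum_Basis_pick[OF ey, of "\<lambda>k. partial (half_space_with S) (k # replicate m (0, 1)) \<Phi> ((x, 0) + y *\<^sub>R (0, 1))"]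
      by (simp add: g_def del: partial.simps)
    then show ?thesis by (rule DERIV_subset) auto
  qed
  have g0: "g 0 y = \<Phi> (x, y)" for y by (simp add: g_def)
  have z: "g 1 0 = 0" "g 3 0 = 0"
    using vertical_third_derivative_zero[OF b x(1)] by (simp_all add: g_def numeral_3_eq_3 del: partial.simps)
  have "continuous_on {0..1} (g 4)"
    by (rule DERIV_continuous_on[of _ _ "g (Suc 4)"]) (rule der)
  from compact_abs_bound[OF compact_Icc this]
  obtain B where B: "\<And>y. y \<in> {0..1} \<Longrightarrow> \<bar>g 4 y\<bar> \<le> B" by blast
  have B0: "0 \<le> B" using B[of 0] by (meson abs_ge_zero atLeastAtMost_iff order_refl order_trans zero_le_one)
  have B3: "\<bar>g 3 y\<bar> \<le> B * y ^ Suc 0" if "y \<in> {0..1}" for y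
    by (rule growth_real[of "g 3" "g 4", OF _ _ z(2) B0 that]) (use B der[of _ 3] in auto)
  have B2: "\<bar>g 2 y - g 2 0\<bar> \<le> B * y ^ Suc (Suc 0)" if y: "y \<in> {0..1}" for y
  proof (rule growth_real[of "\<lambda>y. g 2 y - g 2 0" "g 3", OF _ B3 _ B0 y])
    show "((\<lambda>y. g 2 y - g 2 0) has_real_derivative g 3 t) (at t within {0..1})" if "t \<in> {0..1}" for t
      using DERIV_diff[OF der[OF that, of 2] DERIV_const] by (simp add: numeral_3_eq_3 numeral_2_eq_2)
  qed simp_all
  have B1: "\<bar>g 1 y - g 2 0 * y\<bar> \<le> B * y ^ Suc (Suc (Suc 0))" if y: "y \<in> {0..1}" for y
  proof (rule growth_real[of "\<lambda>y. g 1 y - g 2 0 * y" "\<lambda>y. g 2 y - g 2 0", OF _ B2 _ B0 y])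
    show "((\<lambda>y. g 1 y - g 2 0 * y) has_real_derivative g 2 t - g 2 0) (at t within {0..1})" if "t \<in> {0..1}" for t
      using DERIV_diff[OF der[OF that, of 1] DERIV_cmult[OF DERIV_ident, of "g 2 0"]] by (simp add: numeral_2_eq_2)
  qed (use z in simp_all)
  have B0': "\<bar>g 0 y - g 2 0 / 2 * y\<^sup>2\<bar> \<le> B * y ^ Suc (Suc (Suc (Suc 0)))" if y: "y \<in> {0..1}" for y
  proof (rule growth_real[of "\<lambda>y. g 0 y - g 2 0 / 2 * y\<^sup>2" "\<lambda>y. g 1 y - g 2 0 * y", OF _ B1 _ B0 y])
    show "((\<lambda>y. g 0 y - g 2 0 / 2 * y\<^sup>2) has_real_derivative g 1 t - g 2 0 * t) (at t within {0..1})" if "t \<in> {0..1}" for t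
      using der[OF that, of 0] by (auto intro!: derivative_eq_intros)
  qed (simp_all add: g0 x)
  have s4: "Suc (Suc (Suc (Suc 0))) = 4" by simp
  have "\<forall>y\<in>{0..1}. \<bar>\<Phi> (x, y) - g 2 0 / 2 * y\<^sup>2\<bar> \<le> B * y ^ 4" using B0' unfolding g0 s4 by blast
  with B0 show ?thesis by blast
qed

text \<open>Compares the Poisson denominator with the weight of \<open>L6\<close>: for fixed
  \<open>x\<close> and \<open>y\<close> the quantity
  \<open>y\<^sup>2 + (norm (x - x'))\<^sup>2\<close> dominates, up to constants, both 1 and
  \<open>(norm x')\<^sup>2\<close>; cubing gives the sixth power.\<close>

lemma poisson_weight_bound:
  fixes x x' :: R3
  assumes y: "0 < y"
  shows "1 + norm x' ^ 6 \<le> ((1 / y\<^sup>2) ^ 3 + (2 * (norm x)\<^sup>2 / y\<^sup>2 + 2) ^ 3) * (y\<^sup>2 + (norm (x - x'))\<^sup>2) ^ 3"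
proof -
  define \<rho> where "\<rho> = y\<^sup>2 + (norm (x - x'))\<^sup>2"
  have y2: "0 < y\<^sup>2" using y by simp
  have \<rho>: "y\<^sup>2 \<le> \<rho>" "(norm (x - x'))\<^sup>2 \<le> \<rho>" by (auto simp: \<rho>_def)
  have "1 \<le> 1 / y\<^sup>2 * \<rho>" using \<rho> y2 by (simp add: field_simps)
  then have "1 ^ 3 \<le> (1 / y\<^sup>2 * \<rho>) ^ 3" by (intro power_mono) auto
  then have 1: "1 \<le> (1 / y\<^sup>2) ^ 3 * \<rho> ^ 3" by (simp only: power_mult_distrib power_one)
  have n: "norm x' \<le> norm x + norm (x - x')" using norm_triangle_ineq4[of x "x - x'"] by simp
  have "(norm x')\<^sup>2 \<le> (norm x + norm (x - x'))\<^sup>2" using n by (intro power_mono) auto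
  also have "\<dots> \<le> 2 * (norm x)\<^sup>2 + 2 * (norm (x - x'))\<^sup>2"
    using sum_squares_bound[of "norm x" "norm (x - x')"] by (simp add: power2_sum)
  also have "\<dots> \<le> 2 * (norm x)\<^sup>2 * (1 / y\<^sup>2 * \<rho>) + 2 * \<rho>"
    using \<open>1 \<le> 1 / y\<^sup>2 * \<rho>\<close> \<rho> mult_left_mono[of 1 "1 / y\<^sup>2 * \<rho>" "2 * (norm x)\<^sup>2"] by simp
  also have "\<dots> = (2 * (norm x)\<^sup>2 / y\<^sup>2 + 2) * \<rho>" by (simp add: algebra_simps)
  finally have "((norm x')\<^sup>2) ^ 3 \<le> ((2 * (norm x)\<^sup>2 / y\<^sup>2 + 2) * \<rho>) ^ 3" by (intro power_mono) auto
  then have "norm x' ^ 6 \<le> (2 * (norm x)\<^sup>2 / y\<^sup>2 + 2) ^ 3 * \<rho> ^ 3" by (simp add: power_mult[symmetric] power_mult_distrib)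
  with 1 show ?thesis unfolding \<rho>_def[symmetric] by (simp add: distrib_right)
qed

text \<open>Since \<Phi> is nonpositive on the boundary, the Poisson formula can be rewritten with
  its absolute value; then every integrand is nonnegative and can be estimated by comparison or by
  restriction to a ball. Integrability comes from membership in \<open>L6\<close>.\<close>

lemma poisson_facts:
  assumes b: "profile S \<Phi>"
  shows "integrable lborel (\<lambda>x. \<bar>\<Phi> (x, 0)\<bar> / (1 + norm x ^ 6))"
    and "\<And>x y. 0 < y \<Longrightarrow> integrable lborel (\<lambda>x'. y ^ 3 / (y\<^sup>2 + (norm (x - x'))\<^sup>2) ^ 3 * \<bar>\<Phi> (x', 0)\<bar>)"
    and "\<And>x y. 0 < y \<Longrightarrow> \<Phi> (x, y) = - (4 / pi\<^sup>2 * (LINT x'|lborel. y ^ 3 / (y\<^sup>2 + (norm (x - x'))\<^sup>2) ^ 3 * \<bar>\<Phi> (x', 0)\<bar>))"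
proof -
  note bf = profile_facts[OF b]
  have [measurable]: "bdry \<Phi> \<in> borel_measurable borel" using bf(6) by (rule borel_measurable_continuous_onI)
  have m1: "(\<lambda>x. \<bar>\<Phi> (x, 0)\<bar> / (1 + norm x ^ 6)) \<in> borel_measurable lborel" by measurable
  have "integrable lebesgue (\<lambda>x. \<bar>\<Phi> (x, 0)\<bar> / (1 + norm x ^ 6))"
    using b by (simp add: profile_def representable_def L6_def)
  then show i1: "integrable lborel (\<lambda>x. \<bar>\<Phi> (x, 0)\<bar> / (1 + norm x ^ 6))"
    using integrable_completion[OF m1] by simp
  fix x :: R3 and y assume y: "0 < (y::real)"
  define C where "C = (1 / y\<^sup>2) ^ 3 + (2 * (norm x)\<^sup>2 / y\<^sup>2 + 2) ^ 3"
  show "integrable lborel (\<lambda>x'. y ^ 3 / (y\<^sup>2 + (norm (x - x'))\<^sup>2) ^ 3 * \<bar>\<Phi> (x', 0)\<bar>)"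
  proof (rule Bochner_Integration.integrable_bound[OF integrable_mult_right[OF i1, of "y ^ 3 * C"]])
    show "AE x' in lborel. norm (y ^ 3 / (y\<^sup>2 + (norm (x - x'))\<^sup>2) ^ 3 * \<bar>\<Phi> (x', 0)\<bar>) \<le> norm (y ^ 3 * C * (\<bar>\<Phi> (x', 0)\<bar> / (1 + norm x' ^ 6)))"
    proof (rule AE_I2)
      fix x' :: R3
      have gen: "\<bar>s\<bar> \<le> \<bar>t\<bar>" if "s \<le> t" "0 \<le> s" for s t :: real using that by linarith
      define \<rho> where "\<rho> = (y\<^sup>2 + (norm (x - x'))\<^sup>2) ^ 3"
      have \<rho>: "0 < \<rho>" using y by (simp add: \<rho>_def add_pos_nonneg)
      have n6: "0 < 1 + norm x' ^ 6" by (simp add: add_pos_nonneg)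
      have "1 + norm x' ^ 6 \<le> C * \<rho>" unfolding C_def \<rho>_def by (rule poisson_weight_bound[OF y])
      then have "1 / \<rho> \<le> C / (1 + norm x' ^ 6)" using \<rho> n6 by (simp add: field_simps)
      then have "y ^ 3 * \<bar>\<Phi> (x', 0)\<bar> * (1 / \<rho>) \<le> y ^ 3 * \<bar>\<Phi> (x', 0)\<bar> * (C / (1 + norm x' ^ 6))"
        using y by (intro mult_left_mono) auto
      moreover have "0 \<le> y ^ 3 * \<bar>\<Phi> (x', 0)\<bar> * (1 / \<rho>)" using \<rho> y by simp
      ultimately have "\<bar>y ^ 3 * \<bar>\<Phi> (x', 0)\<bar> * (1 / \<rho>)\<bar> \<le> \<bar>y ^ 3 * \<bar>\<Phi> (x', 0)\<bar> * (C / (1 + norm x' ^ 6))\<bar>"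
        by (rule gen)
      moreover have "y ^ 3 / \<rho> * \<bar>\<Phi> (x', 0)\<bar> = y ^ 3 * \<bar>\<Phi> (x', 0)\<bar> * (1 / \<rho>)"
        "y ^ 3 * C * (\<bar>\<Phi> (x', 0)\<bar> / (1 + norm x' ^ 6)) = y ^ 3 * \<bar>\<Phi> (x', 0)\<bar> * (C / (1 + norm x' ^ 6))" by simp_all
      ultimately show "norm (y ^ 3 / (y\<^sup>2 + (norm (x - x'))\<^sup>2) ^ 3 * \<bar>\<Phi> (x', 0)\<bar>) \<le> norm (y ^ 3 * C * (\<bar>\<Phi> (x', 0)\<bar> / (1 + norm x' ^ 6)))"
        unfolding \<rho>_def[symmetric] real_norm_def by (simp only:)
    qed
  qed measurable
  have m2: "(\<lambda>x'. y ^ 3 / (y\<^sup>2 + (norm (x - x'))\<^sup>2) ^ 3 * \<Phi> (x', 0)) \<in> borel_measurable lborel" by measurable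
  have "\<Phi> (x, y) = 4 / pi\<^sup>2 * (LINT x'|lebesgue. y ^ 3 / (y\<^sup>2 + (norm (x - x'))\<^sup>2) ^ 3 * bdry \<Phi> x')"
    using b y unfolding profile_def representable_def by blast
  also have "(LINT x'|lebesgue. y ^ 3 / (y\<^sup>2 + (norm (x - x'))\<^sup>2) ^ 3 * bdry \<Phi> x') = (LINT x'|lborel. y ^ 3 / (y\<^sup>2 + (norm (x - x'))\<^sup>2) ^ 3 * bdry \<Phi> x')"
    by (rule integral_completion[OF m2])
  also have "\<dots> = (LINT x'|lborel. - (y ^ 3 / (y\<^sup>2 + (norm (x - x'))\<^sup>2) ^ 3 * \<bar>\<Phi> (x', 0)\<bar>))"
    by (rule Bochner_Integration.integral_cong) (use bf(5) in auto)
  finally show "\<Phi> (x, y) = - (4 / pi\<^sup>2 * (LINT x'|lborel. y ^ 3 / (y\<^sup>2 + (norm (x - x'))\<^sup>2) ^ 3 * \<bar>\<Phi> (x', 0)\<bar>))" by simp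
qed

text \<open>Only the contribution of a ball on which \<Phi> is at most \<open>- c\<close> is kept;
  for \<open>y \<le> 1\<close> the Poisson denominator there is at most
  \<open>(1 + D\<^sup>2) ^ 3\<close>, so the factor \<open>y ^ 3\<close> survives.\<close>

lemma vertical_upper_bound:
  assumes b: "profile S \<Phi>"
  shows "\<exists>a>0. \<forall>y. 0 < y \<longrightarrow> y \<le> 1 \<longrightarrow> \<Phi> (x, y) \<le> - a * y ^ 3"
proof -
  obtain p c r where p: "0 < c" "0 < r" "\<And>x. x \<in> ball p r \<Longrightarrow> \<Phi> (x, 0) \<le> - c" using profile_facts(10)[OF b] by blast
  define D where "D = norm (x - p) + r"
  define m where "m = measure lborel (ball p r)"
  have m: "0 < m" unfolding m_def using content_ball_pos[OF p(2)] by simp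
  define a where "a = 4 / pi\<^sup>2 * (c / (1 + D\<^sup>2) ^ 3 * m)"
  have D1: "0 < (1 + D\<^sup>2) ^ 3" by (simp add: add_pos_nonneg)
  have a: "0 < a" using p m D1 by (simp add: a_def)
  have "\<Phi> (x, y) \<le> - a * y ^ 3" if y: "0 < y" "y \<le> 1" for y
  proof -
    have ib: "integrable lborel (\<lambda>x'. (y ^ 3 * (c / (1 + D\<^sup>2) ^ 3)) * indicator (ball p r) x')"
      by (intro integrable_mult_right integrable_real_indicator)
        (simp_all add: emeasure_bounded_finite[OF bounded_ball, unfolded infinity_ennreal_def])
    have "(LINT x'|lborel. (y ^ 3 * (c / (1 + D\<^sup>2) ^ 3)) * indicator (ball p r) x')
       \<le> (LINT x'|lborel. y ^ 3 / (y\<^sup>2 + (norm (x - x'))\<^sup>2) ^ 3 * \<bar>\<Phi> (x', 0)\<bar>)"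
    proof (rule integral_mono[OF ib poisson_facts(2)[OF b y(1)]])
      fix x'
      define \<rho> where "\<rho> = (y\<^sup>2 + (norm (x - x'))\<^sup>2) ^ 3"
      have \<rho>: "0 < \<rho>" using y by (simp add: \<rho>_def add_pos_nonneg)
      show "(y ^ 3 * (c / (1 + D\<^sup>2) ^ 3)) * indicator (ball p r) x' \<le> y ^ 3 / (y\<^sup>2 + (norm (x - x'))\<^sup>2) ^ 3 * \<bar>\<Phi> (x', 0)\<bar>"
      proof (cases "x' \<in> ball p r")
        case True
        have "norm (x - x') \<le> norm (x - p) + norm (p - x')" using norm_triangle_ineq[of "x - p" "p - x'"] by simp
        then have "norm (x - x') \<le> D" using True by (simp add: D_def dist_norm)
        then have "(norm (x - x'))\<^sup>2 \<le> D\<^sup>2" by (intro power_mono) auto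
        moreover have "y\<^sup>2 \<le> 1" using y by (simp add: power_le_one)
        ultimately have "\<rho> \<le> (1 + D\<^sup>2) ^ 3" unfolding \<rho>_def by (intro power_mono) auto
        then have "c / (1 + D\<^sup>2) ^ 3 \<le> \<bar>\<Phi> (x', 0)\<bar> / \<rho>" using p(1) p(3)[OF True] \<rho> by (intro frac_le) auto
        then have "y ^ 3 * (c / (1 + D\<^sup>2) ^ 3) \<le> y ^ 3 * (\<bar>\<Phi> (x', 0)\<bar> / \<rho>)" using y by (intro mult_left_mono) auto
        then show ?thesis using True by (simp add: \<rho>_def)
      next
        case False
        then show ?thesis using \<rho> y by (simp add: \<rho>_def[symmetric])
      qed
    qed
    also have "(LINT x'|lborel. (y ^ 3 * (c / (1 + D\<^sup>2) ^ 3)) * indicator (ball p r) x') = (y ^ 3 * (c / (1 + D\<^sup>2) ^ 3)) * m"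
      by (simp add: m_def)
    finally have "4 / pi\<^sup>2 * ((y ^ 3 * (c / (1 + D\<^sup>2) ^ 3)) * m)
       \<le> 4 / pi\<^sup>2 * (LINT x'|lborel. y ^ 3 / (y\<^sup>2 + (norm (x - x'))\<^sup>2) ^ 3 * \<bar>\<Phi> (x', 0)\<bar>)"
      by (intro mult_left_mono) auto
    then show ?thesis unfolding poisson_facts(3)[OF b y(1)] a_def by (simp add: mult_ac)
  qed
  then show ?thesis using a by blast
qed

text \<open>Near \<open>p\<close> the cubic bound together with \<open>y powr (1/2) * n powr (11/2)
  \<le> (y\<^sup>2 + n\<^sup>2) ^ 3\<close> leaves \<open>y powr (5/2) * n powr - (5/2)\<close>,
  which is integrable in three dimensions, whereas exponent 3 would diverge logarithmically. Away
  from \<open>p\<close> the kernel is at most a constant times \<open>y ^ 3\<close> and the weight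
  of \<open>L6\<close>, and \<open>y ^ 3 \<le> y powr (5/2)\<close>.\<close>

lemma vertical_lower_bound:
  assumes b: "profile S \<Phi>" and C: "0 \<le> C" "0 < r" "\<And>x. x \<in> ball p r \<Longrightarrow> \<bar>\<Phi> (x, 0)\<bar> \<le> C * norm (x - p) ^ 3"
  shows "\<exists>A\<ge>0. \<forall>y. 0 < y \<longrightarrow> y \<le> 1 \<longrightarrow> \<bar>\<Phi> (p, y)\<bar> \<le> A * y powr (5/2)"
proof -
  \<comment> \<open>The factor 8 is the cube of the 2 in
    \<open>r\<^sup>2 + n\<^sup>2 \<le> 2 * (y\<^sup>2 + n\<^sup>2)\<close>, valid for
    \<open>n \<ge> r\<close>.\<close>
  define C' where "C' = ((1 / r\<^sup>2) ^ 3 + (2 * (norm p)\<^sup>2 / r\<^sup>2 + 2) ^ 3) * 8"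
  have C': "0 \<le> C'" by (simp add: C'_def)
  define H where "H = (\<lambda>x. C * (indicator (ball p r) x * norm (x - p) powr - (5/2)) + C' * (\<bar>\<Phi> (x, 0)\<bar> / (1 + norm x ^ 6)))"
  obtain J :: real where J: "\<And>a::R3. integrable lborel (\<lambda>x. indicator (ball p r) x * norm (x - a) powr - (5/2))"
    using integrable_riesz_bounded[of "5/2" "ball p r"] by auto
  have H: "integrable lborel H"
    unfolding H_def by (intro Bochner_Integration.integrable_add integrable_mult_right J poisson_facts(1)[OF b])
  have H0: "0 \<le> H x" for x unfolding H_def using C C' by (intro add_nonneg_nonneg mult_nonneg_nonneg divide_nonneg_nonneg) auto
  define A where "A = 4 / pi\<^sup>2 * (LINT x|lborel. H x)"
  have A: "0 \<le> A" unfolding A_def using H0 by (intro mult_nonneg_nonneg integral_nonneg_AE) auto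
  have "\<bar>\<Phi> (p, y)\<bar> \<le> A * y powr (5/2)" if y: "0 < y" "y \<le> 1" for y
  proof -
    define K where "K = (\<lambda>x. y ^ 3 / (y\<^sup>2 + (norm (p - x))\<^sup>2) ^ 3 * \<bar>\<Phi> (x, 0)\<bar>)"
    have y3: "y ^ 3 \<le> y powr (5/2)" using powr_mono'[of "5/2" 3 y] y by (simp add: powr_numeral)
    have bd: "AE x in lborel. K x \<le> y powr (5/2) * H x"
      using AE_lborel_singleton[of p]
    proof eventually_elim
      case (elim x)
      define n where "n = norm (x - p)"
      have n: "0 < n" "norm (p - x) = n" using elim by (auto simp: n_def norm_minus_commute)
      define \<rho> where "\<rho> = (y\<^sup>2 + n\<^sup>2) ^ 3"
      have \<rho>: "0 < \<rho>" using y by (simp add: \<rho>_def add_pos_nonneg)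
      have Kx: "K x = y ^ 3 / \<rho> * \<bar>\<Phi> (x, 0)\<bar>" by (simp add: K_def \<rho>_def n)
      have p0: "0 \<le> \<bar>\<Phi> (x, 0)\<bar> / (1 + norm x ^ 6)" by simp
      show ?case
      proof (cases "x \<in> ball p r")
        case True
        have s: "0 < y\<^sup>2 + n\<^sup>2" using y by (simp add: add_pos_nonneg)
        \<comment> \<open>The exponent 3 of the denominator is split as \<open>1/4 + 11/4\<close>
          between the two squares.\<close>
        have "y powr (1/2) * n powr (11/2) = (y\<^sup>2) powr (1/4) * (n\<^sup>2) powr (11/4)"
          using y n by (simp add: powr_numeral[symmetric] powr_powr del: powr_numeral)
        also have "\<dots> \<le> (y\<^sup>2 + n\<^sup>2) powr (1/4) * (y\<^sup>2 + n\<^sup>2) powr (11/4)"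
          by (intro mult_mono powr_mono2) auto
        also have "\<dots> = (y\<^sup>2 + n\<^sup>2) powr 3" by (simp add: powr_add[symmetric])
        also have "\<dots> = \<rho>" using s by (simp add: \<rho>_def powr_numeral)
        finally have le: "y powr (1/2) * n powr (11/2) \<le> \<rho>" .
        have yn: "0 < y powr (1/2) * n powr (11/2)" using y n by simp
        have "K x \<le> y ^ 3 / \<rho> * (C * n ^ 3)"
          unfolding Kx using C(3)[OF True] y \<rho> by (intro mult_left_mono) (auto simp: n_def)
        also have "\<dots> \<le> y ^ 3 / (y powr (1/2) * n powr (11/2)) * (C * n ^ 3)"
          using le yn y n C by (intro mult_right_mono divide_left_mono mult_pos_pos \<rho>) auto
        also have "\<dots> = C * ((y powr 3 / y powr (1/2)) * (n powr 3 / n powr (11/2)))"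
          using y n by (simp add: powr_numeral)
        also have "\<dots> = C * (y powr (5/2) * n powr - (5/2))" by (simp add: powr_diff[symmetric])
        also have "\<dots> \<le> y powr (5/2) * H x"
          using True C' p0 y by (simp add: H_def n_def distrib_left mult_ac)
        finally show ?thesis .
      next
        case False
        then have rn: "r \<le> n" by (simp add: n_def dist_norm norm_minus_commute)
        have "(r\<^sup>2 + n\<^sup>2) ^ 3 \<le> (2 * (y\<^sup>2 + n\<^sup>2)) ^ 3"
        proof (intro power_mono)
          have "r\<^sup>2 \<le> n\<^sup>2" using rn C(2) by (intro power_mono) auto
          then have "r\<^sup>2 + n\<^sup>2 \<le> n\<^sup>2 + n\<^sup>2" by (rule add_right_mono)
          also have "\<dots> \<le> 2 * (y\<^sup>2 + n\<^sup>2)" by simp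
          finally show "r\<^sup>2 + n\<^sup>2 \<le> 2 * (y\<^sup>2 + n\<^sup>2)" .
        qed simp
        also have "\<dots> = 8 * \<rho>" by (simp only: \<rho>_def power_mult_distrib) simp
        finally have r8: "(r\<^sup>2 + n\<^sup>2) ^ 3 \<le> 8 * \<rho>" .
        have "1 + norm x ^ 6 \<le> ((1 / r\<^sup>2) ^ 3 + (2 * (norm p)\<^sup>2 / r\<^sup>2 + 2) ^ 3) * (r\<^sup>2 + n\<^sup>2) ^ 3"
          using poisson_weight_bound[OF C(2), of x p] n by simp
        also have "\<dots> \<le> ((1 / r\<^sup>2) ^ 3 + (2 * (norm p)\<^sup>2 / r\<^sup>2 + 2) ^ 3) * (8 * \<rho>)"
          using r8 by (intro mult_left_mono) auto
        also have "\<dots> = C' * \<rho>" by (simp add: C'_def)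
        finally have w: "1 + norm x ^ 6 \<le> C' * \<rho>" .
        have n6: "0 < 1 + norm x ^ 6" by (simp add: add_pos_nonneg)
        have "1 / \<rho> \<le> C' / (1 + norm x ^ 6)" using w n6 \<rho> by (simp add: field_simps)
        then have "y ^ 3 * \<bar>\<Phi> (x, 0)\<bar> * (1 / \<rho>) \<le> y powr (5/2) * \<bar>\<Phi> (x, 0)\<bar> * (C' / (1 + norm x ^ 6))"
          using y y3 \<rho> by (intro mult_mono) auto
        then show ?thesis using False unfolding Kx H_def by (simp add: mult_ac)
      qed
    qed
    have "(LINT x|lborel. K x) \<le> (LINT x|lborel. y powr (5/2) * H x)"
      by (rule integral_mono_AE[OF _ integrable_mult_right[OF H] bd]) (use poisson_facts(2)[OF b y(1)] in \<open>simp add: K_def\<close>)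
    then have le: "(LINT x|lborel. K x) \<le> y powr (5/2) * (LINT x|lborel. H x)" by simp
    have K0: "0 \<le> (LINT x|lborel. K x)" using y by (intro integral_nonneg_AE AE_I2) (simp add: K_def)
    have "\<bar>\<Phi> (p, y)\<bar> = 4 / pi\<^sup>2 * (LINT x|lborel. K x)"
      using poisson_facts(3)[OF b y(1), of p] K0 unfolding K_def by (simp add: abs_mult)
    also have "\<dots> \<le> 4 / pi\<^sup>2 * (y powr (5/2) * (LINT x|lborel. H x))" using le by (intro mult_left_mono) auto
    finally show ?thesis by (simp add: A_def mult_ac)
  qed
  then show ?thesis using A by blast
qed

text \<open>\<open>y powr (5/2)\<close> and \<open>y ^ 4\<close> are of smaller order than
  \<open>y\<^sup>2\<close>, so \<alpha> vanishes; then \<open>y ^ 4\<close> cannot compensate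
  \<open>a * y ^ 3\<close>. Each step is made explicit with one small \<open>y\<close>.\<close>

lemma vertical_asymptotics_contradiction:
  fixes \<phi> :: "real \<Rightarrow> real"
  assumes a: "0 < a" "\<And>y. 0 < y \<Longrightarrow> y \<le> 1 \<Longrightarrow> \<phi> y \<le> - a * y ^ 3"
    and A: "0 \<le> A" "\<And>y. 0 < y \<Longrightarrow> y \<le> 1 \<Longrightarrow> \<bar>\<phi> y\<bar> \<le> A * y powr (5/2)"
    and B: "0 \<le> B" "\<And>y. 0 < y \<Longrightarrow> y \<le> 1 \<Longrightarrow> \<bar>\<phi> y - \<alpha> * y\<^sup>2\<bar> \<le> B * y ^ 4"
  shows False
proof -
  have "\<alpha> = 0"
  proof (rule ccontr)
    assume \<alpha>: "\<alpha> \<noteq> 0"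
    define s where "s = min 1 (\<bar>\<alpha>\<bar> / (2 * (A + B + 1)))"
    have s: "0 < s" "s \<le> 1" using \<alpha> A B by (auto simp: s_def)
    \<comment> \<open>Squaring turns the half-integer power into \<open>s ^ 5\<close>.\<close>
    define y where "y = s\<^sup>2"
    have y: "0 < y" "y \<le> 1" using s by (auto simp: y_def power_le_one)
    have "y powr (5/2) = s ^ 5" using s by (simp add: y_def powr_numeral[symmetric] powr_powr del: powr_numeral)
    moreover have "y ^ 4 = s ^ 8" "y\<^sup>2 = s ^ 4" by (auto simp: y_def power_mult[symmetric])
    moreover have "s ^ 8 \<le> s ^ 5" using s by (intro power_decreasing) auto
    then have "B * s ^ 8 \<le> B * s ^ 5" using B by (intro mult_left_mono)
    moreover have "\<bar>\<alpha> * y\<^sup>2\<bar> \<le> A * y powr (5/2) + B * y ^ 4" using A(2)[OF y] B(2)[OF y] by linarith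
    ultimately have "\<bar>\<alpha>\<bar> * s ^ 4 \<le> A * s ^ 5 + B * s ^ 5" using s by (simp add: abs_mult)
    also have "\<dots> = ((A + B) * s) * s ^ 4" by (simp add: power_numeral_reduce algebra_simps)
    finally have "\<bar>\<alpha>\<bar> \<le> (A + B) * s" using s by simp
    also have "\<dots> \<le> (A + B) * (\<bar>\<alpha>\<bar> / (2 * (A + B + 1)))" using A B by (intro mult_left_mono) (auto simp: s_def)
    also have "\<dots> = \<bar>\<alpha>\<bar> * ((A + B) / (2 * (A + B + 1)))" by simp
    also have "\<dots> < \<bar>\<alpha>\<bar> * 1" using \<alpha> A B by (intro mult_strict_left_mono) (auto simp: field_simps)
    finally show False by simp
  qed
  define y where "y = min 1 (a / (2 * (B + 1)))"
  have y: "0 < y" "y \<le> 1" using a B by (auto simp: y_def)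
  have "a * y ^ 3 \<le> B * y ^ 4" using a(2)[OF y] B(2)[OF y] \<open>\<alpha> = 0\<close> by simp
  also have "\<dots> = (B * y) * y ^ 3" by (simp add: power_numeral_reduce)
  finally have "a \<le> B * y" using y by simp
  also have "\<dots> \<le> B * (a / (2 * (B + 1)))" using B by (intro mult_left_mono) (auto simp: y_def)
  also have "\<dots> = a * (B / (2 * (B + 1)))" by simp
  also have "\<dots> < a * 1" using a B by (intro mult_strict_left_mono) (auto simp: field_simps)
  finally show False by simp
qed

lemma nondegenerate_on_zero_set:
  assumes b: "profile S \<Phi>" and p: "p \<in> S" "\<Phi> (p, 0) = 0"
  shows "\<exists>e\<in>Basis. \<exists>e'\<in>Basis. partial (half_space_with S) [(e, 0), (e', 0)] \<Phi> (p, 0) \<noteq> 0"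
proof (rule ccontr)
  assume "\<not> ?thesis"
  then have z2: "partial (half_space_with S) [(e, 0), (e', 0)] \<Phi> (p, 0) = 0" if "e \<in> Basis" "e' \<in> Basis" for e e' using that by blast
  obtain C r where C: "0 \<le> C" "0 < r" "\<And>x. x \<in> ball p r \<Longrightarrow> \<bar>\<Phi> (x, 0)\<bar> \<le> C * norm (x - p) ^ 3"
    using cubic_vanishing[OF b p z2] by blast
  obtain A where A: "0 \<le> A" "\<And>y. 0 < y \<Longrightarrow> y \<le> 1 \<Longrightarrow> \<bar>\<Phi> (p, y)\<bar> \<le> A * y powr (5/2)"
    using vertical_lower_bound[OF b C] by blast
  obtain a where a: "0 < a" "\<And>y. 0 < y \<Longrightarrow> y \<le> 1 \<Longrightarrow> \<Phi> (p, y) \<le> - a * y ^ 3"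
    using vertical_upper_bound[OF b] by blast
  obtain \<alpha> B where B: "0 \<le> B" "\<forall>y\<in>{0..1}. \<bar>\<Phi> (p, y) - \<alpha> * y\<^sup>2\<bar> \<le> B * y ^ 4"
    using vertical_expansion[OF b p] by blast
  show False
    by (rule vertical_asymptotics_contradiction[OF a A B(1), of \<alpha>]) (use B(2) in auto)
qed

text \<open>The level set used is that of a first tangential derivative: all of these vanish at
  zeros of \<Phi>, and near \<open>p\<close> one of them has a nonzero derivative in a tangential
  direction. Negligibility is a local property.\<close>

lemma zero_set_negligible:
  assumes b: "profile S \<Phi>"
  shows "negligible (zero_set S \<Phi>)"
  unfolding locally_negligible_alt[of "zero_set S \<Phi>"]
proof
  fix p assume "p \<in> zero_set S \<Phi>"
  then have p: "p \<in> S" "\<Phi> (p, 0) = 0" by (auto simp: zero_set_def)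
  note bf = profile_facts[OF b]
  obtain e e' where e: "e \<in> Basis" "e' \<in> Basis" and nz: "partial (half_space_with S) [(e, 0), (e', 0)] \<Phi> (p, 0) \<noteq> 0"
    using nondegenerate_on_zero_set[OF b p] by blast
  define D where "D = (\<lambda>x. partial (half_space_with S) [(e, 0), (e', 0)] \<Phi> (x, 0))"
  define h where "h = (\<lambda>x. partial (half_space_with S) [(e', 0)] \<Phi> (x, 0))"
  have d: "(e, 0::real) \<in> Basis" "(e', 0::real) \<in> Basis" using e by (auto simp: Basis_prod_def)
  have d1: "[(e', 0)] \<in> (dirs 1 :: R4 list set)" and d2: "[(e, 0), (e', 0)] \<in> (dirs 2 :: R4 list set)"
    using d by (auto simp: dirs_def)
  have cD: "continuous_on S D" unfolding D_def by (rule continuous_on_tangential[OF b d2])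
  have ch: "continuous_on S h" unfolding h_def by (rule continuous_on_tangential[OF b d1])
  have "0 < \<bar>D p\<bar>" using nz by (simp add: D_def del: partial.simps)
  from continuous_on_open_near[OF bf(1) cD p(1) this]
  obtain r where r: "0 < r" "ball p r \<subseteq> S" "\<And>x. x \<in> ball p r \<Longrightarrow> \<bar>D x - D p\<bar> < \<bar>D p\<bar>" by blast
  have N: "negligible {x \<in> ball p r. h x = 0}"
  proof (rule null_level_set[OF r(1) continuous_on_subset[OF ch r(2)], of e D])
    show "((\<lambda>t. h (x + t *\<^sub>R e)) has_real_derivative D x) (at 0)" if "x \<in> ball p r" for x
      unfolding h_def D_def
      by (rule tangential_line_derivative[OF bf(3)[of 2] bf(1) _ d1 _ e(1)]) (use that r(2) in auto)
    show "D x \<noteq> 0" if "x \<in> ball p r" for x using r(3)[OF that] by auto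
  qed
  have "zero_set S \<Phi> \<inter> ball p r \<subseteq> {x \<in> ball p r. h x = 0}"
    unfolding h_def zero_set_def using gradient_zero_on_zero_set[OF b _ _ e(2)] by blast
  then have "negligible (zero_set S \<Phi> \<inter> ball p r)" using N negligible_subset by blast
  moreover have "openin (top_of_set (zero_set S \<Phi>)) (zero_set S \<Phi> \<inter> ball p r)" by (simp add: openin_open_Int)
  moreover have "p \<in> zero_set S \<Phi> \<inter> ball p r" using p r by (simp add: zero_set_def)
  ultimately show "\<exists>U. openin (top_of_set (zero_set S \<Phi>)) U \<and> p \<in> U \<and> negligible U" by blast
qed

section \<open>Hoelder norms\<close>

lemma sup_ennreal_le:
  assumes "\<And>X. X \<in> K \<Longrightarrow> g X \<le> B"
  shows "(SUP X\<in>K. ennreal (g X)) \<le> ennreal B"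
  by (rule SUP_least) (simp add: assms ennreal_leI)

text \<open>All terms of the norm share one bound, so the norm is at most that bound times the
  number of words; the factor does not depend on \<open>f\<close>, which is what convergence
  needs.\<close>

lemma holder_norm_le:
  assumes B: "\<And>j vs X. j \<le> m \<Longrightarrow> vs \<in> dirs j \<Longrightarrow> X \<in> K \<Longrightarrow> \<bar>partial S vs f X\<bar> \<le> B"
    and H: "\<And>vs X Y. vs \<in> dirs m \<Longrightarrow> X \<in> K \<Longrightarrow> Y \<in> K \<Longrightarrow> X \<noteq> Y \<Longrightarrow>
      \<bar>partial S vs f X - partial S vs f Y\<bar> \<le> B * dist X Y powr \<alpha>"
  shows "holder_norm m \<alpha> S K (f :: 'a::euclidean_space \<Rightarrow> real) \<le>
    ennreal (real ((\<Sum>j\<le>m. card (dirs j :: 'a list set)) + card (dirs m :: 'a list set)) * B)"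
proof -
  have 1: "(SUP X\<in>K. ennreal \<bar>partial S vs f X\<bar>) \<le> ennreal B" if "j \<le> m" "vs \<in> dirs j" for j vs
    by (rule sup_ennreal_le) (rule B[OF that])
  have 2: "(SUP (X, Y)\<in>{(X, Y). X \<in> K \<and> Y \<in> K \<and> X \<noteq> Y}. ennreal (\<bar>partial S vs f X - partial S vs f Y\<bar> / dist X Y powr \<alpha>)) \<le> ennreal B"
    if "vs \<in> dirs m" for vs
  proof (rule SUP_least)
    fix p assume "p \<in> {(X, Y). X \<in> K \<and> Y \<in> K \<and> X \<noteq> Y}"
    then obtain X Y where p: "p = (X, Y)" "X \<in> K" "Y \<in> K" "X \<noteq> Y" by blast
    have "0 < dist X Y powr \<alpha>" using p(4) by simp
    then have "\<bar>partial S vs f X - partial S vs f Y\<bar> / dist X Y powr \<alpha> \<le> B"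
      using H[OF that p(2-4)] by (subst pos_divide_le_eq)
    then show "(case p of (X, Y) \<Rightarrow> ennreal (\<bar>partial S vs f X - partial S vs f Y\<bar> / dist X Y powr \<alpha>)) \<le> ennreal B"
      unfolding p(1) prod.case by (rule ennreal_leI)
  qed
  have "holder_norm m \<alpha> S K f \<le> (\<Sum>j\<le>m. \<Sum>vs\<in>(dirs j :: 'a list set). ennreal B) + (\<Sum>vs\<in>(dirs m :: 'a list set). ennreal B)"
    unfolding holder_norm_def by (intro add_mono sum_mono 1 2) auto
  also have "\<dots> = of_nat ((\<Sum>j\<le>m. card (dirs j :: 'a list set)) + card (dirs m :: 'a list set)) * ennreal B"
    by (simp add: sum_distrib_right distrib_right)
  also have "\<dots> = ennreal (real ((\<Sum>j\<le>m. card (dirs j :: 'a list set)) + card (dirs m :: 'a list set)) * B)"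
    by (simp only: ennreal_of_nat_eq_real_of_nat ennreal_mult' of_nat_0_le_iff ennreal_mult''[symmetric])
  finally show ?thesis .
qed

lemma holder_norm_finiteI:
  fixes f :: "'a::euclidean_space \<Rightarrow> real"
  assumes B: "\<And>j vs. j \<le> m \<Longrightarrow> vs \<in> dirs j \<Longrightarrow> \<exists>B. \<forall>X\<in>K. \<bar>partial S vs f X\<bar> \<le> B"
    and H: "\<And>vs. vs \<in> dirs m \<Longrightarrow> \<exists>B. \<forall>X\<in>K. \<forall>Y\<in>K. X \<noteq> Y \<longrightarrow>
      \<bar>partial S vs f X - partial S vs f Y\<bar> \<le> B * dist X Y powr \<alpha>"
  shows "holder_norm m \<alpha> S K f < \<infinity>"
proof -
  have "(SUP X\<in>K. ennreal \<bar>partial S vs f X\<bar>) < \<infinity>" if jv: "j \<le> m" "vs \<in> dirs j" for j vs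
  proof -
    obtain B where "\<forall>X\<in>K. \<bar>partial S vs f X\<bar> \<le> B" using B[OF jv] by blast
    then have "(SUP X\<in>K. ennreal \<bar>partial S vs f X\<bar>) \<le> ennreal B" by (intro sup_ennreal_le) blast
    also have "\<dots> < \<infinity>" by simp
    finally show ?thesis .
  qed
  moreover have "(SUP (X, Y)\<in>{(X, Y). X \<in> K \<and> Y \<in> K \<and> X \<noteq> Y}. ennreal (\<bar>partial S vs f X - partial S vs f Y\<bar> / dist X Y powr \<alpha>)) < \<infinity>"
    if v: "vs \<in> dirs m" for vs
  proof -
    obtain B where B: "\<forall>X\<in>K. \<forall>Y\<in>K. X \<noteq> Y \<longrightarrow> \<bar>partial S vs f X - partial S vs f Y\<bar> \<le> B * dist X Y powr \<alpha>" using H[OF v] by blast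
    have "(SUP (X, Y)\<in>{(X, Y). X \<in> K \<and> Y \<in> K \<and> X \<noteq> Y}. ennreal (\<bar>partial S vs f X - partial S vs f Y\<bar> / dist X Y powr \<alpha>)) \<le> ennreal B"
    proof (rule SUP_least)
      fix p assume "p \<in> {(X, Y). X \<in> K \<and> Y \<in> K \<and> X \<noteq> Y}"
      then obtain X Y where p: "p = (X, Y)" "X \<in> K" "Y \<in> K" "X \<noteq> Y" by blast
      have "0 < dist X Y powr \<alpha>" using p(4) by simp
      then have "\<bar>partial S vs f X - partial S vs f Y\<bar> / dist X Y powr \<alpha> \<le> B"
        using B p(2-4) by (subst pos_divide_le_eq) blast+
      then show "(case p of (X, Y) \<Rightarrow> ennreal (\<bar>partial S vs f X - partial S vs f Y\<bar> / dist X Y powr \<alpha>)) \<le> ennreal B"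
        unfolding p(1) prod.case by (rule ennreal_leI)
    qed
    also have "\<dots> < \<infinity>" by simp
    finally show ?thesis .
  qed
  ultimately show ?thesis
    unfolding holder_norm_def infinity_ennreal_def by (auto simp: ennreal_add_less_top ennreal_sum_less_top)
qed

text \<open>\<open>K\<close> need not be convex, but half-balls around its points are; a common
  radius keeps them inside a compact part of the domain, where derivatives are bounded.\<close>

lemma compact_half_space_with_neighbourhood:
  assumes S: "open S" and K: "compact K" "K \<subseteq> half_space_with S"
  obtains \<delta> L where "0 < \<delta>" "\<delta> \<le> 1" "compact L" "L \<subseteq> half_space_with S"
    "\<And>X. X \<in> K \<Longrightarrow> cball X \<delta> \<inter> upper_closed \<subseteq> L"
proof -
  have op: "open (S \<times> (UNIV::real set) \<union> upper)" by (intro open_Un open_Times S open_UNIV open_upper)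
  have KO: "K \<subseteq> S \<times> UNIV \<union> upper" using K(2) by auto
  obtain \<epsilon> where e: "\<epsilon> > 0" "(\<Union>x\<in>K. cball x \<epsilon>) \<subseteq> S \<times> UNIV \<union> upper"
    using compact_subset_open_imp_cball_epsilon_subset[OF K(1) op KO] .
  define \<delta> where "\<delta> = min \<epsilon> 1"
  define L where "L = (\<Union>x\<in>K. cball x \<delta>) \<inter> upper_closed"
  show ?thesis
  proof (rule that[of \<delta> L])
    show "compact L" unfolding L_def by (intro compact_Int_closed compact_minkowski_sum_cball K closed_upper_closed)
    have "(\<Union>x\<in>K. cball x \<delta>) \<subseteq> (\<Union>x\<in>K. cball x \<epsilon>)" by (auto simp: \<delta>_def)
    then show "L \<subseteq> half_space_with S" unfolding L_def upper_Un_boundary using e(2) by blast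
  qed (use e in \<open>auto simp: \<delta>_def L_def\<close>)
qed

lemma convex_upper_closed: "convex upper_closed"
proof -
  have *: "upper_closed = UNIV \<times> {0..}" by (auto simp: upper_closed_def)
  show ?thesis unfolding * by (intro convex_Times convex_UNIV convex_real_interval)
qed

text \<open>For distances up to \<open>\<delta>\<close> the third derivatives bound the increment
  along a convex half-ball; larger distances are absorbed by the supremum divided by
  \<open>\<delta> powr \<alpha>\<close>. The constant adds both cases.\<close>

lemma holder_norm_smooth_finite:
  assumes S: "open S" and f: "f \<in> Ck_on 3 (half_space_with S)" and K: "compact K" "K \<subseteq> half_space_with S" and \<alpha>: "0 \<le> \<alpha>" "\<alpha> \<le> 1"
  shows "holder_norm 2 \<alpha> (half_space_with S) K f < \<infinity>"
proof (rule holder_norm_finiteI)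
  fix j :: nat and vs :: "R4 list" assume jv: "j \<le> 2" "vs \<in> dirs j"
  have "continuous_on (half_space_with S) (partial (half_space_with S) vs f)" by (rule Ck_on_continuous[OF f _ jv(2)]) (use jv in simp)
  then have c: "continuous_on K (partial (half_space_with S) vs f)" using K(2) continuous_on_subset by blast
  show "\<exists>B. \<forall>X\<in>K. \<bar>partial (half_space_with S) vs f X\<bar> \<le> B"
    using compact_imp_bounded[OF compact_continuous_image[OF c K(1)]] by (simp add: bounded_iff del: partial.simps)
next
  fix vs :: "R4 list" assume vs: "vs \<in> dirs 2"
  define g where "g = partial (half_space_with S) vs f"
  obtain \<delta> L where L: "0 < \<delta>" "\<delta> \<le> 1" "compact L" "L \<subseteq> half_space_with S"
    "\<And>X. X \<in> K \<Longrightarrow> cball X \<delta> \<inter> upper_closed \<subseteq> L"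
    using compact_half_space_with_neighbourhood[OF S K] by blast
  define G where "G = (\<lambda>X. \<Sum>i\<in>Basis. \<bar>partial (half_space_with S) (i # vs) f X\<bar>)"
  have iv: "i # vs \<in> dirs 3" if "i \<in> Basis" for i using vs that by (auto simp: dirs_def)
  have "continuous_on (half_space_with S) G"
    unfolding G_def by (intro continuous_on_sum continuous_on_rabs Ck_on_continuous[OF f order_refl iv])
  then have cG: "continuous_on L G" using L(4) continuous_on_subset by blast
  obtain B where B: "\<And>X. X \<in> L \<Longrightarrow> \<bar>G X\<bar> \<le> B"
    using compact_imp_bounded[OF compact_continuous_image[OF cG L(3)]] by (auto simp: bounded_iff)
  have "continuous_on (half_space_with S) g" unfolding g_def by (rule Ck_on_continuous[OF f _ vs]) simp
  then have cg: "continuous_on K g" using K(2) continuous_on_subset by blast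
  obtain D where D: "\<And>X. X \<in> K \<Longrightarrow> \<bar>g X\<bar> \<le> D"
    using compact_imp_bounded[OF compact_continuous_image[OF cg K(1)]] by (auto simp: bounded_iff)
  show "\<exists>B. \<forall>X\<in>K. \<forall>Y\<in>K. X \<noteq> Y \<longrightarrow> \<bar>partial (half_space_with S) vs f X - partial (half_space_with S) vs f Y\<bar> \<le> B * dist X Y powr \<alpha>"
  proof (intro exI[of _ "4 * \<bar>B\<bar> + 2 * \<bar>D\<bar> / \<delta> powr \<alpha>"] ballI impI)
    fix X Y assume X: "X \<in> K" and Y: "Y \<in> K" and ne: "X \<noteq> Y"
    have p: "0 < dist X Y powr \<alpha>" "0 < \<delta> powr \<alpha>" using ne L(1) by auto
    have "\<bar>g X - g Y\<bar> \<le> (4 * \<bar>B\<bar> + 2 * \<bar>D\<bar> / \<delta> powr \<alpha>) * dist X Y powr \<alpha>"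
    proof (cases "dist X Y \<le> \<delta>")
      case True
      define C where "C = cball X \<delta> \<inter> upper_closed"
      have CL: "C \<subseteq> L" unfolding C_def by (rule L(5)[OF X])
      have cv: "convex C" unfolding C_def by (intro convex_Int convex_cball convex_upper_closed)
      have der: "(g has_derivative (\<lambda>h. \<Sum>i\<in>Basis. (h \<bullet> i) * partial (half_space_with S) (i # vs) f Z)) (at Z within C)" if Z: "Z \<in> C" for Z
      proof (rule has_derivative_subset)
        show "(g has_derivative (\<lambda>h. \<Sum>i\<in>Basis. (h \<bullet> i) * partial (half_space_with S) (i # vs) f Z)) (at Z within half_space_with S)"
          unfolding g_def by (rule Ck_onD[OF f _ vs]) (use Z CL L(4) in auto)
        show "C \<subseteq> half_space_with S" using CL L(4) by blast
      qed
      have bd: "\<bar>partial (half_space_with S) (i # vs) f Z\<bar> \<le> \<bar>B\<bar>" if Z: "Z \<in> C" and i: "i \<in> Basis" for Z i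
      proof -
        have "\<bar>partial (half_space_with S) (i # vs) f Z\<bar> \<le> G Z" unfolding G_def by (rule member_le_sum[OF i]) auto
        then show ?thesis using B[of Z] Z CL by fastforce
      qed
      have XC: "X \<in> C" "Y \<in> C" using True L(1) K(2) X Y upper_Un_boundary[of S] by (auto simp: C_def)
      have "\<bar>g X - g Y\<bar> \<le> (\<bar>B\<bar> * DIM(R4)) * norm (X - Y)" by (rule gradient_bound[OF cv der bd XC])
      also have "\<dots> = (4 * \<bar>B\<bar>) * dist X Y" by (simp add: dist_norm)
      also have "\<dots> \<le> (4 * \<bar>B\<bar>) * dist X Y powr \<alpha>"
        using powr_mono'[of \<alpha> 1 "dist X Y"] True L(2) \<alpha> ne by (intro mult_left_mono) auto
      also have "\<dots> \<le> (4 * \<bar>B\<bar> + 2 * \<bar>D\<bar> / \<delta> powr \<alpha>) * dist X Y powr \<alpha>"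
        using p by (intro mult_right_mono) auto
      finally show ?thesis .
    next
      case False
      have "\<bar>g X - g Y\<bar> \<le> 2 * \<bar>D\<bar>" using D[OF X] D[OF Y] by linarith
      also have "\<dots> = (2 * \<bar>D\<bar> / \<delta> powr \<alpha>) * \<delta> powr \<alpha>" using p by simp
      also have "\<dots> \<le> (2 * \<bar>D\<bar> / \<delta> powr \<alpha>) * dist X Y powr \<alpha>"
        using False L(1) \<alpha> p by (intro mult_left_mono powr_mono2) auto
      also have "\<dots> \<le> (4 * \<bar>B\<bar> + 2 * \<bar>D\<bar> / \<delta> powr \<alpha>) * dist X Y powr \<alpha>"
        using p by (intro mult_right_mono) auto
      finally show ?thesis .
    qed
    then show "\<bar>partial (half_space_with S) vs f X - partial (half_space_with S) vs f Y\<bar> \<le> (4 * \<bar>B\<bar> + 2 * \<bar>D\<bar> / \<delta> powr \<alpha>) * dist X Y powr \<alpha>"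
      unfolding g_def .
  qed
qed

lemma holder_norm_add_finite:
  assumes S: "thick S" and K: "K \<subseteq> S" and f: "f \<in> Ck_on m S" and g: "g \<in> Ck_on m S"
    and "holder_norm m \<alpha> S K f < \<infinity>" "holder_norm m \<alpha> S K g < \<infinity>"
  shows "holder_norm m \<alpha> S K (\<lambda>X. f X + g X) < \<infinity>"
proof -
  have fin: "\<exists>B. \<forall>X\<in>K. \<bar>partial S vs h X\<bar> \<le> B" if h: "holder_norm m \<alpha> S K h < \<infinity>" and jv: "j \<le> m" "vs \<in> dirs j" for h j vs
  proof -
    define s where "s = (SUP X\<in>K. ennreal \<bar>partial S vs h X\<bar>)"
    have "s \<le> (\<Sum>vs\<in>dirs j. SUP X\<in>K. ennreal \<bar>partial S vs h X\<bar>)"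
      unfolding s_def by (rule member_le_sum[OF jv(2), of "\<lambda>vs. SUP X\<in>K. ennreal \<bar>partial S vs h X\<bar>"]) auto
    also have "\<dots> \<le> (\<Sum>j\<le>m. \<Sum>vs\<in>dirs j. SUP X\<in>K. ennreal \<bar>partial S vs h X\<bar>)"
      by (rule member_le_sum[of j "{..m}" "\<lambda>j. \<Sum>vs\<in>dirs j. SUP X\<in>K. ennreal \<bar>partial S vs h X\<bar>"]) (use jv in auto)
    also have "\<dots> \<le> holder_norm m \<alpha> S K h" unfolding holder_norm_def by simp
    finally have s: "s < \<infinity>" using h by (rule le_less_trans)
    have "\<bar>partial S vs h X\<bar> \<le> enn2real s" if "X \<in> K" for X
    proof -
      have "ennreal \<bar>partial S vs h X\<bar> \<le> s" unfolding s_def by (rule SUP_upper[OF that])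
      also have "s = ennreal (enn2real s)" using s by simp
      finally show ?thesis by (simp add: ennreal_le_iff)
    qed
    then show ?thesis by blast
  qed
  have finH: "\<exists>B. \<forall>X\<in>K. \<forall>Y\<in>K. X \<noteq> Y \<longrightarrow> \<bar>partial S vs h X - partial S vs h Y\<bar> \<le> B * dist X Y powr \<alpha>"
    if h: "holder_norm m \<alpha> S K h < \<infinity>" and v: "vs \<in> dirs m" for h vs
  proof -
    define q where "q = (\<lambda>vs (X, Y). ennreal (\<bar>partial S vs h X - partial S vs h Y\<bar> / dist X Y powr \<alpha>))"
    define P where "P = {(X, Y). X \<in> K \<and> Y \<in> K \<and> X \<noteq> Y}"
    define s where "s = (SUP p\<in>P. q vs p)"
    have "s \<le> (\<Sum>vs\<in>dirs m. SUP p\<in>P. q vs p)"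
      unfolding s_def by (rule member_le_sum[OF v, of "\<lambda>vs. SUP p\<in>P. q vs p"]) auto
    also have "\<dots> \<le> holder_norm m \<alpha> S K h" unfolding holder_norm_def q_def P_def by simp
    finally have s: "s < \<infinity>" using h by (rule le_less_trans)
    have "\<bar>partial S vs h X - partial S vs h Y\<bar> \<le> enn2real s * dist X Y powr \<alpha>" if "X \<in> K" "Y \<in> K" "X \<noteq> Y" for X Y
    proof -
      have "q vs (X, Y) \<le> s" unfolding s_def by (rule SUP_upper) (use that in \<open>simp add: P_def\<close>)
      also have "s = ennreal (enn2real s)" using s by simp
      finally have "\<bar>partial S vs h X - partial S vs h Y\<bar> / dist X Y powr \<alpha> \<le> enn2real s" by (simp add: q_def ennreal_le_iff)
      moreover have "0 < dist X Y powr \<alpha>" using that by simp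
      ultimately show ?thesis by (subst (asm) pos_divide_le_eq)
    qed
    then show ?thesis by blast
  qed
  have eq: "partial S vs (\<lambda>X. f X + g X) X = partial S vs f X + partial S vs g X" if "j \<le> m" "vs \<in> dirs j" "X \<in> K" for j vs X
    using Ck_on_lincomb(2)[OF S f g that(1,2), of X 1 1] that(3) K by auto
  show ?thesis
  proof (rule holder_norm_finiteI)
    fix j and vs :: "'a list" assume jv: "j \<le> m" "vs \<in> dirs j"
    obtain B1 where B1: "\<forall>X\<in>K. \<bar>partial S vs f X\<bar> \<le> B1" using fin[OF assms(5) jv] by blast
    obtain B2 where B2: "\<forall>X\<in>K. \<bar>partial S vs g X\<bar> \<le> B2" using fin[OF assms(6) jv] by blast
    have "\<bar>partial S vs (\<lambda>X. f X + g X) X\<bar> \<le> B1 + B2" if X: "X \<in> K" for X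
    proof -
      have "\<bar>partial S vs f X\<bar> \<le> B1" "\<bar>partial S vs g X\<bar> \<le> B2" using B1 B2 X by blast+
      then show ?thesis unfolding eq[OF jv X] by linarith
    qed
    then show "\<exists>B. \<forall>X\<in>K. \<bar>partial S vs (\<lambda>X. f X + g X) X\<bar> \<le> B" by blast
  next
    fix vs :: "'a list" assume v: "vs \<in> dirs m"
    obtain B1 where B1: "\<forall>X\<in>K. \<forall>Y\<in>K. X \<noteq> Y \<longrightarrow> \<bar>partial S vs f X - partial S vs f Y\<bar> \<le> B1 * dist X Y powr \<alpha>" using finH[OF assms(5) v] by blast
    obtain B2 where B2: "\<forall>X\<in>K. \<forall>Y\<in>K. X \<noteq> Y \<longrightarrow> \<bar>partial S vs g X - partial S vs g Y\<bar> \<le> B2 * dist X Y powr \<alpha>" using finH[OF assms(6) v] by blast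
    have "\<bar>partial S vs (\<lambda>X. f X + g X) X - partial S vs (\<lambda>X. f X + g X) Y\<bar> \<le> (B1 + B2) * dist X Y powr \<alpha>"
      if XY: "X \<in> K" "Y \<in> K" "X \<noteq> Y" for X Y
    proof -
      have "\<bar>partial S vs f X - partial S vs f Y\<bar> \<le> B1 * dist X Y powr \<alpha>" "\<bar>partial S vs g X - partial S vs g Y\<bar> \<le> B2 * dist X Y powr \<alpha>"
        using B1 B2 XY by blast+
      then show ?thesis unfolding eq[OF order_refl v XY(1)] eq[OF order_refl v XY(2)] distrib_right by linarith
    qed
    then show "\<exists>B. \<forall>X\<in>K. \<forall>Y\<in>K. X \<noteq> Y \<longrightarrow> \<bar>partial S vs (\<lambda>X. f X + g X) X - partial S vs (\<lambda>X. f X + g X) Y\<bar> \<le> B * dist X Y powr \<alpha>"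
      by blast
  qed
qed

text \<open>The order of quantifiers is the point: \<open>A\<close> depends on \<open>K\<close>,
  \<open>\<Omega>\<close> and \<alpha> only, and the bound is linear in \<open>M\<close>. The
  density bounds of the construction may grow exponentially in \<open>k\<close>, and \<beta> is
  adapted to that growth.\<close>

lemma potential_ln_uniform_bounds:
  fixes K :: "R4 set"
  assumes K: "bounded K" and O: "bounded \<Omega>" "\<Omega> \<in> sets borel" and \<alpha>: "0 \<le> \<alpha>" "\<alpha> < 1"
  shows "\<exists>A\<ge>0. \<forall>M f S. bounded_density \<Omega> M f \<longrightarrow> thick S \<longrightarrow> K \<subseteq> S \<longrightarrow>
    (\<forall>j vs X. j \<le> 2 \<longrightarrow> vs \<in> dirs j \<longrightarrow> X \<in> K \<longrightarrow> \<bar>partial S vs (potential (\<lambda>Z. ln (norm Z)) f) X\<bar> \<le> A * M) \<and>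
    (\<forall>vs X Y. vs \<in> dirs 2 \<longrightarrow> X \<in> K \<longrightarrow> Y \<in> K \<longrightarrow> X \<noteq> Y \<longrightarrow>
      \<bar>partial S vs (potential (\<lambda>Z. ln (norm Z)) f) X - partial S vs (potential (\<lambda>Z. ln (norm Z)) f) Y\<bar> \<le> A * M * dist X Y powr \<alpha>)"
proof -
  obtain R1 where R1: "\<And>z. z \<in> \<Omega> \<Longrightarrow> norm z \<le> R1" using O(1) bounded_iff by metis
  obtain R2 where R2: "\<And>X. X \<in> K \<Longrightarrow> norm X \<le> R2" using K bounded_iff by metis
  define R where "R = max R1 R2"
  have OR: "\<Omega> \<subseteq> cball 0 R" and KR: "K \<subseteq> cball 0 R" using R1 R2 by (auto simp: R_def le_max_iff_disj)
  have s: "0 \<le> riesz_sup \<Omega> 1" "0 \<le> riesz_sup \<Omega> 2" "0 \<le> riesz_sup \<Omega> (2 + \<alpha>)"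
    using riesz_sup_bounds(3)[OF O(2,1)] \<alpha> by auto
  define A0 where "A0 = 2 * (4 * R\<^sup>2 + 1) * riesz_sup \<Omega> 1"
  define A1 where "A1 = 2 * 4 * riesz_sup \<Omega> 1"
  have "\<exists>C. \<forall>i\<in>Basis. \<forall>j\<in>Basis. \<exists>q. taylor_kernel 2 (log_hess i j) q (C i j)"
  proof -
    have "\<forall>i\<in>Basis. \<forall>j\<in>Basis. \<exists>C q. taylor_kernel 2 (log_hess i j) q C" using log_hess_taylor_kernel by meson
    then show ?thesis by metis
  qed
  then obtain C where C: "\<And>i j. i \<in> Basis \<Longrightarrow> j \<in> Basis \<Longrightarrow> \<exists>q. taylor_kernel 2 (log_hess i j) q (C i j)" by blast
  have C0: "0 \<le> C i j" if "i \<in> Basis" "j \<in> Basis" for i j using C[OF that] by (auto simp: taylor_kernel_def)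
  \<comment> \<open>One constant for all sixteen Hessian kernels.\<close>
  define CC where "CC = (\<Sum>i\<in>Basis. \<Sum>j\<in>Basis. C i j)"
  have CC: "C i j \<le> CC" if ij: "i \<in> Basis" "j \<in> Basis" for i j
  proof -
    have "C i j \<le> (\<Sum>j\<in>Basis. C i j)" by (rule member_le_sum[OF ij(2)]) (use C0 ij in auto)
    also have "\<dots> \<le> CC" unfolding CC_def
      by (rule member_le_sum[OF ij(1), of "\<lambda>i. \<Sum>j\<in>Basis. C i j"]) (use C0 in \<open>auto intro!: sum_nonneg\<close>)
    finally show ?thesis .
  qed
  have CC0: "0 \<le> CC" unfolding CC_def using C0 by (intro sum_nonneg) auto
  define A2 where "A2 = 2 * CC * riesz_sup \<Omega> 2"
  define A3 where "A3 = 4 * CC * 2 powr (2 + \<alpha>) * riesz_sup \<Omega> (2 + \<alpha>)"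
  define A where "A = A0 + A1 + A2 + A3"
  have nn: "0 \<le> A0" "0 \<le> A1" "0 \<le> A2" "0 \<le> A3" using s CC0 by (auto simp: A0_def A1_def A2_def A3_def)
  have le: "A0 \<le> A" "A1 \<le> A" "A2 \<le> A" "A3 \<le> A" "0 \<le> A" using nn by (auto simp: A_def)
  show ?thesis
  proof (intro exI[of _ A] conjI allI impI)
    show "0 \<le> A" by (rule le)
  next
    fix M f S j and vs :: "R4 list" and X assume f: "bounded_density \<Omega> M f" and S: "thick S" and KS: "K \<subseteq> S" and j: "j \<le> (2::nat)" and vs: "vs \<in> dirs j" and X: "X \<in> K"
    have M: "0 \<le> M" using f by (simp add: bounded_density_def)
    have XS: "X \<in> S" using X KS by blast
    consider "vs = []" | i where "vs = [i]" "i \<in> Basis" | i i' where "vs = [i, i']" "i \<in> Basis" "i' \<in> Basis"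
    proof -
      have "length vs \<le> 2" using j vs by (simp add: dirs_def)
      then have "length vs = 0 \<or> length vs = 1 \<or> length vs = 2" by linarith
      then show ?thesis using vs that unfolding dirs_def
        by (auto simp: length_Suc_conv numeral_2_eq_2)
    qed
    then show "\<bar>partial S vs (potential (\<lambda>Z. ln (norm Z)) f) X\<bar> \<le> A * M"
    proof cases
      case 1
      have "\<bar>potential (\<lambda>Z. ln (norm Z)) f X\<bar> \<le> A0 * M"
        using potential_ln_bound(2)[OF f OR subsetD[OF KR X]] by (simp add: A0_def mult_ac)
      also have "\<dots> \<le> A * M" using le M by (intro mult_right_mono)
      finally show ?thesis using 1 by simp
    next
      case (2 i)
      have m: "log_grad i \<in> borel_measurable borel" by (rule log_kernel_measurable[OF log_kernel_p[OF 2(2)]])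
      have "\<bar>potential (log_grad i) f X\<bar> \<le> A1 * M"
        using potential_kernel_bound(2)[OF f taylor_kernel_p[OF 2(2)] m, of X] by (simp add: A1_def mult_ac)
      also have "\<dots> \<le> A * M" using le M by (intro mult_right_mono)
      finally show ?thesis unfolding 2(1) potential_ln_Ck2(2)[OF f S 2(2) XS] .
    next
      case (3 i i')
      obtain q where q: "taylor_kernel 2 (log_hess i i') q (C i i')" using C[OF 3(2,3)] by blast
      have m: "log_hess i i' \<in> borel_measurable borel" using log_hess_taylor_kernel[OF 3(2,3)] by meson
      have "\<bar>potential (log_hess i i') f X\<bar> \<le> 2 * C i i' * M * riesz_sup \<Omega> 2" using potential_kernel_bound(2)[OF f q m, of X] by simp
      also have "\<dots> \<le> 2 * CC * M * riesz_sup \<Omega> 2" using CC[OF 3(2,3)] M s by (intro mult_right_mono mult_left_mono) auto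
      also have "\<dots> = A2 * M" by (simp add: A2_def)
      also have "\<dots> \<le> A * M" using le M by (intro mult_right_mono)
      finally show ?thesis unfolding 3(1) potential_ln_Ck2(3)[OF f S 3(2,3) XS] .
    qed
  next
    fix M f S and vs :: "R4 list" and X Y assume f: "bounded_density \<Omega> M f" and S: "thick S" and KS: "K \<subseteq> S" and vs: "vs \<in> dirs 2" and X: "X \<in> K" and Y: "Y \<in> K" and ne: "X \<noteq> Y"
    have M: "0 \<le> M" using f by (simp add: bounded_density_def)
    have XS: "X \<in> S" "Y \<in> S" using X Y KS by auto
    obtain i i' where v: "vs = [i, i']" "i \<in> Basis" "i' \<in> Basis"
      using vs by (auto simp: dirs_def length_Suc_conv numeral_2_eq_2)
    obtain q where q: "taylor_kernel 2 (log_hess i i') q (C i i')" using C[OF v(2,3)] by blast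
    have m: "log_hess i i' \<in> borel_measurable borel" using log_hess_taylor_kernel[OF v(2,3)] by meson
    have "\<bar>potential (log_hess i i') f X - potential (log_hess i i') f Y\<bar> \<le> (4 * C i i' * 2 powr (2 + \<alpha>) * M * riesz_sup \<Omega> (2 + \<alpha>)) * dist X Y powr \<alpha>"
      using potential_kernel_holder[OF f q m \<alpha>(1) _ _ ne[symmetric]] \<alpha> by (simp add: dist_norm)
    also have "\<dots> \<le> (4 * CC * 2 powr (2 + \<alpha>) * M * riesz_sup \<Omega> (2 + \<alpha>)) * dist X Y powr \<alpha>"
      using CC[OF v(2,3)] M s by (intro mult_right_mono mult_left_mono) auto
    also have "\<dots> = (A3 * M) * dist X Y powr \<alpha>" by (simp add: A3_def)
    also have "\<dots> \<le> (A * M) * dist X Y powr \<alpha>" using le M by (intro mult_right_mono) auto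
    finally show "\<bar>partial S vs (potential (\<lambda>Z. ln (norm Z)) f) X - partial S vs (potential (\<lambda>Z. ln (norm Z)) f) Y\<bar> \<le> A * M * dist X Y powr \<alpha>"
      unfolding v(1) potential_ln_Ck2(3)[OF f S v(2,3) XS(1)] potential_ln_Ck2(3)[OF f S v(2,3) XS(2)] .
  qed
qed

section \<open>The fixed point equation\<close>

lemma exp_diff_le:
  assumes "a \<le> c" "b \<le> (c::real)"
  shows "\<bar>exp a - exp b\<bar> \<le> exp c * \<bar>a - b\<bar>"
proof -
  have *: "exp s - exp t \<le> exp c * (s - t)" if "t \<le> s" "s \<le> c" for s t :: real
  proof -
    have "1 - (s - t) \<le> exp (t - s)" using exp_ge_add_one_self[of "t - s"] by linarith
    then have "exp s * (1 - (s - t)) \<le> exp s * exp (t - s)" by (rule mult_left_mono) simp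
    also have "\<dots> = exp t" by (simp add: exp_add[symmetric])
    finally have "exp s - exp t \<le> exp s * (s - t)" by (simp add: algebra_simps)
    also have "\<dots> \<le> exp c * (s - t)" using that by (intro mult_right_mono) auto
    finally show ?thesis .
  qed
  show ?thesis
  proof (cases "b \<le> a")
    case True
    then show ?thesis using *[of b a] assms by simp
  next
    case False
    then show ?thesis using *[of a b] assms by simp
  qed
qed

text \<open>\<open>n\<close> is the later value of \<open>\<beta> k\<close>. Being a natural number,
  it makes the weight on \<open>S\<close> the \<open>n\<close>-th power of
  \<open>exp (3 * \<Phi> (z, 0))\<close> and lets dominated convergence run along a
  sequence.\<close>

definition exp_weight :: "R3 set \<Rightarrow> (R4 \<Rightarrow> real) \<Rightarrow> nat \<Rightarrow> R3 \<Rightarrow> real" where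
  "exp_weight S \<Phi> n z = indicator S z * exp (3 * (real n * \<Phi> (z, 0)))"

lemma exp_weight_bounded_density:
  assumes b: "profile S \<Phi>"
  shows "bounded_density S 1 (exp_weight S \<Phi> n)" "0 \<le> exp_weight S \<Phi> n z" "exp_weight S \<Phi> n z \<le> indicator S z"
proof -
  note bf = profile_facts[OF b]
  have [measurable]: "bdry \<Phi> \<in> borel_measurable borel" using bf(6) by (rule borel_measurable_continuous_onI)
  have [measurable]: "S \<in> sets borel" using bf(1) by simp
  have m: "exp_weight S \<Phi> n \<in> borel_measurable borel" unfolding exp_weight_def[abs_def] by measurable
  show 0: "0 \<le> exp_weight S \<Phi> n z" for z by (simp add: exp_weight_def)
  show 1: "exp_weight S \<Phi> n z \<le> indicator S z" for z
    using bf(5)[of z] by (auto simp: exp_weight_def indicator_def mult_nonneg_nonpos)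
  show "bounded_density S 1 (exp_weight S \<Phi> n)" unfolding bounded_density_def using bf(1,2) m 0 1 by (auto simp: abs_of_nonneg)
qed

lemma bounded_density_integrable:
  assumes "bounded_density \<Omega> M f"
  shows "integrable lborel f"
proof -
  obtain R where R: "\<And>z. z \<in> \<Omega> \<Longrightarrow> norm z \<le> R" using assms bounded_iff[of \<Omega>] by (auto simp: bounded_density_def)
  show ?thesis
  proof (rule integrable_bounded_support[where B=M and R=R])
    show "f \<in> borel_measurable borel" using assms by (simp add: bounded_density_def)
    show "\<bar>f x\<bar> \<le> M" for x
    proof -
      have "\<bar>f x\<bar> \<le> M * indicator \<Omega> x" "0 \<le> M" using assms by (auto simp: bounded_density_def)
      then show ?thesis by (cases "x \<in> \<Omega>") auto
    qed
    show "f x = 0" if "R < norm x" for x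
    proof -
      have "x \<notin> \<Omega>" using R[of x] that by auto
      moreover have "\<bar>f x\<bar> \<le> M * indicator \<Omega> x" using assms by (simp add: bounded_density_def)
      ultimately show ?thesis by simp
    qed
  qed
qed

lemma zero_set_AE:
  assumes b: "profile S \<Phi>"
  shows "AE z in lborel. z \<notin> zero_set S \<Phi>"
proof -
  note bf = profile_facts[OF b]
  have "closed (bdry \<Phi> -` {0})" by (rule closed_vimage[OF closed_singleton bf(6)])
  then have m: "zero_set S \<Phi> \<in> sets borel"
    using bf(1) by (auto simp: zero_set_def vimage_def Collect_conj_eq)
  have "zero_set S \<Phi> \<in> null_sets lebesgue" using zero_set_negligible[OF b] by (simp add: negligible_iff_null_sets)
  then have "zero_set S \<Phi> \<in> null_sets lborel" using null_sets_completion_iff[of "zero_set S \<Phi>" lborel] m by simp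
  then show ?thesis by (rule AE_not_in)
qed

lemma exp_weight_integral_tendsto_0:
  assumes b: "profile S \<Phi>"
  shows "(\<lambda>n. LINT z|lborel. exp_weight S \<Phi> n z) \<longlonglongrightarrow> 0"
proof -
  note bf = profile_facts[OF b]
  have iS: "integrable lborel (indicator S :: R3 \<Rightarrow> real)"
    using bf(1,2) by (intro integrable_real_indicator) (simp_all add: emeasure_bounded_finite[unfolded infinity_ennreal_def])
  have "(\<lambda>n. LINT z|lborel. exp_weight S \<Phi> n z) \<longlonglongrightarrow> (LINT z|(lborel::R3 measure). 0)"
  proof (rule integral_dominated_convergence[where w="indicator S"])
    show "exp_weight S \<Phi> n \<in> borel_measurable lborel" for n using exp_weight_bounded_density(1)[OF b] by (simp add: bounded_density_def)
    show "integrable lborel (indicator S :: R3 \<Rightarrow> real)" by (rule iS)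
    show "AE z in lborel. norm (exp_weight S \<Phi> n z) \<le> indicator S z" for n
      using exp_weight_bounded_density(2,3)[OF b] by (auto simp: abs_of_nonneg)
    show "AE z in lborel. (\<lambda>n. exp_weight S \<Phi> n z) \<longlonglongrightarrow> 0"
      using zero_set_AE[OF b]
    proof eventually_elim
      case (elim z)
      show ?case
      proof (cases "z \<in> S")
        case True
        then have neg: "\<Phi> (z, 0) < 0" using elim bf(5)[of z] by (simp add: zero_set_def less_le)
        define r where "r = exp (3 * \<Phi> (z, 0))"
        have "(\<lambda>n. r ^ n) \<longlonglongrightarrow> 0" using neg by (intro LIMSEQ_realpow_zero) (auto simp: r_def)
        moreover have "exp_weight S \<Phi> n z = r ^ n" for n
          using True by (simp add: exp_weight_def r_def exp_of_nat_mult[symmetric] mult_ac)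
        ultimately show ?thesis by simp
      qed (simp add: exp_weight_def)
    qed
  qed simp
  then show ?thesis by simp
qed

text \<open>Measures the potential against the weight and not against the sup bound \<open>M\<close>
  of the density, because only the weight becomes small.\<close>

lemma potential_ln_weighted_bound:
  fixes X :: R4
  assumes b: "profile S \<Phi>" and R: "S \<subseteq> cball 0 R" "X \<in> cball 0 R" and h: "bounded_density S M h" and c: "0 \<le> c"
    and hc: "\<And>z. \<bar>h z\<bar> \<le> c * exp_weight S \<Phi> n z"
  shows "\<bar>potential (\<lambda>Z. ln (norm Z)) h X\<bar> \<le> c * (LINT z|lborel. \<bar>ln (norm (X - (z, 0)))\<bar> * exp_weight S \<Phi> n z)"
proof -
  have i1: "integrable lborel (\<lambda>z. ln (norm (X - (z, 0))) * h z)" by (rule potential_ln_bound(1)[OF h R])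
  have "integrable lborel (\<lambda>z. \<bar>ln (norm (X - (z, 0))) * exp_weight S \<Phi> n z\<bar>)"
    by (intro integrable_abs potential_ln_bound(1)[OF exp_weight_bounded_density(1)[OF b] R])
  then have i2: "integrable lborel (\<lambda>z. \<bar>ln (norm (X - (z, 0)))\<bar> * exp_weight S \<Phi> n z)"
    using exp_weight_bounded_density(2)[OF b] by (simp add: abs_mult)
  have "norm (potential (\<lambda>Z. ln (norm Z)) h X) \<le> (LINT z|lborel. norm (ln (norm (X - (z, 0))) * h z))"
    unfolding potential_def by (rule integral_norm_bound)
  also have "\<dots> \<le> (LINT z|lborel. c * (\<bar>ln (norm (X - (z, 0)))\<bar> * exp_weight S \<Phi> n z))"
  proof (rule integral_mono[OF integrable_norm[OF i1] integrable_mult_right[OF i2]])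
    fix z
    have "\<bar>ln (norm (X - (z, 0)))\<bar> * \<bar>h z\<bar> \<le> \<bar>ln (norm (X - (z, 0)))\<bar> * (c * exp_weight S \<Phi> n z)"
      by (intro mult_left_mono hc) auto
    then show "norm (ln (norm (X - (z, 0))) * h z) \<le> c * (\<bar>ln (norm (X - (z, 0)))\<bar> * exp_weight S \<Phi> n z)"
      by (simp add: abs_mult mult_ac)
  qed
  finally show ?thesis by simp
qed

text \<open>The weight is small only in the mean, while the logarithm is unbounded. The inequality
  \<open>2 * \<delta> * (l * g) \<le> \<delta>\<^sup>2 * l\<^sup>2 + g\<^sup>2\<close> separates
  them: the squared logarithm is controlled by a Riesz kernel of degree 2, whose integral is bounded
  uniformly in \<open>X\<close>, and \<open>g\<^sup>2 \<le> g\<close> because the weight is at most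
  1.\<close>

lemma log_weight_small:
  assumes b: "profile S \<Phi>" and R: "S \<subseteq> cball 0 R" and \<eta>: "0 < \<eta>"
  shows "\<exists>n\<ge>N. (LINT z|lborel. exp_weight S \<Phi> n z) \<le> \<eta> \<and>
    (\<forall>X\<in>cball (0::R4) R. (LINT z|lborel. \<bar>ln (norm (X - (z, 0)))\<bar> * exp_weight S \<Phi> n z) \<le> \<eta>)"
proof -
  note bf = profile_facts[OF b]
  have SB: "S \<in> sets borel" using bf(1) by simp
  define D where "D = (4 * R\<^sup>2 + 1)\<^sup>2 * riesz_sup S 2"
  have D: "0 \<le> D" unfolding D_def using riesz_sup_bounds(3)[OF SB bf(2), of 2] by simp
  \<comment> \<open>With this \<delta> the logarithmic part is at most \<open>\<eta> / 2\<close>; an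
    integral of the weight of at most \<open>\<delta> * \<eta>\<close> then accounts for the other
    half.\<close>
  define \<delta> where "\<delta> = \<eta> / (D + 1)"
  have \<delta>: "0 < \<delta>" using \<eta> D by (simp add: \<delta>_def)
  have "0 < min \<eta> (\<delta> * \<eta>)" using \<eta> \<delta> by simp
  from order_tendstoD(2)[OF exp_weight_integral_tendsto_0[OF b] this]
  obtain N' where N': "\<And>n. n \<ge> N' \<Longrightarrow> (LINT z|lborel. exp_weight S \<Phi> n z) < min \<eta> (\<delta> * \<eta>)"
    unfolding eventually_sequentially by blast
  define n where "n = max N N'"
  have E: "(LINT z|lborel. exp_weight S \<Phi> n z) \<le> \<eta>" "(LINT z|lborel. exp_weight S \<Phi> n z) \<le> \<delta> * \<eta>"
    using N'[of n] by (auto simp: n_def)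
  have "(LINT z|lborel. \<bar>ln (norm (X - (z, 0)))\<bar> * exp_weight S \<Phi> n z) \<le> \<eta>" if X: "X \<in> cball (0::R4) R" for X
  proof -
    have "integrable lborel (\<lambda>z. \<bar>ln (norm (X - (z, 0))) * exp_weight S \<Phi> n z\<bar>)"
      by (intro integrable_abs potential_ln_bound(1)[OF exp_weight_bounded_density(1)[OF b] R X])
    then have i1: "integrable lborel (\<lambda>z. \<bar>ln (norm (X - (z, 0)))\<bar> * exp_weight S \<Phi> n z)"
      using exp_weight_bounded_density(2)[OF b] by (simp add: abs_mult)
    have ir: "integrable lborel (\<lambda>z. indicator S z * norm (X - (z, 0)) powr - 2)" by (rule riesz_sup_bounds(1)[OF SB bf(2)]) auto
    have ie: "integrable lborel (exp_weight S \<Phi> n)" by (rule bounded_density_integrable[OF exp_weight_bounded_density(1)[OF b]])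
    define c where "c = \<delta> / 2 * (4 * R\<^sup>2 + 1)\<^sup>2"
    have "(LINT z|lborel. \<bar>ln (norm (X - (z, 0)))\<bar> * exp_weight S \<Phi> n z)
      \<le> (LINT z|lborel. c * (indicator S z * norm (X - (z, 0)) powr - 2) + (1 / (2 * \<delta>)) * exp_weight S \<Phi> n z)"
    proof (rule integral_mono_AE[OF i1 Bochner_Integration.integrable_add[OF integrable_mult_right[OF ir] integrable_mult_right[OF ie]]])
      show "AE z in lborel. \<bar>ln (norm (X - (z, 0)))\<bar> * exp_weight S \<Phi> n z
          \<le> c * (indicator S z * norm (X - (z, 0)) powr - 2) + (1 / (2 * \<delta>)) * exp_weight S \<Phi> n z"
        using AE_off_boundary_point[of X]
      proof eventually_elim
        case (elim z)
        show ?case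
        proof (cases "z \<in> S")
          case True
          define r where "r = norm (X - (z, 0))"
          define l where "l = \<bar>ln r\<bar>"
          define g where "g = exp_weight S \<Phi> n z"
          have g: "0 \<le> g" "g \<le> 1" using exp_weight_bounded_density(2,3)[OF b, of n z] True by (auto simp: g_def)
          have r: "0 < r" using elim by (simp add: r_def)
          have "norm (z, 0::real) \<le> R" using R True by (auto simp: norm_Pair)
          then have "r \<le> 2 * R" using norm_triangle_ineq4[of X "(z, 0)"] X by (simp add: r_def)
          then have "r * r \<le> (2 * R) * (2 * R)" using r by (intro mult_mono) auto
          then have "r * r + 1 \<le> 4 * R\<^sup>2 + 1" by (simp add: power2_eq_square)
          then have "(r * r + 1) * (1 / r) \<le> (4 * R\<^sup>2 + 1) * (1 / r)" using r by (intro mult_right_mono) auto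
          then have "r + 1 / r \<le> (4 * R\<^sup>2 + 1) * (1 / r)" using r by (simp add: field_simps)
          then have "l \<le> (4 * R\<^sup>2 + 1) * (1 / r)" using abs_ln_le[OF r] by (simp only: l_def)
          then have "l\<^sup>2 \<le> ((4 * R\<^sup>2 + 1) * (1 / r))\<^sup>2" by (intro power_mono) (auto simp: l_def)
          also have "\<dots> = (4 * R\<^sup>2 + 1)\<^sup>2 * r powr - 2"
            using r by (simp add: power_mult_distrib powr_minus powr_numeral divide_inverse power_inverse)
          finally have l2: "\<delta> / 2 * l\<^sup>2 \<le> c * r powr - 2"
            using \<delta> unfolding c_def mult.assoc by (intro mult_left_mono) auto
          have "0 \<le> (\<delta> * l - g)\<^sup>2" by simp
          then have "2 * \<delta> * (l * g) \<le> \<delta>\<^sup>2 * l\<^sup>2 + g\<^sup>2" by (simp add: power2_diff power_mult_distrib algebra_simps)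
          also have "g\<^sup>2 \<le> g" using g by (simp add: power2_eq_square mult_left_le)
          finally have "2 * \<delta> * (l * g) \<le> \<delta>\<^sup>2 * l\<^sup>2 + g" by simp
          then have "(2 * \<delta> * (l * g)) / (2 * \<delta>) \<le> (\<delta>\<^sup>2 * l\<^sup>2 + g) / (2 * \<delta>)" using \<delta> by (intro divide_right_mono) auto
          then have "l * g \<le> \<delta> / 2 * l\<^sup>2 + (1 / (2 * \<delta>)) * g" using \<delta> by (simp add: field_simps power2_eq_square)
          with l2 have "l * g \<le> c * r powr - 2 + (1 / (2 * \<delta>)) * g" by linarith
          then show ?thesis using True by (simp add: l_def r_def g_def)
        qed (simp add: exp_weight_def)
      qed
    qed
    also have "\<dots> = c * (LINT z|lborel. indicator S z * norm (X - (z, 0)) powr - 2) + (1 / (2 * \<delta>)) * (LINT z|lborel. exp_weight S \<Phi> n z)"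
      by (subst Bochner_Integration.integral_add[OF integrable_mult_right[OF ir] integrable_mult_right[OF ie]]) simp
    also have "\<dots> \<le> c * riesz_sup S 2 + (1 / (2 * \<delta>)) * (\<delta> * \<eta>)"
      using \<delta> E(2) riesz_sup_bounds(2)[OF SB bf(2), of 2 X] by (intro add_mono mult_left_mono) (auto simp: c_def)
    also have "c * riesz_sup S 2 = (\<delta> / 2) * D" by (simp add: c_def D_def)
    also have "(\<delta> / 2) * D = \<eta> / 2 * (D / (D + 1))" by (simp add: \<delta>_def)
    also have "\<dots> \<le> \<eta> / 2 * 1" using D \<eta> by (intro mult_left_mono) (auto simp: field_simps)
    finally show ?thesis using \<delta> by simp
  qed
  then show ?thesis using E(1) by (intro exI[of _ n]) (auto simp: n_def)
qed

text \<open>The unknown of the fixed point problem is the boundary correction \<open>v\<close> and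
  not the density. Bounding \<open>v\<close> by 1 costs the factor \<open>exp 3\<close> and makes
  the exponential Lipschitz; \<open>n\<close> is chosen after all these constants, so that the
  contraction constant is 1/2.\<close>

lemma fixed_point_solution:
  assumes b: "profile S \<Phi>" and Q: "Q \<in> borel_measurable borel" "\<And>z. \<bar>Q z\<bar> \<le> C * indicator S z" and C: "0 \<le> C"
    and \<eta>: "0 < \<eta>"
  shows "\<exists>n\<ge>N. \<exists>f. bounded_density S (C * exp (3 * k + 3)) f \<and>
    (\<forall>z. f z = Q z * exp (3 * (real n * \<Phi> (z, 0) + (k + (- 1 / flux_const) * potential (\<lambda>Z. ln (norm Z)) f (z, 0))))) \<and>
    (\<forall>z\<in>S. \<bar>(- 1 / flux_const) * potential (\<lambda>Z. ln (norm Z)) f (z, 0)\<bar> \<le> 1) \<and>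
    (LINT z|lborel. exp_weight S \<Phi> n z) \<le> \<eta>"
proof -
  note bf = profile_facts[OF b]
  obtain R0 where R0: "\<And>z. z \<in> S \<Longrightarrow> norm z \<le> R0" using bf(2) bounded_iff by metis
  define R where "R = max R0 0"
  have RS: "S \<subseteq> cball 0 R" and R: "0 \<le> R" using R0 by (auto simp: R_def le_max_iff_disj)
  define E where "E = C * exp (3 * k + 3)"
  have E0: "0 \<le> E" using C by (simp add: E_def)
  \<comment> \<open>Lipschitz constant of the map per unit of weighted logarithm: 3 from the
    exponent, \<open>E\<close> from the density, \<open>1 / flux_const\<close> from the
    normalisation.\<close>
  define L where "L = 3 * E / flux_const"
  have L: "0 \<le> L" using E0 flux_const_pos by (simp add: L_def)
  \<comment> \<open>The first entry is the smallness demanded of the weight, the second makes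
    \<open>L * \<eta>' \<le> 1 / 2\<close>.\<close>
  define \<eta>' where "\<eta>' = min \<eta> (1 / (2 * (L + 1)))"
  have \<eta>': "0 < \<eta>'" using \<eta> L by (simp add: \<eta>'_def)
  obtain n where n: "n \<ge> N" "(LINT z|lborel. exp_weight S \<Phi> n z) \<le> \<eta>'"
    "\<And>X. X \<in> cball (0::R4) R \<Longrightarrow> (LINT z|lborel. \<bar>ln (norm (X - (z, 0)))\<bar> * exp_weight S \<Phi> n z) \<le> \<eta>'"
    using log_weight_small[OF b RS \<eta>', of N] by blast
  have L\<eta>: "L * \<eta>' \<le> 1 / 2"
  proof -
    have "L * \<eta>' \<le> L * (1 / (2 * (L + 1)))" using L by (intro mult_left_mono) (auto simp: \<eta>'_def)
    also have "\<dots> \<le> 1 / 2" using L by (simp add: field_simps)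
    finally show ?thesis .
  qed
  define F where "F = (\<lambda>v z. Q z * exp (3 * (real n * \<Phi> (z, 0) + (k + v z))))"
  define lp where "lp = potential (\<lambda>Z. ln (norm Z))"
  have [measurable]: "bdry \<Phi> \<in> borel_measurable borel" using bf(6) by (rule borel_measurable_continuous_onI)
  note [measurable] = Q(1)
  have Fle: "\<bar>F v z\<bar> \<le> E * exp_weight S \<Phi> n z" if "v z \<le> 1" for v z
  proof -
    have "exp (3 * (real n * \<Phi> (z, 0) + (k + v z))) \<le> exp (3 * (real n * \<Phi> (z, 0))) * exp (3 * k + 3)"
      unfolding exp_add[symmetric] using that by simp
    then have "\<bar>F v z\<bar> \<le> (C * indicator S z) * (exp (3 * (real n * \<Phi> (z, 0))) * exp (3 * k + 3))"
      unfolding F_def abs_mult using Q(2)[of z] C by (intro mult_mono) auto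
    then show ?thesis by (simp add: E_def exp_weight_def mult_ac)
  qed
  have Fd: "bounded_density S E (F v)" if v: "\<And>z. v z \<le> 1" "v \<in> borel_measurable borel" for v
  proof -
    have [measurable]: "v \<in> borel_measurable borel" by (rule v)
    have "F v \<in> borel_measurable borel" unfolding F_def by measurable
    moreover have "\<bar>F v z\<bar> \<le> E * indicator S z" for z
      using Fle[of v z] v(1) mult_left_mono[OF exp_weight_bounded_density(3)[OF b, of n z] E0] by (meson order_trans)
    ultimately show ?thesis using bf(1,2) E0 by (simp add: bounded_density_def)
  qed
  \<comment> \<open>The logarithmic potential is in general unbounded on the whole boundary.
    Composition with the projection onto a ball containing \<open>S\<close> gives a bounded
    continuous function that is unchanged on \<open>S\<close>, the only place where the density
    evaluates it.\<close>
  define cp where "cp = (\<lambda>x::R3. closest_point (cball 0 R) x)"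
  have cpR: "cp x \<in> cball 0 R" for x unfolding cp_def by (rule closest_point_in_set) (use R in auto)
  have cp4: "(cp x, 0::real) \<in> cball 0 R" for x using cpR[of x] by (simp add: norm_Pair)
  have cpS: "cp z = z" if "z \<in> S" for z unfolding cp_def by (rule closest_point_self) (use RS that in auto)
  have ccp: "continuous_on UNIV cp" unfolding cp_def by (rule continuous_on_closest_point) (use R in auto)
  define P where "P = (\<lambda>v x. (- 1 / flux_const) * lp (F v) (cp x, 0))"
  have Pc: "continuous_on UNIV (P v)" if v: "\<And>z. v z \<le> 1" "v \<in> borel_measurable borel" for v
  proof -
    have "continuous_on UNIV (lp (F v))" unfolding lp_def
      by (intro continuous_at_imp_continuous_on ballI has_derivative_continuous[OF potential_ln_has_derivative[OF Fd[OF v]]])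
    then have "continuous_on UNIV (\<lambda>x. lp (F v) (cp x, 0))"
      by (rule continuous_on_compose2) (auto intro!: continuous_intros ccp)
    then show ?thesis unfolding P_def by (intro continuous_intros)
  qed
  have Pb: "\<bar>P v x\<bar> \<le> 1 / 2" if v: "\<And>z. v z \<le> 1" "v \<in> borel_measurable borel" for v x
  proof -
    have "\<bar>lp (F v) (cp x, 0)\<bar> \<le> E * (LINT z|lborel. \<bar>ln (norm ((cp x, 0) - (z, 0::real)))\<bar> * exp_weight S \<Phi> n z)"
      unfolding lp_def by (rule potential_ln_weighted_bound[OF b RS cp4 Fd[of v, OF v] E0 Fle[of v]]) (rule v(1))
    also have "\<dots> \<le> E * \<eta>'" by (intro mult_left_mono n(3) cp4 E0)
    finally have "\<bar>P v x\<bar> \<le> (1 / flux_const) * (E * \<eta>')" unfolding P_def abs_mult using flux_const_pos by (simp add: divide_right_mono)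
    also have "\<dots> \<le> L * \<eta>'" unfolding L_def using flux_const_pos E0 \<eta>' by (simp add: divide_right_mono)
    finally show ?thesis using L\<eta> by linarith
  qed
  have Pl: "\<bar>P v x - P w x\<bar> \<le> 1 / 2 * d" if v: "\<And>z. v z \<le> 1" "v \<in> borel_measurable borel"
    and w: "\<And>z. w z \<le> 1" "w \<in> borel_measurable borel" and d: "\<And>z. \<bar>v z - w z\<bar> \<le> d" for v w x d
  proof -
    have d0: "0 \<le> d" using d[of 0] abs_ge_zero order_trans by blast
    have fd: "\<bar>F v z - F w z\<bar> \<le> (3 * E * d) * exp_weight S \<Phi> n z" for z
    proof -
      have "F v z - F w z = (Q z * exp (3 * (real n * \<Phi> (z, 0))) * exp (3 * k)) * (exp (3 * v z) - exp (3 * w z))"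
        by (simp add: F_def exp_add[symmetric] algebra_simps)
      then have "\<bar>F v z - F w z\<bar> = \<bar>Q z\<bar> * (exp (3 * (real n * \<Phi> (z, 0))) * exp (3 * k)) * \<bar>exp (3 * v z) - exp (3 * w z)\<bar>"
        by (simp add: abs_mult)
      also have "\<dots> \<le> (C * indicator S z) * (exp (3 * (real n * \<Phi> (z, 0))) * exp (3 * k)) * (exp 3 * (3 * d))"
      proof (intro mult_mono mult_right_mono Q(2))
        have "\<bar>exp (3 * v z) - exp (3 * w z)\<bar> \<le> exp 3 * \<bar>3 * v z - 3 * w z\<bar>" using v(1)[of z] w(1)[of z] by (intro exp_diff_le) auto
        also have "\<dots> \<le> exp 3 * (3 * d)" using d[of z] by (intro mult_left_mono) auto
        finally show "\<bar>exp (3 * v z) - exp (3 * w z)\<bar> \<le> exp 3 * (3 * d)" .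
      qed (use C d0 in auto)
      also have "\<dots> = (3 * E * d) * exp_weight S \<Phi> n z" by (simp add: E_def exp_weight_def exp_add mult_ac)
      finally show ?thesis .
    qed
    have dd: "bounded_density S (3 * E * d) (\<lambda>z. F v z - F w z)"
    proof -
      have m: "(\<lambda>z. F v z - F w z) \<in> borel_measurable borel"
        using Fd[OF v] Fd[OF w] by (intro borel_measurable_diff) (auto simp: bounded_density_def)
      have p: "0 \<le> 3 * E * d" using E0 d0 by simp
      have "\<bar>F v z - F w z\<bar> \<le> (3 * E * d) * indicator S z" for z
        using fd[of z] mult_left_mono[OF exp_weight_bounded_density(3)[OF b, of n z] p] by (rule order_trans)
      then show ?thesis using bf(1,2) m p by (simp add: bounded_density_def)
    qed
    have "lp (F v) (cp x, 0) - lp (F w) (cp x, 0) = lp (\<lambda>z. F v z - F w z) (cp x, 0)"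
      unfolding lp_def potential_def right_diff_distrib
      by (rule Bochner_Integration.integral_diff[symmetric]) (rule potential_ln_bound(1)[OF Fd[OF v] RS cp4], rule potential_ln_bound(1)[OF Fd[OF w] RS cp4])
    also have "\<bar>lp (\<lambda>z. F v z - F w z) (cp x, 0)\<bar> \<le> (3 * E * d) * (LINT z|lborel. \<bar>ln (norm ((cp x, 0) - (z, 0::real)))\<bar> * exp_weight S \<Phi> n z)"
      unfolding lp_def by (rule potential_ln_weighted_bound[OF b RS cp4 dd]) (use E0 d0 fd in auto)
    also have "\<dots> \<le> (3 * E * d) * \<eta>'" using E0 d0 by (intro mult_left_mono n(3) cp4) auto
    finally have le: "\<bar>lp (F v) (cp x, 0) - lp (F w) (cp x, 0)\<bar> \<le> (3 * E * d) * \<eta>'" .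
    have "P v x - P w x = (- 1 / flux_const) * (lp (F v) (cp x, 0) - lp (F w) (cp x, 0))" by (simp add: P_def algebra_simps)
    then have "\<bar>P v x - P w x\<bar> = (1 / flux_const) * \<bar>lp (F v) (cp x, 0) - lp (F w) (cp x, 0)\<bar>" using flux_const_pos by (simp add: abs_mult)
    also have "\<dots> \<le> (1 / flux_const) * ((3 * E * d) * \<eta>')" using le flux_const_pos by (intro mult_left_mono) auto
    also have "\<dots> = (L * \<eta>') * d" by (simp add: L_def)
    also have "\<dots> \<le> 1 / 2 * d" using L\<eta> d0 by (intro mult_right_mono) auto
    finally show ?thesis .
  qed
  define D where "D = cball (0 :: R3 \<Rightarrow>\<^sub>C real) 1"
  define T where "T = (\<lambda>v. Bcontfun (P (apply_bcontfun v)))"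
  have vD: "apply_bcontfun v z \<le> 1" if "v \<in> D" for v z
  proof -
    have "norm (apply_bcontfun v z) \<le> norm v" by (rule norm_bounded)
    then show ?thesis using that by (simp add: D_def abs_le_iff)
  qed
  have vm: "apply_bcontfun v \<in> borel_measurable borel" for v :: "R3 \<Rightarrow>\<^sub>C real"
    by (rule borel_measurable_continuous_onI) simp
  have TP: "apply_bcontfun (T v) = P (apply_bcontfun v)" if "v \<in> D" for v
    unfolding T_def by (rule Bcontfun_inverse, rule bcontfun_normI[of _ "1/2"]) (use Pc Pb vD[OF that] vm in auto)
  have "\<exists>!v\<in>D. T v = v"
  proof (rule Banach_fix[of D "1/2" T])
    show "complete D" by (simp add: D_def complete_eq_closed)
    show "D \<noteq> {}" by (auto simp: D_def)
    show "T ` D \<subseteq> D"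
    proof
      fix u assume "u \<in> T ` D"
      then obtain v where v: "u = T v" "v \<in> D" by blast
      have "norm (apply_bcontfun (T v) x) \<le> 1" for x
        unfolding TP[OF v(2)] using Pb[OF vD[OF v(2)] vm, of x] by simp
      then have "norm (T v) \<le> 1" by (rule norm_bound)
      then show "u \<in> D" by (simp add: v D_def)
    qed
    show "dist (T v) (T w) \<le> 1 / 2 * dist v w" if v: "v \<in> D" and w: "w \<in> D" for v w
    proof (rule dist_bound)
      fix x
      have "\<bar>P (apply_bcontfun v) x - P (apply_bcontfun w) x\<bar> \<le> 1 / 2 * dist v w"
        by (rule Pl[OF vD[OF v] vm vD[OF w] vm]) (use dist_bounded[of v _ w] in \<open>simp add: dist_real_def\<close>)
      then show "dist (apply_bcontfun (T v) x) (apply_bcontfun (T w) x) \<le> 1 / 2 * dist v w"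
        unfolding TP[OF v] TP[OF w] by (simp add: dist_real_def)
    qed
  qed auto
  then obtain v where v: "v \<in> D" "T v = v" by blast
  define f where "f = F (apply_bcontfun v)"
  have fix_eq: "apply_bcontfun v z = (- 1 / flux_const) * lp f (z, 0)" if "z \<in> S" for z
  proof -
    have "apply_bcontfun v z = P (apply_bcontfun v) z" using TP[OF v(1)] v(2) by simp
    then show ?thesis using cpS[OF that] by (simp add: P_def f_def)
  qed
  have "f z = Q z * exp (3 * (real n * \<Phi> (z, 0) + (k + (- 1 / flux_const) * lp f (z, 0))))" for z
  proof (cases "z \<in> S")
    case True
    then show ?thesis using fix_eq[OF True] by (simp add: f_def F_def)
  next
    case False
    then have "Q z = 0" using Q(2)[of z] by simp
    then show ?thesis by (simp add: f_def F_def)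
  qed
  moreover have "bounded_density S E f" unfolding f_def by (rule Fd[OF vD[OF v(1)] vm])
  moreover have "\<bar>(- 1 / flux_const) * lp f (z, 0)\<bar> \<le> 1" if "z \<in> S" for z
  proof -
    have "apply_bcontfun v z = P (apply_bcontfun v) z" using TP[OF v(1)] v(2) by simp
    then have "\<bar>apply_bcontfun v z\<bar> \<le> 1 / 2" using Pb[OF vD[OF v(1)] vm, of z] by simp
    then show ?thesis unfolding fix_eq[OF that] by linarith
  qed
  moreover have "(LINT z|lborel. exp_weight S \<Phi> n z) \<le> \<eta>" using n(2) by (simp add: \<eta>'_def)
  ultimately show ?thesis using n(1) unfolding lp_def E_def by blast
qed

section \<open>Solutions and their convergence\<close>

lemma affine_Ck_on:
  assumes S: "thick S" and p: "p \<in> Ck_on k S"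
  shows "(\<lambda>X. c + b * p X) \<in> Ck_on k S"
    and "\<And>m vs X. m \<le> k \<Longrightarrow> vs \<in> dirs m \<Longrightarrow> X \<in> S \<Longrightarrow>
      partial S vs (\<lambda>X. c + b * p X) X = (if vs = [] then c else 0) + b * partial S vs p X"
proof -
  have d: "((\<lambda>X::'a. if vs = [] then c else 0) has_derivative
      (\<lambda>h. \<Sum>i\<in>Basis. (h \<bullet> i) * (if i # vs = [] then c else 0))) (at X within S)" for vs :: "'a list" and X
    by simp
  have e: "(if ([]::'a list) = [] then c else 0) = c" by simp
  have t: "continuous_on S (\<lambda>X::'a. if vs = [] then c else 0)" for vs :: "'a list" by (rule continuous_on_const)
  note const = Ck_onI[OF S, of "\<lambda>vs X. if vs = [] then c else 0" "\<lambda>X. c" k, OF e d t]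
  note L = Ck_on_lincomb[OF S const(1) p, where a=1 and b=b]
  show "(\<lambda>X. c + b * p X) \<in> Ck_on k S" using L(1) by simp
  show "partial S vs (\<lambda>X. c + b * p X) X = (if vs = [] then c else 0) + b * partial S vs p X"
    if "m \<le> k" "vs \<in> dirs m" "X \<in> S" for m vs X
    using L(2)[OF that] const(2)[OF that] by (simp only: mult_1)
qed

lemma laplacian_laplacian_eq:
  assumes "U \<in> Ck_on 4 upper" "X \<in> upper"
  shows "laplacian (laplacian U) X = (\<Sum>i\<in>Basis. \<Sum>j\<in>Basis. partial upper ([i, i] @ [j, j]) U X)"
  unfolding laplacian_def[of "laplacian U"]
proof (rule sum.cong[OF refl])
  fix i :: R4 assume "i \<in> Basis"
  then have "[i, i] \<in> dirs 2" by (simp add: dirs_def)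
  then show "partial UNIV [i, i] (laplacian U) X = (\<Sum>j\<in>Basis. partial upper ([i, i] @ [j, j]) U X)"
    using partial_laplacian[of U 2 upper 2 "[i, i]" X] assms thick_open[OF open_upper] by simp
qed

lemma laplacian_upper_eq: "X \<in> upper \<Longrightarrow> laplacian U X = (\<Sum>i\<in>Basis. partial upper [i, i] U X)"
  unfolding laplacian_def by (rule sum.cong[OF refl], rule partial_UNIV_open[OF open_upper])

lemma laplacian_affine_combination:
  fixes a b c :: real and p \<Phi> :: "R4 \<Rightarrow> real"
  assumes F: "\<Phi> \<in> Ck_on 4 upper" and p: "p \<in> Ck_on 4 upper" and X: "X \<in> upper"
  defines "U \<equiv> \<lambda>X. a * \<Phi> X + (c + b * p X)"
  shows "U \<in> Ck_on 4 upper" "laplacian U X = a * laplacian \<Phi> X + b * laplacian p X"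
    "laplacian (laplacian U) X = a * laplacian (laplacian \<Phi>) X + b * laplacian (laplacian p) X"
proof -
  note th = thick_open[OF open_upper]
  note A = affine_Ck_on[OF th p, where c=c and b=b]
  note L = Ck_on_lincomb[OF th F A(1), where a=a and b=1]
  show U: "U \<in> Ck_on 4 upper" using L(1) by (simp add: U_def)
  have P: "partial upper vs U X = a * partial upper vs \<Phi> X + b * partial upper vs p X"
    if "vs \<in> dirs m" "m \<le> 4" "vs \<noteq> []" for vs m
    using L(2)[OF that(2,1) X] A(2)[OF that(2,1) X] that(3) by (simp add: U_def del: partial.simps)
  have "partial upper [i, i] U X = a * partial upper [i, i] \<Phi> X + b * partial upper [i, i] p X" if "i \<in> Basis" for i
    by (rule P[of _ 2]) (use that in \<open>auto simp: dirs_def\<close>)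
  then show "laplacian U X = a * laplacian \<Phi> X + b * laplacian p X"
    unfolding laplacian_upper_eq[OF X] sum_distrib_left sum.distrib[symmetric] by (rule sum.cong[OF refl])
  have "partial upper ([i, i] @ [j, j]) U X = a * partial upper ([i, i] @ [j, j]) \<Phi> X + b * partial upper ([i, i] @ [j, j]) p X"
    if "i \<in> Basis" "j \<in> Basis" for i j
    by (rule P[of _ 4]) (use that in \<open>auto simp: dirs_def\<close>)
  then show "laplacian (laplacian U) X = a * laplacian (laplacian \<Phi>) X + b * laplacian (laplacian p) X"
    unfolding laplacian_laplacian_eq[OF U X] laplacian_laplacian_eq[OF F X] laplacian_laplacian_eq[OF p X]
      sum_distrib_left sum.distrib[symmetric] by (intro sum.cong[OF refl])
qed

text \<open>Seen from a boundary point, all sources lie in the same hyperplane, so the vertical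
  component of the gradient kernel is identically zero.\<close>

lemma potential_ln_dy_zero:
  assumes f: "bounded_density \<Omega> M f"
  shows "dy_zero_on S (potential (\<lambda>Z. ln (norm Z)) f)"
  unfolding dy_zero_on_def
proof
  fix x
  have ey: "(0::R3, 1::real) \<in> Basis" by (simp add: Basis_prod_def)
  have d: "(potential (\<lambda>Z. ln (norm Z)) f has_derivative (\<lambda>h. \<Sum>i\<in>Basis. (h \<bullet> i) * potential (log_grad i) f ((x, 0) + 0 *\<^sub>R (0, 1))))
      (at ((x, 0) + 0 *\<^sub>R (0, 1)) within UNIV)"
    by (rule potential_ln_has_derivative[OF f])
  have "((\<lambda>s. potential (\<lambda>Z. ln (norm Z)) f ((x, 0) + s *\<^sub>R (0, 1))) has_real_derivative
      (\<Sum>i\<in>Basis. ((0, 1) \<bullet> i) * potential (log_grad i) f ((x, 0) + 0 *\<^sub>R (0, 1)))) (at 0 within {s. (x, 0) + s *\<^sub>R (0, 1) \<in> (UNIV :: R4 set)})"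
    using has_derivative_line[OF d] .
  then have "((\<lambda>s. potential (\<lambda>Z. ln (norm Z)) f (x, s)) has_real_derivative potential (log_grad (0, 1)) f (x, 0)) (at 0)"
    unfolding sum_Basis_pick[OF ey, of "\<lambda>i. potential (log_grad i) f ((x, 0) + 0 *\<^sub>R (0, 1))"] by simp
  moreover have "potential (log_grad (0, 1)) f (x, 0) = 0" by (simp add: potential_def log_grad_def inner_prod_def)
  ultimately show "((\<lambda>y. potential (\<lambda>Z. ln (norm Z)) f (x, y)) has_real_derivative 0) (at 0 within {0..})"
    using has_field_derivative_at_within by fastforce
qed

text \<open>\<open>Q\<close> is only Lebesgue measurable and bounded almost everywhere, whereas the
  fixed point construction works with a Borel function bounded at every point. A Borel version is
  truncated to the interval from \<open>- C'\<close> to \<open>C'\<close>; integrals do not notice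
  the difference.\<close>

lemma Linf_representative:
  assumes S: "S \<in> sets borel" and Q: "Q \<in> Linf S" "Linf_norm S Q \<le> ereal C" and C: "C \<le> C'" "0 \<le> C'"
  shows "\<exists>q\<in>borel_measurable borel. (\<forall>z. \<bar>q z\<bar> \<le> C' * indicator S z) \<and> (AE z in lborel. z \<in> S \<longrightarrow> Q z = q z)"
    and "(\<lambda>z. indicator S z * Q z) \<in> borel_measurable lebesgue"
proof -
  have Sl: "S \<inter> space lebesgue \<in> sets lebesgue" using S by simp
  have Qm: "Q \<in> borel_measurable (lebesgue_on S)" using Q(1) by (simp add: Linf_def)
  then show m: "(\<lambda>z. indicator S z * Q z) \<in> borel_measurable lebesgue"
    unfolding borel_measurable_restrict_space_iff[OF Sl] by simp
  obtain g where g: "g \<in> borel_measurable lborel" "AE z in lborel. indicator S z * Q z = g z"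
    using completion_ex_borel_measurable_real[OF m] by blast
  have "AE z in lebesgue_on S. ereal \<bar>Q z\<bar> \<le> Linf_norm S Q" unfolding Linf_norm_def by (rule esssup_AE)
  then have "AE z in lebesgue_on S. \<bar>Q z\<bar> \<le> C'"
  proof eventually_elim
    case (elim z)
    then have "ereal \<bar>Q z\<bar> \<le> ereal C" using Q(2) by (rule order_trans)
    then show ?case using C by simp
  qed
  then have b: "AE z in lborel. z \<in> S \<longrightarrow> \<bar>Q z\<bar> \<le> C'"
    unfolding AE_restrict_space_iff[OF Sl] AE_completion_iff .
  define q where "q = (\<lambda>z. indicator S z * max (- C') (min C' (g z)))"
  have "q \<in> borel_measurable borel" using g(1) S unfolding q_def by simp
  moreover have "\<bar>q z\<bar> \<le> C' * indicator S z" for z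
    using C(2) by (auto simp: q_def indicator_def abs_le_iff)
  moreover have "AE z in lborel. z \<in> S \<longrightarrow> Q z = q z"
    using g(2) b by eventually_elim (auto simp: q_def)
  ultimately show "\<exists>q\<in>borel_measurable borel. (\<forall>z. \<bar>q z\<bar> \<le> C' * indicator S z) \<and> (AE z in lborel. z \<in> S \<longrightarrow> Q z = q z)"
    by blast
qed

lemma test_trace_bounded:
  assumes \<psi>: "\<psi> \<in> test_functions S"
  shows "(\<lambda>z. \<psi> (z, 0)) \<in> borel_measurable borel" "\<exists>B\<ge>0. \<forall>z. \<bar>\<psi> (z, 0)\<bar> \<le> B"
proof -
  note tf = test_function_facts[OF \<psi>]
  define K where "K = closure {X \<in> upper_closed. \<psi> X \<noteq> 0}"
  have c: "continuous_on upper_closed \<psi>" using Ck_on_continuous[OF tf(4)[of 0], of 0 "[]"] by simp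
  have "continuous_on UNIV (\<lambda>z. \<psi> (z, 0))"
    by (rule continuous_on_compose2[OF c]) (auto intro!: continuous_intros simp: upper_closed_def)
  then show "(\<lambda>z. \<psi> (z, 0)) \<in> borel_measurable borel" by (rule borel_measurable_continuous_onI)
  have "continuous_on K \<psi>" using c tf(2) continuous_on_subset by (auto simp: K_def)
  from compact_imp_bounded[OF compact_continuous_image[OF this]] tf(1)
  obtain B where B: "\<And>X. X \<in> K \<Longrightarrow> \<bar>\<psi> X\<bar> \<le> B" by (auto simp: K_def bounded_iff)
  have "\<bar>\<psi> (z, 0)\<bar> \<le> max B 0" for z
  proof (cases "(z, 0) \<in> K")
    case False
    then have "\<psi> (z, 0) = 0" using tf(5)[of "[]" 0 "(z, 0)"] by (simp add: K_def upper_closed_def)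
    then show ?thesis by simp
  qed (use B[of "(z, 0)"] in simp)
  then show "\<exists>B\<ge>0. \<forall>z. \<bar>\<psi> (z, 0)\<bar> \<le> B" by (intro exI[of _ "max B 0"]) simp
qed

text \<open>The profile contributes nothing to the weak equation; the potential contributes
  \<open>2 * (- 1 / flux_const) * (- flux_const) = 2\<close> times the integral of
  \<open>f * \<psi>\<close>, which explains the normalisation of the correction. On
  \<open>S\<close>, \<open>f\<close> coincides almost everywhere with the prescribed right-hand
  side.\<close>

lemma is_solution_log_perturbation:
  assumes b: "profile S \<Phi>" and dy: "dy_zero_on UNIV \<Phi>" and f: "bounded_density S M f"
    and fq: "\<And>z. f z = q z * exp (3 * (\<beta> * \<Phi> (z, 0) + (c + (- 1 / flux_const) * potential (\<lambda>Z. ln (norm Z)) f (z, 0))))"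
    and Qm: "(\<lambda>z. indicator S z * Q z) \<in> borel_measurable lebesgue"
    and Qq: "AE z in lborel. z \<in> S \<longrightarrow> Q z = q z"
  shows "is_solution S Q (\<lambda>X. \<beta> * \<Phi> X + (c + (- 1 / flux_const) * potential (\<lambda>Z. ln (norm Z)) f X))"
proof -
  note bf = profile_facts[OF b]
  define p where "p = potential (\<lambda>Z. ln (norm Z)) f"
  define U where "U = (\<lambda>X. \<beta> * \<Phi> X + (c + (- 1 / flux_const) * p X))"
  have th: "thick upper" by (rule thick_open[OF open_upper])
  have F4: "\<Phi> \<in> Ck_on 4 upper" using bf(8) by (simp add: biharmonic_def)
  have p4: "p \<in> Ck_on 4 upper" unfolding p_def by (rule potential_ln_Ck_upper[OF f])
  note lap = laplacian_affine_combination[OF F4 p4, where a=\<beta> and c=c and b="- 1 / flux_const", folded U_def]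
  have pc: "continuous_on UNIV p" unfolding p_def
    by (intro continuous_at_imp_continuous_on ballI has_derivative_continuous[OF potential_ln_has_derivative[OF f]])
  have fS: "f z = 0" if "z \<notin> S" for z
  proof -
    have "\<bar>f z\<bar> \<le> M * indicator S z" using f by (simp add: bounded_density_def)
    then show ?thesis using that by simp
  qed
  have "continuous_on upper_closed \<Phi>" using b by (simp add: profile_def representable_def)
  then have 1: "continuous_on upper_closed U"
    unfolding U_def by (intro continuous_intros continuous_on_subset[OF pc]) auto
  have 2: "biharmonic U"
    unfolding biharmonic_def
  proof (intro conjI ballI)
    have "((0::R3), (1::real)) \<in> upper" by (simp add: upper_def)
    then show "U \<in> Ck_on 4 upper" by (rule lap(1))
    fix X assume X: "X \<in> upper"
    show "laplacian (laplacian U) X = 0"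
      using lap(3)[OF X] bf(8) biharmonic_potential_ln[OF f] X by (simp add: biharmonic_def p_def)
  qed
  have 3: "dy_zero_on UNIV U"
    unfolding dy_zero_on_def
  proof
    fix x
    have "((\<lambda>y. \<Phi> (x, y)) has_real_derivative 0) (at 0 within {0..})" using dy by (simp add: dy_zero_on_def)
    moreover have "((\<lambda>y. p (x, y)) has_real_derivative 0) (at 0 within {0..})"
      using potential_ln_dy_zero[OF f, of UNIV] by (simp add: dy_zero_on_def p_def)
    ultimately have "((\<lambda>y. \<beta> * \<Phi> (x, y) + (c + (- 1 / flux_const) * p (x, y))) has_real_derivative (\<beta> * 0 + (0 + (- 1 / flux_const) * 0))) (at 0 within {0..})"
      by (intro DERIV_add DERIV_const DERIV_cmult)
    then show "((\<lambda>y. U (x, y)) has_real_derivative 0) (at 0 within {0..})" by (simp add: U_def)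
  qed
  have 4: "L32_weak_on S U (\<lambda>x. Q x * exp (3 * bdry U x))"
    unfolding L32_weak_on_def
  proof
    fix \<psi> assume \<psi>: "\<psi> \<in> test_functions S"
    note w1 = weak_equation_smooth[OF bf(1) bf(3) bf(8) bf(7) \<psi>]
    note w2 = weak_equation_potential[OF f \<psi>]
    note tt = test_trace_bounded[OF \<psi>]
    obtain B where B: "0 \<le> B" "\<And>z. \<bar>\<psi> (z, 0)\<bar> \<le> B" using tt(2) by blast
    have "bounded_density S (M * B) (\<lambda>z. f z * \<psi> (z, 0))"
    proof -
      have "(\<lambda>z. f z * \<psi> (z, 0)) \<in> borel_measurable borel" using f tt(1) by (intro borel_measurable_times) (auto simp: bounded_density_def)
      moreover have "\<bar>f z * \<psi> (z, 0)\<bar> \<le> M * B * indicator S z" for z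
      proof -
        have "\<bar>f z\<bar> * \<bar>\<psi> (z, 0)\<bar> \<le> (M * indicator S z) * B" using f B by (intro mult_mono) (auto simp: bounded_density_def)
        then show ?thesis by (simp add: abs_mult mult_ac)
      qed
      ultimately show ?thesis using f B by (simp add: bounded_density_def)
    qed
    from bounded_density_integrable[OF this] have i: "integrable lborel (\<lambda>z. f z * \<psi> (z, 0))" .
    then have m: "(\<lambda>z. f z * \<psi> (z, 0)) \<in> borel_measurable lborel" by (rule borel_measurable_integrable)
    have il: "integrable lebesgue (\<lambda>z. f z * \<psi> (z, 0))" using integrable_completion[OF m] i by simp
    define G where "G = (\<lambda>z. indicator S z *\<^sub>R (Q z * exp (3 * bdry U z) * \<psi> (z, 0)))"
    have Ub: "continuous_on UNIV (bdry U)"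
      by (rule continuous_on_compose2[OF 1]) (auto intro!: continuous_intros simp: upper_closed_def)
    then have "continuous_on UNIV (\<lambda>z. exp (3 * bdry U z))" by (intro continuous_intros)
    then have "(\<lambda>z. exp (3 * bdry U z)) \<in> borel_measurable lborel"
      using borel_measurable_continuous_onI by simp
    from measurable_completion[OF this] have me: "(\<lambda>z. exp (3 * bdry U z)) \<in> borel_measurable lebesgue" .
    have mt: "(\<lambda>z. \<psi> (z, 0)) \<in> borel_measurable lebesgue" using measurable_completion[of "\<lambda>z. \<psi> (z, 0)" lborel borel] tt(1) by simp
    have "G = (\<lambda>z. (indicator S z * Q z) * (exp (3 * bdry U z) * \<psi> (z, 0)))" by (simp add: G_def fun_eq_iff)
    then have Gm: "G \<in> borel_measurable lebesgue" using borel_measurable_times[OF Qm borel_measurable_times[OF me mt]] by simp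
    have "AE z in lborel. f z * \<psi> (z, 0) = G z"
      using Qq
    proof eventually_elim
      case (elim z)
      show ?case
      proof (cases "z \<in> S")
        case True
        then show ?thesis using elim fq[of z] by (simp add: G_def U_def p_def)
      qed (simp add: fS G_def)
    qed
    then have ae: "AE z in lebesgue. f z * \<psi> (z, 0) = G z" by (rule AE_completion)
    have Gi: "integrable lebesgue G" by (rule integrable_cong_AE_imp[OF il Gm ae])
    have "(LINT z|lebesgue. G z) = (LINT z|lebesgue. f z * \<psi> (z, 0))"
      by (rule integral_cong_AE[symmetric]) (use il Gm ae in \<open>auto intro: borel_measurable_integrable\<close>)
    also have "\<dots> = (LINT z|lborel. f z * \<psi> (z, 0))" by (rule integral_completion[OF m])
    finally have Gv: "(LINT x:S|lebesgue. Q x * exp (3 * bdry U x) * \<psi> (x, 0)) = (LINT z|lborel. f z * \<psi> (z, 0))"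
      by (simp add: G_def set_lebesgue_integral_def)
    have lapU: "laplacian U X = \<beta> * laplacian \<Phi> X + (- 2 / flux_const) * potential inv_square f X" if "X \<in> upper" for X
      using lap(2)[OF that] laplacian_potential_ln[OF f, of X] by (simp add: p_def)
    define H1 where "H1 = (\<lambda>X. indicator upper X *\<^sub>R (laplacian \<Phi> X * laplacian \<psi> X))"
    define H2 where "H2 = (\<lambda>X. indicator upper X *\<^sub>R (potential inv_square f X * laplacian \<psi> X))"
    have H: "integrable lebesgue H1" "integrable lebesgue H2"
      using w1(1) w2(1) by (auto simp: H1_def H2_def set_integrable_def)
    have eq: "(\<lambda>X. indicator upper X *\<^sub>R (laplacian U X * laplacian \<psi> X)) = (\<lambda>X. \<beta> * H1 X + (- 2 / flux_const) * H2 X)"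
    proof
      fix X
      show "indicator upper X *\<^sub>R (laplacian U X * laplacian \<psi> X) = \<beta> * H1 X + (- 2 / flux_const) * H2 X"
      proof (cases "X \<in> upper")
        case True
        show ?thesis unfolding H1_def H2_def lapU[OF True] using True by (simp add: algebra_simps)
      qed (simp add: H1_def H2_def)
    qed
    have Hi: "integrable lebesgue (\<lambda>X. \<beta> * H1 X)" "integrable lebesgue (\<lambda>X. (- 2 / flux_const) * H2 X)"
      using H by (auto intro: integrable_mult_right)
    have Hv: "(LINT X|lebesgue. H1 X) = 0" "(LINT X|lebesgue. H2 X) = - flux_const * (LINT z|lborel. f z * \<psi> (z, 0))"
      using w1(2) w2(2) by (auto simp: H1_def H2_def set_lebesgue_integral_def)
    have "(LINT X:upper|lebesgue. laplacian U X * laplacian \<psi> X) = (LINT X|lebesgue. \<beta> * H1 X + (- 2 / flux_const) * H2 X)"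
      unfolding set_lebesgue_integral_def eq ..
    also have "\<dots> = (LINT X|lebesgue. \<beta> * H1 X) + (LINT X|lebesgue. (- 2 / flux_const) * H2 X)"
      by (rule Bochner_Integration.integral_add[OF Hi])
    also have "\<dots> = \<beta> * (LINT X|lebesgue. H1 X) + (- 2 / flux_const) * (LINT X|lebesgue. H2 X)"
      by (simp only: integral_mult_right_zero)
    also have "\<dots> = 2 * (LINT z|lborel. f z * \<psi> (z, 0))" unfolding Hv using flux_const_pos by simp
    finally have Lv: "(LINT X:upper|lebesgue. laplacian U X * laplacian \<psi> X) = 2 * (LINT z|lborel. f z * \<psi> (z, 0))" .
    show "set_integrable lebesgue upper (\<lambda>X. laplacian U X * laplacian \<psi> X) \<and>
        set_integrable lebesgue S (\<lambda>x. Q x * exp (3 * bdry U x) * \<psi> (x, 0)) \<and>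
        (LINT X:upper|lebesgue. laplacian U X * laplacian \<psi> X)
          - 2 * (LINT x:S|lebesgue. Q x * exp (3 * bdry U x) * \<psi> (x, 0)) = 0"
    proof (intro conjI)
      show "set_integrable lebesgue upper (\<lambda>X. laplacian U X * laplacian \<psi> X)"
        unfolding set_integrable_def eq by (rule Bochner_Integration.integrable_add[OF Hi])
      show "set_integrable lebesgue S (\<lambda>x. Q x * exp (3 * bdry U x) * \<psi> (x, 0))"
        using Gi by (simp only: set_integrable_def G_def)
      show "(LINT X:upper|lebesgue. laplacian U X * laplacian \<psi> X)
          - 2 * (LINT x:S|lebesgue. Q x * exp (3 * bdry U x) * \<psi> (x, 0)) = 0"
        unfolding Lv Gv by simp
    qed
  qed
  show ?thesis using 1 2 3 4 unfolding is_solution_def U_def p_def by blast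
qed

text \<open>The correction is at most 1 on \<open>S\<close>, so the mass in any ball is bounded by a
  multiple of the integral of the weight over all of \<open>S\<close>.\<close>

lemma concentration_integral_le:
  assumes b: "profile S \<Phi>" and C: "0 \<le> C" and q: "\<And>z. \<bar>q z\<bar> \<le> C * indicator S z"
    and Qq: "AE z in lborel. z \<in> S \<longrightarrow> Q z = q z"
    and W: "\<And>z. z \<in> S \<Longrightarrow> \<bar>w z\<bar> \<le> 1" and u: "\<And>z. u z = real n * \<Phi> (z, 0) + (c + w z)"
  shows "(\<integral>\<^sup>+x\<in>B \<inter> S. ennreal (\<bar>Q x\<bar> * exp (3 * u x)) \<partial>lebesgue)
    \<le> ennreal (C * exp (3 * c + 3) * (LINT z|lborel. exp_weight S \<Phi> n z))"
proof -
  define M where "M = C * exp (3 * c + 3)"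
  have M: "0 \<le> M" using C by (simp add: M_def)
  have ie: "integrable lborel (\<lambda>z. M * exp_weight S \<Phi> n z)"
    by (intro integrable_mult_right bounded_density_integrable[OF exp_weight_bounded_density(1)[OF b]])
  have e0: "0 \<le> M * exp_weight S \<Phi> n z" for z using M exp_weight_bounded_density(2)[OF b, of n z] by simp
  have "(\<integral>\<^sup>+x\<in>B \<inter> S. ennreal (\<bar>Q x\<bar> * exp (3 * u x)) \<partial>lebesgue) \<le> (\<integral>\<^sup>+z. ennreal (M * exp_weight S \<Phi> n z) \<partial>lebesgue)"
  proof (rule nn_integral_mono_AE)
    show "AE z in lebesgue. ennreal (\<bar>Q z\<bar> * exp (3 * u z)) * indicator (B \<inter> S) z \<le> ennreal (M * exp_weight S \<Phi> n z)"
      using AE_completion[OF Qq]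
    proof eventually_elim
      case (elim z)
      show ?case
      proof (cases "z \<in> B \<inter> S")
        case True
        then have z: "z \<in> S" by simp
        have "\<bar>Q z\<bar> * exp (3 * u z) \<le> C * (exp (3 * (real n * \<Phi> (z, 0))) * exp (3 * c + 3))"
        proof (rule mult_mono)
          show "\<bar>Q z\<bar> \<le> C" using q[of z] elim z by simp
          show "exp (3 * u z) \<le> exp (3 * (real n * \<Phi> (z, 0))) * exp (3 * c + 3)"
            unfolding exp_add[symmetric] u using W[OF z] by (simp add: abs_le_iff)
        qed (use C in auto)
        also have "\<dots> = M * exp_weight S \<Phi> n z" using z by (simp add: M_def exp_weight_def)
        finally show ?thesis using True by (simp add: ennreal_leI)
      qed simp
    qed
  qed
  also have "\<dots> = (\<integral>\<^sup>+z. ennreal (M * exp_weight S \<Phi> n z) \<partial>lborel)" by (rule nn_integral_completion)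
  also have "\<dots> = ennreal (LINT z|lborel. M * exp_weight S \<Phi> n z)" by (rule nn_integral_eq_integral[OF ie]) (use e0 in simp)
  also have "(LINT z|lborel. M * exp_weight S \<Phi> n z) = M * (LINT z|lborel. exp_weight S \<Phi> n z)" by (rule integral_mult_right_zero)
  finally show ?thesis by (simp add: M_def)
qed

text \<open>\<open>Lim\<close> is a definite description, so its value has to be identified before
  it can be compared with the threshold: the inner limits are 0 for every radius, hence so is the
  outer one.\<close>

lemma concentration_set_empty:
  assumes "\<And>p \<epsilon>. (\<lambda>k. \<integral>\<^sup>+x\<in>ball p \<epsilon> \<inter> S. ennreal (\<bar>Q k x\<bar> * exp (3 * u k x)) \<partial>lebesgue) \<longlonglongrightarrow> 0"
  shows "concentration_set S Q u = {}"
proof -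
  have "liminf (\<lambda>k. \<integral>\<^sup>+x\<in>ball p \<epsilon> \<inter> S. ennreal (\<bar>Q k x\<bar> * exp (3 * u k x)) \<partial>lebesgue) = 0" for p \<epsilon>
    by (rule lim_imp_Liminf[OF _ assms]) simp
  moreover have "Lim (at_right (0::real)) (\<lambda>\<epsilon>. 0::ennreal) = 0"
    by (rule tendsto_Lim[OF trivial_limit_at_right_real tendsto_const])
  moreover have "\<not> ennreal (2 * pi\<^sup>2) \<le> 0" by simp
  ultimately show ?thesis unfolding concentration_set_def by simp
qed

text \<open>Removing the zero set leaves a set of the same form with an open boundary part, so the
  lemmas on \<open>half_space_with\<close> apply to the domain of convergence.\<close>

lemma half_space_with_minus_zero_set:
  assumes "profile S \<Phi>"
  shows "(upper \<union> S \<times> {0}) - zero_set S \<Phi> \<times> {0} = half_space_with (S - zero_set S \<Phi>)" "open (S - zero_set S \<Phi>)"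
proof -
  show "(upper \<union> S \<times> {0}) - zero_set S \<Phi> \<times> {0} = half_space_with (S - zero_set S \<Phi>)" by (auto simp: upper_def)
  note bf = profile_facts[OF assms]
  have "open (S \<inter> (bdry \<Phi> -` (- {0})))" by (intro open_Int bf(1) open_vimage bf(6) open_Compl closed_singleton)
  moreover have "S - zero_set S \<Phi> = S \<inter> (bdry \<Phi> -` (- {0}))" by (auto simp: zero_set_def)
  ultimately show "open (S - zero_set S \<Phi>)" by simp
qed

text \<open>After division by \<open>\<beta> k\<close> the difference to \<Phi> is
  \<open>V k\<close>, whose norm on a compact set is at most a constant times
  \<open>(real k + M k + 1) / \<beta> k\<close>. The assumed lower bound on \<beta> makes this of
  order \<open>1 / (real k + 1)\<close>, however fast \<open>M k\<close> grows.\<close>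

lemma holder_convergence:
  assumes b: "profile S \<Phi>" and f: "\<And>k. bounded_density S (M k) (f k)" and \<alpha>: "0 \<le> \<alpha>" "\<alpha> < 1"
    and n: "\<And>k. (real k + 1) * (real k + M k + 1) \<le> \<beta> k"
  defines "T \<equiv> (upper \<union> S \<times> {0}) - zero_set S \<Phi> \<times> {0}"
  shows "tendsto_holder_loc 2 \<alpha> T
    (\<lambda>k X. (\<beta> k * \<Phi> X + (real k + (- 1 / flux_const) * potential (\<lambda>Z. ln (norm Z)) (f k) X)) / \<beta> k) \<Phi>"
proof -
  note bf = profile_facts[OF b]
  define p where "p = (\<lambda>k. potential (\<lambda>Z. ln (norm Z)) (f k))"
  note Z = half_space_with_minus_zero_set[OF b]
  have T: "T = half_space_with (S - zero_set S \<Phi>)" unfolding T_def by (rule Z(1))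
  have th: "thick T" unfolding T by (rule thick_upper_Un_boundary[OF Z(2)])
  have Tsub: "T \<subseteq> half_space_with S" by (auto simp: T_def)
  have F: "\<Phi> \<in> Ck_on k T" for k by (rule Ck_on_subset(1)[OF th Tsub bf(3)])
  have Fh: "holder_norm 2 \<alpha> T K \<Phi> < \<infinity>" if "compact K" "K \<subseteq> T" for K
    using holder_norm_smooth_finite[OF Z(2) F[unfolded T] that(1) that(2)[unfolded T] \<alpha>(1)] \<alpha>(2) by (simp add: T)
  have M0: "0 \<le> M k" for k using f[of k] by (simp add: bounded_density_def)
  have \<beta>0: "0 < \<beta> k" for k
  proof -
    have "0 < (real k + 1) * (real k + M k + 1)" using M0[of k] by (intro mult_pos_pos) auto
    then show ?thesis using n[of k] by linarith
  qed
  define V where "V = (\<lambda>k X. real k / \<beta> k + (- 1 / flux_const / \<beta> k) * p k X)"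
  have eq: "(\<beta> k * \<Phi> X + (real k + (- 1 / flux_const) * p k X)) / \<beta> k = \<Phi> X + V k X" for k X
    using \<beta>0[of k] by (simp add: V_def add_divide_distrib diff_divide_distrib)
  have p2: "p k \<in> Ck_on 2 T" for k unfolding p_def by (rule potential_ln_Ck2(1)[OF f th])
  note VA = affine_Ck_on[OF th p2]
  have V2: "V k \<in> Ck_on 2 T" for k unfolding V_def by (rule VA(1))
  have sum2: "(\<lambda>X. \<Phi> X + V k X) \<in> Ck_on 2 T" for k
    using Ck_on_lincomb(1)[OF th F V2, where a=1 and b=1, of k] by simp
  have Vn: "\<exists>A\<ge>0. \<forall>k. holder_norm 2 \<alpha> T K (V k) \<le> ennreal (A * (1 / (real k + 1)))"
    if K: "compact K" "K \<subseteq> T" for K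
  proof -
    obtain A where A0: "0 \<le> A" and AA: "\<forall>M f S'. bounded_density S M f \<longrightarrow> thick S' \<longrightarrow> K \<subseteq> S' \<longrightarrow>
      (\<forall>j vs X. j \<le> 2 \<longrightarrow> vs \<in> dirs j \<longrightarrow> X \<in> K \<longrightarrow> \<bar>partial S' vs (potential (\<lambda>Z. ln (norm Z)) f) X\<bar> \<le> A * M) \<and>
      (\<forall>vs X Y. vs \<in> dirs 2 \<longrightarrow> X \<in> K \<longrightarrow> Y \<in> K \<longrightarrow> X \<noteq> Y \<longrightarrow>
        \<bar>partial S' vs (potential (\<lambda>Z. ln (norm Z)) f) X - partial S' vs (potential (\<lambda>Z. ln (norm Z)) f) Y\<bar> \<le> A * M * dist X Y powr \<alpha>)"
      using potential_ln_uniform_bounds[OF compact_imp_bounded[OF K(1)] bf(2) borel_open[OF bf(1)] \<alpha>] by (elim exE conjE) (rule that)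
    note A1 = AA[rule_format, OF f th K(2)]
    have A2: "\<bar>partial T vs (p k) X\<bar> \<le> A * M k" if "j \<le> 2" "vs \<in> dirs j" "X \<in> K" for k j vs X
      unfolding p_def using conjunct1[OF A1] that by blast
    have A3: "\<bar>partial T vs (p k) X - partial T vs (p k) Y\<bar> \<le> A * M k * dist X Y powr \<alpha>"
      if "vs \<in> dirs 2" "X \<in> K" "Y \<in> K" "X \<noteq> Y" for k vs X Y
      unfolding p_def using conjunct2[OF A1] that by blast
    define N where "N = real ((\<Sum>j\<le>2. card (dirs j :: R4 list set)) + card (dirs 2 :: R4 list set))"
    \<comment> \<open>Dominates both coefficients at once: 1 for \<open>real k\<close> and
      \<open>A / flux_const\<close> for \<open>M k\<close>.\<close>
    define A' where "A' = 1 + A / flux_const"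
    have A': "1 \<le> A'" "A / flux_const \<le> A'" "0 \<le> A / flux_const" using A0 flux_const_pos by (auto simp: A'_def)
    have b1: "(real k + (A / flux_const) * M k) / \<beta> k \<le> A' * (1 / (real k + 1))" for k
    proof -
      have "real k + (A / flux_const) * M k \<le> A' * real k + A' * M k"
        using A' M0[of k] by (intro add_mono mult_right_mono) (auto simp: mult_le_cancel_right1)
      also have "\<dots> \<le> A' * (real k + M k + 1)" using A' by (simp add: algebra_simps)
      finally have "(real k + (A / flux_const) * M k) * (real k + 1) \<le> A' * (real k + M k + 1) * (real k + 1)" by (intro mult_right_mono) auto
      also have "\<dots> = A' * ((real k + 1) * (real k + M k + 1))" by (simp add: mult_ac)
      also have "\<dots> \<le> A' * \<beta> k" using A' n[of k] by (intro mult_left_mono) auto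
      finally show ?thesis using \<beta>0[of k] by (simp add: field_simps)
    qed
    have "holder_norm 2 \<alpha> T K (V k) \<le> ennreal (N * (A' * (1 / (real k + 1))))" for k
      unfolding N_def
    proof (rule holder_norm_le)
      have c: "\<bar>- 1 / flux_const / \<beta> k\<bar> = 1 / flux_const / \<beta> k" using flux_const_pos \<beta>0[of k] by simp
      have s: "(1 / flux_const / \<beta> k) * (A * M k) = (A / flux_const) * M k / \<beta> k" by simp
      fix j and vs :: "R4 list" and X assume j: "j \<le> 2" and vs: "vs \<in> dirs j" and X: "X \<in> K"
      have "\<bar>partial T vs (V k) X\<bar> = \<bar>(if vs = [] then real k / \<beta> k else 0) + (- 1 / flux_const / \<beta> k) * partial T vs (p k) X\<bar>"
        unfolding V_def by (subst VA(2)[OF j vs subsetD[OF K(2) X]]) (rule refl)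
      also have "\<dots> \<le> \<bar>(if vs = [] then real k / \<beta> k else 0)\<bar> + \<bar>(- 1 / flux_const / \<beta> k) * partial T vs (p k) X\<bar>" by (rule abs_triangle_ineq)
      also have "\<dots> \<le> real k / \<beta> k + (1 / flux_const / \<beta> k) * (A * M k)"
      proof (rule add_mono)
        show "\<bar>(if vs = [] then real k / \<beta> k else 0)\<bar> \<le> real k / \<beta> k" using \<beta>0[of k] by simp
        show "\<bar>(- 1 / flux_const / \<beta> k) * partial T vs (p k) X\<bar> \<le> (1 / flux_const / \<beta> k) * (A * M k)"
          unfolding abs_mult c
          by (intro mult_left_mono A2[OF j vs X]) (use flux_const_pos \<beta>0[of k] in simp)
      qed
      also have "\<dots> = (real k + (A / flux_const) * M k) / \<beta> k" by (simp only: s add_divide_distrib)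
      also note b1
      finally show "\<bar>partial T vs (V k) X\<bar> \<le> A' * (1 / (real k + 1))" .
    next
      have c: "\<bar>- 1 / flux_const / \<beta> k\<bar> = 1 / flux_const / \<beta> k" using flux_const_pos \<beta>0[of k] by simp
      fix vs :: "R4 list" and X Y assume vs: "vs \<in> dirs 2" and X: "X \<in> K" and Y: "Y \<in> K" and XY: "X \<noteq> Y"
      have VP: "partial T vs (V k) Z = (if vs = [] then real k / \<beta> k else 0) + (- 1 / flux_const / \<beta> k) * partial T vs (p k) Z" if "Z \<in> K" for Z
        unfolding V_def by (rule VA(2)[OF order_refl vs subsetD[OF K(2) that]])
      have "partial T vs (V k) X - partial T vs (V k) Y = (- 1 / flux_const / \<beta> k) * (partial T vs (p k) X - partial T vs (p k) Y)"
        unfolding VP[OF X] VP[OF Y] right_diff_distrib by linarith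
      then have "\<bar>partial T vs (V k) X - partial T vs (V k) Y\<bar> = (1 / flux_const / \<beta> k) * \<bar>partial T vs (p k) X - partial T vs (p k) Y\<bar>"
        by (simp only: abs_mult c)
      also have "\<dots> \<le> (1 / flux_const / \<beta> k) * (A * M k * dist X Y powr \<alpha>)"
        by (intro mult_left_mono A3[OF vs X Y XY]) (use flux_const_pos \<beta>0[of k] in simp)
      also have "\<dots> = ((A / flux_const) * M k / \<beta> k) * dist X Y powr \<alpha>" by simp
      also have "\<dots> \<le> (A' * (1 / (real k + 1))) * dist X Y powr \<alpha>"
      proof (rule mult_right_mono)
        have "(A / flux_const) * M k / \<beta> k \<le> (real k + (A / flux_const) * M k) / \<beta> k" using \<beta>0[of k] by (intro divide_right_mono) auto
        then show "(A / flux_const) * M k / \<beta> k \<le> A' * (1 / (real k + 1))" using b1 by (rule order_trans)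
      qed simp
      finally show "\<bar>partial T vs (V k) X - partial T vs (V k) Y\<bar> \<le> A' * (1 / (real k + 1)) * dist X Y powr \<alpha>" .
    qed
    moreover have "0 \<le> N * A'" using A'(1) unfolding N_def by (intro mult_nonneg_nonneg of_nat_0_le_iff) simp
    ultimately show ?thesis by (intro exI[of _ "N * A'"] conjI allI) (auto simp only: mult.assoc)
  qed
  have Vf: "holder_norm 2 \<alpha> T K (V k) < \<infinity>" if "compact K" "K \<subseteq> T" for K k
    using Vn[OF that] ennreal_less_top le_less_trans by (metis infinity_ennreal_def)
  show ?thesis
    unfolding tendsto_holder_loc_def eq[unfolded p_def]
  proof (intro conjI allI impI)
    show "(\<lambda>X. \<Phi> X + V k X) \<in> holder_loc 2 \<alpha> T" for k
      unfolding holder_loc_def using sum2[of k] holder_norm_add_finite[OF th _ F V2 Fh Vf] by blast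
    show "\<Phi> \<in> holder_loc 2 \<alpha> T" unfolding holder_loc_def using F Fh by blast
    fix K assume K: "compact K \<and> K \<subseteq> T"
    obtain A where A: "0 \<le> A" "\<And>k. holder_norm 2 \<alpha> T K (V k) \<le> ennreal (A * (1 / (real k + 1)))" using Vn K by blast
    have "(\<lambda>k. A * (1 / (real k + 1))) \<longlonglongrightarrow> A * 0"
      using LIMSEQ_inverse_real_of_nat by (intro tendsto_mult_left) (simp add: inverse_eq_divide add.commute)
    then have "(\<lambda>k. ennreal (A * (1 / (real k + 1)))) \<longlonglongrightarrow> ennreal 0" by (intro tendsto_ennrealI) simp
    then have "(\<lambda>k. ennreal (A * (1 / (real k + 1)))) \<longlonglongrightarrow> 0" by simp
    then have "(\<lambda>k. holder_norm 2 \<alpha> T K (V k)) \<longlonglongrightarrow> 0"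
      by (rule tendsto_sandwich[OF _ _ tendsto_const, rotated 2]) (use A(2) in auto)
    then show "(\<lambda>k. holder_norm 2 \<alpha> T K (\<lambda>X. \<Phi> X + V k X - \<Phi> X)) \<longlonglongrightarrow> 0" by simp
  qed
qed

theorem proposition1p8:
  fixes \<Sigma>\<^sub>0 :: "R3 set" and \<Phi> :: "R4 \<Rightarrow> real" and Q :: "nat \<Rightarrow> R3 \<Rightarrow> real" and C :: real
  assumes "smooth_bounded_domain \<Sigma>\<^sub>0"
    and "\<Phi> \<in> K_class \<Sigma>\<^sub>0"
    and "dy_zero_on UNIV \<Phi>"
    and "representable \<Phi>"
    and "\<And>k. Q k \<in> Linf \<Sigma>\<^sub>0"
    and "\<And>k. Linf_norm \<Sigma>\<^sub>0 (Q k) \<le> ereal C"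
  shows "\<exists>(U :: nat \<Rightarrow> R4 \<Rightarrow> real) (\<beta> :: nat \<Rightarrow> real).
      (\<forall>k. is_solution \<Sigma>\<^sub>0 (Q k) (U k)) \<and>
      (\<forall>x\<in>zero_set \<Sigma>\<^sub>0 \<Phi>. filterlim (\<lambda>k. U k (x, 0)) at_top sequentially) \<and>
      concentration_set \<Sigma>\<^sub>0 Q (\<lambda>k. bdry (U k)) = {} \<and>
      filterlim \<beta> at_top sequentially \<and>
      (\<forall>\<alpha>\<in>{0..<1}. tendsto_holder_loc 2 \<alpha>
         ((upper \<union> \<Sigma>\<^sub>0 \<times> {0}) - zero_set \<Sigma>\<^sub>0 \<Phi> \<times> {0})
         (\<lambda>k X. U k X / \<beta> k) \<Phi>)"
proof -
  have b: "profile \<Sigma>\<^sub>0 \<Phi>" using assms(1,2,4) by (simp add: profile_def smooth_bounded_domain_def)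
  note bf = profile_facts[OF b]
  have SB: "\<Sigma>\<^sub>0 \<in> sets borel" using bf(1) by simp
  \<comment> \<open>A nonnegative bound, as \<open>bounded_density\<close> requires.\<close>
  define C' where "C' = max C 0"
  have C': "C \<le> C'" "0 \<le> C'" by (auto simp: C'_def)
  define M where "M = (\<lambda>k. C' * exp (3 * real k + 3))"
  have M0: "0 \<le> M k" for k using C' by (simp add: M_def)
  \<comment> \<open>Lower bound for \<open>\<beta> k\<close>: the factor
    \<open>real k + M k + 1\<close> absorbs the added constant and the density bound, the factor
    \<open>real k + 1\<close> yields decay.\<close>
  define lo where "lo = (\<lambda>k. (real k + 1) * (real k + M k + 1))"
  \<comment> \<open>Chosen so that \<open>M k * \<eta> k\<close> is at most
    \<open>1 / (real k + 1)\<close>; this makes the mass of the densities tend to zero in spite of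
    the factor \<open>exp (3 * real k + 3)\<close>.\<close>
  define \<eta> where "\<eta> = (\<lambda>k. 1 / ((real k + 1) * (M k + 1)))"
  have \<eta>0: "0 < \<eta> k" for k unfolding \<eta>_def using M0[of k] by (intro divide_pos_pos mult_pos_pos) auto
  \<comment> \<open>Named predicates turn the choice over all \<open>k\<close>, of Borel
    representatives here and of fixed points below, into a single step each.\<close>
  define R where "R = (\<lambda>k q. q \<in> borel_measurable borel \<and> (\<forall>z. \<bar>q z\<bar> \<le> C' * indicator \<Sigma>\<^sub>0 z) \<and>
    (AE z in lborel. z \<in> \<Sigma>\<^sub>0 \<longrightarrow> Q k z = q z))"
  have "\<exists>q. R k q" for k
    using Linf_representative(1)[OF SB assms(5,6) C', of k] unfolding R_def by blast
  then obtain q where "\<And>k. R k (q k)" by metis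
  then have q: "q k \<in> borel_measurable borel" "\<And>z. \<bar>q k z\<bar> \<le> C' * indicator \<Sigma>\<^sub>0 z"
    "AE z in lborel. z \<in> \<Sigma>\<^sub>0 \<longrightarrow> Q k z = q k z" for k
    unfolding R_def by blast+
  define lp where "lp = potential (\<lambda>Z::R4. ln (norm Z))"
  define P where "P = (\<lambda>k n f. nat \<lceil>lo k\<rceil> \<le> n \<and> bounded_density \<Sigma>\<^sub>0 (M k) f \<and>
    (\<forall>z. f z = q k z * exp (3 * (real n * \<Phi> (z, 0) + (real k + (- 1 / flux_const) * lp f (z, 0))))) \<and>
    (\<forall>z\<in>\<Sigma>\<^sub>0. \<bar>(- 1 / flux_const) * lp f (z, 0)\<bar> \<le> 1) \<and>
    (LINT z|lborel. exp_weight \<Sigma>\<^sub>0 \<Phi> n z) \<le> \<eta> k)"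
  have "\<exists>n f. P k n f" for k
    using fixed_point_solution[OF b q(1)[of k] q(2)[of k] C'(2) \<eta>0[of k], of "nat \<lceil>lo k\<rceil>" "real k"]
    unfolding P_def M_def lp_def by blast
  then obtain n f where "\<And>k. P k (n k) (f k)" by metis
  then have nf: "nat \<lceil>lo k\<rceil> \<le> n k" "bounded_density \<Sigma>\<^sub>0 (M k) (f k)"
    "\<And>z. f k z = q k z * exp (3 * (real (n k) * \<Phi> (z, 0) + (real k + (- 1 / flux_const) * lp (f k) (z, 0))))"
    "\<And>z. z \<in> \<Sigma>\<^sub>0 \<Longrightarrow> \<bar>(- 1 / flux_const) * lp (f k) (z, 0)\<bar> \<le> 1"
    "(LINT z|lborel. exp_weight \<Sigma>\<^sub>0 \<Phi> (n k) z) \<le> \<eta> k" for k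
    unfolding P_def by blast+
  have n: "lo k \<le> real (n k)" for k using real_nat_ceiling_ge[of "lo k"] nf(1)[of k] by linarith
  define U where "U = (\<lambda>k X. real (n k) * \<Phi> X + (real k + (- 1 / flux_const) * lp (f k) X))"
  have inv0: "(\<lambda>k. 1 / (real k + 1)) \<longlonglongrightarrow> 0"
    using LIMSEQ_inverse_real_of_nat by (simp add: inverse_eq_divide add.commute)
  have 1: "is_solution \<Sigma>\<^sub>0 (Q k) (U k)" for k
    unfolding U_def lp_def
    by (rule is_solution_log_perturbation[OF b assms(3) nf(2) nf(3)[unfolded lp_def]
        Linf_representative(2)[OF SB assms(5,6) C'] q(3)])
  have 2: "filterlim (\<lambda>k. U k (x, 0)) at_top sequentially" if x: "x \<in> zero_set \<Sigma>\<^sub>0 \<Phi>" for x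
  proof (rule filterlim_at_top_mono)
    \<comment> \<open>At a zero of \<Phi> the profile term vanishes and the correction is at least
      -1, which leaves \<open>real k - 1\<close>.\<close>
    show "filterlim (\<lambda>k. real k - 1) at_top sequentially"
      using filterlim_tendsto_add_at_top[OF tendsto_const[of "-1::real"] filterlim_real_sequentially] by simp
    have "real k - 1 \<le> U k (x, 0)" for k
    proof -
      have "U k (x, 0) = real k + (- 1 / flux_const) * lp (f k) (x, 0)" using x by (simp add: U_def zero_set_def)
      moreover have "- 1 \<le> (- 1 / flux_const) * lp (f k) (x, 0)" using abs_le_D2[OF nf(4)[of x k]] x by (simp add: zero_set_def)
      ultimately show ?thesis by linarith
    qed
    then show "\<forall>\<^sub>F k in sequentially. real k - 1 \<le> U k (x, 0)" by simp
  qed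
  have 3: "concentration_set \<Sigma>\<^sub>0 Q (\<lambda>k. bdry (U k)) = {}"
  proof (rule concentration_set_empty)
    fix p :: R3 and \<epsilon> :: real
    have le: "(\<integral>\<^sup>+x\<in>ball p \<epsilon> \<inter> \<Sigma>\<^sub>0. ennreal (\<bar>Q k x\<bar> * exp (3 * bdry (U k) x)) \<partial>lebesgue) \<le> ennreal (1 / (real k + 1))" for k
    proof -
      have "(\<integral>\<^sup>+x\<in>ball p \<epsilon> \<inter> \<Sigma>\<^sub>0. ennreal (\<bar>Q k x\<bar> * exp (3 * bdry (U k) x)) \<partial>lebesgue)
        \<le> ennreal (C' * exp (3 * real k + 3) * (LINT z|lborel. exp_weight \<Sigma>\<^sub>0 \<Phi> (n k) z))"
        by (rule concentration_integral_le[OF b C'(2) q(2) q(3) nf(4)]) (auto simp: U_def)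
      also have "\<dots> \<le> ennreal (1 / (real k + 1))"
      proof (rule ennreal_leI)
        have "C' * exp (3 * real k + 3) * (LINT z|lborel. exp_weight \<Sigma>\<^sub>0 \<Phi> (n k) z) \<le> M k * \<eta> k"
          unfolding M_def[symmetric] using M0 nf(5) by (simp add: M_def mult_left_mono)
        also have "\<dots> = (1 / (real k + 1)) * (M k / (M k + 1))" by (simp add: \<eta>_def)
        also have "\<dots> \<le> (1 / (real k + 1)) * 1" using M0[of k] by (intro mult_left_mono) (auto simp: field_simps)
        finally show "C' * exp (3 * real k + 3) * (LINT z|lborel. exp_weight \<Sigma>\<^sub>0 \<Phi> (n k) z) \<le> 1 / (real k + 1)" by simp
      qed
      finally show ?thesis .
    qed
    have "(\<lambda>k. ennreal (1 / (real k + 1))) \<longlonglongrightarrow> ennreal 0" by (rule tendsto_ennrealI[OF inv0])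
    then have "(\<lambda>k. ennreal (1 / (real k + 1))) \<longlonglongrightarrow> 0" by simp
    then show "(\<lambda>k. \<integral>\<^sup>+x\<in>ball p \<epsilon> \<inter> \<Sigma>\<^sub>0. ennreal (\<bar>Q k x\<bar> * exp (3 * bdry (U k) x)) \<partial>lebesgue) \<longlonglongrightarrow> 0"
      by (rule tendsto_sandwich[OF _ _ tendsto_const, rotated 2]) (use le in auto)
  qed
  have 4: "filterlim (\<lambda>k. real (n k)) at_top sequentially"
  proof (rule filterlim_at_top_mono[OF filterlim_real_sequentially])
    have "real k \<le> real (n k)" for k
    proof -
      have "real k * 1 \<le> lo k" unfolding lo_def using M0[of k] by (intro mult_mono) auto
      then show ?thesis using n[of k] by simp
    qed
    then show "\<forall>\<^sub>F k in sequentially. real k \<le> real (n k)" by simp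
  qed
  have 5: "tendsto_holder_loc 2 \<alpha> ((upper \<union> \<Sigma>\<^sub>0 \<times> {0}) - zero_set \<Sigma>\<^sub>0 \<Phi> \<times> {0}) (\<lambda>k X. U k X / real (n k)) \<Phi>"
    if "\<alpha> \<in> {0..<1}" for \<alpha>
    unfolding U_def lp_def
    by (rule holder_convergence[OF b nf(2)]) (use that n in \<open>auto simp: lo_def\<close>)
  show ?thesis
    by (rule exI[of _ U], rule exI[of _ "\<lambda>k. real (n k)"]) (use 1 2 3 4 5 in blast)
qed

end
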